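(* Let $\mathcal{C}$ be a coalgebra with a group-like element $e$, let $\mathcal{B}\subseteq\mathcal{A}$ and $\mathcal{B}'\subseteq\mathcal{A}'$ be $e$-coaugmented $\mathcal{C}$-Galois extensions, and let $V$ be a left $\mathcal{C}$-comodule (of arbitrary dimension). Assume that $\mathcal{A}'$ is faithfully flat as a right $\mathcal{B}'$-module and that the coalgebra $\mathcal{C}$ is cosemisimple. Then every $\mathcal{C}$-equivariant (right $\mathcal{C}$-colinear) algebra map $f\colon\mathcal{A}\to\mathcal{A}'$ restricts and corestricts to an algebra homomorphism $\mathcal{B}\to\mathcal{B}'$, and induces an isomorphism $$\mathcal{B}'\otimes_{\mathcal{B}}(\mathcal{A}\,\Box^{\mathcal{C}}V)\cong\mathcal{A}'\,\Box^{\mathcal{C}}V$$ of left $\mathcal{B}'$-modules that is natural in $V$.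
   Context: Algebras, coalgebras and vector spaces are over $\mathbb{C}$; algebras and algebra homomorphisms are unital; unadorned $\otimes$ is over $\mathbb{C}$. For a right $\mathcal{C}$-comodule $(M,\delta_M)$ and a left $\mathcal{C}$-comodule $(N,{}_N\delta)$, the cotensor product is $M\,\Box^{\mathcal{C}}N:=\ker(\delta_M\otimes\mathrm{id}-\mathrm{id}\otimes{}_N\delta)\subseteq M\otimes N$. $e$-coaugmented $\mathcal{C}$-Galois extension: let $e\in\mathcal{C}$ be group-like, and let $\mathcal{A}$ be an algebra and a right $\mathcal{C}$-comodule via $\delta_{\mathcal{A}}\colon\mathcal{A}\to\mathcal{A}\otimes\mathcal{C}$ (not assumed to be an algebra map) with $\delta_{\mathcal{A}}(1)=1\otimes e$. Put $\mathcal{B}:=\{b\in\mathcal{A}\mid\forall a\in\mathcal{A}:\ \delta_{\mathcal{A}}(ba)=b\,\delta_{\mathcal{A}}(a)\}$ (coaction-invariant subalgebra). The inclusion $\mathcal{B}\subseteq\mathcal{A}$ is an $e$-coaugmented $\mathcal{C}$-Galois extension if the canonical map $can\colon\mathcal{A}\otimes_{\mathcal{B}}\mathcal{A}\to\mathcal{A}\otimes\mathcal{C}$, $a\otimes a'\mapsto a\,\delta_{\mathcal{A}}(a')$, is bijective. The left $\mathcal{B}$-module structure on $\mathcal{A}\,\Box^{\mathcal{C}}V$ is by left multiplication on $\mathcal{A}$ (and similarly for $\mathcal{A}'$); $\mathcal{B}'$ is a right $\mathcal{B}$-module via $b'\cdot b:=b'f(b)$. *)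

theory Defs
  imports Complex_Main "HOL-Algebra.Module" "HOL-Algebra.Free_Abelian_Groups"
begin

text \<open>
  Everything is carrier based, on the records of HOL-Algebra. The record \<open>module\<close> contains all ring
  fields, so it serves for algebras (over the complex numbers), for vector spaces and for one-sided
  modules; for the latter two its \<open>mult\<close> and \<open>one\<close> fields are irrelevant. The locale \<open>module\<close> of
  HOL-Algebra needs a commutative base ring and \<open>algebra\<close> a commutative algebra, so the
  noncommutative versions are introduced here.
\<close>

definition complex_ring :: "complex ring" where
  "complex_ring = \<lparr>carrier = UNIV, monoid.mult = (*), monoid.one = 1, ring.zero = 0, ring.add = (+)\<rparr>"

locale left_module = R?: ring R + M?: abelian_group M
  for R :: "('r, 'x) ring_scheme" (structure) and M :: "('r, 'm, 'y) module_scheme" (structure) +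
  assumes left_smult_closed:
      "\<lbrakk>a \<in> carrier R; x \<in> carrier M\<rbrakk> \<Longrightarrow> a \<odot>\<^bsub>M\<^esub> x \<in> carrier M"
    and left_smult_l_distr:
      "\<lbrakk>a \<in> carrier R; b \<in> carrier R; x \<in> carrier M\<rbrakk> \<Longrightarrow>
        (a \<oplus>\<^bsub>R\<^esub> b) \<odot>\<^bsub>M\<^esub> x = a \<odot>\<^bsub>M\<^esub> x \<oplus>\<^bsub>M\<^esub> b \<odot>\<^bsub>M\<^esub> x"
    and left_smult_r_distr:
      "\<lbrakk>a \<in> carrier R; x \<in> carrier M; y \<in> carrier M\<rbrakk> \<Longrightarrow>
        a \<odot>\<^bsub>M\<^esub> (x \<oplus>\<^bsub>M\<^esub> y) = a \<odot>\<^bsub>M\<^esub> x \<oplus>\<^bsub>M\<^esub> a \<odot>\<^bsub>M\<^esub> y"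
    and left_smult_assoc:
      "\<lbrakk>a \<in> carrier R; b \<in> carrier R; x \<in> carrier M\<rbrakk> \<Longrightarrow>
        (a \<otimes>\<^bsub>R\<^esub> b) \<odot>\<^bsub>M\<^esub> x = a \<odot>\<^bsub>M\<^esub> (b \<odot>\<^bsub>M\<^esub> x)"
    and left_smult_one:
      "x \<in> carrier M \<Longrightarrow> \<one>\<^bsub>R\<^esub> \<odot>\<^bsub>M\<^esub> x = x"

text \<open>In a right module, \<open>a \<odot> x\<close> stands for the product \<open>x a\<close>.\<close>

locale right_module = R?: ring R + M?: abelian_group M
  for R :: "('r, 'x) ring_scheme" (structure) and M :: "('r, 'm, 'y) module_scheme" (structure) +
  assumes right_smult_closed:
      "\<lbrakk>a \<in> carrier R; x \<in> carrier M\<rbrakk> \<Longrightarrow> a \<odot>\<^bsub>M\<^esub> x \<in> carrier M"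
    and right_smult_l_distr:
      "\<lbrakk>a \<in> carrier R; b \<in> carrier R; x \<in> carrier M\<rbrakk> \<Longrightarrow>
        (a \<oplus>\<^bsub>R\<^esub> b) \<odot>\<^bsub>M\<^esub> x = a \<odot>\<^bsub>M\<^esub> x \<oplus>\<^bsub>M\<^esub> b \<odot>\<^bsub>M\<^esub> x"
    and right_smult_r_distr:
      "\<lbrakk>a \<in> carrier R; x \<in> carrier M; y \<in> carrier M\<rbrakk> \<Longrightarrow>
        a \<odot>\<^bsub>M\<^esub> (x \<oplus>\<^bsub>M\<^esub> y) = a \<odot>\<^bsub>M\<^esub> x \<oplus>\<^bsub>M\<^esub> a \<odot>\<^bsub>M\<^esub> y"
    and right_smult_assoc:
      "\<lbrakk>a \<in> carrier R; b \<in> carrier R; x \<in> carrier M\<rbrakk> \<Longrightarrow>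
        (a \<otimes>\<^bsub>R\<^esub> b) \<odot>\<^bsub>M\<^esub> x = b \<odot>\<^bsub>M\<^esub> (a \<odot>\<^bsub>M\<^esub> x)"
    and right_smult_one:
      "x \<in> carrier M \<Longrightarrow> \<one>\<^bsub>R\<^esub> \<odot>\<^bsub>M\<^esub> x = x"

definition mod_homs ::
  "('r, 'x) ring_scheme \<Rightarrow> ('r, 'm, 'y) module_scheme \<Rightarrow> ('r, 'n, 'z) module_scheme \<Rightarrow> ('m \<Rightarrow> 'n) set"
  where "mod_homs R M N = {h \<in> carrier M \<rightarrow> carrier N.
    (\<forall>x\<in>carrier M. \<forall>y\<in>carrier M. h (x \<oplus>\<^bsub>M\<^esub> y) = h x \<oplus>\<^bsub>N\<^esub> h y) \<and>
    (\<forall>r\<in>carrier R. \<forall>x\<in>carrier M. h (r \<odot>\<^bsub>M\<^esub> x) = r \<odot>\<^bsub>N\<^esub> h x)}"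

definition left_module_iso ::
  "('r, 'x) ring_scheme \<Rightarrow> ('r, 'm, 'y) module_scheme \<Rightarrow> ('r, 'n, 'z) module_scheme \<Rightarrow> ('m \<Rightarrow> 'n) \<Rightarrow> bool"
  where "left_module_iso R M N h \<longleftrightarrow> left_module R M \<and> left_module R N \<and>
    h \<in> mod_homs R M N \<and> bij_betw h (carrier M) (carrier N)"

definition with_smult :: "('m, 'x) ring_scheme \<Rightarrow> ('r \<Rightarrow> 'm \<Rightarrow> 'm) \<Rightarrow> ('r, 'm) module" where
  "with_smult M s = \<lparr>carrier = carrier M, monoid.mult = monoid.mult M, monoid.one = monoid.one M,
     ring.zero = ring.zero M, ring.add = ring.add M, smult = s\<rparr>"

definition left_mult_module :: "('m, 'x) ring_scheme \<Rightarrow> ('m, 'm) module" where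
  "left_mult_module A = with_smult A (\<lambda>b a. b \<otimes>\<^bsub>A\<^esub> a)"

definition right_mult_module :: "('m, 'x) ring_scheme \<Rightarrow> ('m, 'm) module" where
  "right_mult_module A = with_smult A (\<lambda>b a. a \<otimes>\<^bsub>A\<^esub> b)"

text \<open>
  The tensor product of a right module \<open>M\<close> and a left module \<open>N\<close> is the free abelian group on
  \<open>carrier M \<times> carrier N\<close> modulo the usual relations; its elements are cosets.
\<close>

type_synonym ('m, 'n) tens = "(('m \<times> 'n) \<Rightarrow>\<^sub>0 int) set"

definition tensor_relators ::
  "('r, 'x) ring_scheme \<Rightarrow> ('r, 'm, 'y) module_scheme \<Rightarrow> ('r, 'n, 'z) module_scheme \<Rightarrow> ('m, 'n) tens"
  where "tensor_relators R M N =
    {frag_of (m \<oplus>\<^bsub>M\<^esub> m', n) - frag_of (m, n) - frag_of (m', n) | m m' n.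
       m \<in> carrier M \<and> m' \<in> carrier M \<and> n \<in> carrier N} \<union>
    {frag_of (m, n \<oplus>\<^bsub>N\<^esub> n') - frag_of (m, n) - frag_of (m, n') | m n n'.
       m \<in> carrier M \<and> n \<in> carrier N \<and> n' \<in> carrier N} \<union>
    {frag_of (r \<odot>\<^bsub>M\<^esub> m, n) - frag_of (m, r \<odot>\<^bsub>N\<^esub> n) | r m n.
       r \<in> carrier R \<and> m \<in> carrier M \<and> n \<in> carrier N}"

definition tensor_kernel ::
  "('r, 'x) ring_scheme \<Rightarrow> ('r, 'm, 'y) module_scheme \<Rightarrow> ('r, 'n, 'z) module_scheme \<Rightarrow> ('m, 'n) tens"
  where "tensor_kernel R M N =
    generate (free_Abelian_group (carrier M \<times> carrier N)) (tensor_relators R M N)"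

definition pure_tensor ::
  "('r, 'x) ring_scheme \<Rightarrow> ('r, 'm, 'y) module_scheme \<Rightarrow> ('r, 'n, 'z) module_scheme \<Rightarrow>
   'm \<Rightarrow> 'n \<Rightarrow> ('m, 'n) tens"
  where "pure_tensor R M N m n =
    tensor_kernel R M N #>\<^bsub>free_Abelian_group (carrier M \<times> carrier N)\<^esub> frag_of (m, n)"

text \<open>Only the additive structure of this record is meaningful.\<close>

definition tensor ::
  "('r, 'x) ring_scheme \<Rightarrow> ('r, 'm, 'y) module_scheme \<Rightarrow> ('r, 'n, 'z) module_scheme \<Rightarrow> ('m, 'n) tens ring"
  where "tensor R M N =
    (let Q = free_Abelian_group (carrier M \<times> carrier N) Mod tensor_kernel R M N
     in \<lparr>carrier = carrier Q, monoid.mult = undefined, monoid.one = undefined,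
         ring.zero = monoid.one Q, ring.add = monoid.mult Q\<rparr>)"

text \<open>
  \<open>tensor_lift P \<beta>\<close> is the map sending the class of \<open>m \<otimes> n\<close> to \<open>\<beta> m n\<close>, for balanced \<open>\<beta>\<close> with values
  in the abelian group \<open>P\<close>: all representatives of a class then have the same value.
\<close>

definition frag_eval :: "('p, 'x) ring_scheme \<Rightarrow> ('m \<Rightarrow> 'n \<Rightarrow> 'p) \<Rightarrow> (('m \<times> 'n) \<Rightarrow>\<^sub>0 int) \<Rightarrow> 'p" where
  "frag_eval P \<beta> c =
     (\<Oplus>\<^bsub>P\<^esub>p\<in>Poly_Mapping.keys c. [Poly_Mapping.lookup c p] \<cdot>\<^bsub>P\<^esub> \<beta> (fst p) (snd p))"

definition tensor_lift :: "('p, 'x) ring_scheme \<Rightarrow> ('m \<Rightarrow> 'n \<Rightarrow> 'p) \<Rightarrow> ('m, 'n) tens \<Rightarrow> 'p" where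
  "tensor_lift P \<beta> X = the_elem (frag_eval P \<beta> ` X)"

text \<open>\<open>tensor_map R M' N' g h\<close> is \<open>g \<otimes> h\<close> with values in \<open>tensor R M' N'\<close>.\<close>

definition tensor_map ::
  "('r, 'x) ring_scheme \<Rightarrow> ('r, 'm', 'y) module_scheme \<Rightarrow> ('r, 'n', 'z) module_scheme \<Rightarrow>
   ('m \<Rightarrow> 'm') \<Rightarrow> ('n \<Rightarrow> 'n') \<Rightarrow> ('m, 'n) tens \<Rightarrow> ('m', 'n') tens"
  where "tensor_map R M' N' g h =
    tensor_lift (tensor R M' N') (\<lambda>m n. pure_tensor R M' N' (g m) (h n))"

text \<open>
  \<open>tensor_module R M N L\<close> is \<open>tensor R M N\<close> with the left action coming from a left module
  structure \<open>L\<close> on the same abelian group as \<open>M\<close> (that is, \<open>M\<close> and \<open>L\<close> form a bimodule).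
\<close>

definition tensor_module ::
  "('r, 'x) ring_scheme \<Rightarrow> ('r, 'm, 'y) module_scheme \<Rightarrow> ('r, 'n, 'z) module_scheme \<Rightarrow>
   ('s, 'm, 'w) module_scheme \<Rightarrow> ('s, ('m, 'n) tens) module"
  where "tensor_module R M N L =
    with_smult (tensor R M N) (\<lambda>s. tensor_map R M N (\<lambda>m. s \<odot>\<^bsub>L\<^esub> m) id)"

definition ctensor ::
  "(complex, 'm, 'y) module_scheme \<Rightarrow> (complex, 'n, 'z) module_scheme \<Rightarrow> (complex, ('m, 'n) tens) module"
  where "ctensor M N = tensor_module complex_ring M N M"

abbreviation cpure ::
  "(complex, 'm, 'y) module_scheme \<Rightarrow> (complex, 'n, 'z) module_scheme \<Rightarrow> 'm \<Rightarrow> 'n \<Rightarrow> ('m, 'n) tens"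
  where "cpure \<equiv> pure_tensor complex_ring"

abbreviation cmap ::
  "(complex, 'm', 'y) module_scheme \<Rightarrow> (complex, 'n', 'z) module_scheme \<Rightarrow>
   ('m \<Rightarrow> 'm') \<Rightarrow> ('n \<Rightarrow> 'n') \<Rightarrow> ('m, 'n) tens \<Rightarrow> ('m', 'n') tens"
  where "cmap \<equiv> tensor_map complex_ring"

text \<open>The associator \<open>(X \<otimes> Y) \<otimes> Z \<rightarrow> X \<otimes> (Y \<otimes> Z)\<close>.\<close>

definition cassoc ::
  "(complex, 'l, 'x) module_scheme \<Rightarrow> (complex, 'm, 'y) module_scheme \<Rightarrow> (complex, 'n, 'z) module_scheme \<Rightarrow>
   (('l, 'm) tens, 'n) tens \<Rightarrow> ('l, ('m, 'n) tens) tens"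
  where "cassoc X Y Z =
    tensor_lift (ctensor X (ctensor Y Z))
      (\<lambda>t z. tensor_lift (ctensor X (ctensor Y Z))
        (\<lambda>x y. cpure X (ctensor Y Z) x (cpure Y Z y z)) t)"

definition exact_at ::
  "('l, 'x) ring_scheme \<Rightarrow> ('l \<Rightarrow> 'm) \<Rightarrow> ('m, 'y) ring_scheme \<Rightarrow> ('m \<Rightarrow> 'n) \<Rightarrow> ('n, 'z) ring_scheme \<Rightarrow> bool"
  where "exact_at L g M h N \<longleftrightarrow> g ` carrier L = {y \<in> carrier M. h y = \<zero>\<^bsub>N\<^esub>}"

text \<open>
  A right module \<open>M\<close> is faithfully flat if a sequence of left modules is exact precisely when it is
  exact after tensoring with \<open>M\<close>. A definition cannot quantify over types, so the test modules have
  their elements in the fixed type \<open>(nat \<Rightarrow> 'r) set\<close>. This is no restriction: all finitely generated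
  left modules occur there up to isomorphism (represent \<open>x\<close> by the set of coefficient tuples \<open>r\<close>
  with \<open>x = \<Sum>i. r i \<odot> x i\<close>), and they suffice. Indeed, if an element of \<open>M \<otimes> P\<close> dies in
  \<open>M \<otimes> Q\<close> for a submodule \<open>P\<close> of \<open>Q\<close>, this already happens for finitely generated submodules of
  \<open>P\<close> and \<open>Q\<close>, so \<open>M\<close> is flat; and if \<open>M \<otimes> P = 0\<close> then \<open>M \<otimes> R x = 0\<close> for every \<open>x\<close> in \<open>P\<close>,
  so \<open>P = 0\<close>.
\<close>

definition faithfully_flat_right :: "('r, 'x) ring_scheme \<Rightarrow> ('r, 'm, 'y) module_scheme \<Rightarrow> bool" where
  "faithfully_flat_right R M \<longleftrightarrow> right_module R M \<and>
    (\<forall>(N1 :: ('r, (nat \<Rightarrow> 'r) set) module) (N2 :: ('r, (nat \<Rightarrow> 'r) set) module)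
      (N3 :: ('r, (nat \<Rightarrow> 'r) set) module) g h.
      left_module R N1 \<longrightarrow> left_module R N2 \<longrightarrow> left_module R N3 \<longrightarrow>
      g \<in> mod_homs R N1 N2 \<longrightarrow> h \<in> mod_homs R N2 N3 \<longrightarrow>
      (exact_at N1 g N2 h N3 \<longleftrightarrow>
       exact_at (tensor R M N1) (tensor_map R M N2 id g) (tensor R M N2)
         (tensor_map R M N3 id h) (tensor R M N3)))"

definition complex_algebra :: "(complex, 'a, 'x) module_scheme \<Rightarrow> bool" where
  "complex_algebra A \<longleftrightarrow> ring A \<and> module complex_ring A \<and>
    (\<forall>c. \<forall>x\<in>carrier A. \<forall>y\<in>carrier A.
      (c \<odot>\<^bsub>A\<^esub> x) \<otimes>\<^bsub>A\<^esub> y = c \<odot>\<^bsub>A\<^esub> (x \<otimes>\<^bsub>A\<^esub> y) \<and>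
      x \<otimes>\<^bsub>A\<^esub> (c \<odot>\<^bsub>A\<^esub> y) = c \<odot>\<^bsub>A\<^esub> (x \<otimes>\<^bsub>A\<^esub> y))"

definition algebra_hom ::
  "(complex, 'a, 'x) module_scheme \<Rightarrow> (complex, 'b, 'y) module_scheme \<Rightarrow> ('a \<Rightarrow> 'b) \<Rightarrow> bool"
  where "algebra_hom A B f \<longleftrightarrow> complex_algebra A \<and> complex_algebra B \<and>
    f \<in> ring_hom A B \<and> f \<in> mod_homs complex_ring A B"

record 'c coalgebra = "(complex, 'c) module" +
  comult :: "'c \<Rightarrow> ('c, 'c) tens"
  counit :: "'c \<Rightarrow> complex"

definition is_coalgebra :: "'c coalgebra \<Rightarrow> bool" where
  "is_coalgebra C \<longleftrightarrow> module complex_ring C \<and>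
    comult C \<in> mod_homs complex_ring C (ctensor C C) \<and>
    counit C \<in> mod_homs complex_ring C (with_smult complex_ring (*)) \<and>
    (\<forall>c\<in>carrier C.
      cassoc C C C (cmap (ctensor C C) C (comult C) id (comult C c))
        = cmap C (ctensor C C) id (comult C) (comult C c) \<and>
      tensor_lift C (\<lambda>x y. counit C x \<odot>\<^bsub>C\<^esub> y) (comult C c) = c \<and>
      tensor_lift C (\<lambda>x y. counit C y \<odot>\<^bsub>C\<^esub> x) (comult C c) = c)"

definition group_like :: "'c coalgebra \<Rightarrow> 'c \<Rightarrow> bool" where
  "group_like C e \<longleftrightarrow> e \<in> carrier C \<and> comult C e = cpure C C e e \<and> counit C e = 1"

text \<open>The second condition says that \<open>comult\<close> maps \<open>D\<close> into the image of \<open>D \<otimes> D\<close> in \<open>C \<otimes> C\<close>.\<close>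

definition subcoalgebra :: "'c coalgebra \<Rightarrow> 'c set \<Rightarrow> bool" where
  "subcoalgebra C D \<longleftrightarrow> submodule D complex_ring C \<and>
    comult C ` D \<subseteq>
      cmap C C id id ` carrier (ctensor (C\<lparr>carrier := D\<rparr>) (C\<lparr>carrier := D\<rparr>))"

definition simple_subcoalgebra :: "'c coalgebra \<Rightarrow> 'c set \<Rightarrow> bool" where
  "simple_subcoalgebra C D \<longleftrightarrow> subcoalgebra C D \<and> D \<noteq> {\<zero>\<^bsub>C\<^esub>} \<and>
    (\<forall>E. subcoalgebra C E \<and> E \<subseteq> D \<longrightarrow> E = {\<zero>\<^bsub>C\<^esub>} \<or> E = D)"

text \<open>A coalgebra is cosemisimple if it is the (internal) direct sum of simple subcoalgebras.\<close>

definition cosemisimple :: "'c coalgebra \<Rightarrow> bool" where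
  "cosemisimple C \<longleftrightarrow> (\<exists>\<D>. (\<forall>D\<in>\<D>. simple_subcoalgebra C D) \<and>
    (\<forall>c\<in>carrier C. \<exists>F x. finite F \<and> F \<subseteq> \<D> \<and> (\<forall>D\<in>F. x D \<in> D) \<and> c = (\<Oplus>\<^bsub>C\<^esub>D\<in>F. x D)) \<and>
    (\<forall>F x. finite F \<and> F \<subseteq> \<D> \<and> (\<forall>D\<in>F. x D \<in> D) \<and> (\<Oplus>\<^bsub>C\<^esub>D\<in>F. x D) = \<zero>\<^bsub>C\<^esub> \<longrightarrow>
      (\<forall>D\<in>F. x D = \<zero>\<^bsub>C\<^esub>)))"

definition right_comodule ::
  "'c coalgebra \<Rightarrow> (complex, 'm) module \<Rightarrow> ('m \<Rightarrow> ('m, 'c) tens) \<Rightarrow> bool"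
  where "right_comodule C M \<delta> \<longleftrightarrow> module complex_ring M \<and>
    \<delta> \<in> mod_homs complex_ring M (ctensor M C) \<and>
    (\<forall>m\<in>carrier M.
      cassoc M C C (cmap (ctensor M C) C \<delta> id (\<delta> m)) = cmap M (ctensor C C) id (comult C) (\<delta> m) \<and>
      tensor_lift M (\<lambda>x c. counit C c \<odot>\<^bsub>M\<^esub> x) (\<delta> m) = m)"

definition left_comodule ::
  "'c coalgebra \<Rightarrow> (complex, 'v) module \<Rightarrow> ('v \<Rightarrow> ('c, 'v) tens) \<Rightarrow> bool"
  where "left_comodule C V \<rho> \<longleftrightarrow> module complex_ring V \<and>
    \<rho> \<in> mod_homs complex_ring V (ctensor C V) \<and>
    (\<forall>v\<in>carrier V.
      cassoc C C V (cmap (ctensor C C) V (comult C) id (\<rho> v)) = cmap C (ctensor C V) id \<rho> (\<rho> v) \<and>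
      tensor_lift V (\<lambda>c x. counit C c \<odot>\<^bsub>V\<^esub> x) (\<rho> v) = v)"

definition right_colinear ::
  "'c coalgebra \<Rightarrow> (complex, 'm) module \<Rightarrow> ('m \<Rightarrow> ('m, 'c) tens) \<Rightarrow>
   (complex, 'n) module \<Rightarrow> ('n \<Rightarrow> ('n, 'c) tens) \<Rightarrow> ('m \<Rightarrow> 'n) \<Rightarrow> bool"
  where "right_colinear C M \<delta> N \<delta>' f \<longleftrightarrow> f \<in> mod_homs complex_ring M N \<and>
    (\<forall>m\<in>carrier M. \<delta>' (f m) = cmap N C f id (\<delta> m))"

definition left_colinear ::
  "'c coalgebra \<Rightarrow> (complex, 'v) module \<Rightarrow> ('v \<Rightarrow> ('c, 'v) tens) \<Rightarrow>
   (complex, 'w) module \<Rightarrow> ('w \<Rightarrow> ('c, 'w) tens) \<Rightarrow> ('v \<Rightarrow> 'w) \<Rightarrow> bool"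
  where "left_colinear C V \<rho> W \<sigma> \<phi> \<longleftrightarrow> \<phi> \<in> mod_homs complex_ring V W \<and>
    (\<forall>v\<in>carrier V. \<sigma> (\<phi> v) = cmap C W id \<phi> (\<rho> v))"

definition cotensor ::
  "'c coalgebra \<Rightarrow> (complex, 'm) module \<Rightarrow> ('m \<Rightarrow> ('m, 'c) tens) \<Rightarrow>
   (complex, 'v) module \<Rightarrow> ('v \<Rightarrow> ('c, 'v) tens) \<Rightarrow> (complex, ('m, 'v) tens) module"
  where "cotensor C M \<delta> V \<rho> = (ctensor M V)\<lparr>carrier := {t \<in> carrier (ctensor M V).
    cassoc M C V (cmap (ctensor M C) V \<delta> id t) = cmap M (ctensor C V) id \<rho> t}\<rparr>"

text \<open>\<open>left_act A X a\<close> is left multiplication by \<open>a\<close> on the first factor of \<open>A \<otimes> X\<close>.\<close>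

definition left_act ::
  "(complex, 'a) module \<Rightarrow> (complex, 'm, 'y) module_scheme \<Rightarrow> 'a \<Rightarrow> ('a, 'm) tens \<Rightarrow> ('a, 'm) tens"
  where "left_act A X a = cmap A X (\<lambda>x. a \<otimes>\<^bsub>A\<^esub> x) id"

definition coinvariants :: "'c coalgebra \<Rightarrow> (complex, 'a) module \<Rightarrow> ('a \<Rightarrow> ('a, 'c) tens) \<Rightarrow> 'a set" where
  "coinvariants C A \<delta> = {b \<in> carrier A. \<forall>a\<in>carrier A. \<delta> (b \<otimes>\<^bsub>A\<^esub> a) = left_act A C b (\<delta> a)}"

definition coinv_alg ::
  "'c coalgebra \<Rightarrow> (complex, 'a) module \<Rightarrow> ('a \<Rightarrow> ('a, 'c) tens) \<Rightarrow> (complex, 'a) module"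
  where "coinv_alg C A \<delta> = A\<lparr>carrier := coinvariants C A \<delta>\<rparr>"

definition canonical_map ::
  "'c coalgebra \<Rightarrow> (complex, 'a) module \<Rightarrow> ('a \<Rightarrow> ('a, 'c) tens) \<Rightarrow> ('a, 'a) tens \<Rightarrow> ('a, 'c) tens"
  where "canonical_map C A \<delta> = tensor_lift (ctensor A C) (\<lambda>a a'. left_act A C a (\<delta> a'))"

definition coaugmented_galois ::
  "'c coalgebra \<Rightarrow> 'c \<Rightarrow> (complex, 'a) module \<Rightarrow> ('a \<Rightarrow> ('a, 'c) tens) \<Rightarrow> bool"
  where "coaugmented_galois C e A \<delta> \<longleftrightarrow> complex_algebra A \<and> right_comodule C A \<delta> \<and>
    \<delta> \<one>\<^bsub>A\<^esub> = cpure A C \<one>\<^bsub>A\<^esub> e \<and>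
    bij_betw (canonical_map C A \<delta>)
      (carrier (tensor (coinv_alg C A \<delta>) (right_mult_module A) (left_mult_module A)))
      (carrier (ctensor A C))"

text \<open>The cotensor product of \<open>A\<close> with \<open>V\<close> as a left module over the coinvariants of \<open>A\<close>.\<close>

definition cotensor_module ::
  "'c coalgebra \<Rightarrow> (complex, 'a) module \<Rightarrow> ('a \<Rightarrow> ('a, 'c) tens) \<Rightarrow>
   (complex, 'v) module \<Rightarrow> ('v \<Rightarrow> ('c, 'v) tens) \<Rightarrow> ('a, ('a, 'v) tens) module"
  where "cotensor_module C A \<delta> V \<rho> = with_smult (cotensor C A \<delta> V \<rho>) (left_act A V)"

text \<open>An algebra \<open>B'\<close> as a right module over the source of \<open>f\<close>: \<open>b' \<cdot> b = b' f(b)\<close>.\<close>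

definition restricted_right_module :: "(complex, 'b) module \<Rightarrow> ('a \<Rightarrow> 'b) \<Rightarrow> ('a, 'b) module" where
  "restricted_right_module B' f = with_smult B' (\<lambda>b b'. b' \<otimes>\<^bsub>B'\<^esub> f b)"

text \<open>The extension of scalars of a left \<open>B\<close>-module along \<open>f\<close>, as a left \<open>B'\<close>-module.\<close>

definition induced_module ::
  "(complex, 'a) module \<Rightarrow> (complex, 'b) module \<Rightarrow> ('a \<Rightarrow> 'b) \<Rightarrow> ('a, 'n) module \<Rightarrow>
   ('b, ('b, 'n) tens) module"
  where "induced_module B B' f N =
    tensor_module B (restricted_right_module B' f) N (left_mult_module B')"

definition induced_map ::
  "(complex, 'a) module \<Rightarrow> (complex, 'b) module \<Rightarrow> ('a \<Rightarrow> 'b) \<Rightarrow> ('a, 'n') module \<Rightarrow> ('n \<Rightarrow> 'n') \<Rightarrow>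
   ('b, 'n) tens \<Rightarrow> ('b, 'n') tens"
  where "induced_map B B' f N' h = tensor_map B (restricted_right_module B' f) N' id h"

text \<open>The map sending \<open>b' \<otimes> (\<Sum>i. a i \<otimes> v i)\<close> to \<open>\<Sum>i. b' f(a i) \<otimes> v i\<close>.\<close>

definition comparison_map ::
  "(complex, 'b) module \<Rightarrow> ('a \<Rightarrow> 'b) \<Rightarrow> (complex, 'v) module \<Rightarrow>
   ('b, ('a, 'v) tens) tens \<Rightarrow> ('b, 'v) tens"
  where "comparison_map A' f V =
    tensor_lift (ctensor A' V) (\<lambda>b' t. left_act A' V b' (cmap A' V f id t))"

end

theory Submission
  imports Defs
begin

text \<open>
  The idea is to split the cotensor product off the tensor product. A kernel need not
  commute with extension of scalars from \<open>B\<close> to \<open>B'\<close>, but a direct summand of \<open>A \<otimes> V\<close> with a natural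
  projection can be reached by explicit formulas. Sweedler notation is used throughout: \<open>c\<^sub>1 \<otimes> c\<^sub>2\<close> for the comultiplication,
  \<open>a\<^sub>0 \<otimes> a\<^sub>1\<close> and \<open>v\<^sub>-\<^sub>1 \<otimes> v\<^sub>0\<close> for the coactions.

  \<^bold>\<open>Splitting.\<close> A cosemisimple coalgebra over the complex numbers carries a bilinear form \<open>\<theta>\<close> with
  \<open>\<theta>(c\<^sub>1, c\<^sub>2) = \<epsilon>(c)\<close> and \<open>c\<^sub>1 \<theta>(c\<^sub>2, d) = \<theta>(c, d\<^sub>1) d\<^sub>2\<close> (\<open>cosemisimple_form\<close>). A simple subcoalgebra
  \<open>D\<close> is finite-dimensional, and the character \<open>\<tau>\<close> of its regular comodule is cocommutative with
  \<open>\<epsilon>(\<tau>) = dim D \<noteq> 0\<close>. The elements \<open>g(\<tau>\<^sub>1) \<tau>\<^sub>2\<close>, for functionals \<open>g\<close>, form a nonzero subcoalgebra,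
  which is all of \<open>D\<close> by simplicity; so \<open>\<tau>\<close> is nondegenerate, and \<open>\<theta>\<close> is its inverse
  (\<open>simple_block_form\<close>). Distinct simple summands are made orthogonal. For a left comodule \<open>V\<close>, the map
  \<open>\<pi>(c, v) = \<theta>(c, v\<^sub>-\<^sub>1) v\<^sub>0\<close> is then a colinear retraction of the coaction (\<open>comodule_retraction\<close>), and
  \<open>P(a \<otimes> v) = a\<^sub>0 \<otimes> \<pi>(a\<^sub>1, v)\<close> is a projection of \<open>A \<otimes> V\<close> onto the cotensor product that commutes with
  multiplication by coinvariants (\<open>proj_cotensor\<close>, \<open>proj_ident\<close>).

  \<^bold>\<open>The total algebra.\<close> For every algebra map \<open>f\<close> from \<open>A\<close> to an algebra \<open>A'\<close>, the map
  \<open>a' \<otimes> (\<Sum>i. a i \<otimes> v i) \<mapsto> \<Sum>i. a' f(a i) \<otimes> v i\<close> from \<open>A' \<otimes>\<^sub>B (A \<box> V)\<close> to \<open>A' \<otimes> V\<close> is bijective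
  (\<open>comparison_bij\<close>; here \<open>A \<box> V\<close> is the cotensor product). Its inverse sends \<open>a' \<otimes> v\<close> to
  \<open>a' f(x) \<otimes> P(y \<otimes> v\<^sub>0)\<close>, where \<open>x \<otimes> y\<close> is the preimage of \<open>1 \<otimes> v\<^sub>-\<^sub>1\<close> under the canonical map of \<open>A\<close>.
  This is used twice: for the given \<open>f\<close>, and for the identity of \<open>A'\<close>.

  \<^bold>\<open>Coinvariants.\<close> If \<open>b\<close> is coinvariant, then \<open>f(b)\<close> has coaction \<open>f(b) \<otimes> e\<close>, so \<open>1 \<otimes> f(b)\<close> and
  \<open>f(b) \<otimes> 1\<close> have the same image under the canonical map of \<open>A'\<close>. They are therefore equal over \<open>B'\<close>,
  which forces \<open>f(b)\<close> to be coinvariant (\<open>coinvariant_of_galois\<close>).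

  \<^bold>\<open>Descent.\<close> Faithful flatness enters through one consequence: \<open>1 \<otimes> n = 0\<close> in \<open>A' \<otimes>\<^sub>B' N\<close> only if
  \<open>n = 0\<close> (\<open>faithfully_flat_unit\<close>). Let \<open>h\<close> be the comparison map over \<open>B'\<close>. If \<open>h(n) = 0\<close>, then the
  image of \<open>n\<close> in \<open>A' \<otimes>\<^sub>B (A \<box> V)\<close> vanishes by the bijection above, hence \<open>1 \<otimes> n = 0\<close> and \<open>n = 0\<close>
  (\<open>comparison_kernel_trivial\<close>). For \<open>p\<close> in \<open>A' \<box> V\<close>, the two bijections show that \<open>1 \<otimes> p\<close> is a sum of
  terms \<open>a' \<otimes> h(1 \<otimes> t)\<close>; so it dies in \<open>A' \<otimes>\<^sub>B' ((A' \<box> V) / im h)\<close>, and \<open>p\<close> lies in the image of \<open>h\<close>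
  (\<open>comparison_surj\<close>). Naturality is visible on pure tensors (\<open>comparison_natural\<close>).
\<close>

section \<open>Tensor products over a ring\<close>

definition additive_map :: "('m, 'x) ring_scheme \<Rightarrow> ('p, 'y) ring_scheme \<Rightarrow> ('m \<Rightarrow> 'p) \<Rightarrow> bool" where
  "additive_map M P g \<longleftrightarrow> (\<forall>x\<in>carrier M. g x \<in> carrier P) \<and>
     (\<forall>x\<in>carrier M. \<forall>y\<in>carrier M. g (x \<oplus>\<^bsub>M\<^esub> y) = g x \<oplus>\<^bsub>P\<^esub> g y)"

lemma additive_closed: "additive_map M P g \<Longrightarrow> x \<in> carrier M \<Longrightarrow> g x \<in> carrier P"
  and additive_add: "additive_map M P g \<Longrightarrow> x \<in> carrier M \<Longrightarrow> y \<in> carrier M \<Longrightarrow> g (x \<oplus>\<^bsub>M\<^esub> y) = g x \<oplus>\<^bsub>P\<^esub> g y"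
  by (auto simp: additive_map_def)

lemma additiveI:
  "(\<And>x. x \<in> carrier M \<Longrightarrow> g x \<in> carrier P) \<Longrightarrow>
   (\<And>x y. x \<in> carrier M \<Longrightarrow> y \<in> carrier M \<Longrightarrow> g (x \<oplus>\<^bsub>M\<^esub> y) = g x \<oplus>\<^bsub>P\<^esub> g y) \<Longrightarrow> additive_map M P g"
  by (auto simp: additive_map_def)

lemma additive_zero:
  assumes "abelian_group M" "abelian_group P" "additive_map M P g"
  shows "g \<zero>\<^bsub>M\<^esub> = \<zero>\<^bsub>P\<^esub>"
proof -
  interpret M: abelian_group M by fact
  interpret P: abelian_group P by fact
  have "g \<zero>\<^bsub>M\<^esub> \<oplus>\<^bsub>P\<^esub> g \<zero>\<^bsub>M\<^esub> = g \<zero>\<^bsub>M\<^esub>"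
    using additive_add[OF assms(3), of "\<zero>\<^bsub>M\<^esub>" "\<zero>\<^bsub>M\<^esub>"] by simp
  then show ?thesis using additive_closed[OF assms(3), of "\<zero>\<^bsub>M\<^esub>"] by (metis P.add.l_cancel_one M.zero_closed)
qed

lemma additive_neg:
  assumes "abelian_group M" "abelian_group P" "additive_map M P g" "x \<in> carrier M"
  shows "g (\<ominus>\<^bsub>M\<^esub> x) = \<ominus>\<^bsub>P\<^esub> (g x)"
proof -
  interpret M: abelian_group M by fact
  interpret P: abelian_group P by fact
  have "g (\<ominus>\<^bsub>M\<^esub> x) \<oplus>\<^bsub>P\<^esub> g x = \<zero>\<^bsub>P\<^esub>"
    using additive_add[OF assms(3), of "\<ominus>\<^bsub>M\<^esub> x" x] assms(4) additive_zero[OF assms(1-3)] by (simp add: M.l_neg)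
  then show ?thesis using additive_closed[OF assms(3)] assms(4) by (metis M.a_inv_closed P.minus_equality)
qed

lemma additive_comp: "additive_map M N g \<Longrightarrow> additive_map N P h \<Longrightarrow> additive_map M P (\<lambda>x. h (g x))"
  by (auto simp: additive_map_def)

definition balanced ::
  "('r, 'x) ring_scheme \<Rightarrow> ('r, 'm, 'y) module_scheme \<Rightarrow> ('r, 'n, 'z) module_scheme \<Rightarrow>
   ('p, 'w) ring_scheme \<Rightarrow> ('m \<Rightarrow> 'n \<Rightarrow> 'p) \<Rightarrow> bool"
  where "balanced R M N P \<beta> \<longleftrightarrow>
    (\<forall>m\<in>carrier M. additive_map N P (\<beta> m)) \<and> (\<forall>n\<in>carrier N. additive_map M P (\<lambda>m. \<beta> m n)) \<and>
    (\<forall>r\<in>carrier R. \<forall>m\<in>carrier M. \<forall>n\<in>carrier N. \<beta> (r \<odot>\<^bsub>M\<^esub> m) n = \<beta> m (r \<odot>\<^bsub>N\<^esub> n))"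

lemma balancedI:
  assumes "\<And>m n. m \<in> carrier M \<Longrightarrow> n \<in> carrier N \<Longrightarrow> \<beta> m n \<in> carrier P"
    and "\<And>m n n'. m \<in> carrier M \<Longrightarrow> n \<in> carrier N \<Longrightarrow> n' \<in> carrier N \<Longrightarrow> \<beta> m (n \<oplus>\<^bsub>N\<^esub> n') = \<beta> m n \<oplus>\<^bsub>P\<^esub> \<beta> m n'"
    and "\<And>m m' n. m \<in> carrier M \<Longrightarrow> m' \<in> carrier M \<Longrightarrow> n \<in> carrier N \<Longrightarrow> \<beta> (m \<oplus>\<^bsub>M\<^esub> m') n = \<beta> m n \<oplus>\<^bsub>P\<^esub> \<beta> m' n"
    and "\<And>r m n. r \<in> carrier R \<Longrightarrow> m \<in> carrier M \<Longrightarrow> n \<in> carrier N \<Longrightarrow> \<beta> (r \<odot>\<^bsub>M\<^esub> m) n = \<beta> m (r \<odot>\<^bsub>N\<^esub> n)"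
  shows "balanced R M N P \<beta>"
  using assms by (auto simp: balanced_def additive_map_def)

lemma balancedD:
  assumes "balanced R M N P \<beta>" "m \<in> carrier M" "n \<in> carrier N"
  shows "\<beta> m n \<in> carrier P"
    and "n' \<in> carrier N \<Longrightarrow> \<beta> m (n \<oplus>\<^bsub>N\<^esub> n') = \<beta> m n \<oplus>\<^bsub>P\<^esub> \<beta> m n'"
    and "m' \<in> carrier M \<Longrightarrow> \<beta> (m \<oplus>\<^bsub>M\<^esub> m') n = \<beta> m n \<oplus>\<^bsub>P\<^esub> \<beta> m' n"
    and "r \<in> carrier R \<Longrightarrow> \<beta> (r \<odot>\<^bsub>M\<^esub> m) n = \<beta> m (r \<odot>\<^bsub>N\<^esub> n)"
  using assms by (auto simp: balanced_def additive_map_def)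

context
  fixes P :: "('p, 'x) ring_scheme" and \<beta> :: "'m \<Rightarrow> 'n \<Rightarrow> 'p" and S :: "('m \<times> 'n) set"
  assumes P: "abelian_group P" and \<beta>: "\<And>m n. (m, n) \<in> S \<Longrightarrow> \<beta> m n \<in> carrier P"
begin

interpretation P: abelian_group P by (rule P)

text \<open>
  Evaluation sums over the support of its argument. Enlarging the index set makes the sums of two
  elements comparable term by term.
\<close>

lemma frag_eval_superset:
  assumes "Poly_Mapping.keys c \<subseteq> T" "finite T" "T \<subseteq> S"
  shows "frag_eval P \<beta> c = (\<Oplus>\<^bsub>P\<^esub>p\<in>T. [Poly_Mapping.lookup c p] \<cdot>\<^bsub>P\<^esub> \<beta> (fst p) (snd p))"
  unfolding frag_eval_def
  by (rule P.add.finprod_mono_neutral_cong_left)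
    (use assms \<beta> in \<open>auto simp: in_keys_iff Pi_iff subset_iff add_pow_int_ge\<close>)

lemma frag_eval_closed: "Poly_Mapping.keys c \<subseteq> S \<Longrightarrow> frag_eval P \<beta> c \<in> carrier P"
  unfolding frag_eval_def
  by (rule P.finsum_closed) (use \<beta> in \<open>force simp: Pi_iff intro!: P.add.int_pow_closed\<close>)

lemma frag_eval_add:
  assumes "Poly_Mapping.keys c \<subseteq> S" "Poly_Mapping.keys d \<subseteq> S"
  shows "frag_eval P \<beta> (c + d) = frag_eval P \<beta> c \<oplus>\<^bsub>P\<^esub> frag_eval P \<beta> d"
proof -
  let ?T = "Poly_Mapping.keys c \<union> Poly_Mapping.keys d"
  have T: "finite ?T" "?T \<subseteq> S" using assms by auto
  have b: "p \<in> ?T \<Longrightarrow> \<beta> (fst p) (snd p) \<in> carrier P" for p using T(2) \<beta>[of "fst p" "snd p"] by auto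
  have "frag_eval P \<beta> (c + d) = (\<Oplus>\<^bsub>P\<^esub>p\<in>?T. [Poly_Mapping.lookup (c + d) p] \<cdot>\<^bsub>P\<^esub> \<beta> (fst p) (snd p))"
    by (rule frag_eval_superset) (use T Poly_Mapping.keys_add[of c d] in auto)
  also have "\<dots> = (\<Oplus>\<^bsub>P\<^esub>p\<in>?T. [Poly_Mapping.lookup c p] \<cdot>\<^bsub>P\<^esub> \<beta> (fst p) (snd p) \<oplus>\<^bsub>P\<^esub>
      [Poly_Mapping.lookup d p] \<cdot>\<^bsub>P\<^esub> \<beta> (fst p) (snd p))"
    using b by (intro P.finsum_cong') (auto simp: lookup_add P.add.int_pow_mult)
  also have "\<dots> = frag_eval P \<beta> c \<oplus>\<^bsub>P\<^esub> frag_eval P \<beta> d"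
    using frag_eval_superset[of c ?T] frag_eval_superset[of d ?T] T b
    by (subst P.finsum_addf) (auto simp: Pi_iff)
  finally show ?thesis .
qed

lemma frag_eval_diff:
  assumes "Poly_Mapping.keys c \<subseteq> S" "Poly_Mapping.keys d \<subseteq> S"
  shows "frag_eval P \<beta> (c - d) = frag_eval P \<beta> c \<ominus>\<^bsub>P\<^esub> frag_eval P \<beta> d"
proof -
  have k: "Poly_Mapping.keys (c - d) \<subseteq> S"
    by (rule order_trans[OF keys_diff]) (use assms in simp)
  have e: "frag_eval P \<beta> c = frag_eval P \<beta> (c - d) \<oplus>\<^bsub>P\<^esub> frag_eval P \<beta> d"
    by (subst frag_eval_add[OF k assms(2), symmetric]) (simp only: diff_add_cancel)
  show ?thesis
    unfolding e a_minus_def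
    by (simp only: P.a_assoc P.r_neg P.r_zero P.a_inv_closed frag_eval_closed[OF k] frag_eval_closed[OF assms(2)])
qed

lemma frag_eval_of: "(m, n) \<in> S \<Longrightarrow> frag_eval P \<beta> (frag_of (m, n)) = \<beta> m n"
  using \<beta> by (simp add: frag_eval_def P.add.finprod_singleton P.finsum_insert)

end

context
  fixes R :: "('r, 'x) ring_scheme" and M :: "('r, 'm, 'y) module_scheme" and N :: "('r, 'n, 'z) module_scheme"
  assumes rm: "right_module R M" and lm: "left_module R N"
begin

interpretation M: right_module R M by (rule rm)
interpretation N: left_module R N by (rule lm)

abbreviation (input) "FG \<equiv> free_Abelian_group (carrier M \<times> carrier N)"

interpretation F: comm_group FG by (rule abelian_free_Abelian_group)

lemma tensor_relators_carrier: "tensor_relators R M N \<subseteq> carrier FG"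
proof -
  have k2: "Poly_Mapping.keys (frag_of x - frag_of y) \<subseteq> {x, y}" for x y :: "'m \<times> 'n"
    using keys_diff[of "frag_of x" "frag_of y"] by auto
  have k3: "Poly_Mapping.keys (frag_of x - frag_of y - frag_of z) \<subseteq> {x, y, z}" for x y z :: "'m \<times> 'n"
    using keys_diff[of "frag_of x - frag_of y" "frag_of z"] k2[of x y] by auto
  show ?thesis
    unfolding tensor_relators_def
    by (auto dest!: subsetD[OF k3] subsetD[OF k2] intro: M.right_smult_closed N.left_smult_closed)
qed

lemma tensor_kernel_subgroup: "subgroup (tensor_kernel R M N) FG"
  unfolding tensor_kernel_def by (rule F.generate_is_subgroup[OF tensor_relators_carrier])

lemma tensor_kernel_normal: "tensor_kernel R M N \<lhd> FG"
  by (simp add: F.normal_iff_subgroup tensor_kernel_subgroup)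

lemma tensor_abelian_group: "abelian_group (tensor R M N)"
proof -
  have "add_monoid (tensor R M N) = FG Mod tensor_kernel R M N"
    by (simp add: tensor_def Let_def FactGroup_def)
  then have "comm_group (add_monoid (tensor R M N))"
    using F.abelian_FactGroup[OF tensor_kernel_subgroup] by simp
  then show ?thesis by (rule comm_group_abelian_groupI)
qed

abbreviation (input) "cls x \<equiv> tensor_kernel R M N #>\<^bsub>FG\<^esub> x"

lemma tensor_carrierE:
  assumes "t \<in> carrier (tensor R M N)"
  obtains x where "x \<in> carrier FG" "t = cls x"
  using assms by (auto simp: tensor_def Let_def FactGroup_def RCOSETS_def)

lemma tensor_cls_closed: "x \<in> carrier FG \<Longrightarrow> cls x \<in> carrier (tensor R M N)"
  by (auto simp: tensor_def Let_def FactGroup_def RCOSETS_def)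

lemma tensor_cls_add: "x \<in> carrier FG \<Longrightarrow> y \<in> carrier FG \<Longrightarrow> cls x \<oplus>\<^bsub>tensor R M N\<^esub> cls y = cls (x + y)"
  using normal.rcos_sum[OF tensor_kernel_normal, of x y]
  by (simp add: tensor_def Let_def FactGroup_def)

lemma tensor_cls_zero: "\<zero>\<^bsub>tensor R M N\<^esub> = cls 0"
  using F.coset_mult_one[of "tensor_kernel R M N"] subgroup.subset[OF tensor_kernel_subgroup]
  by (simp add: tensor_def Let_def FactGroup_def)

lemma tensor_cls_eq: "x \<in> carrier FG \<Longrightarrow> y \<in> carrier FG \<Longrightarrow> cls x = cls y \<longleftrightarrow> x - y \<in> tensor_kernel R M N"
proof -
  assume x: "x \<in> carrier FG" and y: "y \<in> carrier FG"
  have yi: "inv\<^bsub>FG\<^esub> y = - y" using y by simp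
  interpret K: subgroup "tensor_kernel R M N" FG by (rule tensor_kernel_subgroup)
  show ?thesis
  proof
    assume "cls x = cls y"
    then have "x \<in> cls y" using F.rcos_self[OF x tensor_kernel_subgroup] by simp
    then show "x - y \<in> tensor_kernel R M N" by (auto simp: r_coset_def)
  next
    assume k: "x - y \<in> tensor_kernel R M N"
    have "x \<in> cls y" unfolding r_coset_def using k by (auto intro!: bexI[of _ "x - y"])
    then show "cls x = cls y" using F.repr_independence[OF _ y tensor_kernel_subgroup] by metis
  qed
qed

lemma tensor_cls_neg: "x \<in> carrier FG \<Longrightarrow> \<ominus>\<^bsub>tensor R M N\<^esub> cls x = cls (- x)"
proof -
  assume x: "x \<in> carrier FG"
  interpret T: abelian_group "tensor R M N" by (rule tensor_abelian_group)
  have mx: "- x \<in> carrier FG" using x by simp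
  show ?thesis
    by (rule T.minus_equality) (use x mx tensor_cls_add[OF mx x] tensor_cls_zero in \<open>auto intro: tensor_cls_closed\<close>)
qed

lemma pure_closed: "m \<in> carrier M \<Longrightarrow> n \<in> carrier N \<Longrightarrow> pure_tensor R M N m n \<in> carrier (tensor R M N)"
  unfolding pure_tensor_def by (rule tensor_cls_closed) simp

lemma relator_cls: "x - y \<in> tensor_relators R M N \<Longrightarrow> x \<in> carrier FG \<Longrightarrow> y \<in> carrier FG \<Longrightarrow> cls x = cls y"
  by (subst tensor_cls_eq) (auto simp: tensor_kernel_def intro: generate.incl)

lemma pure_add_left:
  assumes "m \<in> carrier M" "m' \<in> carrier M" "n \<in> carrier N"
  shows "pure_tensor R M N (m \<oplus>\<^bsub>M\<^esub> m') n = pure_tensor R M N m n \<oplus>\<^bsub>tensor R M N\<^esub> pure_tensor R M N m' n"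
proof -
  have c: "frag_of (m, n) \<in> carrier FG" "frag_of (m', n) \<in> carrier FG" using assms by auto
  then have c2: "frag_of (m, n) + frag_of (m', n) \<in> carrier FG" by (metis F.m_closed mult_free_Abelian_group)
  have "cls (frag_of (m \<oplus>\<^bsub>M\<^esub> m', n)) = cls (frag_of (m, n) + frag_of (m', n))"
    by (rule relator_cls[OF _ _ c2]) (use assms in \<open>auto simp: tensor_relators_def algebra_simps\<close>)
  then show ?thesis unfolding pure_tensor_def by (simp add: tensor_cls_add[OF c])
qed

lemma pure_add_right:
  assumes "m \<in> carrier M" "n \<in> carrier N" "n' \<in> carrier N"
  shows "pure_tensor R M N m (n \<oplus>\<^bsub>N\<^esub> n') = pure_tensor R M N m n \<oplus>\<^bsub>tensor R M N\<^esub> pure_tensor R M N m n'"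
proof -
  have c: "frag_of (m, n) \<in> carrier FG" "frag_of (m, n') \<in> carrier FG" using assms by auto
  then have c2: "frag_of (m, n) + frag_of (m, n') \<in> carrier FG" by (metis F.m_closed mult_free_Abelian_group)
  have "cls (frag_of (m, n \<oplus>\<^bsub>N\<^esub> n')) = cls (frag_of (m, n) + frag_of (m, n'))"
    by (rule relator_cls[OF _ _ c2]) (use assms in \<open>auto simp: tensor_relators_def algebra_simps\<close>)
  then show ?thesis unfolding pure_tensor_def by (simp add: tensor_cls_add[OF c])
qed

lemma pure_balanced:
  assumes "r \<in> carrier R" "m \<in> carrier M" "n \<in> carrier N"
  shows "pure_tensor R M N (r \<odot>\<^bsub>M\<^esub> m) n = pure_tensor R M N m (r \<odot>\<^bsub>N\<^esub> n)"
  unfolding pure_tensor_def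
  by (rule relator_cls) (use assms in \<open>auto simp: tensor_relators_def intro: M.right_smult_closed N.left_smult_closed\<close>)

lemma pure_tensor_balanced: "balanced R M N (tensor R M N) (pure_tensor R M N)"
  by (rule balancedI) (auto simp: pure_closed pure_add_left pure_add_right pure_balanced)

text \<open>
  The negative of a pure tensor is a pure tensor, so the classes of the free generators reach every
  element by addition alone. The proof is an induction over the free abelian group, whose induction rule
  uses differences; the negation step replaces \<open>Q\<close> by the reflected property \<open>Q (\<ominus> t)\<close>, which is why
  the invariant quantifies over all properties with the two closure conditions.
\<close>

lemma tensor_induct [consumes 1, case_names pure add]:
  assumes t: "t \<in> carrier (tensor R M N)"
    and p: "\<And>m n. m \<in> carrier M \<Longrightarrow> n \<in> carrier N \<Longrightarrow> Q (pure_tensor R M N m n)"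
    and a: "\<And>x y. x \<in> carrier (tensor R M N) \<Longrightarrow> y \<in> carrier (tensor R M N) \<Longrightarrow> Q x \<Longrightarrow> Q y \<Longrightarrow>
      Q (x \<oplus>\<^bsub>tensor R M N\<^esub> y)"
  shows "Q t"
proof -
  interpret T: abelian_group "tensor R M N" by (rule tensor_abelian_group)
  define cl where "cl Q \<longleftrightarrow> (\<forall>m\<in>carrier M. \<forall>n\<in>carrier N. Q (pure_tensor R M N m n)) \<and>
    (\<forall>x\<in>carrier (tensor R M N). \<forall>y\<in>carrier (tensor R M N). Q x \<longrightarrow> Q y \<longrightarrow> Q (x \<oplus>\<^bsub>tensor R M N\<^esub> y))" for Q
  define G where "G x \<longleftrightarrow> x \<in> carrier FG \<and> (\<forall>Q. cl Q \<longrightarrow> Q (cls x))" for x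
  have GD: "Q (cls x)" if "G x" "cl Q" for Q x
    using that(1) unfolding G_def by (elim conjE allE[of _ Q] impE) (rule that(2))
  have neg: "G (- x)" if Gx: "G x" for x
  proof -
    have x: "x \<in> carrier FG" "- x \<in> carrier FG" using Gx by (simp_all add: G_def)
    have "Q (cls (- x))" if Q: "cl Q" for Q
    proof -
      let ?Q = "\<lambda>t. Q (\<ominus>\<^bsub>tensor R M N\<^esub> t)"
      have "?Q (pure_tensor R M N m n)" if mn: "m \<in> carrier M" "n \<in> carrier N" for m n
      proof -
        have add: "additive_map M (tensor R M N) (\<lambda>m. pure_tensor R M N m n)"
          using pure_tensor_balanced mn by (simp add: balanced_def)
        have "\<ominus>\<^bsub>tensor R M N\<^esub> pure_tensor R M N m n = pure_tensor R M N (\<ominus>\<^bsub>M\<^esub> m) n"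
          using additive_neg[OF M.abelian_group_axioms tensor_abelian_group add mn(1)] by simp
        then show ?thesis using Q mn by (simp add: cl_def)
      qed
      moreover have "?Q (x \<oplus>\<^bsub>tensor R M N\<^esub> y)"
        if "x \<in> carrier (tensor R M N)" "y \<in> carrier (tensor R M N)" "?Q x" "?Q y" for x y
        using Q that by (simp add: cl_def T.minus_add)
      ultimately have "cl ?Q" by (simp add: cl_def)
      then have "?Q (cls x)" by (rule GD[OF Gx])
      then show ?thesis using tensor_cls_neg[OF x(1)] by simp
    qed
    then show ?thesis unfolding G_def using x(2) by (intro conjI allI impI)
  qed
  have G: "G x" if "Poly_Mapping.keys x \<subseteq> carrier M \<times> carrier N" for x
    using that
  proof (rule free_Abelian_group_induct)
    have "cls 0 = pure_tensor R M N \<zero>\<^bsub>M\<^esub> \<zero>\<^bsub>N\<^esub>"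
      using additive_zero[of M "tensor R M N" "\<lambda>m. pure_tensor R M N m \<zero>\<^bsub>N\<^esub>"] pure_tensor_balanced
      by (simp add: balanced_def M.abelian_group_axioms tensor_abelian_group tensor_cls_zero)
    then show "G 0" by (simp add: G_def cl_def)
  next
    fix x y assume k: "Poly_Mapping.keys x \<subseteq> carrier M \<times> carrier N" "Poly_Mapping.keys y \<subseteq> carrier M \<times> carrier N"
      and "G x" "G y"
    then have x: "G x" and y: "G (- y)" using neg by auto
    have xy: "x - y \<in> carrier FG"
      using order_trans[OF keys_diff[of x y]] k by simp
    have c: "x \<in> carrier FG" "- y \<in> carrier FG" using x y by (simp_all add: G_def)
    have "Q (cls (x - y))" if Q: "cl Q" for Q
    proof -
      have "Q (cls x)" "Q (cls (- y))" using GD[OF x Q] GD[OF y Q] .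
      then have "Q (cls x \<oplus>\<^bsub>tensor R M N\<^esub> cls (- y))"
        using Q tensor_cls_closed[OF c(1)] tensor_cls_closed[OF c(2)] by (simp add: cl_def)
      then show ?thesis using tensor_cls_add[OF c] by simp
    qed
    then show "G (x - y)" unfolding G_def using xy by (intro conjI allI impI)
  next
    fix a assume "a \<in> carrier M \<times> carrier N"
    then show "G (frag_of a)" by (cases a) (simp add: G_def cl_def pure_tensor_def)
  qed
  obtain x where x: "x \<in> carrier FG" "t = cls x" by (rule tensor_carrierE[OF t])
  then have "G x" using G by simp
  then have "Q (cls x)" by (rule GD) (simp add: cl_def p a)
  then show ?thesis using x by simp
qed

context
  fixes P :: "('p, 'w) ring_scheme" and \<beta> :: "'m \<Rightarrow> 'n \<Rightarrow> 'p"
  assumes P: "abelian_group P" and \<beta>: "balanced R M N P \<beta>"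
begin

interpretation P: abelian_group P by (rule P)

lemma balanced_value_closed: "(m, n) \<in> carrier M \<times> carrier N \<Longrightarrow> \<beta> m n \<in> carrier P"
  using balancedD(1)[OF \<beta>] by simp

lemma lift_eval_closed: "Poly_Mapping.keys c \<subseteq> carrier M \<times> carrier N \<Longrightarrow> frag_eval P \<beta> c \<in> carrier P"
  by (rule frag_eval_closed[OF P, where S = "carrier M \<times> carrier N"]) (erule balanced_value_closed | assumption)+

lemma lift_eval_add: "Poly_Mapping.keys c \<subseteq> carrier M \<times> carrier N \<Longrightarrow> Poly_Mapping.keys d \<subseteq> carrier M \<times> carrier N \<Longrightarrow>
    frag_eval P \<beta> (c + d) = frag_eval P \<beta> c \<oplus>\<^bsub>P\<^esub> frag_eval P \<beta> d"
  by (rule frag_eval_add[OF P, where S = "carrier M \<times> carrier N"]) (erule balanced_value_closed | assumption)+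

lemma lift_eval_diff: "Poly_Mapping.keys c \<subseteq> carrier M \<times> carrier N \<Longrightarrow> Poly_Mapping.keys d \<subseteq> carrier M \<times> carrier N \<Longrightarrow>
    frag_eval P \<beta> (c - d) = frag_eval P \<beta> c \<ominus>\<^bsub>P\<^esub> frag_eval P \<beta> d"
  by (rule frag_eval_diff[OF P, where S = "carrier M \<times> carrier N"]) (erule balanced_value_closed | assumption)+

lemma lift_eval_zero: "frag_eval P \<beta> 0 = \<zero>\<^bsub>P\<^esub>"
  by (simp add: frag_eval_def)

lemma lift_eval_of: "m \<in> carrier M \<Longrightarrow> n \<in> carrier N \<Longrightarrow> frag_eval P \<beta> (frag_of (m, n)) = \<beta> m n"
  by (rule frag_eval_of[OF P, where S = "carrier M \<times> carrier N"]) (erule balanced_value_closed | simp)+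

text \<open>
  The three kinds of relators correspond to the three clauses of balancedness.
\<close>

lemma frag_eval_relator:
  assumes "x \<in> tensor_relators R M N" shows "frag_eval P \<beta> x = \<zero>\<^bsub>P\<^esub>"
proof -
  have 2: "frag_eval P \<beta> (frag_of (m, n) - frag_of (m', n')) = \<beta> m n \<ominus>\<^bsub>P\<^esub> \<beta> m' n'"
    if "m \<in> carrier M" "n \<in> carrier N" "m' \<in> carrier M" "n' \<in> carrier N" for m n m' n'
    by (subst lift_eval_diff) (use that in \<open>simp_all add: lift_eval_of\<close>)
  have 3: "frag_eval P \<beta> (frag_of (m, n) - frag_of (m', n') - frag_of (m'', n'')) = \<zero>\<^bsub>P\<^esub>"
    if "m \<in> carrier M" "n \<in> carrier N" "m' \<in> carrier M" "n' \<in> carrier N" "m'' \<in> carrier M" "n'' \<in> carrier N"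
      and e: "\<beta> m n = \<beta> m' n' \<oplus>\<^bsub>P\<^esub> \<beta> m'' n''" for m n m' n' m'' n''
  proof -
    have "Poly_Mapping.keys (frag_of (m, n) - frag_of (m', n')) \<subseteq> carrier M \<times> carrier N"
      by (rule order_trans[OF keys_diff]) (use that in simp)
    then have "frag_eval P \<beta> (frag_of (m, n) - frag_of (m', n') - frag_of (m'', n''))
      = \<beta> m n \<ominus>\<^bsub>P\<^esub> \<beta> m' n' \<ominus>\<^bsub>P\<^esub> \<beta> m'' n''"
      by (subst lift_eval_diff) (use that in \<open>simp_all add: 2 lift_eval_of\<close>)
    moreover have "u \<oplus>\<^bsub>P\<^esub> v \<ominus>\<^bsub>P\<^esub> u \<ominus>\<^bsub>P\<^esub> v = \<zero>\<^bsub>P\<^esub>" if "u \<in> carrier P" "v \<in> carrier P" for u v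
    proof -
      have "u \<oplus>\<^bsub>P\<^esub> v \<ominus>\<^bsub>P\<^esub> u = v"
        unfolding a_minus_def P.a_comm[OF that] using that by (simp add: P.a_assoc P.r_neg)
      then show ?thesis using that by (simp add: a_minus_def P.r_neg)
    qed
    ultimately show ?thesis using that balanced_value_closed by (simp add: e)
  qed
  have 4: "u \<ominus>\<^bsub>P\<^esub> u = \<zero>\<^bsub>P\<^esub>" if "u \<in> carrier P" for u
    using that by (simp add: a_minus_def P.r_neg)
  show ?thesis
    using assms unfolding tensor_relators_def
    by (elim UnE; clarsimp)
      (auto intro!: 3 simp: 2 4 balancedD[OF \<beta>] M.right_smult_closed N.left_smult_closed)
qed

lemma frag_eval_kernel:
  assumes "x \<in> tensor_kernel R M N" shows "frag_eval P \<beta> x = \<zero>\<^bsub>P\<^esub>"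
proof -
  have kc: "x \<in> tensor_kernel R M N \<Longrightarrow> Poly_Mapping.keys x \<subseteq> carrier M \<times> carrier N" for x
    using subgroup.mem_carrier[OF tensor_kernel_subgroup, of x] by simp
  have rc: "x \<in> tensor_relators R M N \<Longrightarrow> Poly_Mapping.keys x \<subseteq> carrier M \<times> carrier N" for x
    using subsetD[OF tensor_relators_carrier, of x] by simp
  show ?thesis
    using assms unfolding tensor_kernel_def
  proof (induction x rule: generate.induct)
    case one then show ?case by (simp add: lift_eval_zero)
  next
    case (incl h) then show ?case by (rule frag_eval_relator)
  next
    case (inv h)
    then show ?case
      using lift_eval_diff[of 0 h] frag_eval_relator[OF inv] rc[OF inv]
      by (simp add: lift_eval_zero a_minus_def)
  next
    case (eng h1 h2)
    then show ?case using lift_eval_add[of h1 h2] kc by (simp add: tensor_kernel_def)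
  qed
qed

text \<open>
  Two representatives of a class differ by an element of the kernel, on which evaluation vanishes;
  the set of values on the class is therefore a singleton.
\<close>

lemma tensor_lift_cls:
  assumes "x \<in> carrier FG" shows "tensor_lift P \<beta> (cls x) = frag_eval P \<beta> x"
proof -
  have eq: "frag_eval P \<beta> y = frag_eval P \<beta> x" if "y \<in> cls x" for y
  proof -
    from that obtain k where k: "k \<in> tensor_kernel R M N" "y = k + x" by (auto simp: r_coset_def)
    then have "k \<in> carrier FG" using subgroup.subset[OF tensor_kernel_subgroup] by blast
    then show ?thesis using k lift_eval_add[of k x] frag_eval_kernel[OF k(1)] assms
        lift_eval_closed[of x] by simp
  qed
  have "frag_eval P \<beta> ` cls x = (\<lambda>_. frag_eval P \<beta> x) ` cls x"
    by (rule image_cong[OF refl eq])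
  also have "\<dots> = {frag_eval P \<beta> x}"
    by (rule image_constant[OF F.rcos_self[OF assms tensor_kernel_subgroup]])
  finally show ?thesis by (simp add: tensor_lift_def)
qed

lemma tensor_lift_pure:
  "m \<in> carrier M \<Longrightarrow> n \<in> carrier N \<Longrightarrow> tensor_lift P \<beta> (pure_tensor R M N m n) = \<beta> m n"
  unfolding pure_tensor_def by (simp add: tensor_lift_cls lift_eval_of)

lemma tensor_lift_additive: "additive_map (tensor R M N) P (tensor_lift P \<beta>)"
proof (rule additiveI)
  fix t assume "t \<in> carrier (tensor R M N)"
  then obtain x where x: "x \<in> carrier FG" "t = cls x" by (rule tensor_carrierE)
  show "tensor_lift P \<beta> t \<in> carrier P" using x lift_eval_closed[of x] by (simp add: tensor_lift_cls)
  fix t' assume "t' \<in> carrier (tensor R M N)"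
  then obtain y where y: "y \<in> carrier FG" "t' = cls y" by (rule tensor_carrierE)
  have xy: "x + y \<in> carrier FG" using x y by (metis F.m_closed mult_free_Abelian_group)
  show "tensor_lift P \<beta> (t \<oplus>\<^bsub>tensor R M N\<^esub> t') = tensor_lift P \<beta> t \<oplus>\<^bsub>P\<^esub> tensor_lift P \<beta> t'"
    using x y xy lift_eval_add[of x y] by (simp add: tensor_cls_add tensor_lift_cls)
qed

end

lemma tensor_additive_eqI:
  assumes "additive_map (tensor R M N) P F" "additive_map (tensor R M N) P G"
    and "\<And>m n. m \<in> carrier M \<Longrightarrow> n \<in> carrier N \<Longrightarrow> F (pure_tensor R M N m n) = G (pure_tensor R M N m n)"
    and "t \<in> carrier (tensor R M N)"
  shows "F t = G t"
  using assms(4) by (induction t rule: tensor_induct) (auto simp: assms(3) additive_add[OF assms(1)] additive_add[OF assms(2)])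

end

lemma tensor_map_balanced:
  assumes "right_module R M'" "left_module R N'" "g \<in> mod_homs R M M'" "h \<in> mod_homs R N N'"
  shows "balanced R M N (tensor R M' N') (\<lambda>m n. pure_tensor R M' N' (g m) (h n))"
  using assms(3,4)
  by (intro balancedI) (simp_all add: mod_homs_def Pi_iff pure_closed[OF assms(1,2)] pure_add_left[OF assms(1,2)]
      pure_add_right[OF assms(1,2)] pure_balanced[OF assms(1,2)])

lemma tensor_map_pure:
  assumes "right_module R M" "left_module R N" "right_module R M'" "left_module R N'"
    "g \<in> mod_homs R M M'" "h \<in> mod_homs R N N'" "m \<in> carrier M" "n \<in> carrier N"
  shows "tensor_map R M' N' g h (pure_tensor R M N m n) = pure_tensor R M' N' (g m) (h n)"
  unfolding tensor_map_def
  by (rule tensor_lift_pure[OF assms(1,2) tensor_abelian_group[OF assms(3,4)] tensor_map_balanced]) (use assms in auto)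

lemma tensor_map_additive:
  assumes "right_module R M" "left_module R N" "right_module R M'" "left_module R N'"
    "g \<in> mod_homs R M M'" "h \<in> mod_homs R N N'"
  shows "additive_map (tensor R M N) (tensor R M' N') (tensor_map R M' N' g h)"
  unfolding tensor_map_def
  by (rule tensor_lift_additive[OF assms(1,2) tensor_abelian_group[OF assms(3,4)] tensor_map_balanced]) (use assms in auto)

section \<open>One-sided modules and bimodules\<close>

lemma mod_homsD:
  assumes "h \<in> mod_homs R M N"
  shows "x \<in> carrier M \<Longrightarrow> h x \<in> carrier N"
    "x \<in> carrier M \<Longrightarrow> y \<in> carrier M \<Longrightarrow> h (x \<oplus>\<^bsub>M\<^esub> y) = h x \<oplus>\<^bsub>N\<^esub> h y"
    "r \<in> carrier R \<Longrightarrow> x \<in> carrier M \<Longrightarrow> h (r \<odot>\<^bsub>M\<^esub> x) = r \<odot>\<^bsub>N\<^esub> h x"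
  using assms by (auto simp: mod_homs_def)

lemma mod_homsI:
  "(\<And>x. x \<in> carrier M \<Longrightarrow> h x \<in> carrier N) \<Longrightarrow>
   (\<And>x y. x \<in> carrier M \<Longrightarrow> y \<in> carrier M \<Longrightarrow> h (x \<oplus>\<^bsub>M\<^esub> y) = h x \<oplus>\<^bsub>N\<^esub> h y) \<Longrightarrow>
   (\<And>r x. r \<in> carrier R \<Longrightarrow> x \<in> carrier M \<Longrightarrow> h (r \<odot>\<^bsub>M\<^esub> x) = r \<odot>\<^bsub>N\<^esub> h x) \<Longrightarrow> h \<in> mod_homs R M N"
  by (simp add: mod_homs_def)

lemma mod_homs_additive: "h \<in> mod_homs R M N \<Longrightarrow> additive_map M N h"
  by (auto intro!: additiveI simp: mod_homsD)

lemma mod_homs_id [simp]: "id \<in> mod_homs R M M" by (rule mod_homsI) simp_all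

lemma left_moduleD:
  assumes "left_module R N"
  shows "ring R" "abelian_group N"
    and "a \<in> carrier R \<Longrightarrow> x \<in> carrier N \<Longrightarrow> a \<odot>\<^bsub>N\<^esub> x \<in> carrier N"
    and "a \<in> carrier R \<Longrightarrow> b \<in> carrier R \<Longrightarrow> x \<in> carrier N \<Longrightarrow> (a \<oplus>\<^bsub>R\<^esub> b) \<odot>\<^bsub>N\<^esub> x = a \<odot>\<^bsub>N\<^esub> x \<oplus>\<^bsub>N\<^esub> b \<odot>\<^bsub>N\<^esub> x"
    and "a \<in> carrier R \<Longrightarrow> x \<in> carrier N \<Longrightarrow> y \<in> carrier N \<Longrightarrow> a \<odot>\<^bsub>N\<^esub> (x \<oplus>\<^bsub>N\<^esub> y) = a \<odot>\<^bsub>N\<^esub> x \<oplus>\<^bsub>N\<^esub> a \<odot>\<^bsub>N\<^esub> y"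
    and "a \<in> carrier R \<Longrightarrow> b \<in> carrier R \<Longrightarrow> x \<in> carrier N \<Longrightarrow> (a \<otimes>\<^bsub>R\<^esub> b) \<odot>\<^bsub>N\<^esub> x = a \<odot>\<^bsub>N\<^esub> (b \<odot>\<^bsub>N\<^esub> x)"
    and "x \<in> carrier N \<Longrightarrow> \<one>\<^bsub>R\<^esub> \<odot>\<^bsub>N\<^esub> x = x"
proof -
  interpret left_module R N by fact
  show "ring R" "abelian_group N" by unfold_locales
  show "a \<in> carrier R \<Longrightarrow> x \<in> carrier N \<Longrightarrow> a \<odot>\<^bsub>N\<^esub> x \<in> carrier N"
    and "a \<in> carrier R \<Longrightarrow> b \<in> carrier R \<Longrightarrow> x \<in> carrier N \<Longrightarrow> (a \<oplus>\<^bsub>R\<^esub> b) \<odot>\<^bsub>N\<^esub> x = a \<odot>\<^bsub>N\<^esub> x \<oplus>\<^bsub>N\<^esub> b \<odot>\<^bsub>N\<^esub> x"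
    and "a \<in> carrier R \<Longrightarrow> x \<in> carrier N \<Longrightarrow> y \<in> carrier N \<Longrightarrow> a \<odot>\<^bsub>N\<^esub> (x \<oplus>\<^bsub>N\<^esub> y) = a \<odot>\<^bsub>N\<^esub> x \<oplus>\<^bsub>N\<^esub> a \<odot>\<^bsub>N\<^esub> y"
    and "a \<in> carrier R \<Longrightarrow> b \<in> carrier R \<Longrightarrow> x \<in> carrier N \<Longrightarrow> (a \<otimes>\<^bsub>R\<^esub> b) \<odot>\<^bsub>N\<^esub> x = a \<odot>\<^bsub>N\<^esub> (b \<odot>\<^bsub>N\<^esub> x)"
    and "x \<in> carrier N \<Longrightarrow> \<one>\<^bsub>R\<^esub> \<odot>\<^bsub>N\<^esub> x = x"
    by (rule left_smult_closed left_smult_l_distr left_smult_r_distr left_smult_assoc left_smult_one; assumption)+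
qed

lemma left_smult_zero:
  assumes "left_module R N"
  shows "r \<in> carrier R \<Longrightarrow> r \<odot>\<^bsub>N\<^esub> \<zero>\<^bsub>N\<^esub> = \<zero>\<^bsub>N\<^esub>" "x \<in> carrier N \<Longrightarrow> \<zero>\<^bsub>R\<^esub> \<odot>\<^bsub>N\<^esub> x = \<zero>\<^bsub>N\<^esub>"
proof -
  note L = left_moduleD[OF assms]
  interpret R: ring R by (rule L(1))
  show "r \<in> carrier R \<Longrightarrow> r \<odot>\<^bsub>N\<^esub> \<zero>\<^bsub>N\<^esub> = \<zero>\<^bsub>N\<^esub>"
    by (rule additive_zero[OF L(2) L(2)]) (simp add: additive_map_def L)
  show "x \<in> carrier N \<Longrightarrow> \<zero>\<^bsub>R\<^esub> \<odot>\<^bsub>N\<^esub> x = \<zero>\<^bsub>N\<^esub>"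
    by (rule additive_zero[OF R.is_abelian_group L(2), where g = "\<lambda>r. r \<odot>\<^bsub>N\<^esub> x"]) (simp add: additive_map_def L)
qed

lemma left_smult_minus_one:
  assumes "left_module R N" "x \<in> carrier N"
  shows "(\<ominus>\<^bsub>R\<^esub> \<one>\<^bsub>R\<^esub>) \<odot>\<^bsub>N\<^esub> x = \<ominus>\<^bsub>N\<^esub> x"
proof -
  note L = left_moduleD[OF assms(1)]
  interpret R: ring R by (rule L(1))
  have "additive_map R N (\<lambda>r. r \<odot>\<^bsub>N\<^esub> x)" using assms(2) by (simp add: additive_map_def L)
  from additive_neg[OF R.is_abelian_group L(2) this R.one_closed] show ?thesis using L(7)[OF assms(2)] by simp
qed

lemma left_moduleI:
  assumes "ring R" "abelian_group N"
    and "\<And>a x. a \<in> carrier R \<Longrightarrow> x \<in> carrier N \<Longrightarrow> a \<odot>\<^bsub>N\<^esub> x \<in> carrier N"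
    and "\<And>a b x. a \<in> carrier R \<Longrightarrow> b \<in> carrier R \<Longrightarrow> x \<in> carrier N \<Longrightarrow> (a \<oplus>\<^bsub>R\<^esub> b) \<odot>\<^bsub>N\<^esub> x = a \<odot>\<^bsub>N\<^esub> x \<oplus>\<^bsub>N\<^esub> b \<odot>\<^bsub>N\<^esub> x"
    and "\<And>a x y. a \<in> carrier R \<Longrightarrow> x \<in> carrier N \<Longrightarrow> y \<in> carrier N \<Longrightarrow> a \<odot>\<^bsub>N\<^esub> (x \<oplus>\<^bsub>N\<^esub> y) = a \<odot>\<^bsub>N\<^esub> x \<oplus>\<^bsub>N\<^esub> a \<odot>\<^bsub>N\<^esub> y"
    and "\<And>a b x. a \<in> carrier R \<Longrightarrow> b \<in> carrier R \<Longrightarrow> x \<in> carrier N \<Longrightarrow> (a \<otimes>\<^bsub>R\<^esub> b) \<odot>\<^bsub>N\<^esub> x = a \<odot>\<^bsub>N\<^esub> (b \<odot>\<^bsub>N\<^esub> x)"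
    and "\<And>x. x \<in> carrier N \<Longrightarrow> \<one>\<^bsub>R\<^esub> \<odot>\<^bsub>N\<^esub> x = x"
  shows "left_module R N"
  using assms by (simp add: left_module_def left_module_axioms_def)

lemma with_smult_simps [simp]:
  "carrier (with_smult M s) = carrier M" "x \<oplus>\<^bsub>with_smult M s\<^esub> y = x \<oplus>\<^bsub>M\<^esub> y"
  "\<zero>\<^bsub>with_smult M s\<^esub> = \<zero>\<^bsub>M\<^esub>" "a \<odot>\<^bsub>with_smult M s\<^esub> x = s a x"
  "x \<otimes>\<^bsub>with_smult M s\<^esub> y = x \<otimes>\<^bsub>M\<^esub> y" "\<one>\<^bsub>with_smult M s\<^esub> = \<one>\<^bsub>M\<^esub>"
  by (simp_all add: with_smult_def)

lemma abelian_group_transfer: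
  assumes "abelian_group M" "carrier M' = carrier M" "\<zero>\<^bsub>M'\<^esub> = \<zero>\<^bsub>M\<^esub>" "\<And>x y. x \<oplus>\<^bsub>M'\<^esub> y = x \<oplus>\<^bsub>M\<^esub> y"
  shows "abelian_group M'"
proof -
  interpret M: abelian_group M by fact
  show ?thesis
  proof (rule abelian_groupI)
    fix x assume "x \<in> carrier M'"
    then show "\<exists>y\<in>carrier M'. y \<oplus>\<^bsub>M'\<^esub> x = \<zero>\<^bsub>M'\<^esub>"
      using assms by (intro bexI[of _ "\<ominus>\<^bsub>M\<^esub> x"]) (auto simp: M.l_neg)
  qed (auto simp: assms M.a_ac)
qed

lemma with_smult_abelian_group [simp]: "abelian_group M \<Longrightarrow> abelian_group (with_smult M s)"
  by (rule abelian_group_transfer) simp_all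

lemma tensor_module_simps [simp]:
  "carrier (tensor_module R M N L) = carrier (tensor R M N)"
  "x \<oplus>\<^bsub>tensor_module R M N L\<^esub> y = x \<oplus>\<^bsub>tensor R M N\<^esub> y"
  "\<zero>\<^bsub>tensor_module R M N L\<^esub> = \<zero>\<^bsub>tensor R M N\<^esub>"
  "s \<odot>\<^bsub>tensor_module R M N L\<^esub> x = tensor_map R M N (\<lambda>m. s \<odot>\<^bsub>L\<^esub> m) id x"
  by (simp_all add: tensor_module_def)

text \<open>
  The bimodule condition makes the left action of \<open>s\<close> on the first factor \<open>R\<close>-linear, so that it passes
  to the tensor product; the module laws are then checked on pure tensors.
\<close>

lemma tensor_module_left_module:
  assumes M: "right_module R M" and N: "left_module R N" and L: "left_module S L"
    and c: "carrier L = carrier M" "\<And>x y. x \<oplus>\<^bsub>L\<^esub> y = x \<oplus>\<^bsub>M\<^esub> y"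
    and bi: "\<And>s r m. s \<in> carrier S \<Longrightarrow> r \<in> carrier R \<Longrightarrow> m \<in> carrier M \<Longrightarrow> s \<odot>\<^bsub>L\<^esub> (r \<odot>\<^bsub>M\<^esub> m) = r \<odot>\<^bsub>M\<^esub> (s \<odot>\<^bsub>L\<^esub> m)"
  shows "left_module S (tensor_module R M N L)"
    and "s \<in> carrier S \<Longrightarrow> m \<in> carrier M \<Longrightarrow> n \<in> carrier N \<Longrightarrow>
      s \<odot>\<^bsub>tensor_module R M N L\<^esub> pure_tensor R M N m n = pure_tensor R M N (s \<odot>\<^bsub>L\<^esub> m) n"
proof -
  note LD = left_moduleD[OF L]
  have h: "(\<lambda>m. s \<odot>\<^bsub>L\<^esub> m) \<in> mod_homs R M M" if "s \<in> carrier S" for s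
    by (rule mod_homsI) (use LD(3,5) that bi in \<open>simp_all add: c(1) c(2)[symmetric]\<close>)
  note A = tensor_map_additive[OF M N M N h mod_homs_id]
  have p: "tensor_map R M N (\<lambda>m. s \<odot>\<^bsub>L\<^esub> m) id (pure_tensor R M N m n) = pure_tensor R M N (s \<odot>\<^bsub>L\<^esub> m) n"
    if "s \<in> carrier S" "m \<in> carrier M" "n \<in> carrier N" for s m n
    using tensor_map_pure[OF M N M N h[OF that(1)] mod_homs_id that(2,3)] by simp
  then show "s \<in> carrier S \<Longrightarrow> m \<in> carrier M \<Longrightarrow> n \<in> carrier N \<Longrightarrow>
      s \<odot>\<^bsub>tensor_module R M N L\<^esub> pure_tensor R M N m n = pure_tensor R M N (s \<odot>\<^bsub>L\<^esub> m) n" by simp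
  interpret S: ring S by (rule LD(1))
  interpret T: abelian_group "tensor R M N" by (rule tensor_abelian_group[OF M N])
  show "left_module S (tensor_module R M N L)"
  proof (rule left_moduleI[OF LD(1)])
    show "abelian_group (tensor_module R M N L)"
      by (rule abelian_group_transfer[OF tensor_abelian_group[OF M N]]) simp_all
    show "a \<odot>\<^bsub>tensor_module R M N L\<^esub> x \<in> carrier (tensor_module R M N L)"
      if "a \<in> carrier S" "x \<in> carrier (tensor_module R M N L)" for a x
      using additive_closed[OF A[OF that(1)]] that(2) by simp
    show "a \<odot>\<^bsub>tensor_module R M N L\<^esub> (x \<oplus>\<^bsub>tensor_module R M N L\<^esub> y) =
        a \<odot>\<^bsub>tensor_module R M N L\<^esub> x \<oplus>\<^bsub>tensor_module R M N L\<^esub> a \<odot>\<^bsub>tensor_module R M N L\<^esub> y"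
      if "a \<in> carrier S" "x \<in> carrier (tensor_module R M N L)" "y \<in> carrier (tensor_module R M N L)" for a x y
      using additive_add[OF A[OF that(1)]] that(2,3) by simp
    fix a b x assume a: "a \<in> carrier S" and b: "b \<in> carrier S" and "x \<in> carrier (tensor_module R M N L)"
    then have x: "x \<in> carrier (tensor R M N)" by simp
    have add: "additive_map (tensor R M N) (tensor R M N) (\<lambda>x. tensor_map R M N (\<lambda>m. a \<odot>\<^bsub>L\<^esub> m) id x \<oplus>\<^bsub>tensor R M N\<^esub> tensor_map R M N (\<lambda>m. b \<odot>\<^bsub>L\<^esub> m) id x)"
      by (rule additiveI) (simp_all add: additive_add[OF A[OF a]] additive_add[OF A[OF b]] additive_closed[OF A[OF a]] additive_closed[OF A[OF b]] T.a_ac)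
    show "(a \<oplus>\<^bsub>S\<^esub> b) \<odot>\<^bsub>tensor_module R M N L\<^esub> x =
        a \<odot>\<^bsub>tensor_module R M N L\<^esub> x \<oplus>\<^bsub>tensor_module R M N L\<^esub> b \<odot>\<^bsub>tensor_module R M N L\<^esub> x"
      unfolding tensor_module_simps
      by (rule tensor_additive_eqI[OF M N A add _ x])
        (use a b LD(3,4) in \<open>simp_all add: p c pure_add_left[OF M N]\<close>)
    show "(a \<otimes>\<^bsub>S\<^esub> b) \<odot>\<^bsub>tensor_module R M N L\<^esub> x = a \<odot>\<^bsub>tensor_module R M N L\<^esub> (b \<odot>\<^bsub>tensor_module R M N L\<^esub> x)"
      unfolding tensor_module_simps
      by (rule tensor_additive_eqI[OF M N A additive_comp[OF A A] _ x])
        (use a b LD(3,6) in \<open>simp_all add: p c\<close>)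
  next
    fix x assume "x \<in> carrier (tensor_module R M N L)"
    then have x: "x \<in> carrier (tensor R M N)" by simp
    show "\<one>\<^bsub>S\<^esub> \<odot>\<^bsub>tensor_module R M N L\<^esub> x = x"
      unfolding tensor_module_simps
      by (rule tensor_additive_eqI[OF M N A _ _ x])
        (use LD(7) in \<open>simp_all add: p c additive_map_def\<close>)
  qed
qed

section \<open>Complex vector spaces and their tensor products\<close>

abbreviation cspace :: "(complex, 'm, 'x) module_scheme \<Rightarrow> bool" where "cspace \<equiv> module complex_ring"

abbreviation clin ::
  "(complex, 'm, 'x) module_scheme \<Rightarrow> (complex, 'n, 'y) module_scheme \<Rightarrow> ('m \<Rightarrow> 'n) set"
  where "clin \<equiv> mod_homs complex_ring"

abbreviation cfield :: "(complex, complex) module" where "cfield \<equiv> with_smult complex_ring (*)"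

lemma complex_ring_simps [simp]:
  "carrier complex_ring = UNIV" "a \<otimes>\<^bsub>complex_ring\<^esub> b = a * b" "\<one>\<^bsub>complex_ring\<^esub> = 1"
  "\<zero>\<^bsub>complex_ring\<^esub> = 0" "a \<oplus>\<^bsub>complex_ring\<^esub> b = a + b"
  by (simp_all add: complex_ring_def)

lemma cring_complex_ring: "cring complex_ring"
proof (rule cringI)
  show "abelian_group complex_ring"
    by (rule abelian_groupI) (auto simp: algebra_simps intro: exI[of _ "- x" for x :: complex])
  show "comm_monoid complex_ring"
    by unfold_locales (auto simp: algebra_simps)
qed (auto simp: algebra_simps)

lemma complex_ring_neg [simp]: "\<ominus>\<^bsub>complex_ring\<^esub> a = - a"
proof -
  interpret cring complex_ring by (rule cring_complex_ring)
  show ?thesis by (rule minus_equality) auto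
qed

lemma cfield_cspace [simp]: "cspace cfield"
proof (rule moduleI[OF cring_complex_ring])
  show "abelian_group cfield" using cring_complex_ring by (simp add: cring_def ring_def)
qed (auto simp: algebra_simps)

lemma cspaceI:
  assumes "abelian_group M" "\<And>a x. x \<in> carrier M \<Longrightarrow> a \<odot>\<^bsub>M\<^esub> x \<in> carrier M"
    "\<And>a b x. x \<in> carrier M \<Longrightarrow> (a + b) \<odot>\<^bsub>M\<^esub> x = a \<odot>\<^bsub>M\<^esub> x \<oplus>\<^bsub>M\<^esub> b \<odot>\<^bsub>M\<^esub> x"
    "\<And>a x y. x \<in> carrier M \<Longrightarrow> y \<in> carrier M \<Longrightarrow> a \<odot>\<^bsub>M\<^esub> (x \<oplus>\<^bsub>M\<^esub> y) = a \<odot>\<^bsub>M\<^esub> x \<oplus>\<^bsub>M\<^esub> a \<odot>\<^bsub>M\<^esub> y"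
    "\<And>a b x. x \<in> carrier M \<Longrightarrow> (a * b) \<odot>\<^bsub>M\<^esub> x = a \<odot>\<^bsub>M\<^esub> (b \<odot>\<^bsub>M\<^esub> x)"
    "\<And>x. x \<in> carrier M \<Longrightarrow> 1 \<odot>\<^bsub>M\<^esub> x = x"
  shows "cspace M"
  by (rule moduleI[OF cring_complex_ring assms(1)]) (auto simp: assms)

lemma cspace_abelian_group [simp]: "cspace M \<Longrightarrow> abelian_group M"
  by (simp add: module_def)

lemma cspace_simps [simp]:
  assumes "cspace M"
  shows "\<zero>\<^bsub>M\<^esub> \<in> carrier M"
    and "x \<in> carrier M \<Longrightarrow> a \<odot>\<^bsub>M\<^esub> x \<in> carrier M"
    and "x \<in> carrier M \<Longrightarrow> y \<in> carrier M \<Longrightarrow> x \<oplus>\<^bsub>M\<^esub> y \<in> carrier M"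
    and "x \<in> carrier M \<Longrightarrow> \<ominus>\<^bsub>M\<^esub> x \<in> carrier M"
    and "x \<in> carrier M \<Longrightarrow> 1 \<odot>\<^bsub>M\<^esub> x = x"
    and "x \<in> carrier M \<Longrightarrow> 0 \<odot>\<^bsub>M\<^esub> x = \<zero>\<^bsub>M\<^esub>"
    and "a \<odot>\<^bsub>M\<^esub> \<zero>\<^bsub>M\<^esub> = \<zero>\<^bsub>M\<^esub>"
    and "x \<in> carrier M \<Longrightarrow> x \<oplus>\<^bsub>M\<^esub> \<zero>\<^bsub>M\<^esub> = x"
    and "x \<in> carrier M \<Longrightarrow> \<zero>\<^bsub>M\<^esub> \<oplus>\<^bsub>M\<^esub> x = x"
    and "x \<in> carrier M \<Longrightarrow> y \<in> carrier M \<Longrightarrow> a \<odot>\<^bsub>M\<^esub> (x \<oplus>\<^bsub>M\<^esub> y) = a \<odot>\<^bsub>M\<^esub> x \<oplus>\<^bsub>M\<^esub> a \<odot>\<^bsub>M\<^esub> y"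
    and "x \<in> carrier M \<Longrightarrow> a \<odot>\<^bsub>M\<^esub> (b \<odot>\<^bsub>M\<^esub> x) = (a * b) \<odot>\<^bsub>M\<^esub> x"
proof -
  interpret module complex_ring M by fact
  show "\<zero>\<^bsub>M\<^esub> \<in> carrier M"
    and "x \<in> carrier M \<Longrightarrow> a \<odot>\<^bsub>M\<^esub> x \<in> carrier M"
    and "x \<in> carrier M \<Longrightarrow> y \<in> carrier M \<Longrightarrow> x \<oplus>\<^bsub>M\<^esub> y \<in> carrier M"
    and "x \<in> carrier M \<Longrightarrow> \<ominus>\<^bsub>M\<^esub> x \<in> carrier M"
    and "x \<in> carrier M \<Longrightarrow> 1 \<odot>\<^bsub>M\<^esub> x = x"
    and "x \<in> carrier M \<Longrightarrow> 0 \<odot>\<^bsub>M\<^esub> x = \<zero>\<^bsub>M\<^esub>"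
    and "a \<odot>\<^bsub>M\<^esub> \<zero>\<^bsub>M\<^esub> = \<zero>\<^bsub>M\<^esub>"
    and "x \<in> carrier M \<Longrightarrow> x \<oplus>\<^bsub>M\<^esub> \<zero>\<^bsub>M\<^esub> = x"
    and "x \<in> carrier M \<Longrightarrow> \<zero>\<^bsub>M\<^esub> \<oplus>\<^bsub>M\<^esub> x = x"
    and "x \<in> carrier M \<Longrightarrow> y \<in> carrier M \<Longrightarrow> a \<odot>\<^bsub>M\<^esub> (x \<oplus>\<^bsub>M\<^esub> y) = a \<odot>\<^bsub>M\<^esub> x \<oplus>\<^bsub>M\<^esub> a \<odot>\<^bsub>M\<^esub> y"
    and "x \<in> carrier M \<Longrightarrow> a \<odot>\<^bsub>M\<^esub> (b \<odot>\<^bsub>M\<^esub> x) = (a * b) \<odot>\<^bsub>M\<^esub> x"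
    using smult_one[of x] smult_l_null[of x] smult_r_null[of a] smult_r_distr[of a x y] smult_assoc1[of a b x]
    by (auto simp: smult_closed)
qed

lemma cspace_smult_add: "cspace M \<Longrightarrow> x \<in> carrier M \<Longrightarrow> (a + b) \<odot>\<^bsub>M\<^esub> x = a \<odot>\<^bsub>M\<^esub> x \<oplus>\<^bsub>M\<^esub> b \<odot>\<^bsub>M\<^esub> x"
  using module.smult_l_distr[of complex_ring M a b x] by simp

lemma cspace_neg: "cspace M \<Longrightarrow> x \<in> carrier M \<Longrightarrow> \<ominus>\<^bsub>M\<^esub> x = (-1) \<odot>\<^bsub>M\<^esub> x"
  using module.smult_l_minus[of complex_ring M 1 x] by simp

lemma cspace_add_assoc:
  assumes "cspace M" "x \<in> carrier M" "y \<in> carrier M" "z \<in> carrier M"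
  shows "(x \<oplus>\<^bsub>M\<^esub> y) \<oplus>\<^bsub>M\<^esub> z = x \<oplus>\<^bsub>M\<^esub> (y \<oplus>\<^bsub>M\<^esub> z)"
proof -
  interpret abelian_group M using assms by simp
  show ?thesis using assms by (simp add: a_assoc)
qed

lemma cspace_add_comm:
  assumes "cspace M" "x \<in> carrier M" "y \<in> carrier M"
  shows "x \<oplus>\<^bsub>M\<^esub> y = y \<oplus>\<^bsub>M\<^esub> x"
proof -
  interpret abelian_group M using assms by simp
  show ?thesis using assms by (simp add: a_comm)
qed

lemma cspace_add_lcomm:
  assumes "cspace M" "x \<in> carrier M" "y \<in> carrier M" "z \<in> carrier M"
  shows "x \<oplus>\<^bsub>M\<^esub> (y \<oplus>\<^bsub>M\<^esub> z) = y \<oplus>\<^bsub>M\<^esub> (x \<oplus>\<^bsub>M\<^esub> z)"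
proof -
  interpret abelian_group M using assms by simp
  show ?thesis using assms by (simp add: a_lcomm)
qed

lemmas cspace_add_ac = cspace_add_assoc cspace_add_comm cspace_add_lcomm

lemma cspace_right_module: "cspace M \<Longrightarrow> right_module complex_ring M"
  by (intro right_module.intro right_module_axioms.intro)
    (auto simp: cspace_smult_add mult.commute cring.axioms(1)[OF cring_complex_ring])

lemma cspace_left_module: "cspace M \<Longrightarrow> left_module complex_ring M"
  by (intro left_module.intro left_module_axioms.intro)
    (auto simp: cspace_smult_add cring.axioms(1)[OF cring_complex_ring])

lemma clinI:
  assumes "\<And>x. x \<in> carrier X \<Longrightarrow> f x \<in> carrier Y"
    "\<And>x y. x \<in> carrier X \<Longrightarrow> y \<in> carrier X \<Longrightarrow> f (x \<oplus>\<^bsub>X\<^esub> y) = f x \<oplus>\<^bsub>Y\<^esub> f y"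
    "\<And>a x. x \<in> carrier X \<Longrightarrow> f (a \<odot>\<^bsub>X\<^esub> x) = a \<odot>\<^bsub>Y\<^esub> f x"
  shows "f \<in> clin X Y"
  using assms by (simp add: mod_homs_def)

lemma clinD:
  assumes "f \<in> clin X Y"
  shows "x \<in> carrier X \<Longrightarrow> f x \<in> carrier Y"
    "x \<in> carrier X \<Longrightarrow> y \<in> carrier X \<Longrightarrow> f (x \<oplus>\<^bsub>X\<^esub> y) = f x \<oplus>\<^bsub>Y\<^esub> f y"
    "x \<in> carrier X \<Longrightarrow> f (a \<odot>\<^bsub>X\<^esub> x) = a \<odot>\<^bsub>Y\<^esub> f x"
  using assms by (auto simp: mod_homs_def)

lemma clin_additive: "f \<in> clin X Y \<Longrightarrow> additive_map X Y f"
  by (auto intro!: additiveI simp: clinD)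

lemma clin_zero: "cspace X \<Longrightarrow> cspace Y \<Longrightarrow> f \<in> clin X Y \<Longrightarrow> f \<zero>\<^bsub>X\<^esub> = \<zero>\<^bsub>Y\<^esub>"
  by (rule additive_zero) (auto simp: clin_additive)

lemma clin_id [simp]: "id \<in> clin X X" and clin_ident [simp]: "(\<lambda>x. x) \<in> clin X X"
  by (auto intro: clinI)

lemma clin_comp: "f \<in> clin X Y \<Longrightarrow> g \<in> clin Y Z \<Longrightarrow> (\<lambda>x. g (f x)) \<in> clin X Z"
  by (rule clinI) (auto simp: clinD)

lemma clin_smult [simp]: "cspace X \<Longrightarrow> (\<odot>\<^bsub>X\<^esub>) a \<in> clin X X"
  by (rule clinI) (auto simp: mult.commute)

lemma clin_functional_smult: "cspace Y \<Longrightarrow> h \<in> clin X cfield \<Longrightarrow> y \<in> carrier Y \<Longrightarrow> (\<lambda>x. h x \<odot>\<^bsub>Y\<^esub> y) \<in> clin X Y"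
  by (rule clinI) (auto simp: clinD cspace_smult_add)

lemma additive_finsum:
  assumes "abelian_group M" "abelian_group P" "additive_map M P g" "finite I" "\<And>i. i \<in> I \<Longrightarrow> x i \<in> carrier M"
  shows "g (\<Oplus>\<^bsub>M\<^esub>i\<in>I. x i) = (\<Oplus>\<^bsub>P\<^esub>i\<in>I. g (x i))"
proof -
  interpret M: abelian_group M by fact
  interpret P: abelian_group P by fact
  show ?thesis
    using assms(4,5)
  proof (induction I)
    case empty then show ?case using additive_zero[OF assms(1-3)] by simp
  next
    case (insert i I)
    then show ?case using additiveI by (simp add: additive_add[OF assms(3)] additive_closed[OF assms(3)] Pi_iff)
  qed
qed

lemmas clin_finsum = additive_finsum[OF cspace_abelian_group cspace_abelian_group clin_additive]

lemma cspace_finsum_closed: "cspace M \<Longrightarrow> (\<And>i. i \<in> I \<Longrightarrow> x i \<in> carrier M) \<Longrightarrow> (\<Oplus>\<^bsub>M\<^esub>i\<in>I. x i) \<in> carrier M"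
  using abelian_monoid.finsum_closed[of M x I] by (auto simp: abelian_group_def dest!: cspace_abelian_group)

lemma finsum_cfield [simp]: "finite I \<Longrightarrow> (\<Oplus>\<^bsub>cfield\<^esub>i\<in>I. f i) = sum f I"
proof -
  interpret abelian_group cfield by simp
  assume "finite I" then show ?thesis by (induction I) auto
qed

definition cbilin ::
  "(complex, 'l, 'x) module_scheme \<Rightarrow> (complex, 'm, 'y) module_scheme \<Rightarrow> (complex, 'n, 'z) module_scheme \<Rightarrow>
   ('l \<Rightarrow> 'm \<Rightarrow> 'n) \<Rightarrow> bool"
  where "cbilin X Y Z \<beta> \<longleftrightarrow> (\<forall>x\<in>carrier X. \<beta> x \<in> clin Y Z) \<and> (\<forall>y\<in>carrier Y. (\<lambda>x. \<beta> x y) \<in> clin X Z)"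

lemma cbilinI:
  "(\<And>x. x \<in> carrier X \<Longrightarrow> \<beta> x \<in> clin Y Z) \<Longrightarrow> (\<And>y. y \<in> carrier Y \<Longrightarrow> (\<lambda>x. \<beta> x y) \<in> clin X Z) \<Longrightarrow> cbilin X Y Z \<beta>"
  by (simp add: cbilin_def)

lemma cbilinD:
  assumes "cbilin X Y Z \<beta>"
  shows "x \<in> carrier X \<Longrightarrow> \<beta> x \<in> clin Y Z" "y \<in> carrier Y \<Longrightarrow> (\<lambda>x. \<beta> x y) \<in> clin X Z"
    "x \<in> carrier X \<Longrightarrow> y \<in> carrier Y \<Longrightarrow> \<beta> x y \<in> carrier Z"
    "x \<in> carrier X \<Longrightarrow> y \<in> carrier Y \<Longrightarrow> y' \<in> carrier Y \<Longrightarrow> \<beta> x (y \<oplus>\<^bsub>Y\<^esub> y') = \<beta> x y \<oplus>\<^bsub>Z\<^esub> \<beta> x y'"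
    "x \<in> carrier X \<Longrightarrow> x' \<in> carrier X \<Longrightarrow> y \<in> carrier Y \<Longrightarrow> \<beta> (x \<oplus>\<^bsub>X\<^esub> x') y = \<beta> x y \<oplus>\<^bsub>Z\<^esub> \<beta> x' y"
    "x \<in> carrier X \<Longrightarrow> y \<in> carrier Y \<Longrightarrow> \<beta> x (a \<odot>\<^bsub>Y\<^esub> y) = a \<odot>\<^bsub>Z\<^esub> \<beta> x y"
    "x \<in> carrier X \<Longrightarrow> y \<in> carrier Y \<Longrightarrow> \<beta> (a \<odot>\<^bsub>X\<^esub> x) y = a \<odot>\<^bsub>Z\<^esub> \<beta> x y"
  using assms by (auto simp: cbilin_def mod_homs_def)

lemma cbilin_balanced: "cbilin X Y Z \<beta> \<Longrightarrow> balanced complex_ring X Y Z \<beta>"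
  by (rule balancedI) (auto simp: cbilinD)

lemma ctensor_simps [simp]:
  "carrier (ctensor X Y) = carrier (tensor complex_ring X Y)"
  "s \<oplus>\<^bsub>ctensor X Y\<^esub> t = s \<oplus>\<^bsub>tensor complex_ring X Y\<^esub> t"
  "\<zero>\<^bsub>ctensor X Y\<^esub> = \<zero>\<^bsub>tensor complex_ring X Y\<^esub>"
  "a \<odot>\<^bsub>ctensor X Y\<^esub> t = cmap X Y ((\<odot>\<^bsub>X\<^esub>) a) id t"
  by (simp_all add: ctensor_def tensor_module_def)

context
  fixes X :: "(complex, 'm, 'x) module_scheme" and Y :: "(complex, 'n, 'y) module_scheme"
  assumes X: "cspace X" and Y: "cspace Y"
begin

lemma cpure_closed [simp]: "x \<in> carrier X \<Longrightarrow> y \<in> carrier Y \<Longrightarrow> cpure X Y x y \<in> carrier (ctensor X Y)"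
  by (simp add: pure_closed[OF cspace_right_module[OF X] cspace_left_module[OF Y]])

lemma ctensor_left_module: "left_module complex_ring (ctensor X Y)"
  and cscale_pure: "x \<in> carrier X \<Longrightarrow> y \<in> carrier Y \<Longrightarrow> a \<odot>\<^bsub>ctensor X Y\<^esub> cpure X Y x y = cpure X Y (a \<odot>\<^bsub>X\<^esub> x) y"
  using tensor_module_left_module[OF cspace_right_module[OF X] cspace_left_module[OF Y] cspace_left_module[OF X]] X unfolding ctensor_def
  by (simp_all add: mult.commute del: tensor_module_simps)

lemma cspace_ctensor [simp]: "cspace (ctensor X Y)"
proof -
  note L = left_moduleD[OF ctensor_left_module, unfolded complex_ring_simps]
  show ?thesis by (rule cspaceI) (rule L(2-7); (rule UNIV_I | assumption))+
qed

end

(* From here on the vector space ctensor X Y is opaque; its elements are handled through pure tensors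
   and lifts. *)
declare ctensor_simps [simp del]

lemma additive_map_ctensor_iff:
  "additive_map (tensor complex_ring X Y) P F \<longleftrightarrow> additive_map (ctensor X Y) P F"
  "additive_map P (tensor complex_ring X Y) G \<longleftrightarrow> additive_map P (ctensor X Y) G"
  by (simp_all add: additive_map_def ctensor_simps)

lemma cpure_add:
  assumes "cspace X" "cspace Y"
  shows "x \<in> carrier X \<Longrightarrow> x' \<in> carrier X \<Longrightarrow> y \<in> carrier Y \<Longrightarrow>
      cpure X Y (x \<oplus>\<^bsub>X\<^esub> x') y = cpure X Y x y \<oplus>\<^bsub>ctensor X Y\<^esub> cpure X Y x' y"
    and "x \<in> carrier X \<Longrightarrow> y \<in> carrier Y \<Longrightarrow> y' \<in> carrier Y \<Longrightarrow>
      cpure X Y x (y \<oplus>\<^bsub>Y\<^esub> y') = cpure X Y x y \<oplus>\<^bsub>ctensor X Y\<^esub> cpure X Y x y'"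
  using assms by (simp_all add: ctensor_simps pure_add_left pure_add_right cspace_right_module cspace_left_module)

lemma cpure_smult:
  assumes "cspace X" "cspace Y" "x \<in> carrier X" "y \<in> carrier Y"
  shows "cpure X Y (a \<odot>\<^bsub>X\<^esub> x) y = a \<odot>\<^bsub>ctensor X Y\<^esub> cpure X Y x y"
    and "cpure X Y x (a \<odot>\<^bsub>Y\<^esub> y) = a \<odot>\<^bsub>ctensor X Y\<^esub> cpure X Y x y"
  using assms pure_balanced[of complex_ring X Y a x y]
  by (simp_all add: cscale_pure cspace_right_module cspace_left_module)

lemma cbilin_cpure: "cspace X \<Longrightarrow> cspace Y \<Longrightarrow> cbilin X Y (ctensor X Y) (cpure X Y)"
  by (auto intro!: cbilinI clinI simp: cpure_add cpure_smult)

lemma ctensor_induct [consumes 3, case_names pure add]: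
  assumes "cspace X" "cspace Y" "t \<in> carrier (ctensor X Y)"
    and "\<And>m n. m \<in> carrier X \<Longrightarrow> n \<in> carrier Y \<Longrightarrow> Q (cpure X Y m n)"
    and "\<And>x y. x \<in> carrier (ctensor X Y) \<Longrightarrow> y \<in> carrier (ctensor X Y) \<Longrightarrow> Q x \<Longrightarrow> Q y \<Longrightarrow>
      Q (x \<oplus>\<^bsub>ctensor X Y\<^esub> y)"
  shows "Q t"
proof -
  have "t \<in> carrier (tensor complex_ring X Y)" using assms(3) by (simp add: ctensor_simps)
  then show ?thesis
    by (rule tensor_induct[OF cspace_right_module[OF assms(1)] cspace_left_module[OF assms(2)]])
      (use assms(4,5) in \<open>simp_all add: ctensor_simps\<close>)
qed

lemma clift_additive:
  assumes "cspace X" "cspace Y" "abelian_group Z" "balanced complex_ring X Y Z \<beta>"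
  shows "additive_map (ctensor X Y) Z (tensor_lift Z \<beta>)"
  using tensor_lift_additive[OF cspace_right_module[OF assms(1)] cspace_left_module[OF assms(2)] assms(3,4)]
  by (simp add: additive_map_ctensor_iff)

lemma clift_pure_balanced:
  assumes "cspace X" "cspace Y" "abelian_group Z" "balanced complex_ring X Y Z \<beta>" "x \<in> carrier X" "y \<in> carrier Y"
  shows "tensor_lift Z \<beta> (cpure X Y x y) = \<beta> x y"
  by (rule tensor_lift_pure[OF cspace_right_module[OF assms(1)] cspace_left_module[OF assms(2)] assms(3-6)])

lemma ctensor_additive_eqI:
  assumes "cspace X" "cspace Y" "additive_map (ctensor X Y) Z F" "additive_map (ctensor X Y) Z G"
    "\<And>x y. x \<in> carrier X \<Longrightarrow> y \<in> carrier Y \<Longrightarrow> F (cpure X Y x y) = G (cpure X Y x y)"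
    "t \<in> carrier (ctensor X Y)"
  shows "F t = G t"
  using assms(1,2,6)
  by (induction t rule: ctensor_induct) (auto simp: assms(5) additive_add[OF assms(3)] additive_add[OF assms(4)])

lemma ctensor_eqI:
  assumes "cspace X" "cspace Y" "F \<in> clin (ctensor X Y) Z" "G \<in> clin (ctensor X Y) Z"
    "\<And>x y. x \<in> carrier X \<Longrightarrow> y \<in> carrier Y \<Longrightarrow> F (cpure X Y x y) = G (cpure X Y x y)"
    "t \<in> carrier (ctensor X Y)"
  shows "F t = G t"
  by (rule ctensor_additive_eqI[OF assms(1,2) clin_additive[OF assms(3)] clin_additive[OF assms(4)] assms(5,6)])

lemma clift_pure:
  assumes "cspace X" "cspace Y" "cspace Z" "cbilin X Y Z \<beta>" "x \<in> carrier X" "y \<in> carrier Y"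
  shows "tensor_lift Z \<beta> (cpure X Y x y) = \<beta> x y"
  using assms by (intro clift_pure_balanced) (auto simp: cbilin_balanced)

lemma clift_clin:
  assumes "cspace X" "cspace Y" "cspace Z" "cbilin X Y Z \<beta>"
  shows "tensor_lift Z \<beta> \<in> clin (ctensor X Y) Z"
proof (rule clinI)
  note A = clift_additive[OF assms(1,2) cspace_abelian_group[OF assms(3)] cbilin_balanced[OF assms(4)]]
  show "\<And>x. x \<in> carrier (ctensor X Y) \<Longrightarrow> tensor_lift Z \<beta> x \<in> carrier Z" by (rule additive_closed[OF A])
  show "\<And>x y. x \<in> carrier (ctensor X Y) \<Longrightarrow> y \<in> carrier (ctensor X Y) \<Longrightarrow>
    tensor_lift Z \<beta> (x \<oplus>\<^bsub>ctensor X Y\<^esub> y) = tensor_lift Z \<beta> x \<oplus>\<^bsub>Z\<^esub> tensor_lift Z \<beta> y" by (rule additive_add[OF A])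
  fix a t assume "t \<in> carrier (ctensor X Y)"
  with assms(1,2) show "tensor_lift Z \<beta> (a \<odot>\<^bsub>ctensor X Y\<^esub> t) = a \<odot>\<^bsub>Z\<^esub> tensor_lift Z \<beta> t"
  proof (induction t rule: ctensor_induct)
    case (pure m n)
    then show ?case using assms clift_pure[OF assms, of "a \<odot>\<^bsub>X\<^esub> m" n] clift_pure[OF assms, of m n]
      by (simp add: cpure_smult cbilinD[OF assms(4)])
  next
    case (add x y)
    then show ?case using assms by (simp add: additive_add[OF A] additive_closed[OF A])
  qed
qed

lemma cmap_cbilin:
  assumes "cspace X'" "cspace Y'" "g \<in> clin X X'" "h \<in> clin Y Y'"
  shows "cbilin X Y (ctensor X' Y') (\<lambda>x y. cpure X' Y' (g x) (h y))"
  using assms by (auto intro!: cbilinI clinI simp: clinD cpure_add cpure_smult)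

text \<open>
  A lift depends on its codomain only through the additive group. This identifies lifts into the bare
  tensor product with lifts into the same group regarded as a vector space.
\<close>

lemma tensor_lift_same_group:
  fixes P :: "('p, 'x) ring_scheme" and P' :: "('p, 'z) ring_scheme" and \<beta> :: "'m \<Rightarrow> 'n \<Rightarrow> 'p"
  assumes "carrier P = carrier P'" "\<zero>\<^bsub>P\<^esub> = \<zero>\<^bsub>P'\<^esub>" "(\<oplus>\<^bsub>P\<^esub>) = (\<oplus>\<^bsub>P'\<^esub>)"
  shows "tensor_lift P \<beta> = tensor_lift P' \<beta>"
proof -
  have inv: "m_inv (add_monoid P) x = m_inv (add_monoid P') x" for x
    unfolding m_inv_def by (simp add: assms)
  have nat: "[n] \<cdot>\<^bsub>P\<^esub> x = [n] \<cdot>\<^bsub>P'\<^esub> x" for n :: nat and x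
    by (simp add: add_pow_def nat_pow_def assms)
  have int: "[k] \<cdot>\<^bsub>P\<^esub> x = [k] \<cdot>\<^bsub>P'\<^esub> x" for k :: int and x
    unfolding add_pow_def int_pow_def2 inv using nat unfolding add_pow_def by simp
  have "frag_eval P \<beta> = frag_eval P' \<beta>"
    unfolding frag_eval_def finsum_def finprod_def fun_eq_iff int by (simp add: assms)
  then show ?thesis by (simp add: fun_eq_iff tensor_lift_def)
qed

lemma tensor_lift_ctensor: "tensor_lift (tensor complex_ring X' Y') \<beta> = tensor_lift (ctensor X' Y') \<beta>"
  by (rule tensor_lift_same_group) (simp_all add: ctensor_def tensor_module_def with_smult_def)

lemma cmap_eq: "cmap X' Y' g h = tensor_lift (ctensor X' Y') (\<lambda>x y. cpure X' Y' (g x) (h y))"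
  by (simp add: tensor_map_def tensor_lift_ctensor)

lemma cmap_pure [simp]:
  assumes "cspace X" "cspace Y" "cspace X'" "cspace Y'" "g \<in> clin X X'" "h \<in> clin Y Y'" "x \<in> carrier X" "y \<in> carrier Y"
  shows "cmap X' Y' g h (cpure X Y x y) = cpure X' Y' (g x) (h y)"
  unfolding cmap_eq by (rule clift_pure) (use assms in \<open>auto simp: cmap_cbilin\<close>)

lemma cmap_clin [simp]:
  assumes "cspace X" "cspace Y" "cspace X'" "cspace Y'" "g \<in> clin X X'" "h \<in> clin Y Y'"
  shows "cmap X' Y' g h \<in> clin (ctensor X Y) (ctensor X' Y')"
  unfolding cmap_eq by (rule clift_clin) (use assms in \<open>auto simp: cmap_cbilin\<close>)

lemma cmap_comp:
  assumes "cspace X" "cspace Y" "cspace X'" "cspace Y'" "cspace X''" "cspace Y''"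
    "g \<in> clin X X'" "h \<in> clin Y Y'" "g' \<in> clin X' X''" "h' \<in> clin Y' Y''" "t \<in> carrier (ctensor X Y)"
  shows "cmap X'' Y'' g' h' (cmap X' Y' g h t) = cmap X'' Y'' (\<lambda>x. g' (g x)) (\<lambda>y. h' (h y)) t"
proof (rule ctensor_eqI[OF assms(1,2) _ _ _ assms(11)])
  show "(\<lambda>t. cmap X'' Y'' g' h' (cmap X' Y' g h t)) \<in> clin (ctensor X Y) (ctensor X'' Y'')"
    by (rule clin_comp[where Y = "ctensor X' Y'"]) (use assms in simp_all)
  show "cmap X'' Y'' (\<lambda>x. g' (g x)) (\<lambda>y. h' (h y)) \<in> clin (ctensor X Y) (ctensor X'' Y'')"
    using assms clin_comp[OF assms(7,9)] clin_comp[OF assms(8,10)] by simp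
qed (use assms clin_comp[OF assms(7,9)] clin_comp[OF assms(8,10)] in \<open>simp add: clinD\<close>)

lemma cmap_cong:
  assumes "cspace X" "cspace Y" "cspace X'" "cspace Y'" "g \<in> clin X X'" "h \<in> clin Y Y'" "g' \<in> clin X X'" "h' \<in> clin Y Y'"
    "\<And>x. x \<in> carrier X \<Longrightarrow> g x = g' x" "\<And>x. x \<in> carrier Y \<Longrightarrow> h x = h' x" "t \<in> carrier (ctensor X Y)"
  shows "cmap X' Y' g h t = cmap X' Y' g' h' t"
  by (rule ctensor_eqI[OF assms(1,2) _ _ _ assms(11), of _ "ctensor X' Y'"]) (use assms in simp_all)

lemma cmap_ident:
  assumes "cspace X" "cspace Y" "t \<in> carrier (ctensor X Y)"
  shows "cmap X Y id id t = t"
  by (rule ctensor_eqI[OF assms(1,2) cmap_clin clin_ident _ assms(3)]) (use assms in simp_all)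

lemma clift_comp:
  assumes "cspace X" "cspace Y" "cspace Z" "cspace W" "cbilin X Y Z \<beta>" "F \<in> clin Z W" "t \<in> carrier (ctensor X Y)"
  shows "F (tensor_lift Z \<beta> t) = tensor_lift W (\<lambda>x y. F (\<beta> x y)) t"
proof -
  have b: "cbilin X Y W (\<lambda>x y. F (\<beta> x y))"
    using assms by (auto intro!: cbilinI clinI simp: clinD cbilinD)
  show ?thesis
  proof (rule ctensor_eqI[OF assms(1,2) _ _ _ assms(7)])
    show "(\<lambda>t. F (tensor_lift Z \<beta> t)) \<in> clin (ctensor X Y) W"
      by (rule clin_comp[OF clift_clin assms(6)]) (use assms in simp_all)
    show "tensor_lift W (\<lambda>x y. F (\<beta> x y)) \<in> clin (ctensor X Y) W"
      by (rule clift_clin) (use assms b in simp_all)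
  qed (use assms b in \<open>simp add: clift_pure\<close>)
qed

lemma clift_cmap:
  assumes "cspace X" "cspace Y" "cspace X'" "cspace Y'" "cspace Z" "cbilin X' Y' Z \<beta>" "g \<in> clin X X'" "h \<in> clin Y Y'"
    "t \<in> carrier (ctensor X Y)"
  shows "tensor_lift Z \<beta> (cmap X' Y' g h t) = tensor_lift Z (\<lambda>x y. \<beta> (g x) (h y)) t"
proof -
  have b: "cbilin X Y Z (\<lambda>x y. \<beta> (g x) (h y))"
    using assms by (auto intro!: cbilinI clinI simp: clinD cbilinD)
  show ?thesis
  proof (rule ctensor_eqI[OF assms(1,2) _ _ _ assms(9)])
    show "(\<lambda>t. tensor_lift Z \<beta> (cmap X' Y' g h t)) \<in> clin (ctensor X Y) Z"
      by (rule clin_comp[OF cmap_clin clift_clin]) (use assms in simp_all)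
    show "tensor_lift Z (\<lambda>x y. \<beta> (g x) (h y)) \<in> clin (ctensor X Y) Z"
      by (rule clift_clin) (use assms b in simp_all)
  qed (use assms b in \<open>simp add: clift_pure clinD\<close>)
qed

lemma clift_cong:
  assumes "cspace X" "cspace Y" "cspace Z" "cbilin X Y Z \<beta>" "cbilin X Y Z \<gamma>"
    "\<And>x y. x \<in> carrier X \<Longrightarrow> y \<in> carrier Y \<Longrightarrow> \<beta> x y = \<gamma> x y" "t \<in> carrier (ctensor X Y)"
  shows "tensor_lift Z \<beta> t = tensor_lift Z \<gamma> t"
  by (rule ctensor_eqI[OF assms(1,2) _ _ _ assms(7), of _ Z]) (use assms in \<open>simp_all add: clift_clin clift_pure\<close>)

context
  fixes X :: "(complex, 'l, 'x) module_scheme" and Y :: "(complex, 'm, 'y) module_scheme"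
    and Z :: "(complex, 'n, 'z) module_scheme"
  assumes sp: "cspace X" "cspace Y" "cspace Z"
begin

lemma cassoc_inner_cbilin:
  assumes "z \<in> carrier Z"
  shows "cbilin X Y (ctensor X (ctensor Y Z)) (\<lambda>x y. cpure X (ctensor Y Z) x (cpure Y Z y z))"
  using assms sp by (auto intro!: cbilinI clinI simp: cpure_add cpure_smult)

text \<open>
  The associator is a lift of a lift. Linearity in the outer argument \<open>z\<close> can only be tested on pure
  tensors in the inner one, hence the inductions.
\<close>

lemma cassoc_outer_cbilin:
  "cbilin (ctensor X Y) Z (ctensor X (ctensor Y Z))
    (\<lambda>t z. tensor_lift (ctensor X (ctensor Y Z)) (\<lambda>x y. cpure X (ctensor Y Z) x (cpure Y Z y z)) t)"
  (is "cbilin _ _ ?T ?\<beta>")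
proof (rule cbilinI)
  note L = clift_clin[OF sp(1,2) cspace_ctensor[OF sp(1) cspace_ctensor[OF sp(2,3)]] cassoc_inner_cbilin]
  note P = clift_pure[OF sp(1,2) cspace_ctensor[OF sp(1) cspace_ctensor[OF sp(2,3)]] cassoc_inner_cbilin]
  show "(\<lambda>t. ?\<beta> t z) \<in> clin (ctensor X Y) ?T" if "z \<in> carrier Z" for z
    by (rule L[OF that])
  have T: "cspace ?T" using sp by simp
  show "?\<beta> t \<in> clin Z ?T" if t: "t \<in> carrier (ctensor X Y)" for t
  proof (rule clinI)
    show "?\<beta> t z \<in> carrier ?T" if "z \<in> carrier Z" for z using clinD(1)[OF L[OF that] t] .
    show "?\<beta> t (z \<oplus>\<^bsub>Z\<^esub> z') = ?\<beta> t z \<oplus>\<^bsub>?T\<^esub> ?\<beta> t z'" if "z \<in> carrier Z" "z' \<in> carrier Z" for z z'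
      using sp(1,2) t
    proof (induction t rule: ctensor_induct)
      case (pure x y) then show ?case using that sp by (simp add: P cpure_add)
    next
      case (add s t)
      then show ?case using that sp T by (simp add: clinD[OF L] cspace_add_ac)
    qed
    show "?\<beta> t (a \<odot>\<^bsub>Z\<^esub> z) = a \<odot>\<^bsub>?T\<^esub> ?\<beta> t z" if "z \<in> carrier Z" for z a
      using sp(1,2) t
    proof (induction t rule: ctensor_induct)
      case (pure x y) then show ?case using that sp by (simp add: P cpure_smult)
    next
      case (add s t)
      then show ?case using that sp T by (simp add: clinD[OF L])
    qed
  qed
qed

lemma cassoc_clin [simp]: "cassoc X Y Z \<in> clin (ctensor (ctensor X Y) Z) (ctensor X (ctensor Y Z))"
  unfolding cassoc_def by (rule clift_clin) (use sp cassoc_outer_cbilin in simp_all)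

lemma cassoc_pure [simp]:
  assumes "x \<in> carrier X" "y \<in> carrier Y" "z \<in> carrier Z"
  shows "cassoc X Y Z (cpure (ctensor X Y) Z (cpure X Y x y) z) = cpure X (ctensor Y Z) x (cpure Y Z y z)"
  unfolding cassoc_def
  using sp assms by (simp add: clift_pure[OF _ _ _ cassoc_outer_cbilin] clift_pure[OF _ _ _ cassoc_inner_cbilin])

end

lemma ctensor3_additive_eqI:
  assumes sp: "cspace X" "cspace Y" "cspace Z"
    and F: "additive_map (ctensor (ctensor X Y) Z) W F" and G: "additive_map (ctensor (ctensor X Y) Z) W G"
    and e: "\<And>x y z. x \<in> carrier X \<Longrightarrow> y \<in> carrier Y \<Longrightarrow> z \<in> carrier Z \<Longrightarrow>
      F (cpure (ctensor X Y) Z (cpure X Y x y) z) = G (cpure (ctensor X Y) Z (cpure X Y x y) z)"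
    and t: "t \<in> carrier (ctensor (ctensor X Y) Z)"
  shows "F t = G t"
proof (rule ctensor_additive_eqI[OF _ sp(3) F G _ t])
  fix s z assume s: "s \<in> carrier (ctensor X Y)" and z: "z \<in> carrier Z"
  have a: "additive_map (ctensor X Y) W (\<lambda>s. F (cpure (ctensor X Y) Z s z))"
    "additive_map (ctensor X Y) W (\<lambda>s. G (cpure (ctensor X Y) Z s z))"
    using sp z by (auto intro!: additiveI simp: cpure_add additive_add[OF F] additive_closed[OF F]
        additive_add[OF G] additive_closed[OF G])
  show "F (cpure (ctensor X Y) Z s z) = G (cpure (ctensor X Y) Z s z)"
    by (rule ctensor_additive_eqI[OF sp(1,2) a _ s]) (rule e[OF _ _ z])
qed (use sp in simp)

lemma ctensor3_eqI:
  assumes "cspace X" "cspace Y" "cspace Z"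
    "F \<in> clin (ctensor (ctensor X Y) Z) W" "G \<in> clin (ctensor (ctensor X Y) Z) W"
    "\<And>x y z. x \<in> carrier X \<Longrightarrow> y \<in> carrier Y \<Longrightarrow> z \<in> carrier Z \<Longrightarrow>
      F (cpure (ctensor X Y) Z (cpure X Y x y) z) = G (cpure (ctensor X Y) Z (cpure X Y x y) z)"
    "t \<in> carrier (ctensor (ctensor X Y) Z)"
  shows "F t = G t"
  by (rule ctensor3_additive_eqI[OF assms(1-3) clin_additive[OF assms(4)] clin_additive[OF assms(5)] assms(6,7)])

lemma cassoc_natural:
  assumes sp: "cspace X" "cspace Y" "cspace Z" "cspace X'" "cspace Y'" "cspace Z'"
    and l: "f \<in> clin X X'" "g \<in> clin Y Y'" "h \<in> clin Z Z'" and t: "t \<in> carrier (ctensor (ctensor X Y) Z)"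
  shows "cassoc X' Y' Z' (cmap (ctensor X' Y') Z' (cmap X' Y' f g) h t) =
    cmap X' (ctensor Y' Z') f (cmap Y' Z' g h) (cassoc X Y Z t)"
proof (rule ctensor3_eqI[OF sp(1-3) _ _ _ t])
  show "(\<lambda>t. cassoc X' Y' Z' (cmap (ctensor X' Y') Z' (cmap X' Y' f g) h t)) \<in>
      clin (ctensor (ctensor X Y) Z) (ctensor X' (ctensor Y' Z'))"
    by (rule clin_comp[OF cmap_clin cassoc_clin]) (use sp l in simp_all)
  show "(\<lambda>t. cmap X' (ctensor Y' Z') f (cmap Y' Z' g h) (cassoc X Y Z t)) \<in>
      clin (ctensor (ctensor X Y) Z) (ctensor X' (ctensor Y' Z'))"
    by (rule clin_comp[OF cassoc_clin cmap_clin]) (use sp l in simp_all)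
qed (use sp l in \<open>simp add: clinD\<close>)

lemma cspace_cancel:
  assumes "cspace M" "x \<in> carrier M" shows "x \<oplus>\<^bsub>M\<^esub> (-1) \<odot>\<^bsub>M\<^esub> x = \<zero>\<^bsub>M\<^esub>"
proof -
  interpret abelian_group M using assms by simp
  show ?thesis using assms(2) by (simp only: cspace_neg[OF assms, symmetric] r_neg)
qed

section \<open>Functionals and dual bases\<close>

definition csubspace :: "(complex, 'm, 'x) module_scheme \<Rightarrow> 'm set \<Rightarrow> bool" where
  "csubspace M W \<longleftrightarrow> W \<subseteq> carrier M \<and> \<zero>\<^bsub>M\<^esub> \<in> W \<and> (\<forall>x\<in>W. \<forall>y\<in>W. x \<oplus>\<^bsub>M\<^esub> y \<in> W) \<and> (\<forall>a. \<forall>x\<in>W. a \<odot>\<^bsub>M\<^esub> x \<in> W)"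

lemma csubspaceI:
  "W \<subseteq> carrier M \<Longrightarrow> \<zero>\<^bsub>M\<^esub> \<in> W \<Longrightarrow> (\<And>x y. x \<in> W \<Longrightarrow> y \<in> W \<Longrightarrow> x \<oplus>\<^bsub>M\<^esub> y \<in> W) \<Longrightarrow> (\<And>a x. x \<in> W \<Longrightarrow> a \<odot>\<^bsub>M\<^esub> x \<in> W)
   \<Longrightarrow> csubspace M W"
  by (simp add: csubspace_def)

lemma csubspaceD:
  assumes "csubspace M W"
  shows "x \<in> W \<Longrightarrow> x \<in> carrier M" "\<zero>\<^bsub>M\<^esub> \<in> W" "x \<in> W \<Longrightarrow> y \<in> W \<Longrightarrow> x \<oplus>\<^bsub>M\<^esub> y \<in> W" "x \<in> W \<Longrightarrow> a \<odot>\<^bsub>M\<^esub> x \<in> W"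
  using assms by (auto simp: csubspace_def)

lemma submodule_csubspace:
  assumes "cspace M" shows "submodule W complex_ring M \<longleftrightarrow> csubspace M W"
proof
  interpret module complex_ring M by fact
  show "csubspace M W" if W: "submodule W complex_ring M"
  proof (rule csubspaceI)
    show "W \<subseteq> carrier M" by (rule submoduleE(1)[OF W])
    show "\<zero>\<^bsub>M\<^esub> \<in> W" using subgroup.one_closed[OF submodule.axioms(1)[OF W]] by simp
    show "x \<in> W \<Longrightarrow> y \<in> W \<Longrightarrow> x \<oplus>\<^bsub>M\<^esub> y \<in> W" for x y by (rule submoduleE(5)[OF W])
    show "x \<in> W \<Longrightarrow> a \<odot>\<^bsub>M\<^esub> x \<in> W" for a x using submoduleE(4)[OF W, of a x] by simp
  qed
  assume W: "csubspace M W"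
  show "submodule W complex_ring M"
  proof (rule submoduleI)
    show "\<ominus>\<^bsub>M\<^esub> a \<in> W" if "a \<in> W" for a
      using csubspaceD(4)[OF W that, of "-1"] csubspaceD(1)[OF W that] by (simp only: cspace_neg[OF assms])
  qed (use csubspaceD[OF W] in blast)+
qed

lemma csubspace_cspace: "cspace M \<Longrightarrow> csubspace M W \<Longrightarrow> cspace (M\<lparr>carrier := W\<rparr>)"
  using submodule.submodule_is_module[of W complex_ring M] by (simp add: submodule_csubspace)

lemma csubspace_finsum:
  assumes "cspace M" "csubspace M W" "finite I" "\<And>i. i \<in> I \<Longrightarrow> x i \<in> W"
  shows "(\<Oplus>\<^bsub>M\<^esub>i\<in>I. x i) \<in> W"
proof -
  interpret abelian_group M using assms by simp
  show ?thesis using assms(3,4)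
  proof (induction I)
    case empty then show ?case using csubspaceD[OF assms(2)] by simp
  next
    case (insert i I)
    then show ?case by (simp add: csubspaceD[OF assms(2)] Pi_iff)
  qed
qed

text \<open>
  By Zorn there is a subspace \<open>F\<close> maximal among those that avoid \<open>x\<close>. Adjoining any further vector to
  \<open>F\<close> captures \<open>x\<close>, so \<open>F\<close> and \<open>x\<close> together span the space, and the coefficient of \<open>x\<close> modulo \<open>F\<close> is the
  functional.
\<close>

lemma exists_functional:
  fixes M :: "(complex, 'm, 'x) module_scheme"
  assumes M: "cspace M" and x: "x \<in> carrier M" "x \<noteq> \<zero>\<^bsub>M\<^esub>"
  shows "\<exists>h\<in>clin M cfield. h x = 1"
proof -
  interpret module complex_ring M by fact
  let ?A = "{F. csubspace M F \<and> x \<notin> F}"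
  have "\<exists>F\<in>?A. \<forall>X\<in>?A. F \<subseteq> X \<longrightarrow> X = F"
  proof (rule subset_Zorn_nonempty)
    have "{\<zero>\<^bsub>M\<^esub>} \<in> ?A" using M x by (auto intro!: csubspaceI)
    then show "?A \<noteq> {}" by blast
    fix K assume K: "K \<noteq> {}" "subset.chain ?A K"
    have KA: "F \<in> K \<Longrightarrow> csubspace M F \<and> x \<notin> F" for F using K(2) by (auto simp: subset.chain_def)
    have tot: "F \<in> K \<Longrightarrow> G \<in> K \<Longrightarrow> F \<subseteq> G \<or> G \<subseteq> F" for F G using K(2) by (auto simp: subset.chain_def)
    obtain F0 where "F0 \<in> K" using K(1) by blast
    have KD: "F \<in> K \<Longrightarrow> u \<in> F \<Longrightarrow> u \<in> carrier M" "F \<in> K \<Longrightarrow> \<zero>\<^bsub>M\<^esub> \<in> F"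
      "F \<in> K \<Longrightarrow> u \<in> F \<Longrightarrow> v \<in> F \<Longrightarrow> u \<oplus>\<^bsub>M\<^esub> v \<in> F" "F \<in> K \<Longrightarrow> u \<in> F \<Longrightarrow> a \<odot>\<^bsub>M\<^esub> u \<in> F" for F u v a
      using csubspaceD[of M F] KA[of F] by simp_all
    have "csubspace M (\<Union>K)"
    proof (rule csubspaceI)
      show "\<Union>K \<subseteq> carrier M" using KD(1) by (intro Union_least subsetI)
      show "\<zero>\<^bsub>M\<^esub> \<in> \<Union>K" by (rule UnionI[OF \<open>F0 \<in> K\<close> KD(2)[OF \<open>F0 \<in> K\<close>]])
      show "u \<oplus>\<^bsub>M\<^esub> v \<in> \<Union>K" if uv: "u \<in> \<Union>K" "v \<in> \<Union>K" for u v
      proof -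
        from uv obtain F G where FG: "F \<in> K" "G \<in> K" "u \<in> F" "v \<in> G" by blast
        show ?thesis
        proof (cases "F \<subseteq> G")
          case True then show ?thesis using FG KD(3)[OF FG(2), of u v] by blast
        next
          case False
          then have "G \<subseteq> F" using tot FG by blast
          then show ?thesis using FG KD(3)[OF FG(1), of u v] by blast
        qed
      qed
      show "a \<odot>\<^bsub>M\<^esub> u \<in> \<Union>K" if "u \<in> \<Union>K" for a u
        using that by (elim UnionE) (rule UnionI, assumption, rule KD(4))
    qed
    then show "\<Union>K \<in> ?A" using KA by blast
  qed
  then obtain F where F: "csubspace M F" "x \<notin> F"
    and max: "\<And>X. csubspace M X \<Longrightarrow> x \<notin> X \<Longrightarrow> F \<subseteq> X \<Longrightarrow> X = F" by blast
  note FD = csubspaceD[OF F(1)]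
  have ex: "\<exists>c. y \<oplus>\<^bsub>M\<^esub> (- c) \<odot>\<^bsub>M\<^esub> x \<in> F" if y: "y \<in> carrier M" for y
  proof (cases "y \<in> F")
    case True then show ?thesis using x FD(1)[OF True] by (intro exI[of _ 0]) (simp add: M)
  next
    case False
    (* By maximality the span of F and y contains x, and solving for y expresses it modulo F by x. *)
    let ?X = "{f \<oplus>\<^bsub>M\<^esub> c \<odot>\<^bsub>M\<^esub> y |f c. f \<in> F}"
    have X: "csubspace M ?X"
    proof (rule csubspaceI)
      show "?X \<subseteq> carrier M" using M y FD by auto
      show "\<zero>\<^bsub>M\<^esub> \<in> ?X" using M y FD(2) by (auto intro!: exI[of _ "\<zero>\<^bsub>M\<^esub>"] exI[of _ 0])
      fix u v assume "u \<in> ?X" "v \<in> ?X"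
      then obtain f c f' c' where *: "f \<in> F" "f' \<in> F" "u = f \<oplus>\<^bsub>M\<^esub> c \<odot>\<^bsub>M\<^esub> y" "v = f' \<oplus>\<^bsub>M\<^esub> c' \<odot>\<^bsub>M\<^esub> y" by blast
      have "u \<oplus>\<^bsub>M\<^esub> v = (f \<oplus>\<^bsub>M\<^esub> f') \<oplus>\<^bsub>M\<^esub> (c + c') \<odot>\<^bsub>M\<^esub> y"
        using * FD(1)[OF *(1)] FD(1)[OF *(2)] M y by (simp add: cspace_smult_add cspace_add_ac)
      then show "u \<oplus>\<^bsub>M\<^esub> v \<in> ?X" using FD(3)[OF *(1,2)] by blast
    next
      fix a u assume "u \<in> ?X"
      then obtain f c where *: "f \<in> F" "u = f \<oplus>\<^bsub>M\<^esub> c \<odot>\<^bsub>M\<^esub> y" by blast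
      have "a \<odot>\<^bsub>M\<^esub> u = a \<odot>\<^bsub>M\<^esub> f \<oplus>\<^bsub>M\<^esub> (a * c) \<odot>\<^bsub>M\<^esub> y"
        using * FD(1)[OF *(1)] M y by simp
      then show "a \<odot>\<^bsub>M\<^esub> u \<in> ?X" using FD(4)[OF *(1)] by blast
    qed
    have "F \<subseteq> ?X"
    proof
      fix f assume "f \<in> F"
      then show "f \<in> ?X" using FD(1) M y by (auto intro!: exI[of _ f] exI[of _ 0])
    qed
    moreover have "y \<in> ?X" using M y FD(2) by (auto intro!: exI[of _ "\<zero>\<^bsub>M\<^esub>"] exI[of _ 1])
    ultimately have "x \<in> ?X" using max[OF X] False by blast
    then obtain f c where *: "f \<in> F" "x = f \<oplus>\<^bsub>M\<^esub> c \<odot>\<^bsub>M\<^esub> y" by blast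
    have "c \<noteq> 0" using * F(2) FD(1)[OF *(1)] M y by auto
    have "y \<oplus>\<^bsub>M\<^esub> (- (1/c)) \<odot>\<^bsub>M\<^esub> x = (- (1/c)) \<odot>\<^bsub>M\<^esub> f \<oplus>\<^bsub>M\<^esub> (y \<oplus>\<^bsub>M\<^esub> (-1) \<odot>\<^bsub>M\<^esub> y)"
      using * FD(1)[OF *(1)] M y \<open>c \<noteq> 0\<close> by (simp add: cspace_add_ac)
    also have "y \<oplus>\<^bsub>M\<^esub> (-1) \<odot>\<^bsub>M\<^esub> y = \<zero>\<^bsub>M\<^esub>"
      by (rule cspace_cancel[OF M y])
    finally have "y \<oplus>\<^bsub>M\<^esub> (- (1/c)) \<odot>\<^bsub>M\<^esub> x \<in> F" using FD(1,4)[OF *(1)] M by simp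
    then show ?thesis by blast
  qed
  have uniq: "c = d" if y: "y \<in> carrier M" "y \<oplus>\<^bsub>M\<^esub> (- c) \<odot>\<^bsub>M\<^esub> x \<in> F" "y \<oplus>\<^bsub>M\<^esub> (- d) \<odot>\<^bsub>M\<^esub> x \<in> F" for y c d
  proof (rule ccontr)
    assume cd: "c \<noteq> d"
    have "(y \<oplus>\<^bsub>M\<^esub> (- c) \<odot>\<^bsub>M\<^esub> x) \<oplus>\<^bsub>M\<^esub> (-1) \<odot>\<^bsub>M\<^esub> (y \<oplus>\<^bsub>M\<^esub> (- d) \<odot>\<^bsub>M\<^esub> x) \<in> F"
      using FD(3)[OF y(2) FD(4)[OF y(3)]] .
    also have "(y \<oplus>\<^bsub>M\<^esub> (- c) \<odot>\<^bsub>M\<^esub> x) \<oplus>\<^bsub>M\<^esub> (-1) \<odot>\<^bsub>M\<^esub> (y \<oplus>\<^bsub>M\<^esub> (- d) \<odot>\<^bsub>M\<^esub> x)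
      = (1 + (-1)) \<odot>\<^bsub>M\<^esub> y \<oplus>\<^bsub>M\<^esub> (- c + d) \<odot>\<^bsub>M\<^esub> x"
      unfolding cspace_smult_add[OF M y(1)] cspace_smult_add[OF M x(1)] using M y(1) x by (simp add: cspace_add_ac)
    also have "\<dots> = (d - c) \<odot>\<^bsub>M\<^esub> x" using M y x by simp
    finally have "(1 / (d - c)) \<odot>\<^bsub>M\<^esub> ((d - c) \<odot>\<^bsub>M\<^esub> x) \<in> F" by (rule FD(4))
    then show False using F(2) x M cd by simp
  qed
  define h where "h y = (THE c. y \<oplus>\<^bsub>M\<^esub> (- c) \<odot>\<^bsub>M\<^esub> x \<in> F)" for y
  have hI: "h y = c" if "y \<in> carrier M" "y \<oplus>\<^bsub>M\<^esub> (- c) \<odot>\<^bsub>M\<^esub> x \<in> F" for y c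
    unfolding h_def by (rule the_equality) (use that uniq in blast)+
  have hF: "y \<oplus>\<^bsub>M\<^esub> (- h y) \<odot>\<^bsub>M\<^esub> x \<in> F" if "y \<in> carrier M" for y
    using ex[OF that] hI[OF that] by metis
  have "h \<in> clin M cfield"
  proof (rule clinI)
    fix y z assume yz: "y \<in> carrier M" "z \<in> carrier M"
    have "(y \<oplus>\<^bsub>M\<^esub> z) \<oplus>\<^bsub>M\<^esub> (- (h y + h z)) \<odot>\<^bsub>M\<^esub> x = (y \<oplus>\<^bsub>M\<^esub> (- h y) \<odot>\<^bsub>M\<^esub> x) \<oplus>\<^bsub>M\<^esub> (z \<oplus>\<^bsub>M\<^esub> (- h z) \<odot>\<^bsub>M\<^esub> x)"
      using cspace_smult_add[OF M x(1), of "- h y" "- h z"] M yz x by (simp add: cspace_add_ac)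
    then have "(y \<oplus>\<^bsub>M\<^esub> z) \<oplus>\<^bsub>M\<^esub> (- (h y + h z)) \<odot>\<^bsub>M\<^esub> x \<in> F" using FD(3)[OF hF[OF yz(1)] hF[OF yz(2)]] by simp
    then show "h (y \<oplus>\<^bsub>M\<^esub> z) = h y \<oplus>\<^bsub>cfield\<^esub> h z" using hI M yz by simp
  next
    fix a y assume y: "y \<in> carrier M"
    have "a \<odot>\<^bsub>M\<^esub> y \<oplus>\<^bsub>M\<^esub> (- (a * h y)) \<odot>\<^bsub>M\<^esub> x \<in> F"
      using FD(4)[OF hF[OF y], of a] M y x by simp
    then show "h (a \<odot>\<^bsub>M\<^esub> y) = a \<odot>\<^bsub>cfield\<^esub> h y" using hI M y by simp
  qed simp
  moreover have "x \<oplus>\<^bsub>M\<^esub> (- 1) \<odot>\<^bsub>M\<^esub> x \<in> F"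
    unfolding cspace_cancel[OF M x(1)] by (rule FD(2))
  then have "h x = 1" using hI x by simp
  ultimately show ?thesis by blast
qed

lemma functionals_separate:
  assumes M: "cspace M" and x: "x \<in> carrier M" "y \<in> carrier M" and h: "\<And>h. h \<in> clin M cfield \<Longrightarrow> h x = h y"
  shows "x = y"
proof -
  interpret module complex_ring M by fact
  have "x \<ominus>\<^bsub>M\<^esub> y = \<zero>\<^bsub>M\<^esub>"
  proof (rule ccontr)
    assume n: "x \<ominus>\<^bsub>M\<^esub> y \<noteq> \<zero>\<^bsub>M\<^esub>"
    have c: "x \<ominus>\<^bsub>M\<^esub> y \<in> carrier M" using x by simp
    obtain h where hl: "h \<in> clin M cfield" "h (x \<ominus>\<^bsub>M\<^esub> y) = 1" using exists_functional[OF M c n] by blast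
    have "h (x \<ominus>\<^bsub>M\<^esub> y) = h x - h y" using x M
      by (simp add: a_minus_def cspace_neg[OF M] clinD[OF hl(1)])
    then show False using h[OF hl(1)] hl(2) by simp
  qed
  then have "(x \<ominus>\<^bsub>M\<^esub> y) \<oplus>\<^bsub>M\<^esub> y = y" using x M by simp
  then show ?thesis using x M by (simp add: a_minus_def M.a_assoc M.l_neg)
qed

primrec cspan :: "(complex, 'm, 'x) module_scheme \<Rightarrow> 'm list \<Rightarrow> 'm set" where
  "cspan M [] = {\<zero>\<^bsub>M\<^esub>}"
| "cspan M (y # ys) = {s \<oplus>\<^bsub>M\<^esub> c \<odot>\<^bsub>M\<^esub> y |s c. s \<in> cspan M ys}"

lemma cspan_csubspace:
  assumes M: "cspace M" and "set ys \<subseteq> carrier M" shows "csubspace M (cspan M ys)"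
  using assms(2)
proof (induction ys)
  case Nil then show ?case using M by (auto intro!: csubspaceI)
next
  case (Cons y ys)
  then have F: "csubspace M (cspan M ys)" and y: "y \<in> carrier M" by auto
  note FD = csubspaceD[OF F]
  show ?case
  proof (rule csubspaceI)
    show "cspan M (y # ys) \<subseteq> carrier M" using M y FD by auto
    show "\<zero>\<^bsub>M\<^esub> \<in> cspan M (y # ys)" using M y FD(2) by (auto intro!: exI[of _ "\<zero>\<^bsub>M\<^esub>"] exI[of _ 0])
    fix u v assume "u \<in> cspan M (y # ys)" "v \<in> cspan M (y # ys)"
    then obtain f c f' c' where *: "f \<in> cspan M ys" "f' \<in> cspan M ys" "u = f \<oplus>\<^bsub>M\<^esub> c \<odot>\<^bsub>M\<^esub> y" "v = f' \<oplus>\<^bsub>M\<^esub> c' \<odot>\<^bsub>M\<^esub> y" by auto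
    have "u \<oplus>\<^bsub>M\<^esub> v = (f \<oplus>\<^bsub>M\<^esub> f') \<oplus>\<^bsub>M\<^esub> (c + c') \<odot>\<^bsub>M\<^esub> y"
      using * FD(1)[OF *(1)] FD(1)[OF *(2)] M y by (simp add: cspace_smult_add cspace_add_ac)
    then show "u \<oplus>\<^bsub>M\<^esub> v \<in> cspan M (y # ys)" using FD(3)[OF *(1,2)] by auto
  next
    fix a u assume "u \<in> cspan M (y # ys)"
    then obtain f c where *: "f \<in> cspan M ys" "u = f \<oplus>\<^bsub>M\<^esub> c \<odot>\<^bsub>M\<^esub> y" by auto
    have "a \<odot>\<^bsub>M\<^esub> u = a \<odot>\<^bsub>M\<^esub> f \<oplus>\<^bsub>M\<^esub> (a * c) \<odot>\<^bsub>M\<^esub> y"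
      using * FD(1)[OF *(1)] M y by simp
    then show "a \<odot>\<^bsub>M\<^esub> u \<in> cspan M (y # ys)" using FD(4)[OF *(1)] by auto
  qed
qed

lemma cspan_superset:
  assumes M: "cspace M" and "set ys \<subseteq> carrier M" shows "set ys \<subseteq> cspan M ys"
  using assms(2)
proof (induction ys)
  case (Cons y ys)
  then have F: "csubspace M (cspan M ys)" and y: "y \<in> carrier M" using cspan_csubspace[OF M, of ys] by auto
  note FD = csubspaceD[OF F]
  have "y \<in> cspan M (y # ys)" using M y FD(2) by (auto intro!: exI[of _ "\<zero>\<^bsub>M\<^esub>"] exI[of _ 1])
  moreover have "s \<in> cspan M (y # ys)" if "s \<in> cspan M ys" for s
    using that M y FD(1)[OF that] by (auto intro!: exI[of _ s] exI[of _ 0])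
  ultimately show ?case using Cons by auto
qed simp

text \<open>
  The coordinate functionals are defined on the whole space and not just on the finite-dimensional
  subspace \<open>W\<close>, so that they can be applied to tensor factors in the whole space.
\<close>

definition dual_basis :: "(complex, 'm, 'x) module_scheme \<Rightarrow> 'm set \<Rightarrow> nat \<Rightarrow> (nat \<Rightarrow> 'm) \<Rightarrow> (nat \<Rightarrow> 'm \<Rightarrow> complex) \<Rightarrow> bool"
  where "dual_basis M W n e \<phi> \<longleftrightarrow> csubspace M W \<and> (\<forall>i<n. e i \<in> W \<and> \<phi> i \<in> clin M cfield) \<and>
    (\<forall>i<n. \<forall>j<n. \<phi> i (e j) = (if i = j then 1 else 0)) \<and> (\<forall>x\<in>W. x = (\<Oplus>\<^bsub>M\<^esub>i\<in>{..<n}. \<phi> i x \<odot>\<^bsub>M\<^esub> e i))"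

lemma dual_basisD:
  assumes "dual_basis M W n e \<phi>"
  shows "csubspace M W" "i < n \<Longrightarrow> e i \<in> W" "i < n \<Longrightarrow> e i \<in> carrier M" "i < n \<Longrightarrow> \<phi> i \<in> clin M cfield"
    "i < n \<Longrightarrow> j < n \<Longrightarrow> \<phi> i (e j) = (if i = j then 1 else 0)"
    "x \<in> W \<Longrightarrow> (\<Oplus>\<^bsub>M\<^esub>i\<in>{..<n}. \<phi> i x \<odot>\<^bsub>M\<^esub> e i) = x"
  using assms csubspaceD(1)[of M W "e i"] by (auto simp: dual_basis_def)

text \<open>
  Elimination of one functional at a time. If \<open>g\<close> does not vanish on \<open>W\<close>, then \<open>W\<close> is the sum of the
  kernel of \<open>g\<close> and a line spanned by \<open>w\<close> with \<open>g w = 1\<close>; the functionals obtained for the kernel are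
  corrected by multiples of \<open>g\<close> so that they vanish on \<open>w\<close>.
\<close>

lemma dual_basis_of_separating:
  assumes M: "cspace M"
  shows "csubspace M W \<Longrightarrow> set gs \<subseteq> clin M cfield \<Longrightarrow> (\<And>x. x \<in> W \<Longrightarrow> (\<forall>g\<in>set gs. g x = 0) \<Longrightarrow> x = \<zero>\<^bsub>M\<^esub>) \<Longrightarrow>
    \<exists>n e \<phi>. dual_basis M W n e \<phi>"
proof (induction gs arbitrary: W)
  interpret module complex_ring M by (rule M)
  case Nil
  have "dual_basis M W 0 undefined undefined" using Nil by (auto simp: dual_basis_def)
  then show ?case by blast
next
  interpret module complex_ring M by (rule M)
  case (Cons g gs)
  note W = csubspaceD[OF Cons.prems(1)]
  have g: "g \<in> clin M cfield" using Cons.prems(2) by simp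
  show ?case
  proof (cases "\<forall>x\<in>W. g x = 0")
    case True
    show ?thesis by (rule Cons.IH[OF Cons.prems(1)]) (use Cons.prems True in auto)
  next
    case False
    then obtain w0 where w0: "w0 \<in> W" "g w0 \<noteq> 0" by blast
    define w where "w = (1 / g w0) \<odot>\<^bsub>M\<^esub> w0"
    have w: "w \<in> W" "w \<in> carrier M" "g w = 1"
      using W(1,4)[OF w0(1)] w0 M by (auto simp: w_def clinD[OF g])
    let ?W = "{x \<in> W. g x = 0}"
    have "\<exists>n e \<phi>. dual_basis M ?W n e \<phi>"
    proof (rule Cons.IH)
      show "csubspace M ?W"
        using W clin_zero[OF M cfield_cspace g] by (auto intro!: csubspaceI simp: clinD[OF g])
    qed (use Cons.prems in auto)
    then obtain n e \<phi> where db: "dual_basis M ?W n e \<phi>" by blast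
    note D = dual_basisD[OF db]
    let ?e = "e(n := w)" and ?\<phi> = "\<lambda>i. if i < n then (\<lambda>x. \<phi> i x - \<phi> i w * g x) else g"
    have ge: "i < n \<Longrightarrow> g (e i) = 0" for i using D(2) by simp
    have "dual_basis M W (Suc n) ?e ?\<phi>"
      unfolding dual_basis_def
    proof (intro conjI allI impI ballI)
      show "csubspace M W" by (rule Cons.prems(1))
      fix i assume i: "i < Suc n"
      show "?e i \<in> W" using D(2)[of i] w i by (auto simp: less_Suc_eq)
      show "?\<phi> i \<in> clin M cfield"
      proof (cases "i < n")
        case True
        then show ?thesis by (auto intro!: clinI simp: clinD[OF D(4)] clinD[OF g] algebra_simps)
      qed (use g in simp)
      fix j assume j: "j < Suc n"
      show "?\<phi> i (?e j) = (if i = j then 1 else 0)"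
        using i j ge w by (auto simp: less_Suc_eq D(5))
    next
      fix x assume x: "x \<in> W"
      note xc = W(1)[OF x]
      let ?y = "x \<oplus>\<^bsub>M\<^esub> (- g x) \<odot>\<^bsub>M\<^esub> w"
      have y: "?y \<in> ?W" using W(3)[OF x W(4)[OF w(1)]] w xc M by (auto simp: clinD[OF g])
      have ph: "\<phi> i ?y = \<phi> i x - \<phi> i w * g x" if "i < n" for i
        using xc w M by (simp add: clinD[OF D(4)[OF that]])
      have "(\<Oplus>\<^bsub>M\<^esub>i\<in>{..<Suc n}. ?\<phi> i x \<odot>\<^bsub>M\<^esub> ?e i) = g x \<odot>\<^bsub>M\<^esub> w \<oplus>\<^bsub>M\<^esub> (\<Oplus>\<^bsub>M\<^esub>i\<in>{..<n}. ?\<phi> i x \<odot>\<^bsub>M\<^esub> ?e i)"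
        unfolding lessThan_Suc using w M D(3) by (subst M.finsum_insert) (auto simp: Pi_iff)
      also have "(\<Oplus>\<^bsub>M\<^esub>i\<in>{..<n}. ?\<phi> i x \<odot>\<^bsub>M\<^esub> ?e i) = (\<Oplus>\<^bsub>M\<^esub>i\<in>{..<n}. \<phi> i ?y \<odot>\<^bsub>M\<^esub> e i)"
        by (rule M.finsum_cong') (use ph D(3) M in auto)
      also have "\<dots> = ?y" by (rule D(6)[OF y])
      also have "g x \<odot>\<^bsub>M\<^esub> w \<oplus>\<^bsub>M\<^esub> ?y = x \<oplus>\<^bsub>M\<^esub> (g x + (- g x)) \<odot>\<^bsub>M\<^esub> w"
        unfolding cspace_smult_add[OF M w(2)] using xc w M by (simp add: cspace_add_ac)
      also have "\<dots> = x" using xc w M by simp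
      finally show "x = (\<Oplus>\<^bsub>M\<^esub>i\<in>{..<Suc n}. ?\<phi> i x \<odot>\<^bsub>M\<^esub> ?e i)" by simp
    qed
    then show ?thesis by blast
  qed
qed

text \<open>
  One more spanning vector enlarges the common kernel of the functionals already chosen by at most a
  line, and a single functional that is nonzero on that line separates it from zero.
\<close>

lemma span_separating:
  assumes M: "cspace M"
  shows "set ys \<subseteq> carrier M \<Longrightarrow> \<exists>gs. set gs \<subseteq> clin M cfield \<and> (\<forall>x\<in>cspan M ys. (\<forall>g\<in>set gs. g x = 0) \<longrightarrow> x = \<zero>\<^bsub>M\<^esub>)"
proof (induction ys)
  case Nil then show ?case by (auto intro!: exI[of _ "[]"])
next
  case (Cons y ys)
  then obtain gs where gs: "set gs \<subseteq> clin M cfield" "\<And>x. x \<in> cspan M ys \<Longrightarrow> (\<forall>g\<in>set gs. g x = 0) \<Longrightarrow> x = \<zero>\<^bsub>M\<^esub>" by auto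
  have y: "y \<in> carrier M" and ys: "set ys \<subseteq> carrier M" using Cons by auto
  note S = csubspaceD[OF cspan_csubspace[OF M ys]]
  let ?K = "{x \<in> cspan M (y # ys). \<forall>g\<in>set gs. g x = 0}"
  show ?case
  proof (cases "?K \<subseteq> {\<zero>\<^bsub>M\<^esub>}")
    case True then show ?thesis using gs by (intro exI[of _ gs]) blast
  next
    case False
    then obtain x0 where x0: "x0 \<in> cspan M (y # ys)" "\<forall>g\<in>set gs. g x0 = 0" "x0 \<noteq> \<zero>\<^bsub>M\<^esub>" by blast
    then obtain s0 c0 where s0: "s0 \<in> cspan M ys" "x0 = s0 \<oplus>\<^bsub>M\<^esub> c0 \<odot>\<^bsub>M\<^esub> y" by auto
    have x0c: "x0 \<in> carrier M" using s0 S(1) M y by auto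
    have c0: "c0 \<noteq> 0"
    proof
      assume "c0 = 0"
      then have "x0 = s0" using s0 S(1) M y by simp
      then show False using gs(2)[OF s0(1)] x0 by simp
    qed
    obtain h where h: "h \<in> clin M cfield" "h x0 = 1" using exists_functional[OF M x0c x0(3)] by blast
    have "x = \<zero>\<^bsub>M\<^esub>" if x: "x \<in> cspan M (y # ys)" and gx: "\<forall>g\<in>set (h # gs). g x = 0" for x
    proof -
      obtain s c where s: "s \<in> cspan M ys" "x = s \<oplus>\<^bsub>M\<^esub> c \<odot>\<^bsub>M\<^esub> y" using x by auto
      have xc: "x \<in> carrier M" using s S(1) M y by auto
      let ?z = "c0 \<odot>\<^bsub>M\<^esub> x \<oplus>\<^bsub>M\<^esub> (- c) \<odot>\<^bsub>M\<^esub> x0"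
      have "?z = (c0 \<odot>\<^bsub>M\<^esub> s \<oplus>\<^bsub>M\<^esub> (- c) \<odot>\<^bsub>M\<^esub> s0) \<oplus>\<^bsub>M\<^esub> (c0 * c + (- c) * c0) \<odot>\<^bsub>M\<^esub> y"
        unfolding cspace_smult_add[OF M y] using s s0 S(1) M y by (simp add: cspace_add_ac)
      also have "\<dots> = c0 \<odot>\<^bsub>M\<^esub> s \<oplus>\<^bsub>M\<^esub> (- c) \<odot>\<^bsub>M\<^esub> s0" using s s0 S(1) M y by simp
      finally have "?z \<in> cspan M ys" using S(3)[OF S(4)[OF s(1)] S(4)[OF s0(1)]] by simp
      moreover have "\<forall>g\<in>set gs. g ?z = 0"
      proof
        fix g assume g: "g \<in> set gs"
        then have "g \<in> clin M cfield" using gs by blast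
        moreover have "g x = 0" "g x0 = 0" using g gx x0(2) by auto
        ultimately show "g ?z = 0" using xc x0c M by (simp add: clinD[of g M cfield])
      qed
      ultimately have z: "?z = \<zero>\<^bsub>M\<^esub>" by (rule gs(2))
      have "h ?z = c0 * h x - c * h x0" using xc x0c M by (simp add: clinD[OF h(1)])
      then have "c = 0" using z clin_zero[OF M cfield_cspace h(1)] gx h(2) by simp
      then have "x = s" using s S(1) M y by simp
      then show ?thesis using gs(2)[OF s(1)] gx by simp
    qed
    then show ?thesis using gs h by (intro exI[of _ "h # gs"]) auto
  qed
qed

lemma dual_basis_exists:
  assumes "cspace M" "csubspace M W" "set ys \<subseteq> carrier M" "W \<subseteq> cspan M ys"
  shows "\<exists>n e \<phi>. dual_basis M W n e \<phi>"
proof -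
  obtain gs where gs: "set gs \<subseteq> clin M cfield" "\<forall>x\<in>cspan M ys. (\<forall>g\<in>set gs. g x = 0) \<longrightarrow> x = \<zero>\<^bsub>M\<^esub>"
    using span_separating[OF assms(1,3)] by (elim exE conjE) (rule that)
  show ?thesis
  proof (rule dual_basis_of_separating[OF assms(1,2) gs(1)])
    fix x assume "x \<in> W" "\<forall>g\<in>set gs. g x = 0"
    then show "x = \<zero>\<^bsub>M\<^esub>" using gs(2)[rule_format, of x] assms(4) by auto
  qed
qed

section \<open>Contraction of tensors with functionals\<close>

definition contract_left :: "(complex, 'n, 'y) module_scheme \<Rightarrow> ('m \<Rightarrow> complex) \<Rightarrow> ('m, 'n) tens \<Rightarrow> 'n" where
  "contract_left Y g = tensor_lift Y (\<lambda>x y. g x \<odot>\<^bsub>Y\<^esub> y)"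

definition contract_right :: "(complex, 'm, 'x) module_scheme \<Rightarrow> ('n \<Rightarrow> complex) \<Rightarrow> ('m, 'n) tens \<Rightarrow> 'm" where
  "contract_right X h = tensor_lift X (\<lambda>x y. h y \<odot>\<^bsub>X\<^esub> x)"

context
  fixes X :: "(complex, 'm, 'x) module_scheme" and Y :: "(complex, 'n, 'y) module_scheme"
  assumes X: "cspace X" and Y: "cspace Y"
begin

lemma contract_left_cbilin: "g \<in> clin X cfield \<Longrightarrow> cbilin X Y Y (\<lambda>x y. g x \<odot>\<^bsub>Y\<^esub> y)"
  using X Y by (auto intro!: cbilinI clinI simp: clinD cspace_smult_add mult.commute)

lemma contract_right_cbilin: "h \<in> clin Y cfield \<Longrightarrow> cbilin X Y X (\<lambda>x y. h y \<odot>\<^bsub>X\<^esub> x)"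
  using X Y by (auto intro!: cbilinI clinI simp: clinD cspace_smult_add mult.commute)

lemma contract_left_clin: "g \<in> clin X cfield \<Longrightarrow> contract_left Y g \<in> clin (ctensor X Y) Y"
  unfolding contract_left_def by (rule clift_clin[OF X Y Y contract_left_cbilin])

lemma contract_right_clin: "h \<in> clin Y cfield \<Longrightarrow> contract_right X h \<in> clin (ctensor X Y) X"
  unfolding contract_right_def by (rule clift_clin[OF X Y X contract_right_cbilin])

lemma contract_left_pure:
  "g \<in> clin X cfield \<Longrightarrow> x \<in> carrier X \<Longrightarrow> y \<in> carrier Y \<Longrightarrow> contract_left Y g (cpure X Y x y) = g x \<odot>\<^bsub>Y\<^esub> y"
  unfolding contract_left_def by (rule clift_pure[OF X Y Y contract_left_cbilin])

lemma contract_right_pure: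
  "h \<in> clin Y cfield \<Longrightarrow> x \<in> carrier X \<Longrightarrow> y \<in> carrier Y \<Longrightarrow> contract_right X h (cpure X Y x y) = h y \<odot>\<^bsub>X\<^esub> x"
  unfolding contract_right_def by (rule clift_pure[OF X Y X contract_right_cbilin])

lemma contract_commute:
  assumes g: "g \<in> clin X cfield" and h: "h \<in> clin Y cfield" and t: "t \<in> carrier (ctensor X Y)"
  shows "h (contract_left Y g t) = g (contract_right X h t)"
  by (rule ctensor_eqI[OF X Y clin_comp[OF contract_left_clin[OF g] h] clin_comp[OF contract_right_clin[OF h] g] _ t])
    (simp add: contract_left_pure[OF g] contract_right_pure[OF h] clinD[OF g] clinD[OF h] mult.commute)

text \<open>
  A tensor involves only finitely many vectors \<open>ys\<close> of the second factor. These are chosen before the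
  subspace \<open>W\<close>, because in the addition step both summands have to be expanded over the same \<open>W\<close>.
\<close>

lemma tensor_expand:
  assumes "t \<in> carrier (ctensor X Y)"
  shows "\<exists>ys. set ys \<subseteq> carrier Y \<and> (\<forall>W n v \<chi>. dual_basis Y W n v \<chi> \<and> set ys \<subseteq> W \<longrightarrow>
    t = (\<Oplus>\<^bsub>ctensor X Y\<^esub>b\<in>{..<n}. cpure X Y (contract_right X (\<chi> b) t) (v b)))"
  using X Y assms
proof (induction t rule: ctensor_induct)
  case (pure x y)
  have "cpure X Y x y = (\<Oplus>\<^bsub>ctensor X Y\<^esub>b\<in>{..<n}. cpure X Y (contract_right X (\<chi> b) (cpure X Y x y)) (v b))"
    if db: "dual_basis Y W n v \<chi>" and y: "y \<in> W" for W n v \<chi>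
  proof -
    note D = dual_basisD[OF db]
    interpret T: abelian_group "ctensor X Y" using X Y by simp
    have "cpure X Y x y = cpure X Y x (\<Oplus>\<^bsub>Y\<^esub>b\<in>{..<n}. \<chi> b y \<odot>\<^bsub>Y\<^esub> v b)" by (simp only: D(6)[OF y])
    also have "\<dots> = (\<Oplus>\<^bsub>ctensor X Y\<^esub>b\<in>{..<n}. cpure X Y x (\<chi> b y \<odot>\<^bsub>Y\<^esub> v b))"
      by (rule clin_finsum[OF Y cspace_ctensor[OF X Y] cbilinD(1)[OF cbilin_cpure[OF X Y] pure(1)]]) (use D(3) Y in auto)
    also have "\<dots> = (\<Oplus>\<^bsub>ctensor X Y\<^esub>b\<in>{..<n}. cpure X Y (contract_right X (\<chi> b) (cpure X Y x y)) (v b))"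
      by (rule T.finsum_cong') (use D(3,4) X Y pure in \<open>auto simp: contract_right_pure cpure_smult\<close>)
    finally show ?thesis .
  qed
  then show ?case using pure by (intro exI[of _ "[y]"]) auto
next
  case (add s t)
  obtain ys where ys: "set ys \<subseteq> carrier Y" "\<forall>W n v \<chi>. dual_basis Y W n v \<chi> \<and> set ys \<subseteq> W \<longrightarrow>
    s = (\<Oplus>\<^bsub>ctensor X Y\<^esub>b\<in>{..<n}. cpure X Y (contract_right X (\<chi> b) s) (v b))"
    using add(3) by (elim exE conjE) (rule that)
  obtain zs where zs: "set zs \<subseteq> carrier Y" "\<forall>W n v \<chi>. dual_basis Y W n v \<chi> \<and> set zs \<subseteq> W \<longrightarrow>
    t = (\<Oplus>\<^bsub>ctensor X Y\<^esub>b\<in>{..<n}. cpure X Y (contract_right X (\<chi> b) t) (v b))"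
    using add(4) by (elim exE conjE) (rule that)
  have "s \<oplus>\<^bsub>ctensor X Y\<^esub> t = (\<Oplus>\<^bsub>ctensor X Y\<^esub>b\<in>{..<n}. cpure X Y (contract_right X (\<chi> b) (s \<oplus>\<^bsub>ctensor X Y\<^esub> t)) (v b))"
    if db: "dual_basis Y W n v \<chi>" and sub: "set (ys @ zs) \<subseteq> W" for W n v \<chi>
  proof -
    note D = dual_basisD[OF db]
    interpret T: abelian_group "ctensor X Y" using X Y by simp
    have cl: "u \<in> carrier (ctensor X Y) \<Longrightarrow> b < n \<Longrightarrow> contract_right X (\<chi> b) u \<in> carrier X" for u b
      using clinD(1)[OF contract_right_clin[OF D(4)]] by blast
    have "(\<Oplus>\<^bsub>ctensor X Y\<^esub>b\<in>{..<n}. cpure X Y (contract_right X (\<chi> b) (s \<oplus>\<^bsub>ctensor X Y\<^esub> t)) (v b)) =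
       (\<Oplus>\<^bsub>ctensor X Y\<^esub>b\<in>{..<n}. cpure X Y (contract_right X (\<chi> b) s) (v b) \<oplus>\<^bsub>ctensor X Y\<^esub> cpure X Y (contract_right X (\<chi> b) t) (v b))"
      by (rule T.finsum_cong') (use D(3,4) X Y add cl in \<open>auto simp: clinD[OF contract_right_clin] cpure_add\<close>)
    also have "\<dots> = (\<Oplus>\<^bsub>ctensor X Y\<^esub>b\<in>{..<n}. cpure X Y (contract_right X (\<chi> b) s) (v b)) \<oplus>\<^bsub>ctensor X Y\<^esub>
        (\<Oplus>\<^bsub>ctensor X Y\<^esub>b\<in>{..<n}. cpure X Y (contract_right X (\<chi> b) t) (v b))"
      by (rule T.finsum_addf) (use cl add(1,2) D(3) X Y in \<open>auto simp: Pi_iff\<close>)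
    also have "\<dots> = s \<oplus>\<^bsub>ctensor X Y\<^esub> t"
      using ys(2)[rule_format, of W n v \<chi>] zs(2)[rule_format, of W n v \<chi>] db sub by simp
    finally show ?thesis by simp
  qed
  then show ?case using ys(1) zs(1) by (intro exI[of _ "ys @ zs"]) auto
qed

lemma tensor_expansion:
  assumes "t \<in> carrier (ctensor X Y)"
  obtains W n v \<chi> where "dual_basis Y W n v \<chi>"
    "t = (\<Oplus>\<^bsub>ctensor X Y\<^esub>b\<in>{..<n}. cpure X Y (contract_right X (\<chi> b) t) (v b))"
proof -
  obtain ys where ys: "set ys \<subseteq> carrier Y" "\<forall>W n v \<chi>. dual_basis Y W n v \<chi> \<and> set ys \<subseteq> W \<longrightarrow>
    t = (\<Oplus>\<^bsub>ctensor X Y\<^esub>b\<in>{..<n}. cpure X Y (contract_right X (\<chi> b) t) (v b))"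
    using tensor_expand[OF assms] by (elim exE conjE) (rule that)
  obtain n v \<chi> where db: "dual_basis Y (cspan Y ys) n v \<chi>"
    using dual_basis_exists[OF Y cspan_csubspace[OF Y ys(1)] ys(1)] by blast
  show ?thesis
    by (rule that[OF db]) (rule ys(2)[rule_format, OF conjI[OF db cspan_superset[OF Y ys(1)]]])
qed

text \<open>
  The coefficients in the expansion of the difference are contractions of it, hence zero.
\<close>

lemma contract_right_separates:
  assumes s: "s \<in> carrier (ctensor X Y)" and t: "t \<in> carrier (ctensor X Y)"
    and e: "\<And>h. h \<in> clin Y cfield \<Longrightarrow> contract_right X h s = contract_right X h t"
  shows "s = t"
proof -
  interpret T: abelian_group "ctensor X Y" using X Y by simp
  interpret X: abelian_group X using X by simp
  let ?d = "s \<oplus>\<^bsub>ctensor X Y\<^esub> (-1) \<odot>\<^bsub>ctensor X Y\<^esub> t"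
  have XY: "cspace (ctensor X Y)" using X Y by simp
  have d: "?d \<in> carrier (ctensor X Y)" using s t XY by simp
  obtain W n v \<chi> where db: "dual_basis Y W n v \<chi>"
    and exp: "?d = (\<Oplus>\<^bsub>ctensor X Y\<^esub>b\<in>{..<n}. cpure X Y (contract_right X (\<chi> b) ?d) (v b))"
    by (rule tensor_expansion[OF d])
  note D = dual_basisD[OF db]
  have z: "contract_right X (\<chi> b) ?d = \<zero>\<^bsub>X\<^esub>" if "b < n" for b
  proof -
    note l = contract_right_clin[OF D(4)[OF that]]
    have "contract_right X (\<chi> b) ?d = contract_right X (\<chi> b) t \<oplus>\<^bsub>X\<^esub> (-1) \<odot>\<^bsub>X\<^esub> contract_right X (\<chi> b) t"
      using s t XY by (simp add: clinD[OF l] e[OF D(4)[OF that]])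
    then show ?thesis using clinD(1)[OF l t] X by (simp add: cspace_neg[symmetric] X.r_neg)
  qed
  have "(\<Oplus>\<^bsub>ctensor X Y\<^esub>b\<in>{..<n}. cpure X Y (contract_right X (\<chi> b) ?d) (v b)) = (\<Oplus>\<^bsub>ctensor X Y\<^esub>b\<in>{..<n}. \<zero>\<^bsub>ctensor X Y\<^esub>)"
  proof (rule T.finsum_cong')
    fix b assume "b \<in> {..<n}"
    then have b: "b < n" by simp
    have "(\<lambda>x. cpure X Y x (v b)) \<in> clin X (ctensor X Y)" using cbilinD(2)[OF cbilin_cpure[OF X Y] D(3)[OF b]] .
    then show "cpure X Y (contract_right X (\<chi> b) ?d) (v b) = \<zero>\<^bsub>ctensor X Y\<^esub>"
      using clin_zero[OF X XY] z[OF b] by simp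
  qed (use XY in auto)
  then have "?d = \<zero>\<^bsub>ctensor X Y\<^esub>" using exp by simp
  then have "?d \<oplus>\<^bsub>ctensor X Y\<^esub> t = t" using t XY by simp
  moreover have "?d \<oplus>\<^bsub>ctensor X Y\<^esub> t = s" using s t XY by (simp add: T.a_assoc T.l_neg cspace_neg[symmetric])
  ultimately show ?thesis by simp
qed

end

section \<open>Trilinear maps\<close>

lemma clift_param_clin:
  assumes sp: "cspace X" "cspace Y" "cspace Z" "cspace W"
    and b: "\<And>x. x \<in> carrier X \<Longrightarrow> cbilin Y Z W (\<beta> x)"
    and l: "\<And>y z. y \<in> carrier Y \<Longrightarrow> z \<in> carrier Z \<Longrightarrow> (\<lambda>x. \<beta> x y z) \<in> clin X W"
    and t: "t \<in> carrier (ctensor Y Z)"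
  shows "(\<lambda>x. tensor_lift W (\<beta> x) t) \<in> clin X W"
  using sp(2,3) t
proof (induction t rule: ctensor_induct)
  case (pure y z)
  show ?case
    by (rule clinI) (use pure sp in \<open>simp_all add: clift_pure[OF sp(2,3,4) b] clinD[OF l[OF pure]]\<close>)
next
  case (add s t)
  note L = clift_clin[OF sp(2,3,4) b]
  show ?case
    by (rule clinI) (use sp add(1,2) in \<open>simp_all add: clinD[OF L] clinD[OF add(3)] clinD[OF add(4)] cspace_add_ac\<close>)
qed

definition ctrilin where
  "ctrilin X Y Z W \<beta> \<longleftrightarrow> (\<forall>x\<in>carrier X. cbilin Y Z W (\<beta> x)) \<and> (\<forall>y\<in>carrier Y. \<forall>z\<in>carrier Z. (\<lambda>x. \<beta> x y z) \<in> clin X W)"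

lemma ctrilinI:
  "(\<And>x. x \<in> carrier X \<Longrightarrow> cbilin Y Z W (\<beta> x)) \<Longrightarrow>
   (\<And>y z. y \<in> carrier Y \<Longrightarrow> z \<in> carrier Z \<Longrightarrow> (\<lambda>x. \<beta> x y z) \<in> clin X W) \<Longrightarrow> ctrilin X Y Z W \<beta>"
  by (simp add: ctrilin_def)

context
  fixes X :: "(complex, 'l, 'x) module_scheme" and Y :: "(complex, 'm, 'y) module_scheme"
    and Z :: "(complex, 'n, 'z) module_scheme" and W :: "(complex, 'p, 'w) module_scheme"
    and \<beta> :: "'l \<Rightarrow> 'm \<Rightarrow> 'n \<Rightarrow> 'p"
  assumes sp: "cspace X" "cspace Y" "cspace Z" "cspace W" and b: "ctrilin X Y Z W \<beta>"
begin

lemma ctrilin_fix_left: "x \<in> carrier X \<Longrightarrow> cbilin Y Z W (\<beta> x)"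
  and ctrilin_linear_left: "y \<in> carrier Y \<Longrightarrow> z \<in> carrier Z \<Longrightarrow> (\<lambda>x. \<beta> x y z) \<in> clin X W"
  using b by (auto simp: ctrilin_def)

lemma ctrilin_fix_right: "z \<in> carrier Z \<Longrightarrow> cbilin X Y W (\<lambda>x y. \<beta> x y z)"
  using ctrilin_linear_left cbilinD(2)[OF ctrilin_fix_left] by (auto intro!: cbilinI)

lemma ctrilin_right: "cbilin X (ctensor Y Z) W (\<lambda>x t. tensor_lift W (\<beta> x) t)"
  by (rule cbilinI, rule clift_clin[OF sp(2-4) ctrilin_fix_left], assumption,
      rule clift_param_clin[OF sp ctrilin_fix_left ctrilin_linear_left])

lemma ctrilin_left: "cbilin (ctensor X Y) Z W (\<lambda>t z. tensor_lift W (\<lambda>x y. \<beta> x y z) t)"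
proof (rule cbilinI)
  show "(\<lambda>t. tensor_lift W (\<lambda>x y. \<beta> x y z) t) \<in> clin (ctensor X Y) W" if "z \<in> carrier Z" for z
    by (rule clift_clin[OF sp(1,2,4) ctrilin_fix_right[OF that]])
  show "(\<lambda>z. tensor_lift W (\<lambda>x y. \<beta> x y z) t) \<in> clin Z W" if "t \<in> carrier (ctensor X Y)" for t
    by (rule clift_param_clin[OF sp(3,1,2,4) ctrilin_fix_right _ that])
      (use cbilinD(1)[OF ctrilin_fix_left] in auto)
qed

text \<open>
  A trilinear map factors through both bracketings of the triple tensor product. In this form
  coassociativity becomes an identity between iterated lifts, as in Sweedler notation.
\<close>

lemma clift_cassoc:
  assumes "s \<in> carrier (ctensor (ctensor X Y) Z)"
  shows "tensor_lift W (\<lambda>x t. tensor_lift W (\<beta> x) t) (cassoc X Y Z s) =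
    tensor_lift W (\<lambda>t z. tensor_lift W (\<lambda>x y. \<beta> x y z) t) s"
proof (rule ctensor3_eqI[OF sp(1-3) _ _ _ assms])
  show "(\<lambda>s. tensor_lift W (\<lambda>x t. tensor_lift W (\<beta> x) t) (cassoc X Y Z s)) \<in> clin (ctensor (ctensor X Y) Z) W"
    by (rule clin_comp[OF cassoc_clin clift_clin[OF _ _ _ ctrilin_right]]) (use sp in simp_all)
  show "tensor_lift W (\<lambda>t z. tensor_lift W (\<lambda>x y. \<beta> x y z) t) \<in> clin (ctensor (ctensor X Y) Z) W"
    by (rule clift_clin[OF _ _ _ ctrilin_left]) (use sp in simp_all)
qed (use sp in \<open>simp add: clift_pure[OF _ _ _ ctrilin_right] clift_pure[OF _ _ _ ctrilin_left]
    clift_pure[OF _ _ _ ctrilin_fix_left] clift_pure[OF _ _ _ ctrilin_fix_right]\<close>)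

end

section \<open>Coalgebras and the actions of their duals\<close>

lemma cspan_least:
  assumes "csubspace M W" "set ys \<subseteq> W" shows "cspan M ys \<subseteq> W"
  using assms(2) by (induction ys) (auto simp: csubspaceD[OF assms(1)])

lemma cfield_add: "f \<in> clin X cfield \<Longrightarrow> g \<in> clin X cfield \<Longrightarrow> (\<lambda>x. f x + g x) \<in> clin X cfield"
  and cfield_scale: "f \<in> clin X cfield \<Longrightarrow> (\<lambda>x. a * f x) \<in> clin X cfield"
  and cfield_zero: "(\<lambda>x. 0) \<in> clin X cfield"
  by (auto intro!: clinI simp: clinD algebra_simps)

lemma cfield_sum: "finite I \<Longrightarrow> (\<And>i. i \<in> I \<Longrightarrow> f i \<in> clin X cfield) \<Longrightarrow> (\<lambda>x. \<Sum>i\<in>I. f i x) \<in> clin X cfield"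
  by (induction I rule: finite_induct) (auto simp: cfield_add cfield_zero)

lemma clift_sum:
  assumes sp: "cspace X" "cspace Y" and b: "\<And>i. i \<in> I \<Longrightarrow> cbilin X Y cfield (\<beta> i)" and I: "finite I" and t: "t \<in> carrier (ctensor X Y)"
  shows "tensor_lift cfield (\<lambda>x y. \<Sum>i\<in>I. \<beta> i x y) t = (\<Sum>i\<in>I. tensor_lift cfield (\<beta> i) t)"
proof -
  have bI: "cbilin X Y cfield (\<lambda>x y. \<Sum>i\<in>I. \<beta> i x y)" by (intro cbilinI cfield_sum[OF I] cbilinD(1,2)[OF b])
  show ?thesis
    by (rule ctensor_eqI[OF sp clift_clin[OF sp cfield_cspace bI] cfield_sum[OF I clift_clin[OF sp cfield_cspace b]] _ t])
      (simp_all add: clift_pure[OF sp cfield_cspace bI] clift_pure[OF sp cfield_cspace b])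
qed

locale coalg =
  fixes C :: "'c coalgebra"
  assumes coalg: "is_coalgebra C"
begin

abbreviation "\<Delta> \<equiv> comult C"
abbreviation "\<epsilon> \<equiv> counit C"
abbreviation "dual \<equiv> clin C cfield"

lemma cspace_C [simp]: "cspace C"
  and comult_clin [simp]: "\<Delta> \<in> clin C (ctensor C C)"
  and counit_dual [simp]: "\<epsilon> \<in> dual"
  and coassoc: "c \<in> carrier C \<Longrightarrow> cassoc C C C (cmap (ctensor C C) C \<Delta> id (\<Delta> c)) = cmap C (ctensor C C) id \<Delta> (\<Delta> c)"
  and counit_left: "c \<in> carrier C \<Longrightarrow> tensor_lift C (\<lambda>x y. \<epsilon> x \<odot>\<^bsub>C\<^esub> y) (\<Delta> c) = c"
  and counit_right: "c \<in> carrier C \<Longrightarrow> tensor_lift C (\<lambda>x y. \<epsilon> y \<odot>\<^bsub>C\<^esub> x) (\<Delta> c) = c"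
  using coalg by (simp_all add: is_coalgebra_def)

lemma comult_closed [simp]: "c \<in> carrier C \<Longrightarrow> \<Delta> c \<in> carrier (ctensor C C)"
  by (rule clinD(1)[OF comult_clin])

text \<open>
  In Sweedler notation: \<open>\<beta>(c\<^sub>1, c\<^sub>2\<^sub>1, c\<^sub>2\<^sub>2) = \<beta>(c\<^sub>1\<^sub>1, c\<^sub>1\<^sub>2, c\<^sub>2)\<close>.
\<close>

lemma sweedler_coassoc:
  assumes Z: "cspace Z" and b: "ctrilin C C C Z \<beta>" and c: "c \<in> carrier C"
  shows "tensor_lift Z (\<lambda>x y. tensor_lift Z (\<beta> x) (\<Delta> y)) (\<Delta> c) =
    tensor_lift Z (\<lambda>x y. tensor_lift Z (\<lambda>u v. \<beta> u v y) (\<Delta> x)) (\<Delta> c)"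
proof -
  note sp = cspace_C cspace_C cspace_C Z
  have "tensor_lift Z (\<lambda>x y. tensor_lift Z (\<beta> x) (\<Delta> y)) (\<Delta> c) =
    tensor_lift Z (\<lambda>x t. tensor_lift Z (\<beta> x) t) (cmap C (ctensor C C) id \<Delta> (\<Delta> c))"
    by (subst clift_cmap[OF _ _ _ _ Z ctrilin_right[OF sp b] clin_id comult_clin]) (use c in simp_all)
  also have "\<dots> = tensor_lift Z (\<lambda>t z. tensor_lift Z (\<lambda>x y. \<beta> x y z) t) (cmap (ctensor C C) C \<Delta> id (\<Delta> c))"
    unfolding coassoc[OF c, symmetric]
    by (rule clift_cassoc[OF sp b], rule clinD(1)[OF cmap_clin[OF cspace_C cspace_C _ cspace_C comult_clin clin_id]])
      (use c in simp_all)
  also have "\<dots> = tensor_lift Z (\<lambda>x y. tensor_lift Z (\<lambda>u v. \<beta> u v y) (\<Delta> x)) (\<Delta> c)"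
    by (subst clift_cmap[OF _ _ _ _ Z ctrilin_left[OF sp b] comult_clin clin_id]) (use c in simp_all)
  finally show ?thesis .
qed

text \<open>
  \<open>lhit g c\<close> is \<open>g(c\<^sub>1) c\<^sub>2\<close> and \<open>rhit h c\<close> is \<open>c\<^sub>1 h(c\<^sub>2)\<close>: the two actions of the dual algebra on \<open>C\<close>.
\<close>

definition lhit :: "('c \<Rightarrow> complex) \<Rightarrow> 'c \<Rightarrow> 'c" where "lhit g c = contract_left C g (\<Delta> c)"
definition rhit :: "('c \<Rightarrow> complex) \<Rightarrow> 'c \<Rightarrow> 'c" where "rhit h c = contract_right C h (\<Delta> c)"

lemma lhit_clin: "g \<in> dual \<Longrightarrow> lhit g \<in> clin C C"
  unfolding lhit_def[abs_def] by (rule clin_comp[OF comult_clin contract_left_clin]) simp_all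

lemma rhit_clin: "g \<in> dual \<Longrightarrow> rhit g \<in> clin C C"
  unfolding rhit_def[abs_def] by (rule clin_comp[OF comult_clin contract_right_clin]) simp_all

lemmas lhit_closed = clinD(1)[OF lhit_clin] and rhit_closed = clinD(1)[OF rhit_clin]

lemma hit_commute: "g \<in> dual \<Longrightarrow> h \<in> dual \<Longrightarrow> c \<in> carrier C \<Longrightarrow> h (lhit g c) = g (rhit h c)"
  unfolding lhit_def rhit_def by (rule contract_commute) simp_all

lemma functional_product_cbilin: "g \<in> clin X cfield \<Longrightarrow> h \<in> clin Y cfield \<Longrightarrow> cbilin X Y cfield (\<lambda>x y. g x * h y)"
  by (auto intro!: cbilinI clinI simp: clinD algebra_simps)

lemma functional_lhit:
  assumes g: "g \<in> dual" and h: "h \<in> dual" and c: "c \<in> carrier C"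
  shows "h (lhit g c) = tensor_lift cfield (\<lambda>x y. g x * h y) (\<Delta> c)"
proof -
  have "h (lhit g c) = tensor_lift cfield (\<lambda>x y. h (g x \<odot>\<^bsub>C\<^esub> y)) (\<Delta> c)"
    unfolding lhit_def contract_left_def
    by (rule clift_comp[OF _ _ _ _ contract_left_cbilin[OF _ _ g] h]) (use c in simp_all)
  also have "\<dots> = tensor_lift cfield (\<lambda>x y. g x * h y) (\<Delta> c)"
    by (rule clift_cong[where X = C and Y = C])
      (use c g h functional_product_cbilin[OF g h] in \<open>auto intro!: cbilinI clinI simp: clinD cspace_smult_add algebra_simps\<close>)
  finally show ?thesis .
qed

lemma functional_rhit:
  "g \<in> dual \<Longrightarrow> h \<in> dual \<Longrightarrow> c \<in> carrier C \<Longrightarrow> g (rhit h c) = tensor_lift cfield (\<lambda>x y. g x * h y) (\<Delta> c)"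
  by (simp add: functional_lhit hit_commute[symmetric])

lemma clift_scale:
  assumes "cspace X" "cspace Y" "cbilin X Y cfield \<beta>" "t \<in> carrier (ctensor X Y)"
  shows "a * tensor_lift cfield \<beta> t = tensor_lift cfield (\<lambda>x y. a * \<beta> x y) t"
  by (rule clift_comp[OF assms(1,2) cfield_cspace cfield_cspace assms(3) _ assms(4), where F = "\<lambda>z. a * z"])
    (auto intro!: clinI simp: algebra_simps)

text \<open>
  Coassociativity, tested with a third functional \<open>k\<close>: both sides give \<open>g(c\<^sub>1) k(c\<^sub>2) h(c\<^sub>3)\<close>.
\<close>

lemma lhit_rhit:
  assumes g: "g \<in> dual" and h: "h \<in> dual" and c: "c \<in> carrier C"
  shows "rhit h (lhit g c) = lhit g (rhit h c)"
proof (rule functionals_separate[OF cspace_C])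
  fix k assume k: "k \<in> dual"
  let ?\<beta> = "\<lambda>x y z. g x * (k y * h z)"
  have b: "ctrilin C C C cfield ?\<beta>"
    by (intro ctrilinI cbilinI clinI) (use g h k in \<open>auto simp: clinD algebra_simps\<close>)
  have hl: "(\<lambda>y. h (lhit k y)) \<in> dual" by (rule clin_comp[OF lhit_clin[OF k] h])
  have gr: "(\<lambda>y. g (rhit k y)) \<in> dual" by (rule clin_comp[OF rhit_clin[OF k] g])
  have 1: "cbilin C C cfield (\<lambda>x y. g x * h (lhit k y))" by (rule functional_product_cbilin[OF g hl])
  have 2: "cbilin C C cfield (\<lambda>x y. g (rhit k x) * h y)" by (rule functional_product_cbilin[OF gr h])
  have kh: "cbilin C C cfield (\<lambda>x y. k x * h y)" and gk: "cbilin C C cfield (\<lambda>x y. g x * k y)"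
    by (rule functional_product_cbilin; fact)+
  have e1: "g x * h (lhit k y) = tensor_lift cfield (?\<beta> x) (\<Delta> y)" if "y \<in> carrier C" for x y
    unfolding functional_lhit[OF k h that] by (rule clift_scale[OF _ _ kh]) (use that in simp_all)
  have e2: "g (rhit k x) * h y = tensor_lift cfield (\<lambda>u v. ?\<beta> u v y) (\<Delta> x)" if "x \<in> carrier C" for x y
    unfolding functional_rhit[OF g k that]
    using clift_scale[OF _ _ gk, of "\<Delta> x" "h y"] that by (simp add: ac_simps)
  have "k (rhit h (lhit g c)) = h (lhit k (lhit g c))"
    by (rule hit_commute[OF k h lhit_closed[OF g c], symmetric])
  also have "\<dots> = tensor_lift cfield (\<lambda>x y. g x * h (lhit k y)) (\<Delta> c)"
    by (rule functional_lhit[OF g hl c])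
  also have "\<dots> = tensor_lift cfield (\<lambda>x y. tensor_lift cfield (?\<beta> x) (\<Delta> y)) (\<Delta> c)"
  proof (rule clift_cong[where X = C and Y = C, OF _ _ _ 1])
    show "cbilin C C cfield (\<lambda>x y. tensor_lift cfield (?\<beta> x) (\<Delta> y))"
      using 1 by (simp add: cbilin_def mod_homs_def Pi_iff e1)
  qed (use c e1 in simp_all)
  also have "\<dots> = tensor_lift cfield (\<lambda>x y. tensor_lift cfield (\<lambda>u v. ?\<beta> u v y) (\<Delta> x)) (\<Delta> c)"
    by (rule sweedler_coassoc[OF cfield_cspace b c])
  also have "\<dots> = tensor_lift cfield (\<lambda>x y. g (rhit k x) * h y) (\<Delta> c)"
  proof (rule clift_cong[where X = C and Y = C, OF _ _ _ _ 2])
    show "cbilin C C cfield (\<lambda>x y. tensor_lift cfield (\<lambda>u v. ?\<beta> u v y) (\<Delta> x))"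
      using 2 by (simp add: cbilin_def mod_homs_def Pi_iff e2)
  qed (use c e2 in simp_all)
  also have "\<dots> = g (rhit k (rhit h c))"
    by (rule functional_rhit[OF gr h c, symmetric])
  also have "\<dots> = k (lhit g (rhit h c))"
    by (rule hit_commute[OF g k rhit_closed[OF h c], symmetric])
  finally show "k (rhit h (lhit g c)) = k (lhit g (rhit h c))" .
qed (use g h c in \<open>simp_all add: lhit_closed rhit_closed\<close>)

text \<open>
  The product \<open>g(x\<^sub>1) f(x\<^sub>2)\<close> of the dual algebra.
\<close>

definition conv :: "('c \<Rightarrow> complex) \<Rightarrow> ('c \<Rightarrow> complex) \<Rightarrow> 'c \<Rightarrow> complex" where
  "conv g f x = f (lhit g x)"

lemma conv_dual: "g \<in> dual \<Longrightarrow> f \<in> dual \<Longrightarrow> conv g f \<in> dual"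
  unfolding conv_def[abs_def] by (rule clin_comp[OF lhit_clin])

lemma lhit_lhit:
  assumes g: "g \<in> dual" and f: "f \<in> dual" and c: "c \<in> carrier C"
  shows "lhit f (lhit g c) = lhit (conv g f) c"
proof (rule functionals_separate[OF cspace_C])
  fix k assume k: "k \<in> dual"
  show "k (lhit f (lhit g c)) = k (lhit (conv g f) c)"
    by (simp add: hit_commute[OF f k] hit_commute[OF conv_dual[OF g f] k] lhit_closed[OF g] lhit_rhit[OF g k] conv_def c)
qed (use g f c in \<open>simp_all add: lhit_closed conv_dual\<close>)

lemma rhit_rhit:
  assumes g: "g \<in> dual" and f: "f \<in> dual" and c: "c \<in> carrier C"
  shows "rhit f (rhit g c) = rhit (conv f g) c"
proof (rule functionals_separate[OF cspace_C])
  fix k assume k: "k \<in> dual"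
  have "k (rhit f (rhit g c)) = f (rhit g (lhit k c))"
    by (simp add: hit_commute[OF k f, symmetric] rhit_closed[OF g] lhit_rhit[OF k g] c)
  also have "\<dots> = g (lhit f (lhit k c))"
    by (simp add: hit_commute[OF f g] lhit_closed[OF k] c)
  also have "\<dots> = k (rhit (conv f g) c)"
    by (simp add: hit_commute[OF k conv_dual[OF f g], symmetric] conv_def c)
  finally show "k (rhit f (rhit g c)) = k (rhit (conv f g) c)" .
qed (use g f c in \<open>simp_all add: rhit_closed conv_dual\<close>)

lemma lhit_counit: "c \<in> carrier C \<Longrightarrow> lhit \<epsilon> c = c" and rhit_counit: "c \<in> carrier C \<Longrightarrow> rhit \<epsilon> c = c"
  by (simp_all add: lhit_def rhit_def contract_left_def contract_right_def counit_left counit_right)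

lemma lhit_functional_clin:
  assumes c: "c \<in> carrier C"
  shows "f \<in> dual \<Longrightarrow> g \<in> dual \<Longrightarrow> lhit (\<lambda>x. f x + g x) c = lhit f c \<oplus>\<^bsub>C\<^esub> lhit g c"
    and "f \<in> dual \<Longrightarrow> lhit (\<lambda>x. a * f x) c = a \<odot>\<^bsub>C\<^esub> lhit f c"
proof -
  assume f: "f \<in> dual"
  show "lhit (\<lambda>x. a * f x) c = a \<odot>\<^bsub>C\<^esub> lhit f c"
  proof (rule functionals_separate[OF cspace_C])
    fix k assume k: "k \<in> dual"
    show "k (lhit (\<lambda>x. a * f x) c) = k (a \<odot>\<^bsub>C\<^esub> lhit f c)"
      by (simp add: clinD[OF k] lhit_closed f c hit_commute[OF f k] hit_commute[OF cfield_scale[OF f] k])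
  qed (use f c in \<open>simp_all add: lhit_closed cfield_scale\<close>)
  assume g: "g \<in> dual"
  show "lhit (\<lambda>x. f x + g x) c = lhit f c \<oplus>\<^bsub>C\<^esub> lhit g c"
  proof (rule functionals_separate[OF cspace_C])
    fix k assume k: "k \<in> dual"
    show "k (lhit (\<lambda>x. f x + g x) c) = k (lhit f c \<oplus>\<^bsub>C\<^esub> lhit g c)"
      by (simp add: clinD[OF k] lhit_closed f g c hit_commute[OF f k] hit_commute[OF g k] hit_commute[OF cfield_add[OF f g] k])
  qed (use f g c in \<open>simp_all add: lhit_closed cfield_add\<close>)
qed

lemma rhit_functional_clin:
  assumes c: "c \<in> carrier C"
  shows "f \<in> dual \<Longrightarrow> g \<in> dual \<Longrightarrow> rhit (\<lambda>x. f x + g x) c = rhit f c \<oplus>\<^bsub>C\<^esub> rhit g c"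
    and "f \<in> dual \<Longrightarrow> rhit (\<lambda>x. a * f x) c = a \<odot>\<^bsub>C\<^esub> rhit f c"
proof -
  assume f: "f \<in> dual"
  show "rhit (\<lambda>x. a * f x) c = a \<odot>\<^bsub>C\<^esub> rhit f c"
  proof (rule functionals_separate[OF cspace_C])
    fix k assume k: "k \<in> dual"
    show "k (rhit (\<lambda>x. a * f x) c) = k (a \<odot>\<^bsub>C\<^esub> rhit f c)"
      by (simp add: clinD[OF k] rhit_closed f c hit_commute[OF k f, symmetric] hit_commute[OF k cfield_scale[OF f], symmetric])
  qed (use f c in \<open>simp_all add: rhit_closed cfield_scale\<close>)
  assume g: "g \<in> dual"
  show "rhit (\<lambda>x. f x + g x) c = rhit f c \<oplus>\<^bsub>C\<^esub> rhit g c"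
  proof (rule functionals_separate[OF cspace_C])
    fix k assume k: "k \<in> dual"
    show "k (rhit (\<lambda>x. f x + g x) c) = k (rhit f c \<oplus>\<^bsub>C\<^esub> rhit g c)"
      by (simp add: clinD[OF k] rhit_closed f g c hit_commute[OF k f, symmetric] hit_commute[OF k g, symmetric]
          hit_commute[OF k cfield_add[OF f g], symmetric])
  qed (use f g c in \<open>simp_all add: rhit_closed cfield_add\<close>)
qed

lemma hit_zero: "c \<in> carrier C \<Longrightarrow> lhit (\<lambda>_. 0) c = \<zero>\<^bsub>C\<^esub>" "c \<in> carrier C \<Longrightarrow> rhit (\<lambda>_. 0) c = \<zero>\<^bsub>C\<^esub>"
  using lhit_functional_clin(2)[of c "\<lambda>_. 0" 0] rhit_functional_clin(2)[of c "\<lambda>_. 0" 0]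
  by (simp_all add: cfield_zero lhit_closed rhit_closed)

section \<open>Subcoalgebras\<close>

lemma subcoalgebra_csubspace: "subcoalgebra C D \<Longrightarrow> csubspace C D"
  by (simp add: subcoalgebra_def submodule_csubspace)

text \<open>
  The comultiplication of \<open>x\<close> comes from \<open>D \<otimes> D\<close>, so only the values of a bilinear map on \<open>D\<close> matter.
\<close>

lemma subcoalgebra_lift_cong:
  assumes D: "subcoalgebra C D" and Z: "cspace Z" and b: "cbilin C C Z \<beta>" and c: "cbilin C C Z \<gamma>"
    and e: "\<And>x y. x \<in> D \<Longrightarrow> y \<in> D \<Longrightarrow> \<beta> x y = \<gamma> x y" and x: "x \<in> D"
  shows "tensor_lift Z \<beta> (\<Delta> x) = tensor_lift Z \<gamma> (\<Delta> x)"
proof -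
  let ?D = "C\<lparr>carrier := D\<rparr>"
  note S = subcoalgebra_csubspace[OF D]
  have spD: "cspace ?D" by (rule csubspace_cspace[OF cspace_C S])
  have idl: "id \<in> clin ?D C" by (rule clinI) (auto simp: csubspaceD[OF S])
  obtain s where s: "s \<in> carrier (ctensor ?D ?D)" "\<Delta> x = cmap C C id id s"
    using D x by (auto simp: subcoalgebra_def)
  note L = clin_comp[OF cmap_clin[OF spD spD cspace_C cspace_C idl idl] clift_clin[OF cspace_C cspace_C Z]]
  have "tensor_lift Z \<beta> (cmap C C id id s) = tensor_lift Z \<gamma> (cmap C C id id s)"
  proof (rule ctensor_eqI[OF spD spD L[OF b] L[OF c] _ s(1)])
    fix u v assume "u \<in> carrier ?D" "v \<in> carrier ?D"
    then show "tensor_lift Z \<beta> (cmap C C id id (cpure ?D ?D u v)) = tensor_lift Z \<gamma> (cmap C C id id (cpure ?D ?D u v))"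
      using e[of u v] csubspaceD(1)[OF S, of u] csubspaceD(1)[OF S, of v]
      by (simp add: cmap_pure[OF spD spD cspace_C cspace_C idl idl] clift_pure[OF cspace_C cspace_C Z b]
          clift_pure[OF cspace_C cspace_C Z c])
  qed
  then show ?thesis using s by simp
qed

lemma subcoalgebra_hit_closed:
  assumes D: "subcoalgebra C D" and g: "g \<in> dual" and x: "x \<in> D"
  shows "lhit g x \<in> D" "rhit g x \<in> D"
proof -
  let ?D = "C\<lparr>carrier := D\<rparr>"
  note S = subcoalgebra_csubspace[OF D]
  have spD: "cspace ?D" by (rule csubspace_cspace[OF cspace_C S])
  have idl: "id \<in> clin ?D C" by (rule clinI) (auto simp: csubspaceD[OF S])
  define F where "F = cmap C C id id"
  have cm: "F \<in> clin (ctensor ?D ?D) (ctensor C C)"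
    unfolding F_def by (rule cmap_clin[OF spD spD cspace_C cspace_C idl idl])
  have Fp: "F (cpure ?D ?D u v) = cpure C C u v" if "u \<in> carrier ?D" "v \<in> carrier ?D" for u v
    unfolding F_def using cmap_pure[OF spD spD cspace_C cspace_C idl idl that] by simp
  obtain s where s: "s \<in> carrier (ctensor ?D ?D)" "\<Delta> x = F s"
    using D x by (auto simp: subcoalgebra_def F_def)
  have "contract_left C g (F s) \<in> D \<and> contract_right C g (F s) \<in> D"
    using spD spD s(1)
  proof (induction s rule: ctensor_induct)
    case (pure u v)
    then have uv: "u \<in> D" "v \<in> D" "u \<in> carrier C" "v \<in> carrier C" using csubspaceD(1)[OF S] by auto
    then show ?case using g csubspaceD(4)[OF S] unfolding Fp[OF pure]
      by (simp add: contract_left_pure contract_right_pure)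
  next
    case (add s t)
    then show ?case using g csubspaceD(3)[OF S] clinD(1)[OF cm add(1)] clinD(1)[OF cm add(2)]
      unfolding clinD(2)[OF cm add(1,2)]
      by (simp add: clinD(2)[OF contract_left_clin] clinD(2)[OF contract_right_clin])
  qed
  then show "lhit g x \<in> D" "rhit g x \<in> D" using s by (simp_all add: lhit_def rhit_def)
qed

lemma subcoalgebra_hit_cong:
  assumes D: "subcoalgebra C D" and g: "g \<in> dual" and h: "h \<in> dual" and x: "x \<in> D"
    and e: "\<And>y. y \<in> D \<Longrightarrow> g y = h y"
  shows "lhit g x = lhit h x" "rhit g x = rhit h x"
  unfolding lhit_def rhit_def contract_left_def contract_right_def
  using g h e
  by (auto intro!: subcoalgebra_lift_cong[OF D _ _ _ _ x] contract_left_cbilin contract_right_cbilin)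

text \<open>
  With a dual basis \<open>u\<close>, \<open>\<psi>\<close> of \<open>W\<close>, the comultiplication of \<open>x\<close> should be the sum of
  \<open>u a \<otimes> \<psi>\<^sub>a(x\<^sub>1) x\<^sub>2\<close>, which lies in \<open>W \<otimes> W\<close> by stability. The equality is checked by contracting the
  second factor with \<open>h\<close>, which turns it into the expansion of \<open>rhit h x\<close> in the basis.
\<close>

lemma subcoalgebraI:
  assumes db: "dual_basis C W n u \<psi>"
    and l: "\<And>g x. g \<in> dual \<Longrightarrow> x \<in> W \<Longrightarrow> lhit g x \<in> W" and r: "\<And>g x. g \<in> dual \<Longrightarrow> x \<in> W \<Longrightarrow> rhit g x \<in> W"
  shows "subcoalgebra C W"
proof -
  note D = dual_basisD[OF db]
  note S = D(1)
  let ?W = "C\<lparr>carrier := W\<rparr>"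
  have spW: "cspace ?W" by (rule csubspace_cspace[OF cspace_C S])
  have idl: "id \<in> clin ?W C" by (rule clinI) (auto simp: csubspaceD[OF S])
  have spWW: "cspace (ctensor ?W ?W)" using spW by simp
  have spCC: "cspace (ctensor C C)" by simp
  interpret A: abelian_group "ctensor C C" by simp
  have "\<Delta> x \<in> cmap C C id id ` carrier (ctensor ?W ?W)" if x: "x \<in> W" for x
  proof -
    have xc: "x \<in> carrier C" using csubspaceD(1)[OF S x] .
    define w where "w a = lhit (\<psi> a) x" for a
    have w: "a < n \<Longrightarrow> w a \<in> W" "a < n \<Longrightarrow> w a \<in> carrier C" for a
      unfolding w_def using l[OF D(4) x] lhit_closed[OF D(4) xc] by auto
    have p: "a < n \<Longrightarrow> cpure ?W ?W (u a) (w a) \<in> carrier (ctensor ?W ?W)" for a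
      using spW w D(2) by simp
    have pc: "a < n \<Longrightarrow> cpure C C (u a) (w a) \<in> carrier (ctensor C C)" for a
      using w D(3) by simp
    have "cmap C C id id (\<Oplus>\<^bsub>ctensor ?W ?W\<^esub>a\<in>{..<n}. cpure ?W ?W (u a) (w a)) =
      (\<Oplus>\<^bsub>ctensor C C\<^esub>a\<in>{..<n}. cmap C C id id (cpure ?W ?W (u a) (w a)))"
      by (rule clin_finsum[OF spWW spCC cmap_clin[OF spW spW cspace_C cspace_C idl idl]]) (use p in auto)
    also have "\<dots> = (\<Oplus>\<^bsub>ctensor C C\<^esub>a\<in>{..<n}. cpure C C (u a) (w a))"
      by (rule A.finsum_cong') (use pc w D(2) in \<open>auto simp: cmap_pure[OF spW spW cspace_C cspace_C idl idl]\<close>)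
    also have "\<dots> = \<Delta> x"
    proof (rule contract_right_separates[OF cspace_C cspace_C])
      show "(\<Oplus>\<^bsub>ctensor C C\<^esub>a\<in>{..<n}. cpure C C (u a) (w a)) \<in> carrier (ctensor C C)"
        by (rule cspace_finsum_closed[OF spCC]) (use pc in auto)
      show "\<Delta> x \<in> carrier (ctensor C C)" using xc by simp
      fix h assume h: "h \<in> dual"
      interpret B: abelian_group C by simp
      have "contract_right C h (\<Oplus>\<^bsub>ctensor C C\<^esub>a\<in>{..<n}. cpure C C (u a) (w a)) =
        (\<Oplus>\<^bsub>C\<^esub>a\<in>{..<n}. contract_right C h (cpure C C (u a) (w a)))"
        by (rule clin_finsum[OF spCC cspace_C contract_right_clin[OF cspace_C cspace_C h]]) (use pc in auto)
      also have "\<dots> = (\<Oplus>\<^bsub>C\<^esub>a\<in>{..<n}. \<psi> a (rhit h x) \<odot>\<^bsub>C\<^esub> u a)"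
        by (rule B.finsum_cong')
          (use w D(3,4) h xc in \<open>auto simp: contract_right_pure w_def hit_commute rhit_closed\<close>)
      also have "\<dots> = rhit h x" by (rule D(6)[OF r[OF h x]])
      finally show "contract_right C h (\<Oplus>\<^bsub>ctensor C C\<^esub>a\<in>{..<n}. cpure C C (u a) (w a)) = contract_right C h (\<Delta> x)"
        by (simp add: rhit_def)
    qed
    finally have eq: "\<Delta> x = cmap C C id id (\<Oplus>\<^bsub>ctensor ?W ?W\<^esub>a\<in>{..<n}. cpure ?W ?W (u a) (w a))" ..
    have "(\<Oplus>\<^bsub>ctensor ?W ?W\<^esub>a\<in>{..<n}. cpure ?W ?W (u a) (w a)) \<in> carrier (ctensor ?W ?W)"
      by (rule cspace_finsum_closed[OF spWW]) (use p in auto)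
    then show ?thesis by (subst eq) (rule imageI)
  qed
  then show ?thesis using S by (simp add: subcoalgebra_def submodule_csubspace image_subset_iff)
qed

text \<open>
  The comultiplication of \<open>c\<close> is a finite sum of pure tensors, and the two families of factors span all
  the values of the actions on \<open>c\<close>.
\<close>

lemma hit_finite:
  assumes c: "c \<in> carrier C"
  obtains ys zs where "set ys \<subseteq> carrier C" "set zs \<subseteq> carrier C"
    "\<And>g. g \<in> dual \<Longrightarrow> lhit g c \<in> cspan C ys" "\<And>g. g \<in> dual \<Longrightarrow> rhit g c \<in> cspan C zs"
proof -
  obtain W n v \<chi> where db: "dual_basis C W n v \<chi>"
    and exp: "\<Delta> c = (\<Oplus>\<^bsub>ctensor C C\<^esub>b\<in>{..<n}. cpure C C (contract_right C (\<chi> b) (\<Delta> c)) (v b))"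
    by (rule tensor_expansion[OF cspace_C cspace_C comult_closed[OF c]])
  note D = dual_basisD[OF db]
  define a where "a b = rhit (\<chi> b) c" for b
  have a: "b < n \<Longrightarrow> a b \<in> carrier C" for b unfolding a_def by (rule rhit_closed[OF D(4) c])
  have exp': "\<Delta> c = (\<Oplus>\<^bsub>ctensor C C\<^esub>b\<in>{..<n}. cpure C C (a b) (v b))"
    using exp by (simp add: a_def rhit_def)
  have p: "b < n \<Longrightarrow> cpure C C (a b) (v b) \<in> carrier (ctensor C C)" for b using a D(3) by simp
  have spCC: "cspace (ctensor C C)" by simp
  interpret B: abelian_group C by simp
  let ?ys = "map v [0..<n]" and ?zs = "map a [0..<n]"
  have ys: "set ?ys \<subseteq> carrier C" "set ?zs \<subseteq> carrier C" using D(3) a by auto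
  have "lhit g c \<in> cspan C ?ys" if g: "g \<in> dual" for g
  proof -
    have "lhit g c = (\<Oplus>\<^bsub>C\<^esub>b\<in>{..<n}. contract_left C g (cpure C C (a b) (v b)))"
      unfolding lhit_def exp'
      by (rule clin_finsum[OF spCC cspace_C contract_left_clin[OF cspace_C cspace_C g]]) (use p in auto)
    also have "\<dots> \<in> cspan C ?ys"
    proof (rule csubspace_finsum[OF cspace_C cspan_csubspace[OF cspace_C ys(1)]])
      fix b assume "b \<in> {..<n}"
      then have "v b \<in> cspan C ?ys" "b < n" using cspan_superset[OF cspace_C ys(1)] by auto
      then show "contract_left C g (cpure C C (a b) (v b)) \<in> cspan C ?ys"
        using csubspaceD(4)[OF cspan_csubspace[OF cspace_C ys(1)]] g a D(3) by (simp add: contract_left_pure)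
    qed simp
    finally show ?thesis .
  qed
  moreover have "rhit g c \<in> cspan C ?zs" if g: "g \<in> dual" for g
  proof -
    have "rhit g c = (\<Oplus>\<^bsub>C\<^esub>b\<in>{..<n}. contract_right C g (cpure C C (a b) (v b)))"
      unfolding rhit_def exp'
      by (rule clin_finsum[OF spCC cspace_C contract_right_clin[OF cspace_C cspace_C g]]) (use p in auto)
    also have "\<dots> \<in> cspan C ?zs"
    proof (rule csubspace_finsum[OF cspace_C cspan_csubspace[OF cspace_C ys(2)]])
      fix b assume "b \<in> {..<n}"
      then have "a b \<in> cspan C ?zs" "b < n" using cspan_superset[OF cspace_C ys(2)] by auto
      then show "contract_right C g (cpure C C (a b) (v b)) \<in> cspan C ?zs"
        using csubspaceD(4)[OF cspan_csubspace[OF cspace_C ys(2)]] g a D(3) by (simp add: contract_right_pure)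
    qed simp
    finally show ?thesis .
  qed
  ultimately show ?thesis using that[OF ys] by blast
qed

text \<open>
  The sub-bimodule of \<open>C\<close> over the dual algebra that \<open>c\<close> generates. Defining it as an intersection of
  subspaces avoids sums of generators.
\<close>

definition hit_hull :: "'c \<Rightarrow> 'c set" where
  "hit_hull c = {x \<in> carrier C. \<forall>W. csubspace C W \<and> (\<forall>g\<in>dual. \<forall>h\<in>dual. lhit g (rhit h c) \<in> W) \<longrightarrow> x \<in> W}"

lemma hit_hull_csubspace: "csubspace C (hit_hull c)"
  by (rule csubspaceI) (auto simp: hit_hull_def csubspace_def)

lemma hit_hull_least:
  "csubspace C W \<Longrightarrow> (\<And>g h. g \<in> dual \<Longrightarrow> h \<in> dual \<Longrightarrow> lhit g (rhit h c) \<in> W) \<Longrightarrow> hit_hull c \<subseteq> W"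
  unfolding hit_hull_def by blast

lemma hit_hull_gen: "c \<in> carrier C \<Longrightarrow> g \<in> dual \<Longrightarrow> h \<in> dual \<Longrightarrow> lhit g (rhit h c) \<in> hit_hull c"
  by (simp add: hit_hull_def lhit_closed rhit_closed)

lemma clin_vimage_csubspace:
  assumes "cspace X" "cspace Y" "f \<in> clin X Y" "csubspace Y W"
  shows "csubspace X {x \<in> carrier X. f x \<in> W}"
  by (rule csubspaceI) (use assms csubspaceD[OF assms(4)] in \<open>auto simp: clinD[OF assms(3)] clin_zero\<close>)

lemma hit_hull_stable:
  assumes c: "c \<in> carrier C" and g: "g \<in> dual" and x: "x \<in> hit_hull c"
  shows "lhit g x \<in> hit_hull c" "rhit g x \<in> hit_hull c"
proof -
  have "hit_hull c \<subseteq> {x \<in> carrier C. lhit g x \<in> hit_hull c}"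
    by (rule hit_hull_least[OF clin_vimage_csubspace[OF _ _ lhit_clin[OF g] hit_hull_csubspace]])
      (use c g in \<open>auto simp: lhit_closed rhit_closed lhit_lhit conv_dual hit_hull_gen\<close>)
  then show "lhit g x \<in> hit_hull c" using x by blast
  have "hit_hull c \<subseteq> {x \<in> carrier C. rhit g x \<in> hit_hull c}"
    by (rule hit_hull_least[OF clin_vimage_csubspace[OF _ _ rhit_clin[OF g] hit_hull_csubspace]])
      (use c g in \<open>auto simp: lhit_closed rhit_closed lhit_rhit rhit_rhit conv_dual hit_hull_gen\<close>)
  then show "rhit g x \<in> hit_hull c" using x by blast
qed

text \<open>
  The finiteness theorem for coalgebras: every element lies in a finite-dimensional subcoalgebra. The
  elements \<open>rhit h c\<close> have a finite spanning set \<open>zs\<close>, and the elements \<open>lhit g z\<close> have one for each of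
  the finitely many \<open>z\<close> in it.
\<close>

lemma hit_hull_dual_basis:
  assumes c: "c \<in> carrier C"
  shows "\<exists>n e \<phi>. dual_basis C (hit_hull c) n e \<phi>"
proof -
  obtain ys0 zs where zs: "set zs \<subseteq> carrier C" "\<And>g. g \<in> dual \<Longrightarrow> rhit g c \<in> cspan C zs"
    by (rule hit_finite[OF c]) blast
  have "\<exists>ys. set ys \<subseteq> carrier C \<and> (\<forall>g\<in>dual. lhit g z \<in> cspan C ys)" if "z \<in> carrier C" for z
    by (rule hit_finite[OF that]) blast
  then obtain Y where Y: "\<And>z. z \<in> carrier C \<Longrightarrow> set (Y z) \<subseteq> carrier C"
    "\<And>z g. z \<in> carrier C \<Longrightarrow> g \<in> dual \<Longrightarrow> lhit g z \<in> cspan C (Y z)" by metis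
  let ?ys = "concat (map Y zs)"
  have ys: "set ?ys \<subseteq> carrier C" using zs(1) Y(1) by auto
  note S = cspan_csubspace[OF cspace_C ys]
  have "hit_hull c \<subseteq> cspan C ?ys"
  proof (rule hit_hull_least[OF S])
    fix g h assume g: "g \<in> dual" and h: "h \<in> dual"
    have "cspan C zs \<subseteq> {x \<in> carrier C. lhit g x \<in> cspan C ?ys}"
    proof (rule cspan_least[OF clin_vimage_csubspace[OF _ _ lhit_clin[OF g] S]])
      show "set zs \<subseteq> {x \<in> carrier C. lhit g x \<in> cspan C ?ys}"
      proof
        fix z assume z: "z \<in> set zs"
        then have zc: "z \<in> carrier C" using zs(1) by blast
        have "cspan C (Y z) \<subseteq> cspan C ?ys"
          by (rule cspan_least[OF S]) (use z cspan_superset[OF cspace_C ys] in auto)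
        then show "z \<in> {x \<in> carrier C. lhit g x \<in> cspan C ?ys}" using zc Y(2)[OF zc g] by blast
      qed
    qed simp_all
    then show "lhit g (rhit h c) \<in> cspan C ?ys" using zs(2)[OF h] by blast
  qed
  then show ?thesis by (rule dual_basis_exists[OF cspace_C hit_hull_csubspace ys])
qed

lemma hit_hull_self: "c \<in> carrier C \<Longrightarrow> c \<in> hit_hull c"
  using hit_hull_gen[of c \<epsilon> \<epsilon>] by (simp add: lhit_counit rhit_counit)

text \<open>
  The finite-dimensional subcoalgebra generated by a nonzero element of \<open>D\<close> must be \<open>D\<close>.
\<close>

lemma simple_subcoalgebra_dual_basis:
  assumes D: "simple_subcoalgebra C D" shows "\<exists>n e \<phi>. dual_basis C D n e \<phi>"
proof -
  have sub: "subcoalgebra C D" and ne: "D \<noteq> {\<zero>\<^bsub>C\<^esub>}"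
    and min: "\<And>E. subcoalgebra C E \<Longrightarrow> E \<subseteq> D \<Longrightarrow> E = {\<zero>\<^bsub>C\<^esub>} \<or> E = D"
    using D by (simp_all add: simple_subcoalgebra_def)
  note S = subcoalgebra_csubspace[OF sub]
  obtain c where c: "c \<in> D" "c \<noteq> \<zero>\<^bsub>C\<^esub>" using ne csubspaceD(2)[OF S] by blast
  have cc: "c \<in> carrier C" by (rule csubspaceD(1)[OF S c(1)])
  obtain n e \<phi> where db: "dual_basis C (hit_hull c) n e \<phi>" using hit_hull_dual_basis[OF cc] by blast
  have "subcoalgebra C (hit_hull c)" by (rule subcoalgebraI[OF db]) (rule hit_hull_stable[OF cc]; assumption)+
  moreover have "hit_hull c \<subseteq> D"
    by (rule hit_hull_least[OF S]) (use subcoalgebra_hit_closed[OF sub] c in blast)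
  moreover have "hit_hull c \<noteq> {\<zero>\<^bsub>C\<^esub>}" using hit_hull_self[OF cc] c by blast
  ultimately have "hit_hull c = D" using min by blast
  then show ?thesis using db by blast
qed

section \<open>The trace form of a simple coalgebra\<close>

text \<open>
  The equation \<open>tr(AB) = tr(BA)\<close> for endomorphisms of the finite-dimensional subspace \<open>D\<close>.
\<close>

lemma trace_commute:
  assumes db: "dual_basis C D n e \<phi>" and A: "A \<in> clin C C" and B: "B \<in> clin C C"
    and AD: "\<And>x. x \<in> D \<Longrightarrow> A x \<in> D" and BD: "\<And>x. x \<in> D \<Longrightarrow> B x \<in> D"
  shows "(\<Sum>m<n. \<phi> m (A (B (e m)))) = (\<Sum>m<n. \<phi> m (B (A (e m))))"
proof -
  note D = dual_basisD[OF db]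
  have key: "\<phi> m (P (Q (e m))) = (\<Sum>k<n. \<phi> k (Q (e m)) * \<phi> m (P (e k)))"
    if m: "m < n" and P: "P \<in> clin C C" and QD: "\<And>x. x \<in> D \<Longrightarrow> Q x \<in> D" for m P Q
  proof -
    have PP: "(\<lambda>x. \<phi> m (P x)) \<in> dual" by (rule clin_comp[OF P D(4)[OF m]])
    have "\<phi> m (P (Q (e m))) = \<phi> m (P (\<Oplus>\<^bsub>C\<^esub>k\<in>{..<n}. \<phi> k (Q (e m)) \<odot>\<^bsub>C\<^esub> e k))"
      by (simp only: D(6)[OF QD[OF D(2)[OF m]]])
    also have "\<dots> = (\<Oplus>\<^bsub>cfield\<^esub>k\<in>{..<n}. \<phi> m (P (\<phi> k (Q (e m)) \<odot>\<^bsub>C\<^esub> e k)))"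
      by (rule clin_finsum[OF cspace_C cfield_cspace PP]) (use D(3) in auto)
    also have "\<dots> = (\<Sum>k<n. \<phi> k (Q (e m)) * \<phi> m (P (e k)))"
      using D(3) by (simp add: clinD[OF PP])
    finally show ?thesis .
  qed
  have "(\<Sum>m<n. \<phi> m (A (B (e m)))) = (\<Sum>m<n. \<Sum>k<n. \<phi> k (B (e m)) * \<phi> m (A (e k)))"
    by (rule sum.cong[OF refl]) (rule key[OF _ A BD], simp_all)
  also have "\<dots> = (\<Sum>k<n. \<Sum>m<n. \<phi> m (A (e k)) * \<phi> k (B (e m)))"
    by (subst sum.swap) (simp add: mult.commute)
  also have "\<dots> = (\<Sum>m<n. \<phi> m (B (A (e m))))"
    by (rule sum.cong[OF refl], subst key[OF _ B AD]) (simp_all add: mult.commute)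
  finally show ?thesis .
qed

text \<open>
  The form is built from the character \<open>\<tau>\<close> of \<open>D\<close> as a comodule over itself, the element with
  \<open>g(\<tau>) = tr(rhit g)\<close> for all functionals \<open>g\<close>. It is cocommutative because traces are symmetric, and
  \<open>\<epsilon>(\<tau>) = dim D\<close> is nonzero in characteristic zero. By cocommutativity, the elements \<open>g(\<tau>\<^sub>1) \<tau>\<^sub>2\<close> form
  a subspace stable under both actions; as it contains \<open>\<tau>\<close>, it is \<open>D\<close>. Hence every \<open>d\<close> in \<open>D\<close> can be
  written as \<open>\<theta>(\<tau>\<^sub>1, d) \<tau>\<^sub>2\<close> with \<open>\<theta>(_, d)\<close> linear in \<open>d\<close>, and this \<open>\<theta>\<close> has the two properties.
\<close>

lemma simple_block_form:
  assumes simple: "simple_subcoalgebra C D"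
  obtains \<theta> where "cbilin C C cfield \<theta>" "\<And>c. c \<in> D \<Longrightarrow> tensor_lift cfield \<theta> (\<Delta> c) = \<epsilon> c"
    "\<And>c d. c \<in> D \<Longrightarrow> d \<in> D \<Longrightarrow> rhit (\<lambda>y. \<theta> y d) c = lhit (\<theta> c) d"
proof -
  have sub: "subcoalgebra C D" and ne: "D \<noteq> {\<zero>\<^bsub>C\<^esub>}"
    and min: "\<And>E. subcoalgebra C E \<Longrightarrow> E \<subseteq> D \<Longrightarrow> E = {\<zero>\<^bsub>C\<^esub>} \<or> E = D"
    using simple by (simp_all add: simple_subcoalgebra_def)
  note S = subcoalgebra_csubspace[OF sub]
  obtain n e \<phi> where db: "dual_basis C D n e \<phi>" using simple_subcoalgebra_dual_basis[OF simple] by blast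
  note DB = dual_basisD[OF db]
  note hitD = subcoalgebra_hit_closed[OF sub]
  (* the character: the sum of the matrix coefficients phi_m(e_m 1) e_m 2 *)
  define \<tau> where "\<tau> = (\<Oplus>\<^bsub>C\<^esub>m\<in>{..<n}. lhit (\<phi> m) (e m))"
  have \<tau>D: "\<tau> \<in> D" unfolding \<tau>_def by (rule csubspace_finsum[OF cspace_C S]) (use hitD DB in auto)
  have \<tau>c: "\<tau> \<in> carrier C" by (rule csubspaceD(1)[OF S \<tau>D])
  have tr: "g \<tau> = (\<Sum>m<n. \<phi> m (rhit g (e m)))" if g: "g \<in> dual" for g
  proof -
    have "g \<tau> = (\<Oplus>\<^bsub>cfield\<^esub>m\<in>{..<n}. g (lhit (\<phi> m) (e m)))"
      unfolding \<tau>_def by (rule clin_finsum[OF cspace_C cfield_cspace g]) (use lhit_closed DB in auto)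
    also have "\<dots> = (\<Sum>m<n. \<phi> m (rhit g (e m)))"
      by (simp, rule sum.cong) (use hit_commute[OF DB(4) g DB(3)] in auto)
    finally show ?thesis .
  qed
  have cocomm: "lhit g \<tau> = rhit g \<tau>" if g: "g \<in> dual" for g
  proof (rule functionals_separate[OF cspace_C lhit_closed[OF g \<tau>c] rhit_closed[OF g \<tau>c]])
    fix k assume k: "k \<in> dual"
    have "k (lhit g \<tau>) = (\<Sum>m<n. \<phi> m (rhit g (rhit k (e m))))"
      using tr[OF conv_dual[OF g k]] DB(3) by (simp add: conv_def rhit_rhit[OF k g])
    also have "\<dots> = (\<Sum>m<n. \<phi> m (rhit k (rhit g (e m))))"
      by (rule trace_commute[OF db rhit_clin[OF g] rhit_clin[OF k] hitD(2)[OF g] hitD(2)[OF k]])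
    also have "\<dots> = g (lhit k \<tau>)"
      using tr[OF conv_dual[OF k g]] DB(3) by (simp add: conv_def rhit_rhit[OF g k])
    also have "\<dots> = k (rhit g \<tau>)" by (rule hit_commute[OF k g \<tau>c])
    finally show "k (lhit g \<tau>) = k (rhit g \<tau>)" .
  qed
  have "n \<noteq> 0"
  proof
    assume "n = 0"
    interpret abelian_group C by simp
    have "x = \<zero>\<^bsub>C\<^esub>" if "x \<in> D" for x using DB(6)[OF that] \<open>n = 0\<close> by simp
    then show False using ne csubspaceD(2)[OF S] by blast
  qed
  have "\<epsilon> \<tau> = of_nat n" using tr[OF counit_dual] DB(3,5) by (simp add: rhit_counit)
  then have \<tau>0: "\<tau> \<noteq> \<zero>\<^bsub>C\<^esub>" using clin_zero[OF cspace_C cfield_cspace counit_dual] \<open>n \<noteq> 0\<close> by auto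
  (* The right action stays inside E because cocommutativity exchanges it with the left one on tau. *)
  define E where "E = {lhit g \<tau> |g. g \<in> dual}"
  have ES: "csubspace C E"
  proof (rule csubspaceI)
    show "E \<subseteq> carrier C" unfolding E_def using lhit_closed[OF _ \<tau>c] by blast
    show "\<zero>\<^bsub>C\<^esub> \<in> E" unfolding E_def using hit_zero(1)[OF \<tau>c] cfield_zero[of C] by (intro CollectI exI[of _ "\<lambda>_. 0"]) simp
    fix x y assume "x \<in> E" "y \<in> E"
    then obtain g h where gh: "x = lhit g \<tau>" "g \<in> dual" "y = lhit h \<tau>" "h \<in> dual" unfolding E_def by blast
    have "x \<oplus>\<^bsub>C\<^esub> y = lhit (\<lambda>z. g z + h z) \<tau>" using lhit_functional_clin(1)[OF \<tau>c gh(2,4)] gh by simp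
    then show "x \<oplus>\<^bsub>C\<^esub> y \<in> E" unfolding E_def using cfield_add[OF gh(2,4)] by blast
  next
    fix a x assume "x \<in> E"
    then obtain g where g: "x = lhit g \<tau>" "g \<in> dual" unfolding E_def by blast
    have "a \<odot>\<^bsub>C\<^esub> x = lhit (\<lambda>z. a * g z) \<tau>" using lhit_functional_clin(2)[OF \<tau>c g(2)] g by simp
    then show "a \<odot>\<^bsub>C\<^esub> x \<in> E" unfolding E_def using cfield_scale[OF g(2)] by blast
  qed
  have El: "lhit g x \<in> E" and Er: "rhit g x \<in> E" if g: "g \<in> dual" and x: "x \<in> E" for g x
  proof -
    obtain h where h: "x = lhit h \<tau>" "h \<in> dual" using x unfolding E_def by blast
    have "lhit g x = lhit (conv h g) \<tau>" unfolding h(1) by (rule lhit_lhit[OF h(2) g \<tau>c])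
    then show "lhit g x \<in> E" unfolding E_def using conv_dual[OF h(2) g] by blast
    have "rhit g x = lhit (conv g h) \<tau>"
      unfolding h(1) by (simp add: lhit_rhit[OF h(2) g \<tau>c] cocomm[OF g, symmetric] lhit_lhit[OF g h(2) \<tau>c])
    then show "rhit g x \<in> E" unfolding E_def using conv_dual[OF g h(2)] by blast
  qed
  obtain ys zs0 where ys: "set ys \<subseteq> carrier C" "\<And>g. g \<in> dual \<Longrightarrow> lhit g \<tau> \<in> cspan C ys"
    by (rule hit_finite[OF \<tau>c]) blast
  have "E \<subseteq> cspan C ys" unfolding E_def using ys(2) by blast
  then obtain nE u \<psi> where dbE: "dual_basis C E nE u \<psi>" using dual_basis_exists[OF cspace_C ES ys(1)] by blast
  have "subcoalgebra C E" by (rule subcoalgebraI[OF dbE El Er])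
  moreover have "E \<subseteq> D" unfolding E_def using hitD(1)[OF _ \<tau>D] by blast
  moreover have "\<tau> \<in> E" unfolding E_def using lhit_counit[OF \<tau>c] counit_dual by (intro CollectI exI[of _ \<epsilon>]) simp
  ultimately have ED: "E = D" using min \<tau>0 by blast
  have rep: "\<exists>s. s \<in> dual \<and> x = lhit s \<tau>" if "x \<in> D" for x using that unfolding ED[symmetric] E_def by blast
  then have "\<forall>i\<in>{..<n}. \<exists>s. s \<in> dual \<and> e i = lhit s \<tau>" using DB(2) by blast
  then obtain s where s: "\<And>i. i < n \<Longrightarrow> s i \<in> dual" "\<And>i. i < n \<Longrightarrow> e i = lhit (s i) \<tau>" by (metis lessThan_iff)
  (* s i solves e i = lhit (s i) tau, so that theta (_, d) solves d = lhit (theta (_, d)) tau. *)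
  define \<theta> where "\<theta> c d = (\<Sum>i<n. s i c * \<phi> i d)" for c d
  have b: "cbilin C C cfield \<theta>"
  proof (rule cbilinI)
    show "\<theta> x \<in> dual" if "x \<in> carrier C" for x
      unfolding \<theta>_def[abs_def] by (rule cfield_sum) (use cfield_scale[OF DB(4)] in auto)
    show "(\<lambda>x. \<theta> x y) \<in> dual" if "y \<in> carrier C" for y
      unfolding \<theta>_def[abs_def] by (rule cfield_sum) (use cfield_scale[OF s(1)] in \<open>auto simp: mult.commute\<close>)
  qed
  have \<theta>r: "(\<lambda>y. \<theta> y d) \<in> dual" and \<theta>l: "\<theta> d \<in> dual" if "d \<in> carrier C" for d using cbilinD(1,2)[OF b] that by auto
  have star: "lhit (\<lambda>y. \<theta> y d) \<tau> = d" if d: "d \<in> D" for d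
  proof (rule functionals_separate[OF cspace_C])
    have dc: "d \<in> carrier C" by (rule csubspaceD(1)[OF S d])
    show "lhit (\<lambda>y. \<theta> y d) \<tau> \<in> carrier C" "d \<in> carrier C" using lhit_closed[OF \<theta>r[OF dc] \<tau>c] dc by auto
    fix k assume k: "k \<in> dual"
    have "k (lhit (\<lambda>y. \<theta> y d) \<tau>) = \<theta> (rhit k \<tau>) d" by (rule hit_commute[OF \<theta>r[OF dc] k \<tau>c])
    also have "\<dots> = (\<Sum>i<n. \<phi> i d * k (e i))"
      unfolding \<theta>_def by (rule sum.cong) (use s hit_commute[OF s(1) k \<tau>c] in auto)
    also have "\<dots> = (\<Oplus>\<^bsub>cfield\<^esub>i\<in>{..<n}. k (\<phi> i d \<odot>\<^bsub>C\<^esub> e i))" using DB(3) by (simp add: clinD[OF k])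
    also have "\<dots> = k (\<Oplus>\<^bsub>C\<^esub>i\<in>{..<n}. \<phi> i d \<odot>\<^bsub>C\<^esub> e i)"
      by (rule clin_finsum[OF cspace_C cfield_cspace k, symmetric]) (use DB(3) in auto)
    also have "\<dots> = k d" by (simp only: DB(6)[OF d])
    finally show "k (lhit (\<lambda>y. \<theta> y d) \<tau>) = k d" .
  qed
  have one: "tensor_lift cfield \<theta> (\<Delta> c) = \<epsilon> c" if c: "c \<in> D" for c
  proof -
    have cc: "c \<in> carrier C" by (rule csubspaceD(1)[OF S c])
    obtain t where t: "t \<in> dual" "c = lhit t \<tau>" using rep[OF c] by blast
    have ct: "c = rhit t \<tau>" using t cocomm by simp
    have "tensor_lift cfield \<theta> (\<Delta> c) = (\<Sum>i<n. \<phi> i (lhit (s i) c))"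
      unfolding \<theta>_def[abs_def]
      by (subst clift_sum[OF cspace_C cspace_C functional_product_cbilin[OF s(1) DB(4)]])
        (use cc in \<open>simp_all add: functional_lhit[OF s(1) DB(4)]\<close>)
    also have "\<dots> = (\<Sum>i<n. \<phi> i (rhit t (e i)))"
    proof (rule sum.cong[OF refl])
      fix i assume "i \<in> {..<n}"
      then have i: "i < n" by simp
      have "lhit (s i) c = rhit t (lhit (s i) \<tau>)" unfolding ct by (rule lhit_rhit[OF s(1)[OF i] t(1) \<tau>c, symmetric])
      then show "\<phi> i (lhit (s i) c) = \<phi> i (rhit t (e i))" using s(2)[OF i] by simp
    qed
    (* Here c = rhit t tau has turned the value into the trace of the action of t. *)
    also have "\<dots> = t \<tau>" by (rule tr[OF t(1), symmetric])
    also have "\<dots> = \<epsilon> c" unfolding t(2) using hit_commute[OF t(1) counit_dual \<tau>c] by (simp add: rhit_counit \<tau>c)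
    finally show ?thesis .
  qed
  have two: "rhit (\<lambda>y. \<theta> y d) c = lhit (\<theta> c) d" if c: "c \<in> D" and d: "d \<in> D" for c d
  proof -
    have cc: "c \<in> carrier C" and dc: "d \<in> carrier C" using csubspaceD(1)[OF S] c d by auto
    obtain t where t: "t \<in> dual" "c = lhit t \<tau>" using rep[OF c] by blast
    have "rhit (\<lambda>y. \<theta> y d) c = lhit t (rhit (\<lambda>y. \<theta> y d) \<tau>)"
      unfolding t(2) by (rule lhit_rhit[OF t(1) \<theta>r[OF dc] \<tau>c])
    also have "rhit (\<lambda>y. \<theta> y d) \<tau> = d" using cocomm[OF \<theta>r[OF dc]] star[OF d] by simp
    also have "lhit t d = lhit (\<theta> c) d"
    proof (rule subcoalgebra_hit_cong(1)[OF sub t(1) \<theta>l[OF cc] d])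
      fix x assume x: "x \<in> D"
      then have xc: "x \<in> carrier C" by (rule csubspaceD(1)[OF S])
      have "\<theta> c x = t (rhit (\<lambda>y. \<theta> y x) \<tau>)" unfolding t(2) by (rule hit_commute[OF t(1) \<theta>r[OF xc] \<tau>c])
      also have "rhit (\<lambda>y. \<theta> y x) \<tau> = x" using cocomm[OF \<theta>r[OF xc]] star[OF x] by simp
      finally show "t x = \<theta> c x" ..
    qed
    finally show ?thesis .
  qed
  show ?thesis by (rule that[OF b one two])
qed

end

lemma cbilin_cong:
  assumes "cspace X" "cspace Y" "\<And>x y. x \<in> carrier X \<Longrightarrow> y \<in> carrier Y \<Longrightarrow> \<beta> x y = \<gamma> x y" "cbilin X Y Z \<gamma>"
  shows "cbilin X Y Z \<beta>"
proof (intro cbilinI clinI)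
qed (simp_all add: assms(1-3) cbilinD[OF assms(4)])

lemma clin_equalizer_csubspace:
  assumes "cspace X" "cspace Y" "f \<in> clin X Y" "g \<in> clin X Y"
  shows "csubspace X {x \<in> carrier X. f x = g x}"
  by (rule csubspaceI)
    (use assms clin_zero[OF assms(1-3)] clin_zero[OF assms(1,2,4)] in \<open>auto simp: clinD[OF assms(3)] clinD[OF assms(4)]\<close>)

section \<open>The form of a cosemisimple coalgebra\<close>

text \<open>
  Independence makes the components of an element unique once a representation is extended by zero to
  all members of the family. Sums and multiples of representations are representations, so the
  components depend linearly on the element.
\<close>

lemma direct_sum_projections:
  fixes M :: "(complex, 'm, 'x) module_scheme"
  assumes M: "cspace M" and sub: "\<And>D. D \<in> \<D> \<Longrightarrow> csubspace M D"
    and gen: "\<And>c. c \<in> carrier M \<Longrightarrow> \<exists>F x. finite F \<and> F \<subseteq> \<D> \<and> (\<forall>D\<in>F. x D \<in> D) \<and> c = (\<Oplus>\<^bsub>M\<^esub>D\<in>F. x D)"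
    and indep: "\<And>F x. finite F \<Longrightarrow> F \<subseteq> \<D> \<Longrightarrow> (\<forall>D\<in>F. x D \<in> D) \<Longrightarrow> (\<Oplus>\<^bsub>M\<^esub>D\<in>F. x D) = \<zero>\<^bsub>M\<^esub> \<Longrightarrow>
      (\<forall>D\<in>F. x D = \<zero>\<^bsub>M\<^esub>)"
  obtains p :: "'m set \<Rightarrow> 'm \<Rightarrow> 'm"
  where "\<And>D. D \<in> \<D> \<Longrightarrow> p D \<in> clin M M" "\<And>D c. D \<in> \<D> \<Longrightarrow> c \<in> carrier M \<Longrightarrow> p D c \<in> D"
    "\<And>c. c \<in> carrier M \<Longrightarrow> finite {D \<in> \<D>. p D c \<noteq> \<zero>\<^bsub>M\<^esub>}"
    "\<And>D c. D \<in> \<D> \<Longrightarrow> c \<in> D \<Longrightarrow> p D c = c"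
    "\<And>D D' c. D \<in> \<D> \<Longrightarrow> D' \<in> \<D> \<Longrightarrow> D \<noteq> D' \<Longrightarrow> c \<in> D \<Longrightarrow> p D' c = \<zero>\<^bsub>M\<^esub>"
proof -
  interpret abelian_group M using M by simp
  define rep where "rep F x c \<longleftrightarrow> finite F \<and> F \<subseteq> \<D> \<and> (\<forall>D\<in>F. x D \<in> D) \<and> c = (\<Oplus>\<^bsub>M\<^esub>D\<in>F. x D)" for F and x :: "'m set \<Rightarrow> 'm" and c
  define ext where "ext F x D = (if D \<in> F then x D else \<zero>\<^bsub>M\<^esub>)" for F and x :: "'m set \<Rightarrow> 'm" and D
  have mem: "x D \<in> carrier M" if "rep F x c" "D \<in> F" for F x c D
    using that csubspaceD(1)[OF sub[of D]] by (auto simp: rep_def)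
  have extD: "ext F x D \<in> D" if "rep F x c" "D \<in> \<D>" for F x c D
    using that csubspaceD(2)[OF sub[of D]] by (auto simp: rep_def ext_def)
  have extc: "ext F x D \<in> carrier M" if "rep F x c" "D \<in> \<D>" for F x c D
    using extD[OF that] csubspaceD(1)[OF sub[OF that(2)]] by blast
  have extsum: "c = (\<Oplus>\<^bsub>M\<^esub>D\<in>H. ext F x D)" if r: "rep F x c" and H: "finite H" "F \<subseteq> H" "H \<subseteq> \<D>" for F x c H
  proof -
    have "(\<Oplus>\<^bsub>M\<^esub>D\<in>F. x D) = (\<Oplus>\<^bsub>M\<^esub>D\<in>H. ext F x D)"
      by (rule add.finprod_mono_neutral_cong_left)
        (use H mem[OF r] extc[OF r] in \<open>auto simp: ext_def\<close>)
    then show ?thesis using r by (simp add: rep_def)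
  qed
  have uniq: "ext F x D = ext G y D" if r: "rep F x c" "rep G y c" and D: "D \<in> \<D>" for F x G y c D
  proof (cases "D \<in> F \<union> G")
    case True
    let ?H = "F \<union> G"
    have H: "finite ?H" "?H \<subseteq> \<D>" using r by (auto simp: rep_def)
    have xc: "D \<in> ?H \<Longrightarrow> ext F x D \<in> carrier M" "D \<in> ?H \<Longrightarrow> ext G y D \<in> carrier M" for D
      using extc[OF r(1)] extc[OF r(2)] H(2) by auto
    define z where "z D = ext F x D \<oplus>\<^bsub>M\<^esub> (-1) \<odot>\<^bsub>M\<^esub> ext G y D" for D
    have cc: "c \<in> carrier M" using extsum[OF r(1) H(1) _ H(2)] cspace_finsum_closed[OF M, of ?H] xc by auto
    have "(\<Oplus>\<^bsub>M\<^esub>D\<in>?H. z D) = (\<Oplus>\<^bsub>M\<^esub>D\<in>?H. ext F x D) \<oplus>\<^bsub>M\<^esub> (\<Oplus>\<^bsub>M\<^esub>D\<in>?H. (-1) \<odot>\<^bsub>M\<^esub> ext G y D)"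
      unfolding z_def by (rule finsum_addf) (use xc M in auto)
    also have "(\<Oplus>\<^bsub>M\<^esub>D\<in>?H. (-1) \<odot>\<^bsub>M\<^esub> ext G y D) = (-1) \<odot>\<^bsub>M\<^esub> (\<Oplus>\<^bsub>M\<^esub>D\<in>?H. ext G y D)"
      by (rule clin_finsum[OF M M clin_smult[OF M] H(1), symmetric]) (use xc in auto)
    also have "(\<Oplus>\<^bsub>M\<^esub>D\<in>?H. ext G y D) = c" by (rule extsum[OF r(2) H(1) _ H(2), symmetric]) simp
    also have "(\<Oplus>\<^bsub>M\<^esub>D\<in>?H. ext F x D) = c" by (rule extsum[OF r(1) H(1) _ H(2), symmetric]) simp
    also have "c \<oplus>\<^bsub>M\<^esub> (-1) \<odot>\<^bsub>M\<^esub> c = \<zero>\<^bsub>M\<^esub>" by (rule cspace_cancel[OF M cc])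
    finally have z0: "(\<Oplus>\<^bsub>M\<^esub>D\<in>?H. z D) = \<zero>\<^bsub>M\<^esub>" .
    have zD: "\<forall>D\<in>?H. z D \<in> D"
    proof
      fix D assume "D \<in> ?H"
      then have DD: "D \<in> \<D>" using H by blast
      show "z D \<in> D" unfolding z_def
        by (rule csubspaceD(3)[OF sub[OF DD] extD[OF r(1) DD] csubspaceD(4)[OF sub[OF DD] extD[OF r(2) DD]]])
    qed
    have "z D = \<zero>\<^bsub>M\<^esub>" using indep[OF H zD z0] True by blast
    then have "z D \<oplus>\<^bsub>M\<^esub> ext G y D = ext G y D" using xc(2)[OF True] M by simp
    moreover have "z D \<oplus>\<^bsub>M\<^esub> ext G y D = ext F x D"
      unfolding z_def using xc(1)[OF True] xc(2)[OF True] M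
      by (simp add: a_assoc l_neg cspace_neg[symmetric])
    ultimately show ?thesis by simp
  qed (simp add: ext_def)
  have "\<forall>c\<in>carrier M. \<exists>F x. rep F x c" unfolding rep_def using gen by blast
  then obtain F X where FX: "\<And>c. c \<in> carrier M \<Longrightarrow> rep (F c) (X c) c" by metis
  define p where "p D c = ext (F c) (X c) D" for D c
  have pI: "p D c = ext G y D" if "rep G y c" "c \<in> carrier M" "D \<in> \<D>" for D c G y
    unfolding p_def by (rule uniq[OF FX that(1,3)]) (rule that(2))
  have pD: "p D c \<in> D" if "D \<in> \<D>" "c \<in> carrier M" for D c
    unfolding p_def by (rule extD[OF FX[OF that(2)] that(1)])
  show ?thesis
  proof (rule that)
    fix D assume D: "D \<in> \<D>"
    show "p D \<in> clin M M"
    proof (rule clinI)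
      show "p D c \<in> carrier M" if "c \<in> carrier M" for c using pD[OF D that] csubspaceD(1)[OF sub[OF D]] by blast
      fix c d assume c: "c \<in> carrier M" and d: "d \<in> carrier M"
      let ?H = "F c \<union> F d"
      have H: "finite ?H" "?H \<subseteq> \<D>" using FX[OF c] FX[OF d] by (auto simp: rep_def)
      let ?z = "\<lambda>D. ext (F c) (X c) D \<oplus>\<^bsub>M\<^esub> ext (F d) (X d) D"
      have "rep ?H ?z (c \<oplus>\<^bsub>M\<^esub> d)"
        unfolding rep_def
      proof (intro conjI ballI)
        show "c \<oplus>\<^bsub>M\<^esub> d = (\<Oplus>\<^bsub>M\<^esub>D\<in>?H. ?z D)"
          using extsum[OF FX[OF c] H(1) _ H(2)] extsum[OF FX[OF d] H(1) _ H(2)] extc[OF FX[OF c]] extc[OF FX[OF d]] H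
          by (subst finsum_addf) auto
        fix D assume "D \<in> ?H"
        then have DD: "D \<in> \<D>" using H by blast
        show "?z D \<in> D" by (rule csubspaceD(3)[OF sub[OF DD] extD[OF FX[OF c] DD] extD[OF FX[OF d] DD]])
      qed (use H in auto)
      then have "p D (c \<oplus>\<^bsub>M\<^esub> d) = ext ?H ?z D" by (rule pI) (use c d D M in auto)
      also have "\<dots> = p D c \<oplus>\<^bsub>M\<^esub> p D d" unfolding p_def ext_def using M by simp
      finally show "p D (c \<oplus>\<^bsub>M\<^esub> d) = p D c \<oplus>\<^bsub>M\<^esub> p D d" .
    next
      fix a c assume c: "c \<in> carrier M"
      note r = FX[OF c, unfolded rep_def]
      have "rep (F c) (\<lambda>D. a \<odot>\<^bsub>M\<^esub> X c D) (a \<odot>\<^bsub>M\<^esub> c)"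
        unfolding rep_def
      proof (intro conjI ballI)
        have "c = (\<Oplus>\<^bsub>M\<^esub>D\<in>F c. X c D)" using r by blast
        then have "a \<odot>\<^bsub>M\<^esub> c = a \<odot>\<^bsub>M\<^esub> (\<Oplus>\<^bsub>M\<^esub>D\<in>F c. X c D)" by simp
        also have "\<dots> = (\<Oplus>\<^bsub>M\<^esub>D\<in>F c. a \<odot>\<^bsub>M\<^esub> X c D)"
          by (rule clin_finsum[OF M M clin_smult[OF M]]) (use r mem[OF FX[OF c]] in auto)
        finally show "a \<odot>\<^bsub>M\<^esub> c = (\<Oplus>\<^bsub>M\<^esub>D\<in>F c. a \<odot>\<^bsub>M\<^esub> X c D)" .
        fix D assume "D \<in> F c"
        then have "D \<in> \<D>" "X c D \<in> D" using r by auto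
        then show "a \<odot>\<^bsub>M\<^esub> X c D \<in> D" using csubspaceD(4)[OF sub] by blast
      qed (use r in auto)
      then have "p D (a \<odot>\<^bsub>M\<^esub> c) = ext (F c) (\<lambda>D. a \<odot>\<^bsub>M\<^esub> X c D) D" by (rule pI) (use c D M in auto)
      then show "p D (a \<odot>\<^bsub>M\<^esub> c) = a \<odot>\<^bsub>M\<^esub> p D c" unfolding p_def ext_def using M by simp
    qed
    show "\<And>c. c \<in> carrier M \<Longrightarrow> p D c \<in> D" by (rule pD[OF D])
    have r: "rep {D} (\<lambda>_. c) c" "c \<in> carrier M" if "c \<in> D" for c
      using that D csubspaceD(1)[OF sub[OF D]] by (auto simp: rep_def)
    show "p D c = c" if "c \<in> D" for c using pI[OF r[OF that] D] by (simp add: ext_def)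
    show "p D' c = \<zero>\<^bsub>M\<^esub>" if "D' \<in> \<D>" "D \<noteq> D'" "c \<in> D" for D' c
      using pI[OF r[OF that(3)] that(1)] that(2) by (simp add: ext_def)
  next
    fix c assume c: "c \<in> carrier M"
    have "{D \<in> \<D>. p D c \<noteq> \<zero>\<^bsub>M\<^esub>} \<subseteq> F c" by (auto simp: p_def ext_def)
    then show "finite {D \<in> \<D>. p D c \<noteq> \<zero>\<^bsub>M\<^esub>}" using FX[OF c] finite_subset by (auto simp: rep_def)
  qed
qed

context coalg
begin

lemma hit_form_cbilin:
  assumes b: "cbilin C C cfield \<theta>"
  shows "cbilin C C C (\<lambda>c d. lhit (\<theta> c) d)" "cbilin C C C (\<lambda>c d. rhit (\<lambda>y. \<theta> y d) c)"
proof -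
  note l = cbilinD(1)[OF b] and r = cbilinD(2)[OF b] and sp = cspace_C cspace_C cspace_C cspace_C
  have "(\<lambda>c. lhit (\<theta> c) d) \<in> clin C C" if "d \<in> carrier C" for d
    unfolding lhit_def contract_left_def
    by (rule clift_param_clin[OF sp contract_left_cbilin[OF cspace_C cspace_C l]
          clin_functional_smult[OF cspace_C r] comult_closed[OF that]])
  then show "cbilin C C C (\<lambda>c d. lhit (\<theta> c) d)" using lhit_clin[OF l] by (intro cbilinI)
  have "(\<lambda>d. rhit (\<lambda>y. \<theta> y d) c) \<in> clin C C" if "c \<in> carrier C" for c
    unfolding rhit_def contract_right_def
    by (rule clift_param_clin[OF sp contract_right_cbilin[OF cspace_C cspace_C r]
          clin_functional_smult[OF cspace_C l] comult_closed[OF that]])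
  then show "cbilin C C C (\<lambda>c d. rhit (\<lambda>y. \<theta> y d) c)" using rhit_clin[OF r] by (intro cbilinI)
qed

text \<open>
  In Sweedler notation, \<open>\<theta>(c\<^sub>1, c\<^sub>2) = \<epsilon>(c)\<close> and \<open>c\<^sub>1 \<theta>(c\<^sub>2, d) = \<theta>(c, d\<^sub>1) d\<^sub>2\<close>: the coalgebra is
  coseparable. The form is the orthogonal sum of the forms of the simple summands. Both identities are
  linear in each variable, so it suffices to check them on the summands; for \<open>c\<close> and \<open>d\<close> in different
  summands both sides of the second one vanish.
\<close>

lemma cosemisimple_form:
  assumes "cosemisimple C"
  obtains \<theta> where "cbilin C C cfield \<theta>" "\<And>c. c \<in> carrier C \<Longrightarrow> tensor_lift cfield \<theta> (\<Delta> c) = \<epsilon> c"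
    "\<And>c d. c \<in> carrier C \<Longrightarrow> d \<in> carrier C \<Longrightarrow> rhit (\<lambda>y. \<theta> y d) c = lhit (\<theta> c) d"
proof -
  obtain \<D> where simple: "\<And>D. D \<in> \<D> \<Longrightarrow> simple_subcoalgebra C D"
    and gen: "\<And>c. c \<in> carrier C \<Longrightarrow> \<exists>F x. finite F \<and> F \<subseteq> \<D> \<and> (\<forall>D\<in>F. x D \<in> D) \<and> c = (\<Oplus>\<^bsub>C\<^esub>D\<in>F. x D)"
    and indep: "\<And>F x. finite F \<and> F \<subseteq> \<D> \<and> (\<forall>D\<in>F. x D \<in> D) \<and> (\<Oplus>\<^bsub>C\<^esub>D\<in>F. x D) = \<zero>\<^bsub>C\<^esub> \<longrightarrow> (\<forall>D\<in>F. x D = \<zero>\<^bsub>C\<^esub>)"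
    using assms unfolding cosemisimple_def by (elim exE conjE) (rule that, erule bspec, assumption, erule bspec, assumption, erule allE, erule spec)
  have subco: "subcoalgebra C D" if "D \<in> \<D>" for D using simple[OF that] by (simp add: simple_subcoalgebra_def)
  note sub = subcoalgebra_csubspace[OF subco]
  have indep': "\<forall>D\<in>F. x D = \<zero>\<^bsub>C\<^esub>" if "finite F" "F \<subseteq> \<D>" "\<forall>D\<in>F. x D \<in> D" "(\<Oplus>\<^bsub>C\<^esub>D\<in>F. x D) = \<zero>\<^bsub>C\<^esub>" for F x
    using indep[of F x] that by simp
  obtain p where pl: "\<And>D. D \<in> \<D> \<Longrightarrow> p D \<in> clin C C" and pD: "\<And>D c. D \<in> \<D> \<Longrightarrow> c \<in> carrier C \<Longrightarrow> p D c \<in> D"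
    and pfin: "\<And>c. c \<in> carrier C \<Longrightarrow> finite {D \<in> \<D>. p D c \<noteq> \<zero>\<^bsub>C\<^esub>}"
    and pid: "\<And>D c. D \<in> \<D> \<Longrightarrow> c \<in> D \<Longrightarrow> p D c = c"
    and pz: "\<And>D D' c. D \<in> \<D> \<Longrightarrow> D' \<in> \<D> \<Longrightarrow> D \<noteq> D' \<Longrightarrow> c \<in> D \<Longrightarrow> p D' c = \<zero>\<^bsub>C\<^esub>"
    by (rule direct_sum_projections[OF cspace_C sub gen indep']) (assumption | rule that)+
  have span: "carrier C \<subseteq> W" if W: "csubspace C W" and "\<And>D. D \<in> \<D> \<Longrightarrow> D \<subseteq> W" for W
  proof
    fix c assume "c \<in> carrier C"
    then obtain F x where Fx: "finite F" "F \<subseteq> \<D>" "\<forall>D\<in>F. x D \<in> D" and c: "c = (\<Oplus>\<^bsub>C\<^esub>D\<in>F. x D)" using gen by blast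
    show "c \<in> W" unfolding c by (rule csubspace_finsum[OF cspace_C W Fx(1)]) (use Fx that(2) in blast)
  qed
  have "\<exists>\<theta>. cbilin C C cfield \<theta> \<and> (\<forall>c\<in>D. tensor_lift cfield \<theta> (\<Delta> c) = \<epsilon> c) \<and>
      (\<forall>c\<in>D. \<forall>d\<in>D. rhit (\<lambda>y. \<theta> y d) c = lhit (\<theta> c) d)" if "D \<in> \<D>" for D
    by (rule simple_block_form[OF simple[OF that]]) blast
  then obtain \<theta>D where b: "\<And>D. D \<in> \<D> \<Longrightarrow> cbilin C C cfield (\<theta>D D)"
    and one: "\<And>D c. D \<in> \<D> \<Longrightarrow> c \<in> D \<Longrightarrow> tensor_lift cfield (\<theta>D D) (\<Delta> c) = \<epsilon> c"
    and two: "\<And>D c d. D \<in> \<D> \<Longrightarrow> c \<in> D \<Longrightarrow> d \<in> D \<Longrightarrow> rhit (\<lambda>y. \<theta>D D y d) c = lhit (\<theta>D D c) d" by metis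
  (* The index set is the finite support of c; on any larger finite set the extra terms vanish. *)
  define \<theta> where "\<theta> c d = (\<Sum>D\<in>{D \<in> \<D>. p D c \<noteq> \<zero>\<^bsub>C\<^esub>}. \<theta>D D (p D c) (p D d))" for c d
  have pc: "p D c \<in> carrier C" if "D \<in> \<D>" "c \<in> carrier C" for D c by (rule clinD(1)[OF pl[OF that(1)] that(2)])
  have \<theta>z: "\<theta>D D \<zero>\<^bsub>C\<^esub> y = 0" "\<theta>D D y \<zero>\<^bsub>C\<^esub> = 0" if "D \<in> \<D>" "y \<in> carrier C" for D y
    using clin_zero[OF cspace_C cfield_cspace cbilinD(2)[OF b[OF that(1)] that(2)]]
      clin_zero[OF cspace_C cfield_cspace cbilinD(1)[OF b[OF that(1)] that(2)]] by simp_all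
  have \<theta>sup: "\<theta> c d = (\<Sum>D\<in>H. \<theta>D D (p D c) (p D d))"
    if "finite H" "H \<subseteq> \<D>" "{D \<in> \<D>. p D c \<noteq> \<zero>\<^bsub>C\<^esub>} \<subseteq> H" "d \<in> carrier C" for c d H
    unfolding \<theta>_def by (rule sum.mono_neutral_left) (use that \<theta>z pc in auto)
  have pcomp: "(\<lambda>d. \<theta>D D c (p D d)) \<in> dual" if "D \<in> \<D>" "c \<in> carrier C" for D c
    by (rule clin_comp[OF pl[OF that(1)] cbilinD(1)[OF b[OF that(1)] that(2)]])
  have bil: "cbilin C C cfield \<theta>"
  proof (rule cbilinI)
    show "\<theta> c \<in> dual" if "c \<in> carrier C" for c
      unfolding \<theta>_def[abs_def] by (rule cfield_sum[OF pfin[OF that]]) (use pcomp pc that in auto)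
    show "(\<lambda>c. \<theta> c d) \<in> dual" if d: "d \<in> carrier C" for d
    proof (rule clinI)
      fix c c' assume c: "c \<in> carrier C" and c': "c' \<in> carrier C"
      define S where "S c = {D \<in> \<D>. p D c \<noteq> \<zero>\<^bsub>C\<^esub>}" for c
      define H where "H = S c \<union> S c' \<union> S (c \<oplus>\<^bsub>C\<^esub> c')"
      have H: "finite H" "H \<subseteq> \<D>" "S c \<subseteq> H" "S c' \<subseteq> H" "S (c \<oplus>\<^bsub>C\<^esub> c') \<subseteq> H"
        using pfin c c' by (auto simp: S_def H_def)
      have "\<theta> (c \<oplus>\<^bsub>C\<^esub> c') d = (\<Sum>D\<in>H. \<theta>D D (p D (c \<oplus>\<^bsub>C\<^esub> c')) (p D d))"
        by (rule \<theta>sup[OF H(1,2) H(5)[unfolded S_def] d])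
      also have "\<dots> = (\<Sum>D\<in>H. \<theta>D D (p D c) (p D d) + \<theta>D D (p D c') (p D d))"
      proof (rule sum.cong[OF refl])
        fix D assume "D \<in> H"
        then have D: "D \<in> \<D>" using H(2) by blast
        show "\<theta>D D (p D (c \<oplus>\<^bsub>C\<^esub> c')) (p D d) = \<theta>D D (p D c) (p D d) + \<theta>D D (p D c') (p D d)"
          unfolding clinD(2)[OF pl[OF D] c c'] cbilinD(5)[OF b[OF D] pc[OF D c] pc[OF D c'] pc[OF D d]] by simp
      qed
      also have "\<dots> = \<theta> c d + \<theta> c' d"
        unfolding sum.distrib \<theta>sup[OF H(1,2) H(3)[unfolded S_def] d] \<theta>sup[OF H(1,2) H(4)[unfolded S_def] d] ..
      finally show "\<theta> (c \<oplus>\<^bsub>C\<^esub> c') d = \<theta> c d \<oplus>\<^bsub>cfield\<^esub> \<theta> c' d" by simp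
    next
      fix a c assume c: "c \<in> carrier C"
      define S where "S c = {D \<in> \<D>. p D c \<noteq> \<zero>\<^bsub>C\<^esub>}" for c
      define H where "H = S c \<union> S (a \<odot>\<^bsub>C\<^esub> c)"
      have H: "finite H" "H \<subseteq> \<D>" "S c \<subseteq> H" "S (a \<odot>\<^bsub>C\<^esub> c) \<subseteq> H"
        using pfin c by (auto simp: S_def H_def)
      have "\<theta> (a \<odot>\<^bsub>C\<^esub> c) d = (\<Sum>D\<in>H. \<theta>D D (p D (a \<odot>\<^bsub>C\<^esub> c)) (p D d))"
        by (rule \<theta>sup[OF H(1,2) H(4)[unfolded S_def] d])
      also have "\<dots> = (\<Sum>D\<in>H. a * \<theta>D D (p D c) (p D d))"
      proof (rule sum.cong[OF refl])
        fix D assume "D \<in> H"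
        then have D: "D \<in> \<D>" using H(2) by blast
        show "\<theta>D D (p D (a \<odot>\<^bsub>C\<^esub> c)) (p D d) = a * \<theta>D D (p D c) (p D d)"
          unfolding clinD(3)[OF pl[OF D] c] cbilinD(7)[OF b[OF D] pc[OF D c] pc[OF D d]] by simp
      qed
      also have "\<dots> = a * \<theta> c d"
        unfolding \<theta>sup[OF H(1,2) H(3)[unfolded S_def] d] sum_distrib_left ..
      finally show "\<theta> (a \<odot>\<^bsub>C\<^esub> c) d = a \<odot>\<^bsub>cfield\<^esub> \<theta> c d" by simp
    qed simp
  qed
  note \<theta>l = cbilinD(1)[OF bil] and \<theta>r = cbilinD(2)[OF bil]
  have \<theta>on: "\<theta> c d = \<theta>D D c (p D d)" if D: "D \<in> \<D>" "c \<in> D" and d: "d \<in> carrier C" for c d D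
  proof -
    have "{D' \<in> \<D>. p D' c \<noteq> \<zero>\<^bsub>C\<^esub>} \<subseteq> {D}" using pz[OF D(1) _ _ D(2)] by blast
    then show ?thesis using \<theta>sup[of "{D}" c d] D d by (simp add: pid)
  qed
  have \<theta>DD: "\<theta> c d = \<theta>D D c d" if "D \<in> \<D>" "c \<in> D" "d \<in> D" for c d D
    using \<theta>on[OF that(1,2)] csubspaceD(1)[OF sub[OF that(1)] that(3)] pid[OF that(1,3)] by simp
  have cD: "D \<in> \<D> \<Longrightarrow> c \<in> D \<Longrightarrow> c \<in> carrier C" for c D by (rule csubspaceD(1)[OF sub])
  have 1: "tensor_lift cfield \<theta> (\<Delta> c) = \<epsilon> c" if "c \<in> carrier C" for c
  proof -
    note L = clin_comp[OF comult_clin clift_clin[OF cspace_C cspace_C cfield_cspace bil]]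
    let ?W = "{c \<in> carrier C. tensor_lift cfield \<theta> (\<Delta> c) = \<epsilon> c}"
    have "csubspace C ?W" by (rule clin_equalizer_csubspace[OF cspace_C cfield_cspace L counit_dual])
    moreover have "D \<subseteq> ?W" if D: "D \<in> \<D>" for D
    proof
      fix c assume c: "c \<in> D"
      have "tensor_lift cfield \<theta> (\<Delta> c) = tensor_lift cfield (\<theta>D D) (\<Delta> c)"
        by (rule subcoalgebra_lift_cong[OF subco[OF D] cfield_cspace bil b[OF D] \<theta>DD[OF D] c])
      then show "c \<in> ?W" using one[OF D c] cD[OF D c] by simp
    qed
    ultimately show ?thesis using span that by blast
  qed
  have 2: "rhit (\<lambda>y. \<theta> y d) c = lhit (\<theta> c) d" if c: "c \<in> D" and d: "d \<in> D'" and D: "D \<in> \<D>" "D' \<in> \<D>" for c d D D'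
  proof (cases "D = D'")
    case True
    then have d: "d \<in> D" using d by simp
    have "rhit (\<lambda>y. \<theta> y d) c = rhit (\<lambda>y. \<theta>D D y d) c"
      by (rule subcoalgebra_hit_cong(2)[OF subco[OF D(1)] \<theta>r cbilinD(2)[OF b[OF D(1)]] c \<theta>DD[OF D(1) _ d]])
        (use cD[OF D(1) d] in simp_all)
    also have "\<dots> = lhit (\<theta>D D c) d" by (rule two[OF D(1) c d])
    also have "\<dots> = lhit (\<theta> c) d"
      by (rule subcoalgebra_hit_cong(1)[OF subco[OF D(1)] cbilinD(1)[OF b[OF D(1)]] \<theta>l d \<theta>DD[OF D(1) c, symmetric]])
        (use cD[OF D(1) c] in simp_all)
    finally show ?thesis .
  next
    case False
    have dc: "d \<in> carrier C" and cc: "c \<in> carrier C" using cD D c d by auto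
    have "\<theta> y d = 0" if "y \<in> D" for y
      using \<theta>on[OF D(1) that dc] pz[OF D(2,1) _ d] False \<theta>z(2)[OF D(1) cD[OF D(1) that]] by simp
    then have "rhit (\<lambda>y. \<theta> y d) c = rhit (\<lambda>_. 0) c"
      by (intro subcoalgebra_hit_cong(2)[OF subco[OF D(1)] \<theta>r[OF dc] cfield_zero c])
    moreover have "\<theta> c y = 0" if "y \<in> D'" for y
      using \<theta>on[OF D(1) c cD[OF D(2) that]] pz[OF D(2,1) _ that] False \<theta>z(2)[OF D(1) cc] by simp
    then have "lhit (\<theta> c) d = lhit (\<lambda>_. 0) d"
      by (intro subcoalgebra_hit_cong(1)[OF subco[OF D(2)] \<theta>l[OF cc] cfield_zero d])
    ultimately show ?thesis by (simp add: hit_zero dc cc)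
  qed
  note eqs = clin_equalizer_csubspace[OF cspace_C cspace_C]
    and L = cbilinD(1,2)[OF hit_form_cbilin(1)[OF bil]] and R = cbilinD(1,2)[OF hit_form_cbilin(2)[OF bil]]
  have 3: "rhit (\<lambda>y. \<theta> y d) c = lhit (\<theta> c) d" if c: "c \<in> D" and D: "D \<in> \<D>" and d: "d \<in> carrier C" for c d D
    using span[OF eqs[OF R(1)[OF cD[OF D c]] L(1)[OF cD[OF D c]]]] 2[OF c _ D] cD d by blast
  have 4: "rhit (\<lambda>y. \<theta> y d) c = lhit (\<theta> c) d" if c: "c \<in> carrier C" and d: "d \<in> carrier C" for c d
    using span[OF eqs[OF R(2)[OF d] L(2)[OF d]]] 3[OF _ _ d] cD c by blast
  show ?thesis by (rule that[OF bil 1 4])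
qed

section \<open>Comodules over a cosemisimple coalgebra\<close>

lemma left_comoduleD:
  assumes "left_comodule C V \<rho>"
  shows "cspace V" "\<rho> \<in> clin V (ctensor C V)"
    "v \<in> carrier V \<Longrightarrow> cassoc C C V (cmap (ctensor C C) V \<Delta> id (\<rho> v)) = cmap C (ctensor C V) id \<rho> (\<rho> v)"
    "v \<in> carrier V \<Longrightarrow> tensor_lift V (\<lambda>c x. \<epsilon> c \<odot>\<^bsub>V\<^esub> x) (\<rho> v) = v"
  using assms by (simp_all add: left_comodule_def)

text \<open>
  The counterpart for comodules of the iterated comultiplication:
  \<open>\<beta>(v\<^sub>-\<^sub>1, v\<^sub>0\<^sub>-\<^sub>1, v\<^sub>0\<^sub>0) = \<beta>(v\<^sub>-\<^sub>1\<^sub>1, v\<^sub>-\<^sub>1\<^sub>2, v\<^sub>0)\<close>.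
\<close>

lemma sweedler_comodule:
  assumes V: "left_comodule C V \<rho>" and Z: "cspace Z" and b: "ctrilin C C V Z \<beta>" and v: "v \<in> carrier V"
  shows "tensor_lift Z (\<lambda>x u. tensor_lift Z (\<beta> x) (\<rho> u)) (\<rho> v) =
    tensor_lift Z (\<lambda>x u. tensor_lift Z (\<lambda>a b. \<beta> a b u) (\<Delta> x)) (\<rho> v)"
proof -
  note VD = left_comoduleD[OF V]
  note sp = cspace_C cspace_C VD(1) Z
  have rv: "\<rho> v \<in> carrier (ctensor C V)" by (rule clinD(1)[OF VD(2) v])
  have "tensor_lift Z (\<lambda>x u. tensor_lift Z (\<beta> x) (\<rho> u)) (\<rho> v) =
    tensor_lift Z (\<lambda>x t. tensor_lift Z (\<beta> x) t) (cmap C (ctensor C V) id \<rho> (\<rho> v))"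
    by (subst clift_cmap[OF _ _ _ _ Z ctrilin_right[OF sp b] clin_id VD(2)]) (use rv VD in simp_all)
  also have "\<dots> = tensor_lift Z (\<lambda>t z. tensor_lift Z (\<lambda>x y. \<beta> x y z) t) (cmap (ctensor C C) V \<Delta> id (\<rho> v))"
    unfolding VD(3)[OF v, symmetric]
    by (rule clift_cassoc[OF sp b], rule clinD(1)[OF cmap_clin[OF cspace_C VD(1) _ VD(1) comult_clin clin_id]])
      (use rv in simp_all)
  also have "\<dots> = tensor_lift Z (\<lambda>x u. tensor_lift Z (\<lambda>a b. \<beta> a b u) (\<Delta> x)) (\<rho> v)"
    by (subst clift_cmap[OF _ _ _ _ Z ctrilin_left[OF sp b] comult_clin clin_id]) (use rv VD in simp_all)
  finally show ?thesis .
qed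

text \<open>
  The witness is \<open>\<pi>(c, v) = \<theta>(c, v\<^sub>-\<^sub>1) v\<^sub>0\<close>. It retracts the coaction since
  \<open>\<theta>(v\<^sub>-\<^sub>2, v\<^sub>-\<^sub>1) v\<^sub>0 = \<epsilon>(v\<^sub>-\<^sub>1) v\<^sub>0 = v\<close>, and it is colinear since
  \<open>\<theta>(c, v\<^sub>-\<^sub>2) v\<^sub>-\<^sub>1 \<otimes> v\<^sub>0 = c\<^sub>1 \<theta>(c\<^sub>2, v\<^sub>-\<^sub>1) \<otimes> v\<^sub>0\<close>. So \<open>V\<close> is a direct summand of the cofree comodule
  \<open>C \<otimes> V\<close>, that is, every comodule is injective.
\<close>

lemma comodule_retraction:
  assumes V: "left_comodule C V \<rho>" and css: "cosemisimple C"
  obtains \<pi> where "cbilin C V V \<pi>" "\<And>v. v \<in> carrier V \<Longrightarrow> tensor_lift V \<pi> (\<rho> v) = v"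
    "\<And>c v. c \<in> carrier C \<Longrightarrow> v \<in> carrier V \<Longrightarrow> \<rho> (\<pi> c v) = cmap C V id (\<lambda>d. \<pi> d v) (\<Delta> c)"
proof -
  obtain \<theta> where bil: "cbilin C C cfield \<theta>" and one: "\<And>c. c \<in> carrier C \<Longrightarrow> tensor_lift cfield \<theta> (\<Delta> c) = \<epsilon> c"
    and two: "\<And>c d. c \<in> carrier C \<Longrightarrow> d \<in> carrier C \<Longrightarrow> rhit (\<lambda>y. \<theta> y d) c = lhit (\<theta> c) d"
    by (rule cosemisimple_form[OF css]) (rule that)
  note VD = left_comoduleD[OF V]
  note Vs = VD(1)
  note sp [simp] = cspace_C VD(1)
  note \<theta>D = cbilinD[OF bil]
  have rv: "\<rho> v \<in> carrier (ctensor C V)" if "v \<in> carrier V" for v by (rule clinD(1)[OF VD(2) that])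
  have bV: "cbilin C V V (\<lambda>d u. \<theta> c d \<odot>\<^bsub>V\<^esub> u)" if "c \<in> carrier C" for c
    by (rule contract_left_cbilin[OF cspace_C Vs \<theta>D(1)[OF that]])
  have lV: "(\<lambda>c. \<theta> c d \<odot>\<^bsub>V\<^esub> u) \<in> clin C V" if "d \<in> carrier C" "u \<in> carrier V" for d u
    by (rule clin_functional_smult[OF Vs \<theta>D(2)[OF that(1)] that(2)])
  define \<pi> where "\<pi> c v = tensor_lift V (\<lambda>d u. \<theta> c d \<odot>\<^bsub>V\<^esub> u) (\<rho> v)" for c v
  have \<pi>b: "cbilin C V V \<pi>"
    unfolding \<pi>_def[abs_def]
    by (rule cbilinI, rule clin_comp[OF VD(2) clift_clin[OF cspace_C Vs Vs bV]], assumption,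
        rule clift_param_clin[OF cspace_C cspace_C Vs Vs bV lV rv])
  have 1: "tensor_lift V \<pi> (\<rho> v) = v" if v: "v \<in> carrier V" for v
  proof -
    have tri: "ctrilin C C V V (\<lambda>c d u. \<theta> c d \<odot>\<^bsub>V\<^esub> u)" by (rule ctrilinI[OF bV lV])
    have inner: "tensor_lift V (\<lambda>a b. \<theta> a b \<odot>\<^bsub>V\<^esub> u) (\<Delta> x) = \<epsilon> x \<odot>\<^bsub>V\<^esub> u" if "x \<in> carrier C" "u \<in> carrier V" for x u
    proof -
      have l: "(\<lambda>z. z \<odot>\<^bsub>V\<^esub> u) \<in> clin cfield V" by (rule clinI) (use that in \<open>auto simp: cspace_smult_add\<close>)
      show ?thesis
        using clift_comp[OF cspace_C cspace_C cfield_cspace Vs bil l comult_closed[OF that(1)]] one[OF that(1)] by simp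
    qed
    have "tensor_lift V \<pi> (\<rho> v) = tensor_lift V (\<lambda>x u. tensor_lift V (\<lambda>a b. \<theta> a b \<odot>\<^bsub>V\<^esub> u) (\<Delta> x)) (\<rho> v)"
      unfolding \<pi>_def[abs_def] by (rule sweedler_comodule[OF V Vs tri v])
    also have "\<dots> = tensor_lift V (\<lambda>x u. \<epsilon> x \<odot>\<^bsub>V\<^esub> u) (\<rho> v)"
    proof (rule clift_cong[OF cspace_C Vs Vs _ contract_left_cbilin[OF cspace_C Vs counit_dual] inner rv[OF v]])
      show "cbilin C V V (\<lambda>x u. tensor_lift V (\<lambda>a b. \<theta> a b \<odot>\<^bsub>V\<^esub> u) (\<Delta> x))"
        by (rule cbilin_cong[OF cspace_C Vs inner contract_left_cbilin[OF cspace_C Vs counit_dual]])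
    qed
    also have "\<dots> = v" by (rule VD(4)[OF v])
    finally show ?thesis .
  qed
  have 2: "\<rho> (\<pi> c v) = cmap C V id (\<lambda>d. \<pi> d v) (\<Delta> c)" if c: "c \<in> carrier C" and v: "v \<in> carrier V" for c v
  proof -
    let ?T = "ctensor C V"
    have T: "cspace ?T" by simp
    have bT: "cbilin C V ?T (\<lambda>b u. a \<odot>\<^bsub>?T\<^esub> cpure C V b u)" for a
      by (intro cbilinI clinI) (simp_all add: cpure_add cpure_smult mult.commute)
    have tri: "ctrilin C C V ?T (\<lambda>a b u. \<theta> c a \<odot>\<^bsub>?T\<^esub> cpure C V b u)"
      by (intro ctrilinI bT clin_functional_smult[OF T \<theta>D(1)[OF c]]) simp
    have bil1: "cbilin C V ?T (\<lambda>d u. \<theta> c d \<odot>\<^bsub>?T\<^esub> \<rho> u)"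
      by (intro cbilinI clinI) (use rv T in \<open>simp_all add: clinD(2,3)[OF VD(2)] \<theta>D c cspace_smult_add mult.commute\<close>)
    have e1: "\<theta> c d \<odot>\<^bsub>?T\<^esub> s = tensor_lift ?T (\<lambda>b u. \<theta> c d \<odot>\<^bsub>?T\<^esub> cpure C V b u) s" if "s \<in> carrier ?T" for d s
      by (rule ctensor_eqI[OF cspace_C Vs clin_smult[OF T] clift_clin[OF cspace_C Vs T bT] _ that])
        (simp add: clift_pure[OF cspace_C Vs T bT])
    have e2: "tensor_lift ?T (\<lambda>a b. \<theta> c a \<odot>\<^bsub>?T\<^esub> cpure C V b u) (\<Delta> x) = cpure C V (rhit (\<lambda>y. \<theta> y x) c) u"
      if x: "x \<in> carrier C" and u: "u \<in> carrier V" for x u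
    proof -
      have l: "(\<lambda>b. cpure C V b u) \<in> clin C ?T" by (rule cbilinD(2)[OF cbilin_cpure[OF cspace_C Vs] u])
      have "cpure C V (lhit (\<theta> c) x) u = tensor_lift ?T (\<lambda>a b. cpure C V (\<theta> c a \<odot>\<^bsub>C\<^esub> b) u) (\<Delta> x)"
        unfolding lhit_def contract_left_def
        by (rule clift_comp[OF cspace_C cspace_C cspace_C T contract_left_cbilin[OF cspace_C cspace_C \<theta>D(1)[OF c]] l comult_closed[OF x]])
      also have "\<dots> = tensor_lift ?T (\<lambda>a b. \<theta> c a \<odot>\<^bsub>?T\<^esub> cpure C V b u) (\<Delta> x)"
      proof (rule clift_cong[OF cspace_C cspace_C T _ _ _ comult_closed[OF x]])
        show "cbilin C C ?T (\<lambda>a b. \<theta> c a \<odot>\<^bsub>?T\<^esub> cpure C V b u)"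
          by (intro cbilinI clinI) (use u T in \<open>simp_all add: \<theta>D c cpure_add cpure_smult cspace_smult_add mult.commute\<close>)
        show "cbilin C C ?T (\<lambda>a b. cpure C V (\<theta> c a \<odot>\<^bsub>C\<^esub> b) u)"
          by (intro cbilinI clinI) (use u T in \<open>simp_all add: \<theta>D c cpure_add cpure_smult cspace_smult_add mult.commute\<close>)
      qed (use u in \<open>simp add: cpure_smult\<close>)
      finally show ?thesis using two[OF c x] by simp
    qed
    (* c_1 \<otimes> pi(c_2, v) is computed for arbitrary tensors s and r in place of the coproduct of c and
       the coaction of v, since only then can both be reduced to pure tensors. *)
    have key: "cmap C V id (\<lambda>d. tensor_lift V (\<lambda>x u. \<theta> d x \<odot>\<^bsub>V\<^esub> u) r) s =
        tensor_lift ?T (\<lambda>x u. cpure C V (contract_right C (\<lambda>y. \<theta> y x) s) u) r" (is "?L r = ?R r")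
      and keyb: "cbilin C V ?T (\<lambda>x u. cpure C V (contract_right C (\<lambda>y. \<theta> y x) s) u)"
      if s: "s \<in> carrier (ctensor C C)" and r: "r \<in> carrier ?T" for s r
    proof -
      have cr: "contract_right C (\<lambda>y. \<theta> y x) s \<in> carrier C" if "x \<in> carrier C" for x
        by (rule clinD(1)[OF contract_right_clin[OF cspace_C cspace_C \<theta>D(2)[OF that]] s])
      have crl: "(\<lambda>x. contract_right C (\<lambda>y. \<theta> y x) s) \<in> clin C C"
        unfolding contract_right_def
        by (rule clift_param_clin[OF cspace_C cspace_C cspace_C cspace_C contract_right_cbilin[OF cspace_C cspace_C \<theta>D(2)]
              clin_functional_smult[OF cspace_C \<theta>D(1)] s])
      show bil2: "cbilin C V ?T (\<lambda>x u. cpure C V (contract_right C (\<lambda>y. \<theta> y x) s) u)"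
        by (intro cbilinI clinI) (use cr in \<open>simp_all add: clinD(2,3)[OF crl] cpure_add cpure_smult\<close>)
      have liftl: "(\<lambda>d. tensor_lift V (\<lambda>x u. \<theta> d x \<odot>\<^bsub>V\<^esub> u) r) \<in> clin C V" if "r \<in> carrier ?T" for r
        by (rule clift_param_clin[OF cspace_C cspace_C Vs Vs bV lV that])
      have Ll: "?L \<in> clin ?T ?T"
        unfolding cmap_eq id_apply
      proof (rule clift_param_clin[OF T cspace_C cspace_C T _ _ s])
        fix r assume r: "r \<in> carrier ?T"
        show "cbilin C C ?T (\<lambda>x y. cpure C V x (tensor_lift V (\<lambda>x u. \<theta> y x \<odot>\<^bsub>V\<^esub> u) r))"
          using cmap_cbilin[OF cspace_C Vs clin_ident liftl[OF r]] .
      next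
        fix y z assume yz: "y \<in> carrier C" "z \<in> carrier C"
        show "(\<lambda>r. cpure C V y (tensor_lift V (\<lambda>x u. \<theta> z x \<odot>\<^bsub>V\<^esub> u) r)) \<in> clin ?T ?T"
          by (rule clin_comp[OF clift_clin[OF cspace_C Vs Vs bV[OF yz(2)]] cbilinD(1)[OF cbilin_cpure[OF cspace_C Vs] yz(1)]])
      qed
      show "?L r = ?R r"
      proof (rule ctensor_eqI[OF cspace_C Vs Ll clift_clin[OF cspace_C Vs T bil2] _ r])
        fix x u assume x: "x \<in> carrier C" and u: "u \<in> carrier V"
        have l1: "(\<lambda>d. \<theta> d x \<odot>\<^bsub>V\<^esub> u) \<in> clin C V" by (rule lV[OF x u])
        have p: "cpure C V x u \<in> carrier ?T" using x u by simp
        have "?L (cpure C V x u) = cmap C V id (\<lambda>d. \<theta> d x \<odot>\<^bsub>V\<^esub> u) s"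
          by (rule cmap_cong[OF cspace_C cspace_C cspace_C Vs clin_id liftl[OF p] clin_id l1 _ _ s])
            (simp_all add: clift_pure[OF cspace_C Vs Vs bV x u])
        also have "\<dots> = cpure C V (contract_right C (\<lambda>y. \<theta> y x) s) u"
        proof (rule ctensor_eqI[OF cspace_C cspace_C cmap_clin[OF cspace_C cspace_C cspace_C Vs clin_id l1] _ _ s])
          show "(\<lambda>s. cpure C V (contract_right C (\<lambda>y. \<theta> y x) s) u) \<in> clin (ctensor C C) ?T"
            by (rule clin_comp[OF contract_right_clin[OF cspace_C cspace_C \<theta>D(2)[OF x]]
                  cbilinD(2)[OF cbilin_cpure[OF cspace_C Vs] u]])
          fix y d assume "y \<in> carrier C" "d \<in> carrier C"
          then show "cmap C V id (\<lambda>d. \<theta> d x \<odot>\<^bsub>V\<^esub> u) (cpure C C y d) = cpure C V (contract_right C (\<lambda>y. \<theta> y x) (cpure C C y d)) u"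
            using u by (simp add: cmap_pure[OF cspace_C cspace_C cspace_C Vs clin_id l1]
                contract_right_pure[OF cspace_C cspace_C \<theta>D(2)[OF x]] cpure_smult)
        qed
        also have "\<dots> = ?R (cpure C V x u)" by (rule clift_pure[OF cspace_C Vs T bil2 x u, symmetric])
        finally show "?L (cpure C V x u) = ?R (cpure C V x u)" .
      qed
    qed
    have "\<rho> (\<pi> c v) = tensor_lift ?T (\<lambda>d u. \<rho> (\<theta> c d \<odot>\<^bsub>V\<^esub> u)) (\<rho> v)"
      unfolding \<pi>_def by (rule clift_comp[OF cspace_C Vs Vs T bV[OF c] VD(2) rv[OF v]])
    also have "\<dots> = tensor_lift ?T (\<lambda>x u. tensor_lift ?T (\<lambda>b w. \<theta> c x \<odot>\<^bsub>?T\<^esub> cpure C V b w) (\<rho> u)) (\<rho> v)"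
    proof (rule clift_cong[OF cspace_C Vs T _ _ _ rv[OF v]])
      have e: "\<rho> (\<theta> c x \<odot>\<^bsub>V\<^esub> u) = \<theta> c x \<odot>\<^bsub>?T\<^esub> \<rho> u"
        "tensor_lift ?T (\<lambda>b w. \<theta> c x \<odot>\<^bsub>?T\<^esub> cpure C V b w) (\<rho> u) = \<theta> c x \<odot>\<^bsub>?T\<^esub> \<rho> u" if "u \<in> carrier V" for x u
        using clinD(3)[OF VD(2) that] e1[OF rv[OF that]] by simp_all
      show "cbilin C V ?T (\<lambda>d u. \<rho> (\<theta> c d \<odot>\<^bsub>V\<^esub> u))"
        "cbilin C V ?T (\<lambda>x u. tensor_lift ?T (\<lambda>b w. \<theta> c x \<odot>\<^bsub>?T\<^esub> cpure C V b w) (\<rho> u))"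
        by (rule cbilin_cong[OF cspace_C Vs _ bil1], simp only: e)+
      show "\<rho> (\<theta> c x \<odot>\<^bsub>V\<^esub> u) = tensor_lift ?T (\<lambda>b w. \<theta> c x \<odot>\<^bsub>?T\<^esub> cpure C V b w) (\<rho> u)"
        if "u \<in> carrier V" for x u by (simp only: e[OF that])
    qed
    also have "\<dots> = tensor_lift ?T (\<lambda>x u. tensor_lift ?T (\<lambda>a b. \<theta> c a \<odot>\<^bsub>?T\<^esub> cpure C V b u) (\<Delta> x)) (\<rho> v)"
      by (rule sweedler_comodule[OF V T tri v])
    also have "\<dots> = tensor_lift ?T (\<lambda>x u. cpure C V (rhit (\<lambda>y. \<theta> y x) c) u) (\<rho> v)"
    proof (rule clift_cong[OF cspace_C Vs T _ _ e2 rv[OF v]])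
      show b: "cbilin C V ?T (\<lambda>x u. cpure C V (rhit (\<lambda>y. \<theta> y x) c) u)"
        unfolding rhit_def by (rule keyb[OF comult_closed[OF c] rv[OF v]])
      show "cbilin C V ?T (\<lambda>x u. tensor_lift ?T (\<lambda>a b. \<theta> c a \<odot>\<^bsub>?T\<^esub> cpure C V b u) (\<Delta> x))"
        by (rule cbilin_cong[OF cspace_C Vs e2 b])
    qed
    also have "\<dots> = cmap C V id (\<lambda>d. \<pi> d v) (\<Delta> c)"
      unfolding \<pi>_def rhit_def by (rule key[OF comult_closed[OF c] rv[OF v], symmetric])
    finally show ?thesis .
  qed
  show ?thesis by (rule that[OF \<pi>b 1 2])
qed

end

section \<open>Projection onto the cotensor product\<close>

context coalg begin

lemma right_comoduleD:
  assumes "right_comodule C A \<delta>"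
  shows "cspace A" "\<delta> \<in> clin A (ctensor A C)"
    "a \<in> carrier A \<Longrightarrow> cassoc A C C (cmap (ctensor A C) C \<delta> id (\<delta> a)) = cmap A (ctensor C C) id \<Delta> (\<delta> a)"
  using assms by (simp_all add: right_comodule_def)

context
  fixes A :: "(complex, 'a) module" and \<delta> :: "'a \<Rightarrow> ('a, 'c) tens" and V :: "(complex, 'v) module" and \<rho> :: "'v \<Rightarrow> ('c, 'v) tens"
  assumes A: "right_comodule C A \<delta>" and V: "left_comodule C V \<rho>"
begin

lemma cotensor_carrier:
  "t \<in> carrier (cotensor C A \<delta> V \<rho>) \<longleftrightarrow> t \<in> carrier (ctensor A V) \<and>
    cassoc A C V (cmap (ctensor A C) V \<delta> id t) = cmap A (ctensor C V) id \<rho> t"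
  by (simp add: cotensor_def)

lemma coact_left_clin: "(\<lambda>t. cassoc A C V (cmap (ctensor A C) V \<delta> id t)) \<in> clin (ctensor A V) (ctensor A (ctensor C V))"
  using right_comoduleD(1,2)[OF A] left_comoduleD(1,2)[OF V]
  by (intro clin_comp[OF cmap_clin cassoc_clin]) simp_all

lemma coact_right_clin: "cmap A (ctensor C V) id \<rho> \<in> clin (ctensor A V) (ctensor A (ctensor C V))"
  using right_comoduleD(1,2)[OF A] left_comoduleD(1,2)[OF V] by (intro cmap_clin) simp_all

end

end

text \<open>
  The retraction \<open>\<pi>\<close> is a parameter and not a choice, so that the same one is used for both total
  algebras.
\<close>

locale split_comodule = coalg C for C :: "'c coalgebra" +
  fixes V :: "(complex, 'v) module" and \<rho> :: "'v \<Rightarrow> ('c, 'v) tens" and \<pi> :: "'c \<Rightarrow> 'v \<Rightarrow> 'v"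
  assumes V: "left_comodule C V \<rho>" and \<pi>b: "cbilin C V V \<pi>"
    and retraction: "\<And>v. v \<in> carrier V \<Longrightarrow> tensor_lift V \<pi> (\<rho> v) = v"
    and colinear: "\<And>c v. c \<in> carrier C \<Longrightarrow> v \<in> carrier V \<Longrightarrow> \<rho> (\<pi> c v) = cmap C V id (\<lambda>d. \<pi> d v) (\<Delta> c)"
begin

lemma cspace_V [simp]: "cspace V" and \<rho>_clin [simp]: "\<rho> \<in> clin V (ctensor C V)"
  using left_comoduleD[OF V] by auto

lemma \<pi>_clin [simp]: "v \<in> carrier V \<Longrightarrow> (\<lambda>c. \<pi> c v) \<in> clin C V" by (rule cbilinD(2)[OF \<pi>b])

lemma \<pi>_closed [simp]: "c \<in> carrier C \<Longrightarrow> v \<in> carrier V \<Longrightarrow> \<pi> c v \<in> carrier V" by (rule cbilinD(3)[OF \<pi>b])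

text \<open>
  \<open>proj\<close> is the projection \<open>a \<otimes> v \<mapsto> a\<^sub>0 \<otimes> \<pi>(a\<^sub>1, v)\<close>. Its second half \<open>spread\<close> is separate because it is
  also applied to elements \<open>a \<otimes> c\<close> that do not come from the coaction.
\<close>

definition spread :: "(complex, 'a) module \<Rightarrow> 'v \<Rightarrow> ('a, 'c) tens \<Rightarrow> ('a, 'v) tens" where
  "spread A v = cmap A V id (\<lambda>c. \<pi> c v)"

definition proj :: "(complex, 'a) module \<Rightarrow> ('a \<Rightarrow> ('a, 'c) tens) \<Rightarrow> ('a, 'v) tens \<Rightarrow> ('a, 'v) tens" where
  "proj A \<delta> = tensor_lift (ctensor A V) (\<lambda>a v. spread A v (\<delta> a))"

lemma spread_clin: "cspace A \<Longrightarrow> v \<in> carrier V \<Longrightarrow> spread A v \<in> clin (ctensor A C) (ctensor A V)"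
  unfolding spread_def by (rule cmap_clin) simp_all

lemma spread_pure: "cspace A \<Longrightarrow> v \<in> carrier V \<Longrightarrow> a \<in> carrier A \<Longrightarrow> c \<in> carrier C \<Longrightarrow> spread A v (cpure A C a c) = cpure A V a (\<pi> c v)"
  unfolding spread_def by simp

lemma spread_clin_right:
  assumes A: "cspace A" and s: "s \<in> carrier (ctensor A C)"
  shows "(\<lambda>v. spread A v s) \<in> clin V (ctensor A V)"
  unfolding spread_def cmap_eq id_apply
proof (rule clift_param_clin[OF cspace_V A cspace_C _ _ _ s])
  show "cspace (ctensor A V)" using A by simp
  show "cbilin A C (ctensor A V) (\<lambda>x y. cpure A V x (\<pi> y v))" if "v \<in> carrier V" for v
    by (rule cmap_cbilin[OF A cspace_V clin_ident \<pi>_clin[OF that]])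
  show "(\<lambda>v. cpure A V a (\<pi> c v)) \<in> clin V (ctensor A V)" if "a \<in> carrier A" "c \<in> carrier C" for a c
    by (rule clin_comp[OF cbilinD(1)[OF \<pi>b that(2)] cbilinD(1)[OF cbilin_cpure[OF A cspace_V] that(1)]])
qed

context
  fixes A :: "(complex, 'a) module" and \<delta> :: "'a \<Rightarrow> ('a, 'c) tens"
  assumes com: "right_comodule C A \<delta>"
begin

lemma com_cspace: "cspace A" and com_clin: "\<delta> \<in> clin A (ctensor A C)"
  using right_comoduleD[OF com] by auto

lemma com_closed: "a \<in> carrier A \<Longrightarrow> \<delta> a \<in> carrier (ctensor A C)" by (rule clinD(1)[OF com_clin])

lemma proj_cbilin: "cbilin A V (ctensor A V) (\<lambda>a v. spread A v (\<delta> a))"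
  by (rule cbilinI) (rule spread_clin_right[OF com_cspace com_closed], assumption,
      rule clin_comp[OF com_clin spread_clin[OF com_cspace]])

lemma proj_clin: "proj A \<delta> \<in> clin (ctensor A V) (ctensor A V)"
  unfolding proj_def by (rule clift_clin[OF com_cspace cspace_V _ proj_cbilin]) (simp add: com_cspace)

lemma proj_pure: "a \<in> carrier A \<Longrightarrow> v \<in> carrier V \<Longrightarrow> proj A \<delta> (cpure A V a v) = spread A v (\<delta> a)"
  unfolding proj_def by (rule clift_pure[OF com_cspace cspace_V _ proj_cbilin]) (simp_all add: com_cspace)

text \<open>
  For \<open>a \<otimes> v\<close>, colinearity of \<open>\<pi>\<close> turns the right-hand condition into \<open>a\<^sub>0 \<otimes> a\<^sub>1 \<otimes> \<pi>(a\<^sub>2, v)\<close>, and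
  coassociativity of the coaction of \<open>A\<close> turns that into the left-hand one.
\<close>

lemma proj_cotensor:
  assumes t: "t \<in> carrier (ctensor A V)"
  shows "proj A \<delta> t \<in> carrier (cotensor C A \<delta> V \<rho>)"
proof -
  note [simp] = com_cspace com_clin
  have "cassoc A C V (cmap (ctensor A C) V \<delta> id (proj A \<delta> t)) = cmap A (ctensor C V) id \<rho> (proj A \<delta> t)"
  proof (rule ctensor_eqI[OF com_cspace cspace_V clin_comp[OF proj_clin coact_left_clin[OF com V]] clin_comp[OF proj_clin coact_right_clin[OF com V]] _ t])
    fix a v assume a: "a \<in> carrier A" and v: "v \<in> carrier V"
    let ?p = "\<lambda>c. \<pi> c v"
    note da = com_closed[OF a]
    have p [simp]: "?p \<in> clin C V" by (rule \<pi>_clin[OF v])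
    have cp [simp]: "cmap C V id ?p \<in> clin (ctensor C C) (ctensor C V)" by simp
    have dd: "cmap (ctensor A C) C \<delta> id (\<delta> a) \<in> carrier (ctensor (ctensor A C) C)"
      by (rule clinD(1)[OF cmap_clin da]) simp_all
    have ci: "cmap A C id id \<in> clin (ctensor A C) (ctensor A C)" by simp
    have "cmap A (ctensor C V) id \<rho> (proj A \<delta> (cpure A V a v)) = cmap A (ctensor C V) (\<lambda>x. id (id x)) (\<lambda>c. \<rho> (?p c)) (\<delta> a)"
      unfolding proj_pure[OF a v] spread_def
      by (rule cmap_comp[where X = A and Y = C and X' = A and Y' = V]) (use da in simp_all)
    also have "\<dots> = cmap A (ctensor C V) (\<lambda>x. id (id x)) (\<lambda>c. cmap C V id ?p (\<Delta> c)) (\<delta> a)"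
      by (rule cmap_cong[where X = A and Y = C])
        (use da v clin_comp[OF p \<rho>_clin] clin_comp[OF comult_clin cp] in \<open>simp_all add: colinear\<close>)
    also have "\<dots> = cmap A (ctensor C V) id (cmap C V id ?p) (cmap A (ctensor C C) id \<Delta> (\<delta> a))"
      by (rule cmap_comp[where X = A and Y = C and X' = A and Y' = "ctensor C C", symmetric]) (use da in simp_all)
    also have "\<dots> = cmap A (ctensor C V) id (cmap C V id ?p) (cassoc A C C (cmap (ctensor A C) C \<delta> id (\<delta> a)))"
      by (simp only: right_comoduleD(3)[OF com a])
    also have "\<dots> = cassoc A C V (cmap (ctensor A C) V (cmap A C id id) ?p (cmap (ctensor A C) C \<delta> id (\<delta> a)))"
      by (rule cassoc_natural[OF _ _ _ _ _ _ _ _ _ dd, symmetric]) simp_all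
    also have "cmap (ctensor A C) V (cmap A C id id) ?p (cmap (ctensor A C) C \<delta> id (\<delta> a)) =
        cmap (ctensor A C) V (\<lambda>x. cmap A C id id (\<delta> x)) (\<lambda>c. ?p (id c)) (\<delta> a)"
      by (rule cmap_comp[where X = A and Y = C and X' = "ctensor A C" and Y' = C]) (use da in simp_all)
    also have "\<dots> = cmap (ctensor A C) V (\<lambda>x. \<delta> (id x)) (\<lambda>c. id (?p c)) (\<delta> a)"
      by (rule cmap_cong[where X = A and Y = C])
        (use da com_closed clin_comp[OF com_clin ci] in \<open>simp_all add: cmap_ident\<close>)
    also have "\<dots> = cmap (ctensor A C) V \<delta> id (cmap A V id ?p (\<delta> a))"
      by (rule cmap_comp[where X = A and Y = C and X' = A and Y' = V, symmetric]) (use da in simp_all)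
    finally show "cassoc A C V (cmap (ctensor A C) V \<delta> id (proj A \<delta> (cpure A V a v))) =
        cmap A (ctensor C V) id \<rho> (proj A \<delta> (cpure A V a v))"
      unfolding proj_pure[OF a v] spread_def ..
  qed
  then show ?thesis using clinD(1)[OF proj_clin t] by (simp add: cotensor_carrier[OF com V])
qed

text \<open>
  On the cotensor product \<open>a\<^sub>0 \<otimes> a\<^sub>1 \<otimes> v\<close> equals \<open>a \<otimes> v\<^sub>-\<^sub>1 \<otimes> v\<^sub>0\<close>, and \<open>\<pi>\<close> retracts the coaction.
\<close>

lemma proj_ident:
  assumes t: "t \<in> carrier (cotensor C A \<delta> V \<rho>)"
  shows "proj A \<delta> t = t"
proof -
  note [simp] = com_cspace com_clin
  have tc: "t \<in> carrier (ctensor A V)" and te: "cassoc A C V (cmap (ctensor A C) V \<delta> id t) = cmap A (ctensor C V) id \<rho> t"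
    using t by (simp_all add: cotensor_carrier[OF com V])
  let ?H = "cmap A V id (tensor_lift V \<pi>)"
  have lp [simp]: "tensor_lift V \<pi> \<in> clin (ctensor C V) V" by (rule clift_clin[OF cspace_C cspace_V cspace_V \<pi>b])
  have Hl: "?H \<in> clin (ctensor A (ctensor C V)) (ctensor A V)" by simp
  have "proj A \<delta> t = ?H (cassoc A C V (cmap (ctensor A C) V \<delta> id t))"
  proof (rule ctensor_eqI[OF com_cspace cspace_V proj_clin clin_comp[OF coact_left_clin[OF com V] Hl] _ tc])
    fix a v assume a: "a \<in> carrier A" and v: "v \<in> carrier V"
    note da = com_closed[OF a]
    have AC: "cspace (ctensor A C)" by simp
    have "spread A v s = ?H (cassoc A C V (cpure (ctensor A C) V s v))" if s: "s \<in> carrier (ctensor A C)" for s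
    proof (rule ctensor_eqI[OF com_cspace cspace_C spread_clin[OF com_cspace v] _ _ s])
      show "(\<lambda>s. ?H (cassoc A C V (cpure (ctensor A C) V s v))) \<in> clin (ctensor A C) (ctensor A V)"
        by (rule clin_comp[OF clin_comp[OF cbilinD(2)[OF cbilin_cpure[OF AC cspace_V] v] cassoc_clin] Hl]) simp_all
      show "spread A v (cpure A C x y) = ?H (cassoc A C V (cpure (ctensor A C) V (cpure A C x y) v))"
        if "x \<in> carrier A" "y \<in> carrier C" for x y
        using that v by (simp add: spread_pure clift_pure[OF cspace_C cspace_V cspace_V \<pi>b])
    qed
    then show "proj A \<delta> (cpure A V a v) = ?H (cassoc A C V (cmap (ctensor A C) V \<delta> id (cpure A V a v)))"
      using a v da by (simp add: proj_pure)
  qed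
  also have "\<dots> = ?H (cmap A (ctensor C V) id \<rho> t)" by (simp only: te)
  also have "\<dots> = cmap A V (\<lambda>x. id (id x)) (\<lambda>v. tensor_lift V \<pi> (\<rho> v)) t"
    by (rule cmap_comp[where X = A and Y = V and X' = A and Y' = "ctensor C V"]) (use tc in simp_all)
  also have "\<dots> = cmap A V id id t"
    by (rule cmap_cong[where X = A and Y = V]) (use tc retraction clin_comp[OF \<rho>_clin lp] in simp_all)
  also have "\<dots> = t" by (rule cmap_ident[OF com_cspace cspace_V tc])
  finally show ?thesis .
qed

end

end

section \<open>Submodules and images of modules\<close>

definition lsubmodule :: "('r, 'x) ring_scheme \<Rightarrow> ('r, 'n, 'z) module_scheme \<Rightarrow> 'n set \<Rightarrow> bool" where
  "lsubmodule R N S \<longleftrightarrow> S \<subseteq> carrier N \<and> \<zero>\<^bsub>N\<^esub> \<in> S \<and> (\<forall>x\<in>S. \<forall>y\<in>S. x \<oplus>\<^bsub>N\<^esub> y \<in> S) \<and> (\<forall>r\<in>carrier R. \<forall>x\<in>S. r \<odot>\<^bsub>N\<^esub> x \<in> S)"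

lemma lsubmoduleD:
  assumes "lsubmodule R N S"
  shows "x \<in> S \<Longrightarrow> x \<in> carrier N" "\<zero>\<^bsub>N\<^esub> \<in> S" "x \<in> S \<Longrightarrow> y \<in> S \<Longrightarrow> x \<oplus>\<^bsub>N\<^esub> y \<in> S"
    "r \<in> carrier R \<Longrightarrow> x \<in> S \<Longrightarrow> r \<odot>\<^bsub>N\<^esub> x \<in> S"
  using assms by (auto simp: lsubmodule_def)

lemma lsubmodule_left_module:
  assumes N: "left_module R N" and S: "lsubmodule R N S"
  shows "left_module R (N\<lparr>carrier := S\<rparr>)"
proof -
  note L = left_moduleD[OF N] and D = lsubmoduleD[OF S]
  interpret R: ring R by (rule L(1))
  interpret N: abelian_group N by (rule L(2))
  show ?thesis
  proof (rule left_moduleI[OF L(1)])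
    show "abelian_group (N\<lparr>carrier := S\<rparr>)"
    proof (rule abelian_groupI)
      fix x assume "x \<in> carrier (N\<lparr>carrier := S\<rparr>)"
      then have x: "x \<in> S" "x \<in> carrier N" using D(1) by auto
      have "\<ominus>\<^bsub>N\<^esub> x \<in> S" using D(4)[of "\<ominus>\<^bsub>R\<^esub> \<one>\<^bsub>R\<^esub>" x] x by (simp add: left_smult_minus_one[OF N])
      then show "\<exists>y\<in>carrier (N\<lparr>carrier := S\<rparr>). y \<oplus>\<^bsub>N\<lparr>carrier := S\<rparr>\<^esub> x = \<zero>\<^bsub>N\<lparr>carrier := S\<rparr>\<^esub>"
        using x by (auto intro!: bexI[of _ "\<ominus>\<^bsub>N\<^esub> x"] simp: N.l_neg)
    qed (use D in \<open>simp_all add: N.a_ac\<close>)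
  qed (use D L in simp_all)
qed

text \<open>
  The module structure on the image of \<open>N\<close> under any map \<open>\<phi>\<close> whose fibres form a congruence. An injective
  \<open>\<phi>\<close> gives an isomorphic copy in another type, and the map to cosets gives a quotient module.
\<close>

definition image_module :: "('r, 'n, 'z) module_scheme \<Rightarrow> ('n \<Rightarrow> 'q) \<Rightarrow> ('r, 'q) module" where
  "image_module N \<phi> = \<lparr>carrier = \<phi> ` carrier N, monoid.mult = undefined, monoid.one = undefined,
     ring.zero = \<phi> \<zero>\<^bsub>N\<^esub>,
     ring.add = (\<lambda>u v. \<phi> (inv_into (carrier N) \<phi> u \<oplus>\<^bsub>N\<^esub> inv_into (carrier N) \<phi> v)),
     smult = (\<lambda>r u. \<phi> (r \<odot>\<^bsub>N\<^esub> inv_into (carrier N) \<phi> u))\<rparr>"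

lemma image_module:
  assumes N: "left_module R N"
    and add: "\<And>x x' y y'. x \<in> carrier N \<Longrightarrow> x' \<in> carrier N \<Longrightarrow> y \<in> carrier N \<Longrightarrow> y' \<in> carrier N \<Longrightarrow>
      \<phi> x = \<phi> x' \<Longrightarrow> \<phi> y = \<phi> y' \<Longrightarrow> \<phi> (x \<oplus>\<^bsub>N\<^esub> y) = \<phi> (x' \<oplus>\<^bsub>N\<^esub> y')"
    and smult: "\<And>r x x'. r \<in> carrier R \<Longrightarrow> x \<in> carrier N \<Longrightarrow> x' \<in> carrier N \<Longrightarrow> \<phi> x = \<phi> x' \<Longrightarrow>
      \<phi> (r \<odot>\<^bsub>N\<^esub> x) = \<phi> (r \<odot>\<^bsub>N\<^esub> x')"
  shows "left_module R (image_module N \<phi>)" "\<phi> \<in> mod_homs R N (image_module N \<phi>)"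
    "\<zero>\<^bsub>image_module N \<phi>\<^esub> = \<phi> \<zero>\<^bsub>N\<^esub>" "carrier (image_module N \<phi>) = \<phi> ` carrier N"
proof -
  note L = left_moduleD[OF N]
  interpret R: ring R by (rule L(1))
  interpret N: abelian_group N by (rule L(2))
  let ?I = "image_module N \<phi>" and ?g = "inv_into (carrier N) \<phi>"
  have g: "?g (\<phi> x) \<in> carrier N" "\<phi> (?g (\<phi> x)) = \<phi> x" if "x \<in> carrier N" for x
    using that by (simp_all add: inv_into_into f_inv_into_f)
  have a: "\<phi> x \<oplus>\<^bsub>?I\<^esub> \<phi> y = \<phi> (x \<oplus>\<^bsub>N\<^esub> y)" if "x \<in> carrier N" "y \<in> carrier N" for x y
    unfolding image_module_def by (simp, rule add) (use that g in simp_all)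
  have s: "r \<odot>\<^bsub>?I\<^esub> \<phi> x = \<phi> (r \<odot>\<^bsub>N\<^esub> x)" if "r \<in> carrier R" "x \<in> carrier N" for r x
    unfolding image_module_def by (simp, rule smult) (use that g in simp_all)
  show c: "carrier ?I = \<phi> ` carrier N" and z: "\<zero>\<^bsub>?I\<^esub> = \<phi> \<zero>\<^bsub>N\<^esub>" by (simp_all add: image_module_def)
  show "\<phi> \<in> mod_homs R N ?I" by (rule mod_homsI) (simp_all add: c a s)
  have ag: "abelian_group ?I"
  proof (rule abelian_groupI)
    fix u assume "u \<in> carrier ?I"
    then obtain x where x: "u = \<phi> x" "x \<in> carrier N" by (auto simp: c)
    have "\<phi> (\<ominus>\<^bsub>N\<^esub> x) \<oplus>\<^bsub>?I\<^esub> u = \<zero>\<^bsub>?I\<^esub>" unfolding x(1) using x(2) by (simp add: a z N.l_neg)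
    then show "\<exists>y\<in>carrier ?I. y \<oplus>\<^bsub>?I\<^esub> u = \<zero>\<^bsub>?I\<^esub>" using x(2) by (auto simp: c)
  qed (auto simp: c z a N.a_ac)
  show "left_module R ?I"
    by (rule left_moduleI[OF L(1) ag]) (auto simp: c a s L)
qed

section \<open>Faithful flatness\<close>

text \<open>
  A relation between tensors uses finitely many relators, and these mention finitely many elements of
  \<open>N\<close>. The relation therefore already holds over every submodule that contains them.
\<close>

lemma tensor_kernel_finite:
  assumes N: "left_module R N" and x: "x \<in> tensor_kernel R M N" and M: "right_module R M"
  shows "\<exists>S. finite S \<and> S \<subseteq> carrier N \<and> (\<forall>S'. lsubmodule R N S' \<and> S \<subseteq> S' \<longrightarrow> x \<in> tensor_kernel R M (N\<lparr>carrier := S'\<rparr>))"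
proof -
  have relS: "\<exists>S. finite S \<and> S \<subseteq> carrier N \<and> (\<forall>S'. lsubmodule R N S' \<and> S \<subseteq> S' \<longrightarrow> h \<in> tensor_relators R M (N\<lparr>carrier := S'\<rparr>))"
    if h: "h \<in> tensor_relators R M N" for h
  proof -
    from h consider (a) m m' n where "h = frag_of (m \<oplus>\<^bsub>M\<^esub> m', n) - frag_of (m, n) - frag_of (m', n)" "m \<in> carrier M" "m' \<in> carrier M" "n \<in> carrier N"
      | (b) m n n' where "h = frag_of (m, n \<oplus>\<^bsub>N\<^esub> n') - frag_of (m, n) - frag_of (m, n')" "m \<in> carrier M" "n \<in> carrier N" "n' \<in> carrier N"
      | (c) r m n where "h = frag_of (r \<odot>\<^bsub>M\<^esub> m, n) - frag_of (m, r \<odot>\<^bsub>N\<^esub> n)" "r \<in> carrier R" "m \<in> carrier M" "n \<in> carrier N"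
      unfolding tensor_relators_def by blast
    then show ?thesis
    proof cases
      case a
      show ?thesis by (rule exI[of _ "{n}"], unfold tensor_relators_def) (use a in auto)
    next
      case b
      show ?thesis by (rule exI[of _ "{n, n'}"], unfold tensor_relators_def) (use b in auto)
    next
      case c
      show ?thesis by (rule exI[of _ "{n}"], unfold tensor_relators_def) (use c in auto)
    qed
  qed
  have keysN: "Poly_Mapping.keys h \<subseteq> carrier M \<times> carrier N" if "h \<in> tensor_relators R M N" for h
    using subsetD[OF tensor_relators_carrier[OF M N] that] by simp
  have keysS: "Poly_Mapping.keys h \<subseteq> carrier M \<times> S'"
    if "h \<in> tensor_relators R M (N\<lparr>carrier := S'\<rparr>)" "lsubmodule R N S'" for h S'
    using subsetD[OF tensor_relators_carrier[OF M lsubmodule_left_module[OF N that(2)]] that(1)] by simp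
  show ?thesis
    using x unfolding tensor_kernel_def
  proof (induction x rule: generate.induct)
    case one
    show ?case by (rule exI[of _ "{}"]) (auto intro: generate.one[of "free_Abelian_group _", simplified])
  next
    case (incl h)
    then show ?case using relS[of h] by (metis generate.incl)
  next
    case (inv h)
    obtain S where S: "finite S" "S \<subseteq> carrier N" "\<And>S'. lsubmodule R N S' \<Longrightarrow> S \<subseteq> S' \<Longrightarrow> h \<in> tensor_relators R M (N\<lparr>carrier := S'\<rparr>)"
      using relS[OF inv] by metis
    have "- h \<in> generate (free_Abelian_group (carrier M \<times> S')) (tensor_relators R M (N\<lparr>carrier := S'\<rparr>))"
      if "lsubmodule R N S'" "S \<subseteq> S'" for S'
      using generate.inv[OF S(3)[OF that], of "free_Abelian_group (carrier M \<times> S')"] keysS[OF S(3)[OF that] that(1)] by simp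
    then show ?case using S(1,2) keysN[OF inv] by (intro exI[of _ S]) simp
  next
    case (eng h1 h2)
    from eng(3) obtain S1 where S1: "finite S1" "S1 \<subseteq> carrier N" "\<forall>S'. lsubmodule R N S' \<and> S1 \<subseteq> S' \<longrightarrow>
      h1 \<in> generate (free_Abelian_group (carrier M \<times> carrier (N\<lparr>carrier := S'\<rparr>))) (tensor_relators R M (N\<lparr>carrier := S'\<rparr>))" by (elim exE conjE) (rule that)
    from eng(4) obtain S2 where S2: "finite S2" "S2 \<subseteq> carrier N" "\<forall>S'. lsubmodule R N S' \<and> S2 \<subseteq> S' \<longrightarrow>
      h2 \<in> generate (free_Abelian_group (carrier M \<times> carrier (N\<lparr>carrier := S'\<rparr>))) (tensor_relators R M (N\<lparr>carrier := S'\<rparr>))" by (elim exE conjE) (rule that)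
    have "h1 + h2 \<in> generate (free_Abelian_group (carrier M \<times> S')) (tensor_relators R M (N\<lparr>carrier := S'\<rparr>))"
      if "lsubmodule R N S'" "S1 \<union> S2 \<subseteq> S'" for S'
      using generate.eng[of h1 "free_Abelian_group (carrier M \<times> S')" "tensor_relators R M (N\<lparr>carrier := S'\<rparr>)" h2]
        S1(3)[rule_format, of S'] S2(3)[rule_format, of S'] that by simp
    then show ?case using S1(1,2) S2(1,2) by (intro exI[of _ "S1 \<union> S2"]) simp
  qed
qed

lemma pure_zero_right:
  assumes M: "right_module R M" and N: "left_module R N" and m: "m \<in> carrier M"
  shows "pure_tensor R M N m \<zero>\<^bsub>N\<^esub> = \<zero>\<^bsub>tensor R M N\<^esub>"
  by (rule additive_zero[OF left_moduleD(2)[OF N] tensor_abelian_group[OF M N], where g = "pure_tensor R M N m"])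
    (use m in \<open>auto simp: additive_map_def pure_closed[OF M N] pure_add_right[OF M N]\<close>)

lemma pure_eq_zero_iff:
  assumes M: "right_module R M" and N: "left_module R N" and "m \<in> carrier M" "n \<in> carrier N"
  shows "pure_tensor R M N m n = \<zero>\<^bsub>tensor R M N\<^esub> \<longleftrightarrow> frag_of (m, n) \<in> tensor_kernel R M N"
  unfolding pure_tensor_def tensor_cls_zero[OF M N]
  by (subst tensor_cls_eq[OF M N]) (use assms in auto)

lemma tensor_all_zero:
  assumes M: "right_module R M" and N: "left_module R N"
    and p: "\<And>m n. m \<in> carrier M \<Longrightarrow> n \<in> carrier N \<Longrightarrow> pure_tensor R M N m n = \<zero>\<^bsub>tensor R M N\<^esub>"
  shows "carrier (tensor R M N) = {\<zero>\<^bsub>tensor R M N\<^esub>}"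
proof -
  interpret T: abelian_group "tensor R M N" by (rule tensor_abelian_group[OF M N])
  have "t = \<zero>\<^bsub>tensor R M N\<^esub>" if "t \<in> carrier (tensor R M N)" for t
    using that by (rule tensor_induct[OF M N]) (simp_all add: p)
  then show ?thesis by auto
qed

definition lspan :: "('r, 'x) ring_scheme \<Rightarrow> ('r, 'n, 'z) module_scheme \<Rightarrow> 'n list \<Rightarrow> 'n set" where
  "lspan R N xs = {(\<Oplus>\<^bsub>N\<^esub>i\<in>{..<length xs}. r i \<odot>\<^bsub>N\<^esub> xs ! i) |r. \<forall>i. r i \<in> carrier R}"

lemma lspan_lsubmodule:
  assumes N: "left_module R N" and xs: "set xs \<subseteq> carrier N"
  shows "lsubmodule R N (lspan R N xs)" "set xs \<subseteq> lspan R N xs"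
proof -
  note L = left_moduleD[OF N]
  interpret R: ring R by (rule L(1))
  interpret N: abelian_group N by (rule L(2))
  let ?s = "\<lambda>r. (\<Oplus>\<^bsub>N\<^esub>i\<in>{..<length xs}. r i \<odot>\<^bsub>N\<^esub> xs ! i)"
  have xi: "i < length xs \<Longrightarrow> xs ! i \<in> carrier N" for i using xs by auto
  have cl: "r i \<odot>\<^bsub>N\<^esub> xs ! i \<in> carrier N" if "\<forall>i. r i \<in> carrier R" "i < length xs" for r i
    using that xi L(3) by simp
  have scl: "?s r \<in> carrier N" if "\<forall>i. r i \<in> carrier R" for r
    by (rule N.finsum_closed) (use cl[OF that] in auto)
  show "lsubmodule R N (lspan R N xs)"
    unfolding lsubmodule_def
  proof (intro conjI ballI)
    show "lspan R N xs \<subseteq> carrier N" using scl by (auto simp: lspan_def)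
    have "?s (\<lambda>_. \<zero>\<^bsub>R\<^esub>) = (\<Oplus>\<^bsub>N\<^esub>i\<in>{..<length xs}. \<zero>\<^bsub>N\<^esub>)"
      by (rule N.finsum_cong') (use xi left_smult_zero(2)[OF N] in auto)
    then have "\<zero>\<^bsub>N\<^esub> = ?s (\<lambda>_. \<zero>\<^bsub>R\<^esub>)" by simp
    then show "\<zero>\<^bsub>N\<^esub> \<in> lspan R N xs" unfolding lspan_def by (intro CollectI exI[of _ "\<lambda>_. \<zero>\<^bsub>R\<^esub>"]) simp
    fix x y assume "x \<in> lspan R N xs" "y \<in> lspan R N xs"
    then obtain r s where r: "x = ?s r" "\<forall>i. r i \<in> carrier R" and s: "y = ?s s" "\<forall>i. s i \<in> carrier R" unfolding lspan_def by blast
    have "x \<oplus>\<^bsub>N\<^esub> y = (\<Oplus>\<^bsub>N\<^esub>i\<in>{..<length xs}. r i \<odot>\<^bsub>N\<^esub> xs ! i \<oplus>\<^bsub>N\<^esub> s i \<odot>\<^bsub>N\<^esub> xs ! i)"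
      unfolding r(1) s(1) by (rule N.finsum_addf[symmetric]) (use cl r s in auto)
    also have "\<dots> = ?s (\<lambda>i. r i \<oplus>\<^bsub>R\<^esub> s i)"
      by (rule N.finsum_cong') (use cl r s xi L(4) in \<open>auto intro!: L(3)\<close>)
    finally show "x \<oplus>\<^bsub>N\<^esub> y \<in> lspan R N xs" unfolding lspan_def using r s by (intro CollectI exI[of _ "\<lambda>i. r i \<oplus>\<^bsub>R\<^esub> s i"]) simp
  next
    fix a x assume a: "a \<in> carrier R" and "x \<in> lspan R N xs"
    then obtain r where r: "x = ?s r" "\<forall>i. r i \<in> carrier R" unfolding lspan_def by blast
    have add: "additive_map N N (\<lambda>x. a \<odot>\<^bsub>N\<^esub> x)" using a by (simp add: additive_map_def L)
    have "a \<odot>\<^bsub>N\<^esub> x = (\<Oplus>\<^bsub>N\<^esub>i\<in>{..<length xs}. a \<odot>\<^bsub>N\<^esub> (r i \<odot>\<^bsub>N\<^esub> xs ! i))"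
      unfolding r(1) by (rule additive_finsum[OF L(2) L(2) add]) (use cl r in auto)
    also have "\<dots> = ?s (\<lambda>i. a \<otimes>\<^bsub>R\<^esub> r i)"
      by (rule N.finsum_cong') (use a r xi L(6) in \<open>auto intro!: L(3)\<close>)
    finally show "a \<odot>\<^bsub>N\<^esub> x \<in> lspan R N xs" unfolding lspan_def using a r by (intro CollectI exI[of _ "\<lambda>i. a \<otimes>\<^bsub>R\<^esub> r i"]) simp
  qed
  show "set xs \<subseteq> lspan R N xs"
  proof
    fix x assume "x \<in> set xs"
    then obtain j where j: "j < length xs" "x = xs ! j" by (auto simp: in_set_conv_nth)
    have "?s (\<lambda>i. if j = i then \<one>\<^bsub>R\<^esub> else \<zero>\<^bsub>R\<^esub>) = (\<Oplus>\<^bsub>N\<^esub>i\<in>{..<length xs}. if j = i then xs ! i else \<zero>\<^bsub>N\<^esub>)"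
      by (rule N.finsum_cong') (use xi L(7) left_smult_zero(2)[OF N] in auto)
    also have "\<dots> = xs ! j" by (rule N.finsum_singleton) (use j xi in auto)
    finally have "x = ?s (\<lambda>i. if j = i then \<one>\<^bsub>R\<^esub> else \<zero>\<^bsub>R\<^esub>)" using j by simp
    then show "x \<in> lspan R N xs" unfolding lspan_def by (intro CollectI exI[of _ "\<lambda>i. if j = i then \<one>\<^bsub>R\<^esub> else \<zero>\<^bsub>R\<^esub>"]) simp
  qed
qed

text \<open>
  A relation \<open>e \<otimes> n = 0\<close> holds over a finitely generated submodule \<open>N\<^sub>0\<close> of \<open>N\<close>, which has an isomorphic
  copy \<open>T\<close> among the test modules. Let \<open>K\<close> be the cyclic submodule of \<open>T\<close> generated by \<open>n\<close>. Flatness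
  moves the relation into \<open>M \<otimes> K\<close>; since the endomorphisms of \<open>M\<close> carry \<open>e\<close> to every element, all of
  \<open>M \<otimes> K\<close> vanishes. Faithfulness, applied to \<open>0 \<rightarrow> K \<rightarrow> 0\<close>, gives \<open>K = 0\<close>.
\<close>

lemma faithfully_flat_unit:
  fixes R :: "('r, 'x) ring_scheme" and M :: "('r, 'm, 'y) module_scheme" and N :: "('r, 'n, 'z) module_scheme"
  assumes ff: "faithfully_flat_right R M" and N: "left_module R N" and e: "e \<in> carrier M"
    and gen: "\<And>m. m \<in> carrier M \<Longrightarrow> \<exists>l\<in>mod_homs R M M. l e = m"
    and n: "n \<in> carrier N" and z: "pure_tensor R M N e n = \<zero>\<^bsub>tensor R M N\<^esub>"
  shows "n = \<zero>\<^bsub>N\<^esub>"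
proof -
  have M: "right_module R M" using ff by (simp add: faithfully_flat_right_def)
  note L = left_moduleD[OF N]
  interpret R: ring R by (rule L(1))
  interpret N: abelian_group N by (rule L(2))
  have "frag_of (e, n) \<in> tensor_kernel R M N" using z pure_eq_zero_iff[OF M N e n] by simp
  from tensor_kernel_finite[OF N this M] obtain S where S: "finite S" "S \<subseteq> carrier N"
    "\<forall>S'. lsubmodule R N S' \<and> S \<subseteq> S' \<longrightarrow> frag_of (e, n) \<in> tensor_kernel R M (N\<lparr>carrier := S'\<rparr>)" by (elim exE conjE) (rule that)
  obtain xs where xs: "set xs = insert n S" using S(1) finite_list[of "insert n S"] by auto
  have xsc: "set xs \<subseteq> carrier N" using xs S(2) n by simp
  define S' where "S' = lspan R N xs"
  have S': "lsubmodule R N S'" "S \<subseteq> S'" "n \<in> S'"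
    unfolding S'_def using lspan_lsubmodule[OF N xsc] xs by auto
  let ?N0 = "N\<lparr>carrier := S'\<rparr>"
  have N0: "left_module R ?N0" by (rule lsubmodule_left_module[OF N S'(1)])
  have z0: "pure_tensor R M ?N0 e n = \<zero>\<^bsub>tensor R M ?N0\<^esub>"
    using pure_eq_zero_iff[OF M N0 e, of n] S' S(3) by simp
  (* x is coded by the set of its coefficient tuples, which lives in the type of the test modules. *)
  define \<phi> :: "'n \<Rightarrow> (nat \<Rightarrow> 'r) set" where
    "\<phi> x = {r. (\<forall>i. r i \<in> carrier R) \<and> x = (\<Oplus>\<^bsub>N\<^esub>i\<in>{..<length xs}. r i \<odot>\<^bsub>N\<^esub> xs ! i)}" for x
  have inj: "x = y" if "x \<in> S'" "\<phi> x = \<phi> y" for x y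
  proof -
    from that(1) obtain r where "\<forall>i. r i \<in> carrier R" "x = (\<Oplus>\<^bsub>N\<^esub>i\<in>{..<length xs}. r i \<odot>\<^bsub>N\<^esub> xs ! i)"
      unfolding S'_def lspan_def by blast
    moreover from this have "r \<in> \<phi> y" using that(2) unfolding \<phi>_def by blast
    ultimately show ?thesis unfolding \<phi>_def by simp
  qed
  define T where "T = image_module ?N0 \<phi>"
  have T: "left_module R T" "\<phi> \<in> mod_homs R ?N0 T" "\<zero>\<^bsub>T\<^esub> = \<phi> \<zero>\<^bsub>N\<^esub>" "carrier T = \<phi> ` S'"
  proof -
    have ca: "\<phi> (x \<oplus>\<^bsub>?N0\<^esub> y) = \<phi> (x' \<oplus>\<^bsub>?N0\<^esub> y')"
      if "x \<in> carrier ?N0" "x' \<in> carrier ?N0" "y \<in> carrier ?N0" "y' \<in> carrier ?N0" "\<phi> x = \<phi> x'" "\<phi> y = \<phi> y'" for x x' y y'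
      using inj[of x x'] inj[of y y'] that by simp
    have cs: "\<phi> (r \<odot>\<^bsub>?N0\<^esub> x) = \<phi> (r \<odot>\<^bsub>?N0\<^esub> x')"
      if "r \<in> carrier R" "x \<in> carrier ?N0" "x' \<in> carrier ?N0" "\<phi> x = \<phi> x'" for r x x'
      using inj[of x x'] that by simp
    show "left_module R T" "\<phi> \<in> mod_homs R ?N0 T" "\<zero>\<^bsub>T\<^esub> = \<phi> \<zero>\<^bsub>N\<^esub>" "carrier T = \<phi> ` S'"
      unfolding T_def
      by (rule image_module(1)[OF N0], rule ca, assumption+, rule cs, assumption+)
        (rule image_module(2)[OF N0], rule ca, assumption+, rule cs, assumption+,
          simp_all add: image_module_def)
  qed
  note TL = left_moduleD[OF T(1)]
  interpret T: abelian_group T by (rule TL(2))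
  have nu: "\<phi> n \<in> carrier T" using T(4) S'(3) by simp
  have zT: "pure_tensor R M T e (\<phi> n) = \<zero>\<^bsub>tensor R M T\<^esub>"
  proof -
    have "pure_tensor R M T e (\<phi> n) = tensor_map R M T id \<phi> (pure_tensor R M ?N0 e n)"
      using tensor_map_pure[OF M N0 M T(1) mod_homs_id T(2) e, of n] S'(3) by simp
    also have "\<dots> = \<zero>\<^bsub>tensor R M T\<^esub>"
      unfolding z0 by (rule additive_zero[OF tensor_abelian_group[OF M N0] tensor_abelian_group[OF M T(1)]
            tensor_map_additive[OF M N0 M T(1) mod_homs_id T(2)]])
    finally show ?thesis .
  qed
  define K where "K = {r \<odot>\<^bsub>T\<^esub> \<phi> n |r. r \<in> carrier R}"
  have K: "lsubmodule R T K"
    unfolding lsubmodule_def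
  proof (intro conjI ballI)
    show "K \<subseteq> carrier T" unfolding K_def using TL(3) nu by blast
    have "\<zero>\<^bsub>T\<^esub> = \<zero>\<^bsub>R\<^esub> \<odot>\<^bsub>T\<^esub> \<phi> n" using left_smult_zero(2)[OF T(1) nu] by simp
    then show "\<zero>\<^bsub>T\<^esub> \<in> K" unfolding K_def by blast
    fix x y assume "x \<in> K" "y \<in> K"
    then obtain r s where "x = r \<odot>\<^bsub>T\<^esub> \<phi> n" "y = s \<odot>\<^bsub>T\<^esub> \<phi> n" "r \<in> carrier R" "s \<in> carrier R" unfolding K_def by blast
    then have "x \<oplus>\<^bsub>T\<^esub> y = (r \<oplus>\<^bsub>R\<^esub> s) \<odot>\<^bsub>T\<^esub> \<phi> n" "r \<oplus>\<^bsub>R\<^esub> s \<in> carrier R" using TL(4) nu by simp_all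
    then show "x \<oplus>\<^bsub>T\<^esub> y \<in> K" unfolding K_def by blast
  next
    fix a x assume a: "a \<in> carrier R" and "x \<in> K"
    then obtain r where "x = r \<odot>\<^bsub>T\<^esub> \<phi> n" "r \<in> carrier R" unfolding K_def by blast
    then have "a \<odot>\<^bsub>T\<^esub> x = (a \<otimes>\<^bsub>R\<^esub> r) \<odot>\<^bsub>T\<^esub> \<phi> n" "a \<otimes>\<^bsub>R\<^esub> r \<in> carrier R" using TL(6) nu a by simp_all
    then show "a \<odot>\<^bsub>T\<^esub> x \<in> K" unfolding K_def by blast
  qed
  have nK: "\<phi> n \<in> K" unfolding K_def using TL(7)[OF nu] R.one_closed by (intro CollectI exI[of _ "\<one>\<^bsub>R\<^esub>"]) simp
  let ?K = "T\<lparr>carrier := K\<rparr>" and ?Z = "T\<lparr>carrier := {\<zero>\<^bsub>T\<^esub>}\<rparr>"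
  have KL: "left_module R ?K" by (rule lsubmodule_left_module[OF T(1) K])
  have ZL: "left_module R ?Z"
    by (rule lsubmodule_left_module[OF T(1)]) (simp add: lsubmodule_def left_smult_zero[OF T(1)])
  have h1: "id \<in> mod_homs R ?Z ?K" "id \<in> mod_homs R ?K T" "(\<lambda>_. \<zero>\<^bsub>T\<^esub>) \<in> mod_homs R ?K ?Z"
    using lsubmoduleD[OF K] left_smult_zero(1)[OF T(1)] by (auto intro!: mod_homsI)
  have ff': "exact_at N1 g N2 h N3 \<longleftrightarrow> exact_at (tensor R M N1) (tensor_map R M N2 id g) (tensor R M N2) (tensor_map R M N3 id h) (tensor R M N3)"
    if "left_module R N1" "left_module R N2" "left_module R N3" "g \<in> mod_homs R N1 N2" "h \<in> mod_homs R N2 N3"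
    for N1 N2 N3 :: "('r, (nat \<Rightarrow> 'r) set) module" and g h
    using ff that unfolding faithfully_flat_right_def by blast
  have Zt: "carrier (tensor R M ?Z) = {\<zero>\<^bsub>tensor R M ?Z\<^esub>}"
    by (rule tensor_all_zero[OF M ZL]) (use pure_zero_right[OF M ZL] in simp)
  have Zim: "tensor_map R M ?K id id ` carrier (tensor R M ?Z) = {\<zero>\<^bsub>tensor R M ?K\<^esub>}"
    unfolding Zt using additive_zero[OF tensor_abelian_group[OF M ZL] tensor_abelian_group[OF M KL]
        tensor_map_additive[OF M ZL M KL mod_homs_id h1(1)]] by simp
  have ex1: "exact_at ?Z id ?K id T"
    using lsubmoduleD(2)[OF K] by (auto simp: exact_at_def)
  have "exact_at (tensor R M ?Z) (tensor_map R M ?K id id) (tensor R M ?K) (tensor_map R M T id id) (tensor R M T)"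
    using ff'[OF ZL KL T(1) h1(1,2)] ex1 by simp
  then have ker1: "{y \<in> carrier (tensor R M ?K). tensor_map R M T id id y = \<zero>\<^bsub>tensor R M T\<^esub>} = {\<zero>\<^bsub>tensor R M ?K\<^esub>}"
    unfolding exact_at_def Zim by simp
  have nKc: "\<phi> n \<in> carrier ?K" using nK by simp
  have "tensor_map R M T id id (pure_tensor R M ?K e (\<phi> n)) = \<zero>\<^bsub>tensor R M T\<^esub>"
    using tensor_map_pure[OF M KL M T(1) mod_homs_id h1(2) e nKc] zT by simp
  then have zK: "pure_tensor R M ?K e (\<phi> n) = \<zero>\<^bsub>tensor R M ?K\<^esub>"
    using ker1 pure_closed[OF M KL e nKc] by blast
  have Kt: "carrier (tensor R M ?K) = {\<zero>\<^bsub>tensor R M ?K\<^esub>}"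
  proof (rule tensor_all_zero[OF M KL])
    fix m k assume m: "m \<in> carrier M" and "k \<in> carrier ?K"
    then obtain r where r: "k = r \<odot>\<^bsub>?K\<^esub> \<phi> n" "r \<in> carrier R" by (auto simp: K_def)
    have rm: "r \<odot>\<^bsub>M\<^esub> m \<in> carrier M" using M r(2) m by (simp add: right_module_def right_module_axioms_def)
    obtain l where l: "l \<in> mod_homs R M M" "l e = r \<odot>\<^bsub>M\<^esub> m" using gen[OF rm] by blast
    have "pure_tensor R M ?K m k = pure_tensor R M ?K (r \<odot>\<^bsub>M\<^esub> m) (\<phi> n)"
      unfolding r(1) by (rule pure_balanced[OF M KL r(2) m nKc, symmetric])
    also have "\<dots> = tensor_map R M ?K l id (pure_tensor R M ?K e (\<phi> n))"
      using tensor_map_pure[OF M KL M KL l(1) mod_homs_id e nKc] l(2) by simp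
    also have "\<dots> = \<zero>\<^bsub>tensor R M ?K\<^esub>"
      unfolding zK by (rule additive_zero[OF tensor_abelian_group[OF M KL] tensor_abelian_group[OF M KL]
            tensor_map_additive[OF M KL M KL l(1) mod_homs_id]])
    finally show "pure_tensor R M ?K m k = \<zero>\<^bsub>tensor R M ?K\<^esub>" .
  qed
  have "tensor_map R M ?Z id (\<lambda>_. \<zero>\<^bsub>T\<^esub>) \<zero>\<^bsub>tensor R M ?K\<^esub> = \<zero>\<^bsub>tensor R M ?Z\<^esub>"
    by (rule additive_zero[OF tensor_abelian_group[OF M KL] tensor_abelian_group[OF M ZL]
            tensor_map_additive[OF M KL M ZL mod_homs_id h1(3)]])
  then have "exact_at (tensor R M ?Z) (tensor_map R M ?K id id) (tensor R M ?K) (tensor_map R M ?Z id (\<lambda>_. \<zero>\<^bsub>T\<^esub>)) (tensor R M ?Z)"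
    unfolding exact_at_def Zim Kt by auto
  then have "exact_at ?Z id ?K (\<lambda>_. \<zero>\<^bsub>T\<^esub>) ?Z" using ff'[OF ZL KL ZL h1(1,3)] by simp
  then have "K = {\<zero>\<^bsub>T\<^esub>}" by (auto simp: exact_at_def)
  then have "\<phi> n = \<phi> \<zero>\<^bsub>N\<^esub>" using nK T(3) by simp
  then show ?thesis by (rule inj[OF S'(3)])
qed

section \<open>Algebras and coinvariants\<close>

lemma complex_algebraD:
  assumes "complex_algebra A"
  shows "ring A" "cspace A"
    "x \<in> carrier A \<Longrightarrow> y \<in> carrier A \<Longrightarrow> (c \<odot>\<^bsub>A\<^esub> x) \<otimes>\<^bsub>A\<^esub> y = c \<odot>\<^bsub>A\<^esub> (x \<otimes>\<^bsub>A\<^esub> y)"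
    "x \<in> carrier A \<Longrightarrow> y \<in> carrier A \<Longrightarrow> x \<otimes>\<^bsub>A\<^esub> (c \<odot>\<^bsub>A\<^esub> y) = c \<odot>\<^bsub>A\<^esub> (x \<otimes>\<^bsub>A\<^esub> y)"
  using assms by (auto simp: complex_algebra_def)

locale calgebra = fixes A :: "(complex, 'a) module" assumes alg: "complex_algebra A"
begin

sublocale ring A by (rule complex_algebraD(1)[OF alg])

lemma cspace_A [simp]: "cspace A" by (rule complex_algebraD(2)[OF alg])

lemmas smult_mult = complex_algebraD(3,4)[OF alg]

lemma lmult_clin: "a \<in> carrier A \<Longrightarrow> (\<lambda>x. a \<otimes>\<^bsub>A\<^esub> x) \<in> clin A A"
  by (rule clinI) (simp_all add: smult_mult r_distr)

lemma rmult_clin: "a \<in> carrier A \<Longrightarrow> (\<lambda>x. x \<otimes>\<^bsub>A\<^esub> a) \<in> clin A A"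
  by (rule clinI) (simp_all add: smult_mult l_distr)

lemma left_act_clin: "cspace X \<Longrightarrow> a \<in> carrier A \<Longrightarrow> left_act A X a \<in> clin (ctensor A X) (ctensor A X)"
  unfolding left_act_def by (rule cmap_clin) (simp_all add: lmult_clin)

lemma left_act_pure: "cspace X \<Longrightarrow> a \<in> carrier A \<Longrightarrow> x \<in> carrier A \<Longrightarrow> y \<in> carrier X \<Longrightarrow>
    left_act A X a (cpure A X x y) = cpure A X (a \<otimes>\<^bsub>A\<^esub> x) y"
  unfolding left_act_def by (simp add: lmult_clin)

lemma left_act_clin_left:
  assumes X: "cspace X" and t: "t \<in> carrier (ctensor A X)"
  shows "(\<lambda>a. left_act A X a t) \<in> clin A (ctensor A X)"
  unfolding left_act_def cmap_eq
proof (rule clift_param_clin[OF cspace_A cspace_A X _ _ _ t])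
  show "cspace (ctensor A X)" using X by simp
  show "cbilin A X (ctensor A X) (\<lambda>x y. cpure A X (a \<otimes>\<^bsub>A\<^esub> x) (id y))" if "a \<in> carrier A" for a
    by (rule cmap_cbilin[OF cspace_A X lmult_clin[OF that] clin_id])
  show "(\<lambda>a. cpure A X (a \<otimes>\<^bsub>A\<^esub> y) (id z)) \<in> clin A (ctensor A X)" if "y \<in> carrier A" "z \<in> carrier X" for y z
    using clin_comp[OF rmult_clin[OF that(1)] cbilinD(2)[OF cbilin_cpure[OF cspace_A X] that(2)]] by simp
qed

lemma left_act_closed: "cspace X \<Longrightarrow> a \<in> carrier A \<Longrightarrow> t \<in> carrier (ctensor A X) \<Longrightarrow> left_act A X a t \<in> carrier (ctensor A X)"
  by (rule clinD(1)[OF left_act_clin])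

lemma left_act_mult:
  assumes "cspace X" "a \<in> carrier A" "b \<in> carrier A" "t \<in> carrier (ctensor A X)"
  shows "left_act A X (a \<otimes>\<^bsub>A\<^esub> b) t = left_act A X a (left_act A X b t)"
  by (rule ctensor_eqI[OF cspace_A assms(1) left_act_clin clin_comp[OF left_act_clin left_act_clin] _ assms(4)])
    (use assms in \<open>simp_all add: left_act_pure m_assoc\<close>)

lemma left_act_one:
  assumes "cspace X" "t \<in> carrier (ctensor A X)"
  shows "left_act A X \<one>\<^bsub>A\<^esub> t = t"
  by (rule ctensor_eqI[OF cspace_A assms(1) left_act_clin clin_ident _ assms(2)])
    (use assms in \<open>simp_all add: left_act_pure\<close>)

lemma left_act_scalar:
  assumes "cspace X" "t \<in> carrier (ctensor A X)"
  shows "left_act A X (c \<odot>\<^bsub>A\<^esub> \<one>\<^bsub>A\<^esub>) t = c \<odot>\<^bsub>ctensor A X\<^esub> t"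
  using clinD(3)[OF left_act_clin_left[OF assms], of "\<one>\<^bsub>A\<^esub>" c] left_act_one[OF assms] by simp

lemma left_act_natural:
  assumes X: "cspace X" and Y: "cspace Y" and h: "h \<in> clin X Y" and a: "a \<in> carrier A" and t: "t \<in> carrier (ctensor A X)"
  shows "cmap A Y id h (left_act A X a t) = left_act A Y a (cmap A Y id h t)"
  by (rule ctensor_eqI[OF cspace_A X clin_comp[OF left_act_clin cmap_clin] clin_comp[OF cmap_clin left_act_clin] _ t])
    (use X Y h a in \<open>simp_all add: left_act_pure clinD(1)[OF h]\<close>)

end

lemma right_moduleI:
  assumes "ring R" "abelian_group N"
    and "\<And>a x. a \<in> carrier R \<Longrightarrow> x \<in> carrier N \<Longrightarrow> a \<odot>\<^bsub>N\<^esub> x \<in> carrier N"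
    and "\<And>a b x. a \<in> carrier R \<Longrightarrow> b \<in> carrier R \<Longrightarrow> x \<in> carrier N \<Longrightarrow> (a \<oplus>\<^bsub>R\<^esub> b) \<odot>\<^bsub>N\<^esub> x = a \<odot>\<^bsub>N\<^esub> x \<oplus>\<^bsub>N\<^esub> b \<odot>\<^bsub>N\<^esub> x"
    and "\<And>a x y. a \<in> carrier R \<Longrightarrow> x \<in> carrier N \<Longrightarrow> y \<in> carrier N \<Longrightarrow> a \<odot>\<^bsub>N\<^esub> (x \<oplus>\<^bsub>N\<^esub> y) = a \<odot>\<^bsub>N\<^esub> x \<oplus>\<^bsub>N\<^esub> a \<odot>\<^bsub>N\<^esub> y"
    and "\<And>a b x. a \<in> carrier R \<Longrightarrow> b \<in> carrier R \<Longrightarrow> x \<in> carrier N \<Longrightarrow> (a \<otimes>\<^bsub>R\<^esub> b) \<odot>\<^bsub>N\<^esub> x = b \<odot>\<^bsub>N\<^esub> (a \<odot>\<^bsub>N\<^esub> x)"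
    and "\<And>x. x \<in> carrier N \<Longrightarrow> \<one>\<^bsub>R\<^esub> \<odot>\<^bsub>N\<^esub> x = x"
  shows "right_module R N"
  using assms by (simp add: right_module_def right_module_axioms_def)

lemma restricted_simps [simp]:
  "carrier (restricted_right_module S f) = carrier S" "x \<oplus>\<^bsub>restricted_right_module S f\<^esub> y = x \<oplus>\<^bsub>S\<^esub> y"
  "\<zero>\<^bsub>restricted_right_module S f\<^esub> = \<zero>\<^bsub>S\<^esub>" "b \<odot>\<^bsub>restricted_right_module S f\<^esub> x = x \<otimes>\<^bsub>S\<^esub> f b"
  by (simp_all add: restricted_right_module_def)

lemma left_mult_simps [simp]:
  "carrier (left_mult_module S) = carrier S" "x \<oplus>\<^bsub>left_mult_module S\<^esub> y = x \<oplus>\<^bsub>S\<^esub> y"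
  "\<zero>\<^bsub>left_mult_module S\<^esub> = \<zero>\<^bsub>S\<^esub>" "b \<odot>\<^bsub>left_mult_module S\<^esub> x = b \<otimes>\<^bsub>S\<^esub> x"
  by (simp_all add: left_mult_module_def)

lemma right_mult_restricted: "right_mult_module S = restricted_right_module S id"
  by (simp add: right_mult_module_def restricted_right_module_def)

lemma restricted_right_module:
  assumes "ring R" "ring S" "f \<in> ring_hom R S"
  shows "right_module R (restricted_right_module S f)"
proof -
  interpret S: ring S by fact
  show ?thesis
    by (rule right_moduleI[OF assms(1)])
      (simp_all add: restricted_right_module_def S.is_abelian_group ring_hom_closed[OF assms(3)] ring_hom_add[OF assms(3)]
        ring_hom_mult[OF assms(3)] ring_hom_one[OF assms(3)] S.r_distr S.l_distr S.m_assoc)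
qed

locale comodule_algebra = coalg C + calgebra A for C :: "'c coalgebra" and A :: "(complex, 'a) module" +
  fixes \<delta> :: "'a \<Rightarrow> ('a, 'c) tens"
  assumes com: "right_comodule C A \<delta>"
begin

abbreviation "B \<equiv> coinv_alg C A \<delta>"

lemma \<delta>_clin: "\<delta> \<in> clin A (ctensor A C)" using right_comoduleD[OF com] by simp
lemma \<delta>_closed: "a \<in> carrier A \<Longrightarrow> \<delta> a \<in> carrier (ctensor A C)" by (rule clinD(1)[OF \<delta>_clin])

lemma B_simps [simp]: "carrier B = coinvariants C A \<delta>" "x \<oplus>\<^bsub>B\<^esub> y = x \<oplus>\<^bsub>A\<^esub> y" "x \<otimes>\<^bsub>B\<^esub> y = x \<otimes>\<^bsub>A\<^esub> y"
  "\<zero>\<^bsub>B\<^esub> = \<zero>\<^bsub>A\<^esub>" "\<one>\<^bsub>B\<^esub> = \<one>\<^bsub>A\<^esub>" "c \<odot>\<^bsub>B\<^esub> x = c \<odot>\<^bsub>A\<^esub> x"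
  by (simp_all add: coinv_alg_def)

lemma coinvD: "b \<in> coinvariants C A \<delta> \<Longrightarrow> b \<in> carrier A"
  "b \<in> coinvariants C A \<delta> \<Longrightarrow> a \<in> carrier A \<Longrightarrow> \<delta> (b \<otimes>\<^bsub>A\<^esub> a) = left_act A C b (\<delta> a)"
  by (auto simp: coinvariants_def)

lemma coinvI: "b \<in> carrier A \<Longrightarrow> (\<And>a. a \<in> carrier A \<Longrightarrow> \<delta> (b \<otimes>\<^bsub>A\<^esub> a) = left_act A C b (\<delta> a)) \<Longrightarrow> b \<in> coinvariants C A \<delta>"
  by (auto simp: coinvariants_def)

lemma coinv_csubspace: "csubspace A (coinvariants C A \<delta>)"
proof (rule csubspaceI)
  show "coinvariants C A \<delta> \<subseteq> carrier A" using coinvD by blast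
  note LA = left_act_clin_left[OF cspace_C \<delta>_closed]
  show "\<zero>\<^bsub>A\<^esub> \<in> coinvariants C A \<delta>"
    by (rule coinvI) (simp_all add: clin_zero[OF cspace_A _ \<delta>_clin] clin_zero[OF cspace_A _ LA])
  show "x \<oplus>\<^bsub>A\<^esub> y \<in> coinvariants C A \<delta>" if "x \<in> coinvariants C A \<delta>" "y \<in> coinvariants C A \<delta>" for x y
    by (rule coinvI) (use that coinvD in \<open>simp_all add: l_distr clinD(2)[OF \<delta>_clin] clinD(2)[OF LA]\<close>)
  show "c \<odot>\<^bsub>A\<^esub> x \<in> coinvariants C A \<delta>" if "x \<in> coinvariants C A \<delta>" for x c
    by (rule coinvI) (use that coinvD in \<open>simp_all add: smult_mult clinD(3)[OF \<delta>_clin] clinD(3)[OF LA]\<close>)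
qed

lemma coinv_one: "\<one>\<^bsub>A\<^esub> \<in> coinvariants C A \<delta>"
  by (rule coinvI) (simp_all add: left_act_one \<delta>_closed)

lemma coinv_mult: "x \<in> coinvariants C A \<delta> \<Longrightarrow> y \<in> coinvariants C A \<delta> \<Longrightarrow> x \<otimes>\<^bsub>A\<^esub> y \<in> coinvariants C A \<delta>"
  by (rule coinvI) (simp_all add: coinvD m_assoc left_act_mult \<delta>_closed)

lemma coinv_scalar: "c \<odot>\<^bsub>A\<^esub> \<one>\<^bsub>A\<^esub> \<in> coinvariants C A \<delta>"
  by (rule csubspaceD(4)[OF coinv_csubspace coinv_one])

lemma B_algebra: "complex_algebra B"
proof -
  have sp: "cspace B" unfolding coinv_alg_def by (rule csubspace_cspace[OF cspace_A coinv_csubspace])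
  have "ring B"
    by (rule ringI)
      (use sp coinvD coinv_one coinv_mult in \<open>auto intro!: monoidI simp: m_assoc l_distr r_distr\<close>)
  then show ?thesis using sp coinvD by (simp add: complex_algebra_def smult_mult)
qed

lemma B_ring: "ring B" by (rule complex_algebraD(1)[OF B_algebra])

lemma id_B_hom: "id \<in> ring_hom B A" by (rule ring_hom_memI) (auto simp: coinvD)

lemma left_mult_left_module: "left_module B (left_mult_module A)"
  by (rule left_moduleI[OF B_ring])
    (use coinvD in \<open>simp_all add: left_mult_module_def is_abelian_group r_distr l_distr m_assoc\<close>)

lemma right_mult_right_module: "right_module B (right_mult_module A)"
  unfolding right_mult_restricted by (rule restricted_right_module[OF B_ring ring_axioms id_B_hom])

lemma canonical_balanced:
  "balanced B (right_mult_module A) (left_mult_module A) (ctensor A C) (\<lambda>a a'. left_act A C a (\<delta> a'))"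
proof (rule balancedI)
  note LA = left_act_clin_left[OF cspace_C \<delta>_closed]
  note LB = left_act_clin[OF cspace_C]
qed (use coinvD in \<open>simp_all add: right_mult_restricted left_act_closed \<delta>_closed clinD(2)[OF \<delta>_clin]
    clinD(2)[OF left_act_clin[OF cspace_C]] clinD(2)[OF left_act_clin_left[OF cspace_C]] left_act_mult\<close>)

lemma canonical_additive:
  "additive_map (tensor B (right_mult_module A) (left_mult_module A)) (ctensor A C) (canonical_map C A \<delta>)"
  unfolding canonical_map_def
  by (rule tensor_lift_additive[OF right_mult_right_module left_mult_left_module _ canonical_balanced]) simp

lemma canonical_pure:
  "a \<in> carrier A \<Longrightarrow> a' \<in> carrier A \<Longrightarrow>
    canonical_map C A \<delta> (pure_tensor B (right_mult_module A) (left_mult_module A) a a') = left_act A C a (\<delta> a')"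
  unfolding canonical_map_def
  by (rule tensor_lift_pure[OF right_mult_right_module left_mult_left_module _ canonical_balanced]) (simp_all add: right_mult_restricted)

text \<open>
  The tensors \<open>1 \<otimes> x\<close> and \<open>x \<otimes> 1\<close> both map to \<open>x \<otimes> e\<close> and hence agree over \<open>B\<close>. The map
  \<open>u \<otimes> v \<mapsto> u \<delta>(v a)\<close> is well defined over \<open>B\<close>; applied to this equation, it gives \<open>\<delta>(x a) = x \<delta>(a)\<close>.
\<close>

lemma coinvariant_of_galois:
  assumes inj: "inj_on (canonical_map C A \<delta>) (carrier (tensor B (right_mult_module A) (left_mult_module A)))"
    and e: "e \<in> carrier C" "\<delta> \<one>\<^bsub>A\<^esub> = cpure A C \<one>\<^bsub>A\<^esub> e" and x: "x \<in> carrier A" "\<delta> x = cpure A C x e"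
  shows "x \<in> coinvariants C A \<delta>"
proof (rule coinvI[OF x(1)])
  fix a assume a: "a \<in> carrier A"
  let ?M = "right_mult_module A" and ?N = "left_mult_module A"
  note MN = right_mult_right_module left_mult_left_module
  have c: "carrier ?M = carrier A" by (simp add: right_mult_restricted)
  have "canonical_map C A \<delta> (pure_tensor B ?M ?N \<one>\<^bsub>A\<^esub> x) = canonical_map C A \<delta> (pure_tensor B ?M ?N x \<one>\<^bsub>A\<^esub>)"
    using x e by (simp add: canonical_pure left_act_one left_act_pure)
  then have eq: "pure_tensor B ?M ?N \<one>\<^bsub>A\<^esub> x = pure_tensor B ?M ?N x \<one>\<^bsub>A\<^esub>"
    by (rule inj_onD[OF inj]) (use x c in \<open>auto intro!: pure_closed[OF MN]\<close>)
  have b: "balanced B ?M ?N (ctensor A C) (\<lambda>u v. left_act A C u (\<delta> (v \<otimes>\<^bsub>A\<^esub> a)))"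
    by (rule balancedI) (use a coinvD in \<open>simp_all add: right_mult_restricted left_act_closed \<delta>_closed clinD(2)[OF \<delta>_clin] l_distr m_assoc
        clinD(2)[OF left_act_clin[OF cspace_C]] clinD(2)[OF left_act_clin_left[OF cspace_C]] left_act_mult\<close>)
  have p: "tensor_lift (ctensor A C) (\<lambda>u v. left_act A C u (\<delta> (v \<otimes>\<^bsub>A\<^esub> a))) (pure_tensor B ?M ?N u v) = left_act A C u (\<delta> (v \<otimes>\<^bsub>A\<^esub> a))"
    if "u \<in> carrier A" "v \<in> carrier A" for u v
    by (rule tensor_lift_pure[OF MN _ b]) (use that c in simp_all)
  have "left_act A C \<one>\<^bsub>A\<^esub> (\<delta> (x \<otimes>\<^bsub>A\<^esub> a)) = left_act A C x (\<delta> (\<one>\<^bsub>A\<^esub> \<otimes>\<^bsub>A\<^esub> a))"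
    using p[of "\<one>\<^bsub>A\<^esub>" x] p[of x "\<one>\<^bsub>A\<^esub>"] eq x by simp
  then show "\<delta> (x \<otimes>\<^bsub>A\<^esub> a) = left_act A C x (\<delta> a)" using a x by (simp add: left_act_one \<delta>_closed)
qed

context
  fixes V :: "(complex, 'v) module" and \<rho> :: "'v \<Rightarrow> ('c, 'v) tens"
  assumes V: "left_comodule C V \<rho>"
begin

lemma V_cspace: "cspace V" and \<rho>_lin: "\<rho> \<in> clin V (ctensor C V)" using left_comoduleD[OF V] by auto

lemma cotensor_csubspace: "csubspace (ctensor A V) (carrier (cotensor C A \<delta> V \<rho>))"
proof -
  have AV: "cspace (ctensor A V)" "cspace (ctensor A (ctensor C V))" by (simp_all add: V_cspace)
  show ?thesis
    by (rule csubspaceI)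
      (use AV in \<open>auto simp: cotensor_carrier[OF com V] clin_zero[OF AV coact_left_clin[OF com V]] clin_zero[OF AV coact_right_clin[OF com V]]
        clinD(2,3)[OF coact_left_clin[OF com V]] clinD(2,3)[OF coact_right_clin[OF com V]]\<close>)
qed

text \<open>
  Multiplication by a coinvariant commutes with the coaction, so it preserves the defining equation.
\<close>

lemma cotensor_left_act:
  assumes b: "b \<in> coinvariants C A \<delta>" and t: "t \<in> carrier (cotensor C A \<delta> V \<rho>)"
  shows "left_act A V b t \<in> carrier (cotensor C A \<delta> V \<rho>)"
proof -
  note [simp] = V_cspace \<rho>_lin
  have bA: "b \<in> carrier A" by (rule coinvD(1)[OF b])
  have tc: "t \<in> carrier (ctensor A V)" using t by (simp add: cotensor_carrier[OF com V])
  have AC: "cspace (ctensor A C)" by simp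
  have 1: "left_act A (ctensor C V) b (cassoc A C V (cpure (ctensor A C) V s v)) = cassoc A C V (cpure (ctensor A C) V (left_act A C b s) v)"
    if v: "v \<in> carrier V" and s: "s \<in> carrier (ctensor A C)" for s v
  proof (rule ctensor_eqI[OF cspace_A cspace_C _ _ _ s])
    note l = clin_comp[OF cbilinD(2)[OF cbilin_cpure[OF AC V_cspace] v] cassoc_clin[OF cspace_A cspace_C V_cspace]]
    show "(\<lambda>s. left_act A (ctensor C V) b (cassoc A C V (cpure (ctensor A C) V s v))) \<in> clin (ctensor A C) (ctensor A (ctensor C V))"
      by (rule clin_comp[OF l left_act_clin]) (use bA in simp_all)
    show "(\<lambda>s. cassoc A C V (cpure (ctensor A C) V (left_act A C b s) v)) \<in> clin (ctensor A C) (ctensor A (ctensor C V))"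
      by (rule clin_comp[OF left_act_clin[OF cspace_C bA] l])
  qed (use bA v in \<open>simp add: left_act_pure\<close>)
  have "cassoc A C V (cmap (ctensor A C) V \<delta> id (left_act A V b t)) = left_act A (ctensor C V) b (cassoc A C V (cmap (ctensor A C) V \<delta> id t))"
    by (rule ctensor_eqI[OF cspace_A V_cspace clin_comp[OF left_act_clin coact_left_clin[OF com V]] clin_comp[OF coact_left_clin[OF com V] left_act_clin] _ tc])
      (use bA b in \<open>simp_all add: left_act_pure \<delta>_clin 1 \<delta>_closed coinvD(2)\<close>)
  also have "\<dots> = left_act A (ctensor C V) b (cmap A (ctensor C V) id \<rho> t)" using t by (simp add: cotensor_carrier[OF com V])
  also have "\<dots> = cmap A (ctensor C V) id \<rho> (left_act A V b t)"
    by (rule left_act_natural[symmetric]) (use bA tc in simp_all)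
  finally show ?thesis using left_act_closed[OF V_cspace bA tc] by (simp add: cotensor_carrier[OF com V])
qed

abbreviation "N \<equiv> cotensor_module C A \<delta> V \<rho>"

lemma N_simps [simp]: "carrier N = carrier (cotensor C A \<delta> V \<rho>)" "x \<oplus>\<^bsub>N\<^esub> y = x \<oplus>\<^bsub>ctensor A V\<^esub> y"
  "\<zero>\<^bsub>N\<^esub> = \<zero>\<^bsub>ctensor A V\<^esub>" "b \<odot>\<^bsub>N\<^esub> x = left_act A V b x"
  by (simp_all add: cotensor_module_def) (simp_all add: cotensor_def)

lemma N_in: "t \<in> carrier (cotensor C A \<delta> V \<rho>) \<Longrightarrow> t \<in> carrier (ctensor A V)" by (simp add: cotensor_carrier[OF com V])

lemma N_left_module: "left_module B N"
proof (rule left_moduleI[OF B_ring])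
  have "cspace ((ctensor A V)\<lparr>carrier := carrier (cotensor C A \<delta> V \<rho>)\<rparr>)"
    by (rule csubspace_cspace[OF _ cotensor_csubspace]) (simp add: V_cspace)
  then have "abelian_group ((ctensor A V)\<lparr>carrier := carrier (cotensor C A \<delta> V \<rho>)\<rparr>)" by simp
  then show "abelian_group N" by (rule abelian_group_transfer) simp_all
qed (use V_cspace coinvD N_in in \<open>simp_all add: cotensor_left_act clinD(2)[OF left_act_clin] clinD(2)[OF left_act_clin_left]
    left_act_mult left_act_one\<close>)

end

end

section \<open>The comparison isomorphism over the total algebra\<close>

text \<open>
  A Galois extension \<open>B \<subseteq> A\<close> together with an algebra map \<open>f\<close> into a bare algebra \<open>A'\<close>. The
  identity of the total algebra of a Galois extension is an instance.
\<close>

locale galois_map = split_comodule C V \<rho> \<pi> + comodule_algebra C A \<delta> + alg': calgebra A'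
  for C :: "'c coalgebra" and V :: "(complex, 'v) module" and \<rho> \<pi>
    and A :: "(complex, 'a) module" and \<delta> and A' :: "(complex, 'b) module" +
  fixes f :: "'a \<Rightarrow> 'b"
  assumes hom: "algebra_hom A A' f"
    and gal: "bij_betw (canonical_map C A \<delta>) (carrier (tensor B (right_mult_module A) (left_mult_module A))) (carrier (ctensor A C))"
begin

abbreviation "K \<equiv> cotensor_module C A \<delta> V \<rho>"
abbreviation "RA \<equiv> right_mult_module A"
abbreviation "LA \<equiv> left_mult_module A"
abbreviation "U \<equiv> tensor_module B RA LA LA"
abbreviation "M \<equiv> restricted_right_module A' f"
abbreviation "T \<equiv> tensor_module B M K (left_mult_module A')"
abbreviation "G \<equiv> comparison_map A' f V"
abbreviation "F \<equiv> cmap A' V f id"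

lemma f_ring: "f \<in> ring_hom A A'" and f_clin: "f \<in> clin A A'"
  using hom by (simp_all add: algebra_hom_def)

lemmas f_simps [simp] = ring_hom_closed[OF f_ring] ring_hom_mult[OF f_ring] ring_hom_add[OF f_ring] ring_hom_one[OF f_ring]

lemma f_scalar: "f (c \<odot>\<^bsub>A\<^esub> \<one>\<^bsub>A\<^esub>) = c \<odot>\<^bsub>A'\<^esub> \<one>\<^bsub>A'\<^esub>" using clinD(3)[OF f_clin, of "\<one>\<^bsub>A\<^esub>" c] by simp

lemma f_B_ring: "f \<in> ring_hom B A'"
  by (rule ring_hom_memI) (auto simp: coinvD)

lemmas K_simps [simp] = N_simps[OF V]
lemmas K_in = N_in[OF V] and K_left_module = N_left_module[OF V]

lemma M_right_module: "right_module B M" by (rule restricted_right_module[OF B_ring alg'.ring_axioms f_B_ring])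

lemma mult_left_module: "left_module A LA"
  by (rule left_moduleI) (simp_all add: ring_axioms left_mult_module_def is_abelian_group r_distr l_distr m_assoc)

lemma mult_left_module': "left_module A' (left_mult_module A')"
  by (rule left_moduleI) (simp_all add: alg'.ring_axioms left_mult_module_def alg'.is_abelian_group alg'.r_distr alg'.l_distr alg'.m_assoc)

lemma T_left_module: "left_module A' T"
  and T_smult_pure: "s \<in> carrier A' \<Longrightarrow> m \<in> carrier A' \<Longrightarrow> n \<in> carrier K \<Longrightarrow>
      s \<odot>\<^bsub>T\<^esub> pure_tensor B M K m n = pure_tensor B M K (s \<otimes>\<^bsub>A'\<^esub> m) n"
  using tensor_module_left_module[OF M_right_module K_left_module mult_left_module']
  by (simp_all add: alg'.m_assoc coinvD del: tensor_module_simps(4))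

lemma RA_simps [simp]: "carrier RA = carrier A" "x \<oplus>\<^bsub>RA\<^esub> y = x \<oplus>\<^bsub>A\<^esub> y" "b \<odot>\<^bsub>RA\<^esub> x = x \<otimes>\<^bsub>A\<^esub> b"
  by (simp_all add: right_mult_restricted)

lemma U_left_module: "left_module A U"
  and U_smult_pure: "s \<in> carrier A \<Longrightarrow> m \<in> carrier A \<Longrightarrow> n \<in> carrier A \<Longrightarrow>
      s \<odot>\<^bsub>U\<^esub> pure_tensor B RA LA m n = pure_tensor B RA LA (s \<otimes>\<^bsub>A\<^esub> m) n"
  using tensor_module_left_module[OF right_mult_right_module left_mult_left_module mult_left_module]
  by (simp_all add: m_assoc coinvD del: tensor_module_simps(4))

declare tensor_module_simps(4) [simp del]

lemmas T_moduleD = left_moduleD[OF T_left_module] and U_moduleD = left_moduleD[OF U_left_module]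

lemma T_abelian: "abelian_group T" by (rule T_moduleD(2))

lemma T_smult_additive: "s \<in> carrier A' \<Longrightarrow> additive_map T T (\<lambda>x. s \<odot>\<^bsub>T\<^esub> x)"
  by (rule additiveI) (simp_all only: T_moduleD(3,5))

lemma U_smult_additive: "s \<in> carrier A \<Longrightarrow> additive_map U U (\<lambda>x. s \<odot>\<^bsub>U\<^esub> x)"
  by (rule additiveI) (simp_all only: U_moduleD(3,5))

lemma additive_U: "additive_map (tensor B RA LA) P g \<longleftrightarrow> additive_map U P g"
  and additive_T: "additive_map (tensor B M K) P g' \<longleftrightarrow> additive_map T P g'"
  by (simp_all add: additive_map_def)

lemma T_eqI:
  assumes "additive_map T P g" "additive_map T P h"
    "\<And>m n. m \<in> carrier A' \<Longrightarrow> n \<in> carrier K \<Longrightarrow> g (pure_tensor B M K m n) = h (pure_tensor B M K m n)" "t \<in> carrier T"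
  shows "g t = h t"
  by (rule tensor_additive_eqI[OF M_right_module K_left_module]) (use assms in \<open>simp_all add: additive_T\<close>)

lemma U_eqI:
  assumes "additive_map U P g" "additive_map U P h"
    "\<And>m n. m \<in> carrier A \<Longrightarrow> n \<in> carrier A \<Longrightarrow> g (pure_tensor B RA LA m n) = h (pure_tensor B RA LA m n)" "t \<in> carrier U"
  shows "g t = h t"
  by (rule tensor_additive_eqI[OF right_mult_right_module left_mult_left_module]) (use assms in \<open>simp_all add: additive_U\<close>)

lemma T_pure_closed: "m \<in> carrier A' \<Longrightarrow> n \<in> carrier K \<Longrightarrow> pure_tensor B M K m n \<in> carrier T"
  using pure_closed[OF M_right_module K_left_module] by simp

lemma T_pure_add:
  "m \<in> carrier A' \<Longrightarrow> m' \<in> carrier A' \<Longrightarrow> n \<in> carrier K \<Longrightarrow>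
    pure_tensor B M K (m \<oplus>\<^bsub>A'\<^esub> m') n = pure_tensor B M K m n \<oplus>\<^bsub>T\<^esub> pure_tensor B M K m' n"
  "m \<in> carrier A' \<Longrightarrow> n \<in> carrier K \<Longrightarrow> n' \<in> carrier K \<Longrightarrow>
    pure_tensor B M K m (n \<oplus>\<^bsub>ctensor A V\<^esub> n') = pure_tensor B M K m n \<oplus>\<^bsub>T\<^esub> pure_tensor B M K m n'"
  using pure_add_left[OF M_right_module K_left_module] pure_add_right[OF M_right_module K_left_module] by simp_all

lemma T_pure_balanced:
  "b \<in> coinvariants C A \<delta> \<Longrightarrow> m \<in> carrier A' \<Longrightarrow> n \<in> carrier K \<Longrightarrow>
    pure_tensor B M K (m \<otimes>\<^bsub>A'\<^esub> f b) n = pure_tensor B M K m (left_act A V b n)"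
  using pure_balanced[OF M_right_module K_left_module, of b m n] by simp

lemma F_clin: "F \<in> clin (ctensor A V) (ctensor A' V)" by (rule cmap_clin) (simp_all add: f_clin)

lemma F_closed: "t \<in> carrier (ctensor A V) \<Longrightarrow> F t \<in> carrier (ctensor A' V)" by (rule clinD(1)[OF F_clin])

lemma F_left_act:
  assumes a: "a \<in> carrier A" and t: "t \<in> carrier (ctensor A V)"
  shows "F (left_act A V a t) = left_act A' V (f a) (F t)"
  by (rule ctensor_eqI[OF cspace_A cspace_V clin_comp[OF left_act_clin F_clin] clin_comp[OF F_clin alg'.left_act_clin] _ t])
    (use a in \<open>simp_all add: left_act_pure alg'.left_act_pure f_clin\<close>)

text \<open>
  The parameter \<open>S\<close> stands for \<open>A'\<close> itself or a subalgebra of it with the same operations; the two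
  instances are the comparison maps over the total algebra and over its coinvariants.
\<close>

lemma comparison_balanced:
  assumes S: "carrier S \<subseteq> carrier A'" "\<And>x y. x \<otimes>\<^bsub>S\<^esub> y = x \<otimes>\<^bsub>A'\<^esub> y" "\<And>x y. x \<oplus>\<^bsub>S\<^esub> y = x \<oplus>\<^bsub>A'\<^esub> y"
  shows "balanced B (restricted_right_module S f) K (ctensor A' V) (\<lambda>b' t. left_act A' V b' (F t))"
proof (rule balancedI)
  have S': "x \<in> carrier S \<Longrightarrow> x \<in> carrier A'" for x using S(1) by blast
  note LL = clinD(2)[OF alg'.left_act_clin_left[OF cspace_V F_closed]] and LR = clinD(2)[OF alg'.left_act_clin[OF cspace_V]]
  fix m n assume m: "m \<in> carrier (restricted_right_module S f)" and n: "n \<in> carrier K"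
  have mc: "m \<in> carrier A'" and nc: "n \<in> carrier (ctensor A V)" using m n S' K_in by simp_all
  show "left_act A' V m (F n) \<in> carrier (ctensor A' V)" using mc nc by (simp add: alg'.left_act_closed F_closed)
  show "left_act A' V m (F (n \<oplus>\<^bsub>K\<^esub> n')) = left_act A' V m (F n) \<oplus>\<^bsub>ctensor A' V\<^esub> left_act A' V m (F n')" if "n' \<in> carrier K" for n'
    using mc nc K_in that by (simp add: clinD(2)[OF F_clin] LR F_closed)
  show "left_act A' V (m \<oplus>\<^bsub>restricted_right_module S f\<^esub> m') (F n) = left_act A' V m (F n) \<oplus>\<^bsub>ctensor A' V\<^esub> left_act A' V m' (F n)"
    if "m' \<in> carrier (restricted_right_module S f)" for m'
    using mc nc S' that by (simp add: LL S(3))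
  show "left_act A' V (r \<odot>\<^bsub>restricted_right_module S f\<^esub> m) (F n) = left_act A' V m (F (r \<odot>\<^bsub>K\<^esub> n))" if "r \<in> carrier B" for r
    using mc nc that coinvD(1)[of r] by (simp add: S(2) F_left_act alg'.left_act_mult F_closed)
qed

lemma comparison_additive:
  assumes S: "carrier S \<subseteq> carrier A'" "\<And>x y. x \<otimes>\<^bsub>S\<^esub> y = x \<otimes>\<^bsub>A'\<^esub> y" "\<And>x y. x \<oplus>\<^bsub>S\<^esub> y = x \<oplus>\<^bsub>A'\<^esub> y"
    and R: "right_module B (restricted_right_module S f)"
  shows "additive_map (tensor B (restricted_right_module S f) K) (ctensor A' V) G"
  unfolding comparison_map_def
  by (rule tensor_lift_additive[OF R K_left_module _ comparison_balanced[OF S]]) simp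

lemma comparison_pure:
  assumes S: "carrier S \<subseteq> carrier A'" "\<And>x y. x \<otimes>\<^bsub>S\<^esub> y = x \<otimes>\<^bsub>A'\<^esub> y" "\<And>x y. x \<oplus>\<^bsub>S\<^esub> y = x \<oplus>\<^bsub>A'\<^esub> y"
    and R: "right_module B (restricted_right_module S f)" and "m \<in> carrier S" "n \<in> carrier K"
  shows "G (pure_tensor B (restricted_right_module S f) K m n) = left_act A' V m (F n)"
  unfolding comparison_map_def
  by (rule tensor_lift_pure[OF R K_left_module _ comparison_balanced[OF S]]) (use assms in simp_all)

lemma G_additive: "additive_map T (ctensor A' V) G"
  using comparison_additive[OF _ _ _ M_right_module] by (simp add: additive_T)

lemma G_pure: "m \<in> carrier A' \<Longrightarrow> n \<in> carrier K \<Longrightarrow> G (pure_tensor B M K m n) = left_act A' V m (F n)"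
  by (rule comparison_pure[OF _ _ _ M_right_module]) simp_all

lemma G_smult:
  assumes s: "s \<in> carrier A'" and t: "t \<in> carrier T"
  shows "G (s \<odot>\<^bsub>T\<^esub> t) = left_act A' V s (G t)"
  by (rule T_eqI[OF additive_comp[OF T_smult_additive[OF s] G_additive]
        additive_comp[OF G_additive clin_additive[OF alg'.left_act_clin[OF cspace_V s]]] _ t])
    (use s K_in in \<open>simp add: T_smult_pure G_pure alg'.left_act_mult F_closed\<close>)

definition can_inv :: "('a, 'c) tens \<Rightarrow> ('a, 'a) tens" where
  "can_inv = the_inv_into (carrier U) (canonical_map C A \<delta>)"

abbreviation "can \<equiv> canonical_map C A \<delta>"

lemma can_additive: "additive_map U (ctensor A C) can"
  using canonical_additive by (simp add: additive_U)

lemma can_bij: "bij_betw can (carrier U) (carrier (ctensor A C))" using gal by simp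

lemma can_inv_closed: "w \<in> carrier (ctensor A C) \<Longrightarrow> can_inv w \<in> carrier U"
  unfolding can_inv_def by (rule the_inv_into_into[OF bij_betw_imp_inj_on[OF can_bij] _ subset_refl])
    (simp only: bij_betw_imp_surj_on[OF can_bij])

lemma can_of_inv: "w \<in> carrier (ctensor A C) \<Longrightarrow> can (can_inv w) = w"
  unfolding can_inv_def by (rule f_the_inv_into_f_bij_betw[OF can_bij])

lemma inv_of_can: "z \<in> carrier U \<Longrightarrow> can_inv (can z) = z"
  unfolding can_inv_def by (rule the_inv_into_f_f[OF bij_betw_imp_inj_on[OF can_bij]])

lemma can_inv_unique: "z \<in> carrier U \<Longrightarrow> can z = w \<Longrightarrow> can_inv w = z"
  using inv_of_can by blast

lemma can_inv_additive: "additive_map (ctensor A C) U can_inv"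
proof (rule additiveI)
  fix x y assume x: "x \<in> carrier (ctensor A C)" and y: "y \<in> carrier (ctensor A C)"
  interpret U: abelian_group U by (rule U_moduleD(2))
  show "can_inv (x \<oplus>\<^bsub>ctensor A C\<^esub> y) = can_inv x \<oplus>\<^bsub>U\<^esub> can_inv y"
    by (rule can_inv_unique[OF U.a_closed[OF can_inv_closed[OF x] can_inv_closed[OF y]]])
      (simp only: additive_add[OF can_additive can_inv_closed[OF x] can_inv_closed[OF y]] can_of_inv x y)
qed (rule can_inv_closed)

text \<open>
  The canonical map, and hence its inverse, is left \<open>A\<close>-linear.
\<close>

lemma can_smult:
  assumes s: "s \<in> carrier A" and t: "t \<in> carrier U"
  shows "can (s \<odot>\<^bsub>U\<^esub> t) = left_act A C s (can t)"
  by (rule U_eqI[OF additive_comp[OF U_smult_additive[OF s] can_additive]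
        additive_comp[OF can_additive clin_additive[OF left_act_clin[OF cspace_C s]]] _ t])
    (use s in \<open>simp add: U_smult_pure canonical_pure left_act_mult \<delta>_closed\<close>)

lemma can_inv_smult:
  assumes s: "s \<in> carrier A" and w: "w \<in> carrier (ctensor A C)"
  shows "can_inv (left_act A C s w) = s \<odot>\<^bsub>U\<^esub> can_inv w"
  by (rule can_inv_unique[OF U_moduleD(3)[OF s can_inv_closed[OF w]]]) (simp add: can_smult[OF s can_inv_closed[OF w]] can_of_inv[OF w])

lemma spread_left_act:
  assumes a: "a \<in> carrier A" and v: "v \<in> carrier V" and s: "s \<in> carrier (ctensor A C)"
  shows "spread A v (left_act A C a s) = left_act A V a (spread A v s)"
  unfolding spread_def by (rule left_act_natural) (use a v s in simp_all)

lemma proj_closed: "y \<in> carrier A \<Longrightarrow> u \<in> carrier V \<Longrightarrow> proj A \<delta> (cpure A V y u) \<in> carrier K"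
  using proj_cotensor[OF com] by simp

lemma proj_B:
  "b \<in> coinvariants C A \<delta> \<Longrightarrow> y \<in> carrier A \<Longrightarrow> u \<in> carrier V \<Longrightarrow>
    proj A \<delta> (cpure A V (b \<otimes>\<^bsub>A\<^esub> y) u) = left_act A V b (proj A \<delta> (cpure A V y u))"
  by (simp add: proj_pure[OF com] coinvD spread_left_act \<delta>_closed)

lemma proj_add:
  "y \<in> carrier A \<Longrightarrow> y' \<in> carrier A \<Longrightarrow> u \<in> carrier V \<Longrightarrow>
    proj A \<delta> (cpure A V (y \<oplus>\<^bsub>A\<^esub> y') u) = proj A \<delta> (cpure A V y u) \<oplus>\<^bsub>ctensor A V\<^esub> proj A \<delta> (cpure A V y' u)"
  "y \<in> carrier A \<Longrightarrow> u \<in> carrier V \<Longrightarrow> u' \<in> carrier V \<Longrightarrow>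
    proj A \<delta> (cpure A V y (u \<oplus>\<^bsub>V\<^esub> u')) = proj A \<delta> (cpure A V y u) \<oplus>\<^bsub>ctensor A V\<^esub> proj A \<delta> (cpure A V y u')"
  "y \<in> carrier A \<Longrightarrow> u \<in> carrier V \<Longrightarrow>
    proj A \<delta> (cpure A V y (c \<odot>\<^bsub>V\<^esub> u)) = c \<odot>\<^bsub>ctensor A V\<^esub> proj A \<delta> (cpure A V y u)"
  by (simp_all add: cpure_add cpure_smult clinD(2,3)[OF proj_clin[OF com]])

text \<open>
  \<open>slice u\<close> sends \<open>x \<otimes> y\<close> to \<open>f(x) \<otimes> P(y \<otimes> u)\<close>, with \<open>P\<close> the projection onto the cotensor product. It is
  well defined over \<open>B\<close> because \<open>P\<close> commutes with multiplication by \<open>B\<close>.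
\<close>

definition slice :: "'v \<Rightarrow> ('a, 'a) tens \<Rightarrow> ('b, ('a, 'v) tens) tens" where
  "slice u = tensor_lift T (\<lambda>x y. pure_tensor B M K (f x) (proj A \<delta> (cpure A V y u)))"

lemma slice_balanced:
  assumes u: "u \<in> carrier V"
  shows "balanced B RA LA T (\<lambda>x y. pure_tensor B M K (f x) (proj A \<delta> (cpure A V y u)))"
proof (rule balancedI)
  fix m n assume m: "m \<in> carrier RA" and n: "n \<in> carrier LA"
  then have mn: "m \<in> carrier A" "n \<in> carrier A" by simp_all
  note P = proj_closed[OF _ u]
  show "pure_tensor B M K (f m) (proj A \<delta> (cpure A V n u)) \<in> carrier T"
    by (rule T_pure_closed) (use mn P in simp_all)
  show "pure_tensor B M K (f m) (proj A \<delta> (cpure A V (n \<oplus>\<^bsub>LA\<^esub> n') u)) =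
      pure_tensor B M K (f m) (proj A \<delta> (cpure A V n u)) \<oplus>\<^bsub>T\<^esub> pure_tensor B M K (f m) (proj A \<delta> (cpure A V n' u))"
    if "n' \<in> carrier LA" for n'
    using that mn P u by (simp add: proj_add T_pure_add del: tensor_module_simps)
  show "pure_tensor B M K (f (m \<oplus>\<^bsub>RA\<^esub> m')) (proj A \<delta> (cpure A V n u)) =
      pure_tensor B M K (f m) (proj A \<delta> (cpure A V n u)) \<oplus>\<^bsub>T\<^esub> pure_tensor B M K (f m') (proj A \<delta> (cpure A V n u))"
    if "m' \<in> carrier RA" for m'
    using that mn P u by (simp add: T_pure_add del: tensor_module_simps)
  show "pure_tensor B M K (f (r \<odot>\<^bsub>RA\<^esub> m)) (proj A \<delta> (cpure A V n u)) =
      pure_tensor B M K (f m) (proj A \<delta> (cpure A V (r \<odot>\<^bsub>LA\<^esub> n) u))" if "r \<in> carrier B" for r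
    using that mn P u by (simp add: proj_B coinvD T_pure_balanced)
qed

lemma slice_additive: "u \<in> carrier V \<Longrightarrow> additive_map U T (slice u)"
  unfolding slice_def
  using tensor_lift_additive[OF right_mult_right_module left_mult_left_module T_abelian slice_balanced] by (simp only: additive_U)

lemma slice_pure:
  "u \<in> carrier V \<Longrightarrow> x \<in> carrier A \<Longrightarrow> y \<in> carrier A \<Longrightarrow>
    slice u (pure_tensor B RA LA x y) = pure_tensor B M K (f x) (proj A \<delta> (cpure A V y u))"
  unfolding slice_def
  by (rule tensor_lift_pure[OF right_mult_right_module left_mult_left_module T_abelian slice_balanced]) simp_all

lemma slice_closed: "u \<in> carrier V \<Longrightarrow> z \<in> carrier U \<Longrightarrow> slice u z \<in> carrier T"
  by (rule additive_closed[OF slice_additive])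

lemma slice_smult:
  assumes u: "u \<in> carrier V" and s: "s \<in> carrier A" and z: "z \<in> carrier U"
  shows "slice u (s \<odot>\<^bsub>U\<^esub> z) = f s \<odot>\<^bsub>T\<^esub> slice u z"
  by (rule U_eqI[OF additive_comp[OF U_smult_additive[OF s] slice_additive[OF u]]
        additive_comp[OF slice_additive[OF u] T_smult_additive] _ z])
    (use u s proj_closed in \<open>simp_all add: U_smult_pure slice_pure T_smult_pure\<close>)

lemma slice_add:
  assumes u: "u \<in> carrier V" "u' \<in> carrier V" and z: "z \<in> carrier U"
  shows "slice (u \<oplus>\<^bsub>V\<^esub> u') z = slice u z \<oplus>\<^bsub>T\<^esub> slice u' z"
proof (rule U_eqI[OF slice_additive _ _ z])
  interpret T: abelian_group T by (rule T_abelian)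
  show "additive_map U T (\<lambda>z. slice u z \<oplus>\<^bsub>T\<^esub> slice u' z)"
  proof (rule additiveI)
    fix x y assume x: "x \<in> carrier U" and y: "y \<in> carrier U"
    note c = slice_closed[OF u(1) x] slice_closed[OF u(2) x] slice_closed[OF u(1) y] slice_closed[OF u(2) y]
    show "slice u x \<oplus>\<^bsub>T\<^esub> slice u' x \<in> carrier T" by (rule T.a_closed[OF c(1,2)])
    show "slice u (x \<oplus>\<^bsub>U\<^esub> y) \<oplus>\<^bsub>T\<^esub> slice u' (x \<oplus>\<^bsub>U\<^esub> y) = slice u x \<oplus>\<^bsub>T\<^esub> slice u' x \<oplus>\<^bsub>T\<^esub> (slice u y \<oplus>\<^bsub>T\<^esub> slice u' y)"
      by (simp only: additive_add[OF slice_additive[OF u(1)] x y] additive_add[OF slice_additive[OF u(2)] x y] T.a_ac c T.a_closed)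
  qed
  show "u \<oplus>\<^bsub>V\<^esub> u' \<in> carrier V" using u by simp
  show "slice (u \<oplus>\<^bsub>V\<^esub> u') (pure_tensor B RA LA m n) = slice u (pure_tensor B RA LA m n) \<oplus>\<^bsub>T\<^esub> slice u' (pure_tensor B RA LA m n)"
    if "m \<in> carrier A" "n \<in> carrier A" for m n
    using that u proj_closed by (simp add: slice_pure proj_add T_pure_add del: tensor_module_simps)
qed

lemma slice_scale:
  assumes u: "u \<in> carrier V" and z: "z \<in> carrier U"
  shows "slice (c \<odot>\<^bsub>V\<^esub> u) z = f (c \<odot>\<^bsub>A\<^esub> \<one>\<^bsub>A\<^esub>) \<odot>\<^bsub>T\<^esub> slice u z"
proof (rule U_eqI[OF slice_additive additive_comp[OF slice_additive[OF u] T_smult_additive] _ z])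
  fix m n assume m: "m \<in> carrier A" and n: "n \<in> carrier A"
  let ?p = "proj A \<delta> (cpure A V n u)"
  have p: "?p \<in> carrier K" by (rule proj_closed[OF n u])
  have pc: "?p \<in> carrier (ctensor A V)" using p K_in by simp
  have "slice (c \<odot>\<^bsub>V\<^esub> u) (pure_tensor B RA LA m n) = pure_tensor B M K (f m) (left_act A V (c \<odot>\<^bsub>A\<^esub> \<one>\<^bsub>A\<^esub>) ?p)"
    using m n u by (simp add: slice_pure proj_add left_act_scalar[OF cspace_V pc])
  also have "\<dots> = pure_tensor B M K (f m \<otimes>\<^bsub>A'\<^esub> f (c \<odot>\<^bsub>A\<^esub> \<one>\<^bsub>A\<^esub>)) ?p"
    by (rule T_pure_balanced[symmetric]) (use coinv_scalar m p in simp_all)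
  also have "f m \<otimes>\<^bsub>A'\<^esub> f (c \<odot>\<^bsub>A\<^esub> \<one>\<^bsub>A\<^esub>) = f (c \<odot>\<^bsub>A\<^esub> \<one>\<^bsub>A\<^esub>) \<otimes>\<^bsub>A'\<^esub> f m"
    unfolding f_scalar using m by (simp add: alg'.smult_mult)
  also have "pure_tensor B M K (f (c \<odot>\<^bsub>A\<^esub> \<one>\<^bsub>A\<^esub>) \<otimes>\<^bsub>A'\<^esub> f m) ?p = f (c \<odot>\<^bsub>A\<^esub> \<one>\<^bsub>A\<^esub>) \<odot>\<^bsub>T\<^esub> slice u (pure_tensor B RA LA m n)"
    using m n u p by (simp add: slice_pure T_smult_pure)
  finally show "slice (c \<odot>\<^bsub>V\<^esub> u) (pure_tensor B RA LA m n) = f (c \<odot>\<^bsub>A\<^esub> \<one>\<^bsub>A\<^esub>) \<odot>\<^bsub>T\<^esub> slice u (pure_tensor B RA LA m n)" .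
qed (use u in simp_all)

text \<open>
  The translation map of the Galois extension, \<open>c \<mapsto> can\<^sup>-\<^sup>1(1 \<otimes> c)\<close>.
\<close>

abbreviation "translation c \<equiv> can_inv (cpure A C \<one>\<^bsub>A\<^esub> c)"

lemma translation_closed: "c \<in> carrier C \<Longrightarrow> translation c \<in> carrier U"
  by (rule can_inv_closed) simp

lemma translation_add: "c \<in> carrier C \<Longrightarrow> d \<in> carrier C \<Longrightarrow> translation (c \<oplus>\<^bsub>C\<^esub> d) = translation c \<oplus>\<^bsub>U\<^esub> translation d"
  by (simp add: cpure_add additive_add[OF can_inv_additive] del: tensor_module_simps)

lemma translation_scale: "c \<in> carrier C \<Longrightarrow> translation (r \<odot>\<^bsub>C\<^esub> c) = (r \<odot>\<^bsub>A\<^esub> \<one>\<^bsub>A\<^esub>) \<odot>\<^bsub>U\<^esub> translation c"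
  using can_inv_smult[of "r \<odot>\<^bsub>A\<^esub> \<one>\<^bsub>A\<^esub>" "cpure A C \<one>\<^bsub>A\<^esub> c"] by (simp add: cpure_smult left_act_scalar)

text \<open>
  \<open>c \<otimes> u \<mapsto> f(x) \<otimes> P(y \<otimes> u)\<close>, where \<open>x \<otimes> y\<close> is the value of the translation map at \<open>c\<close>.
\<close>

definition translate :: "('c, 'v) tens \<Rightarrow> ('b, ('a, 'v) tens) tens" where
  "translate = tensor_lift T (\<lambda>c u. slice u (translation c))"

lemma translate_balanced: "balanced complex_ring C V T (\<lambda>c u. slice u (translation c))"
proof (rule balancedI)
  fix c u assume c: "c \<in> carrier C" and u: "u \<in> carrier V"
  show "slice u (translation c) \<in> carrier T" by (rule slice_closed[OF u translation_closed[OF c]])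
  show "slice (u \<oplus>\<^bsub>V\<^esub> u') (translation c) = slice u (translation c) \<oplus>\<^bsub>T\<^esub> slice u' (translation c)" if "u' \<in> carrier V" for u'
    by (rule slice_add[OF u that translation_closed[OF c]])
  show "slice u (translation (c \<oplus>\<^bsub>C\<^esub> c')) = slice u (translation c) \<oplus>\<^bsub>T\<^esub> slice u (translation c')" if "c' \<in> carrier C" for c'
    unfolding translation_add[OF c that]
    by (rule additive_add[OF slice_additive[OF u] translation_closed[OF c] translation_closed[OF that]])
  show "slice u (translation (r \<odot>\<^bsub>C\<^esub> c)) = slice (r \<odot>\<^bsub>V\<^esub> u) (translation c)" for r
    unfolding translation_scale[OF c] slice_scale[OF u translation_closed[OF c]]
    by (rule slice_smult[OF u _ translation_closed[OF c]]) simp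
qed

lemma translate_additive: "additive_map (ctensor C V) T translate"
  unfolding translate_def by (rule clift_additive[OF cspace_C cspace_V T_abelian translate_balanced])

lemma translate_pure: "c \<in> carrier C \<Longrightarrow> u \<in> carrier V \<Longrightarrow> translate (cpure C V c u) = slice u (translation c)"
  unfolding translate_def by (rule clift_pure_balanced[OF cspace_C cspace_V T_abelian translate_balanced])

lemma translate_closed: "s \<in> carrier (ctensor C V) \<Longrightarrow> translate s \<in> carrier T" by (rule additive_closed[OF translate_additive])

lemma translate_scale:
  assumes s: "s \<in> carrier (ctensor C V)"
  shows "translate (r \<odot>\<^bsub>ctensor C V\<^esub> s) = f (r \<odot>\<^bsub>A\<^esub> \<one>\<^bsub>A\<^esub>) \<odot>\<^bsub>T\<^esub> translate s"
proof (rule ctensor_additive_eqI[OF cspace_C cspace_V _ additive_comp[OF translate_additive T_smult_additive] _ s])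
  show "additive_map (ctensor C V) T (\<lambda>s. translate (r \<odot>\<^bsub>ctensor C V\<^esub> s))"
    by (rule additive_comp[OF clin_additive[OF clin_smult] translate_additive]) simp
  show "translate (r \<odot>\<^bsub>ctensor C V\<^esub> cpure C V c u) = f (r \<odot>\<^bsub>A\<^esub> \<one>\<^bsub>A\<^esub>) \<odot>\<^bsub>T\<^esub> translate (cpure C V c u)"
    if "c \<in> carrier C" "u \<in> carrier V" for c u
    using that slice_scale[OF that(2) translation_closed[OF that(1)]] by (simp add: cpure_smult(2)[symmetric] translate_pure)
qed simp

text \<open>
  \<open>a' \<otimes> v \<mapsto> a' f(x) \<otimes> P(y \<otimes> v\<^sub>0)\<close>, where \<open>x \<otimes> y\<close> is the value of the translation map at \<open>v\<^sub>-\<^sub>1\<close>.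
\<close>

definition comparison_inv :: "('b, 'v) tens \<Rightarrow> ('b, ('a, 'v) tens) tens" where
  "comparison_inv = tensor_lift T (\<lambda>a' v. a' \<odot>\<^bsub>T\<^esub> translate (\<rho> v))"

lemma \<rho>_closed: "v \<in> carrier V \<Longrightarrow> \<rho> v \<in> carrier (ctensor C V)" by (rule clinD(1)[OF \<rho>_clin])

lemma comparison_inv_balanced: "balanced complex_ring A' V T (\<lambda>a' v. a' \<odot>\<^bsub>T\<^esub> translate (\<rho> v))"
proof (rule balancedI)
  fix a v assume a: "a \<in> carrier A'" and v: "v \<in> carrier V"
  note k = translate_closed[OF \<rho>_closed]
  show "a \<odot>\<^bsub>T\<^esub> translate (\<rho> v) \<in> carrier T" by (rule T_moduleD(3)[OF a k[OF v]])
  show "a \<odot>\<^bsub>T\<^esub> translate (\<rho> (v \<oplus>\<^bsub>V\<^esub> v')) = a \<odot>\<^bsub>T\<^esub> translate (\<rho> v) \<oplus>\<^bsub>T\<^esub> a \<odot>\<^bsub>T\<^esub> translate (\<rho> v')" if v': "v' \<in> carrier V" for v'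
    unfolding clinD(2)[OF \<rho>_clin v v'] additive_add[OF translate_additive \<rho>_closed[OF v] \<rho>_closed[OF v']]
    by (rule T_moduleD(5)[OF a k[OF v] k[OF v']])
  show "(a \<oplus>\<^bsub>A'\<^esub> a') \<odot>\<^bsub>T\<^esub> translate (\<rho> v) = a \<odot>\<^bsub>T\<^esub> translate (\<rho> v) \<oplus>\<^bsub>T\<^esub> a' \<odot>\<^bsub>T\<^esub> translate (\<rho> v)" if "a' \<in> carrier A'" for a'
    by (rule T_moduleD(4)[OF a that k[OF v]])
  show "(r \<odot>\<^bsub>A'\<^esub> a) \<odot>\<^bsub>T\<^esub> translate (\<rho> v) = a \<odot>\<^bsub>T\<^esub> translate (\<rho> (r \<odot>\<^bsub>V\<^esub> v))" for r
  proof -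
    have "a \<odot>\<^bsub>T\<^esub> translate (\<rho> (r \<odot>\<^bsub>V\<^esub> v)) = a \<odot>\<^bsub>T\<^esub> (f (r \<odot>\<^bsub>A\<^esub> \<one>\<^bsub>A\<^esub>) \<odot>\<^bsub>T\<^esub> translate (\<rho> v))"
      unfolding clinD(3)[OF \<rho>_clin v] translate_scale[OF \<rho>_closed[OF v]] ..
    also have "\<dots> = (a \<otimes>\<^bsub>A'\<^esub> f (r \<odot>\<^bsub>A\<^esub> \<one>\<^bsub>A\<^esub>)) \<odot>\<^bsub>T\<^esub> translate (\<rho> v)"
      by (rule T_moduleD(6)[OF a _ k[OF v], symmetric]) simp
    also have "a \<otimes>\<^bsub>A'\<^esub> f (r \<odot>\<^bsub>A\<^esub> \<one>\<^bsub>A\<^esub>) = r \<odot>\<^bsub>A'\<^esub> a" unfolding f_scalar using a by (simp add: alg'.smult_mult)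
    finally show ?thesis ..
  qed
qed

lemma comparison_inv_additive: "additive_map (ctensor A' V) T comparison_inv"
  unfolding comparison_inv_def by (rule clift_additive[OF alg'.cspace_A cspace_V T_abelian comparison_inv_balanced])

lemma comparison_inv_pure: "a \<in> carrier A' \<Longrightarrow> v \<in> carrier V \<Longrightarrow> comparison_inv (cpure A' V a v) = a \<odot>\<^bsub>T\<^esub> translate (\<rho> v)"
  unfolding comparison_inv_def by (rule clift_pure_balanced[OF alg'.cspace_A cspace_V T_abelian comparison_inv_balanced])

lemma comparison_inv_left_act:
  assumes a: "a \<in> carrier A'" and t: "t \<in> carrier (ctensor A' V)"
  shows "comparison_inv (left_act A' V a t) = a \<odot>\<^bsub>T\<^esub> comparison_inv t"
  by (rule ctensor_additive_eqI[OF alg'.cspace_A cspace_V additive_comp[OF clin_additive[OF alg'.left_act_clin[OF cspace_V a]] comparison_inv_additive]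
        additive_comp[OF comparison_inv_additive T_smult_additive[OF a]] _ t])
    (use a T_moduleD(6)[OF a _ translate_closed[OF \<rho>_closed]] in \<open>simp add: alg'.left_act_pure comparison_inv_pure\<close>)

text \<open>
  On \<open>x \<otimes> y\<close> both sides are \<open>f(x y\<^sub>0) \<otimes> \<pi>(y\<^sub>1, u)\<close>.
\<close>

lemma G_slice:
  assumes u: "u \<in> carrier V" and z: "z \<in> carrier U"
  shows "G (slice u z) = F (spread A u (can z))"
  by (rule U_eqI[OF additive_comp[OF slice_additive[OF u] G_additive]
        additive_comp[OF additive_comp[OF can_additive clin_additive[OF spread_clin[OF cspace_A u]]] clin_additive[OF F_clin]] _ z])
    (use u proj_closed in \<open>simp add: slice_pure G_pure canonical_pure spread_left_act \<delta>_closed F_left_act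
      clinD(1)[OF spread_clin[OF cspace_A u]] proj_pure[OF com]\<close>)

text \<open>
  The translation map is a section of the canonical map, so \<open>x y\<^sub>0 \<otimes> y\<^sub>1 = 1 \<otimes> c\<close> in the formula for the
  value of \<open>G\<close> on a slice.
\<close>

lemma G_translate:
  assumes s: "s \<in> carrier (ctensor C V)"
  shows "G (translate s) = cpure A' V \<one>\<^bsub>A'\<^esub> (tensor_lift V \<pi> s)"
proof (rule ctensor_additive_eqI[OF cspace_C cspace_V additive_comp[OF translate_additive G_additive] _ _ s])
  show "additive_map (ctensor C V) (ctensor A' V) (\<lambda>s. cpure A' V \<one>\<^bsub>A'\<^esub> (tensor_lift V \<pi> s))"
    by (rule clin_additive[OF clin_comp[OF clift_clin[OF cspace_C cspace_V cspace_V \<pi>b]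
          cbilinD(1)[OF cbilin_cpure[OF alg'.cspace_A cspace_V] alg'.one_closed]]])
  show "G (translate (cpure C V c u)) = cpure A' V \<one>\<^bsub>A'\<^esub> (tensor_lift V \<pi> (cpure C V c u))"
    if "c \<in> carrier C" "u \<in> carrier V" for c u
    using that by (simp add: translate_pure G_slice[OF that(2) translation_closed[OF that(1)]] can_of_inv spread_pure f_clin
        clift_pure[OF cspace_C cspace_V cspace_V \<pi>b])
qed

lemma G_inv:
  assumes t: "t \<in> carrier (ctensor A' V)" shows "G (comparison_inv t) = t"
proof (rule ctensor_additive_eqI[OF alg'.cspace_A cspace_V additive_comp[OF comparison_inv_additive G_additive] clin_additive[OF clin_ident] _ t])
  fix a v assume a: "a \<in> carrier A'" and v: "v \<in> carrier V"
  show "G (comparison_inv (cpure A' V a v)) = cpure A' V a v"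
    using a v by (simp add: comparison_inv_pure G_smult[OF a translate_closed[OF \<rho>_closed[OF v]]] G_translate[OF \<rho>_closed[OF v]] retraction alg'.left_act_pure)
qed

lemma translate_act_balanced: "balanced complex_ring A (ctensor C V) T (\<lambda>a s. f a \<odot>\<^bsub>T\<^esub> translate s)"
proof (rule balancedI)
  fix a s assume a: "a \<in> carrier A" and s: "s \<in> carrier (ctensor C V)"
  have fa: "f a \<in> carrier A'" using a by simp
  note k = translate_closed
  show "f a \<odot>\<^bsub>T\<^esub> translate s \<in> carrier T" by (rule T_moduleD(3)[OF fa k[OF s]])
  show "f a \<odot>\<^bsub>T\<^esub> translate (s \<oplus>\<^bsub>ctensor C V\<^esub> s') = f a \<odot>\<^bsub>T\<^esub> translate s \<oplus>\<^bsub>T\<^esub> f a \<odot>\<^bsub>T\<^esub> translate s'" if s': "s' \<in> carrier (ctensor C V)" for s'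
    unfolding additive_add[OF translate_additive s s'] by (rule T_moduleD(5)[OF fa k[OF s] k[OF s']])
  show "f (a \<oplus>\<^bsub>A\<^esub> a') \<odot>\<^bsub>T\<^esub> translate s = f a \<odot>\<^bsub>T\<^esub> translate s \<oplus>\<^bsub>T\<^esub> f a' \<odot>\<^bsub>T\<^esub> translate s" if "a' \<in> carrier A" for a'
    using T_moduleD(4)[OF fa _ k[OF s], of "f a'"] a that by (simp del: tensor_module_simps)
  show "f (r \<odot>\<^bsub>A\<^esub> a) \<odot>\<^bsub>T\<^esub> translate s = f a \<odot>\<^bsub>T\<^esub> translate (r \<odot>\<^bsub>ctensor C V\<^esub> s)" for r
  proof -
    have "f a \<odot>\<^bsub>T\<^esub> translate (r \<odot>\<^bsub>ctensor C V\<^esub> s) = (f a \<otimes>\<^bsub>A'\<^esub> f (r \<odot>\<^bsub>A\<^esub> \<one>\<^bsub>A\<^esub>)) \<odot>\<^bsub>T\<^esub> translate s"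
      unfolding translate_scale[OF s] by (rule T_moduleD(6)[OF fa _ k[OF s], symmetric]) simp
    also have "f a \<otimes>\<^bsub>A'\<^esub> f (r \<odot>\<^bsub>A\<^esub> \<one>\<^bsub>A\<^esub>) = f (r \<odot>\<^bsub>A\<^esub> a)"
      unfolding f_scalar using a by (simp add: alg'.smult_mult clinD(3)[OF f_clin])
    finally show ?thesis ..
  qed
qed

text \<open>
  On a cotensor \<open>t\<close> the coaction of \<open>V\<close> can be exchanged for that of \<open>A\<close>. Then the inverse of the
  canonical map is applied to \<open>a\<^sub>0 \<otimes> a\<^sub>1\<close>, where its value is \<open>1 \<otimes> a\<close>, and what remains is the projection
  of \<open>t\<close>, which is \<open>t\<close>.
\<close>

lemma inv_F:
  assumes tK: "t \<in> carrier (cotensor C A \<delta> V \<rho>)"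
  shows "comparison_inv (F t) = pure_tensor B M K \<one>\<^bsub>A'\<^esub> t"
proof -
  have t: "t \<in> carrier (ctensor A V)" using tK K_in by simp
  let ?\<omega> = "tensor_lift T (\<lambda>a s. f a \<odot>\<^bsub>T\<^esub> translate s)"
  have CV: "cspace (ctensor C V)" and AC: "cspace (ctensor A C)" by simp_all
  note \<omega>a = clift_additive[OF cspace_A CV T_abelian translate_act_balanced]
  note \<omega>p = clift_pure_balanced[OF cspace_A CV T_abelian translate_act_balanced]
  have 1: "comparison_inv (F t) = ?\<omega> (cmap A (ctensor C V) id \<rho> t)"
    by (rule ctensor_additive_eqI[OF cspace_A cspace_V additive_comp[OF clin_additive[OF F_clin] comparison_inv_additive]
          additive_comp[OF clin_additive[OF coact_right_clin[OF com V]] \<omega>a] _ t])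
      (simp add: f_clin comparison_inv_pure \<omega>p \<rho>_closed)
  have 2: "?\<omega> (cassoc A C V (cpure (ctensor A C) V s v)) = slice v (can_inv s)"
    if s: "s \<in> carrier (ctensor A C)" and v: "v \<in> carrier V" for s v
  proof (rule ctensor_additive_eqI[OF cspace_A cspace_C _ additive_comp[OF can_inv_additive slice_additive[OF v]] _ s])
    show "additive_map (ctensor A C) T (\<lambda>s. ?\<omega> (cassoc A C V (cpure (ctensor A C) V s v)))"
      by (rule additive_comp[OF clin_additive[OF clin_comp[OF cbilinD(2)[OF cbilin_cpure[OF AC cspace_V] v]
              cassoc_clin[OF cspace_A cspace_C cspace_V]]] \<omega>a])
    fix x c assume x: "x \<in> carrier A" and c: "c \<in> carrier C"
    have "?\<omega> (cassoc A C V (cpure (ctensor A C) V (cpure A C x c) v)) = f x \<odot>\<^bsub>T\<^esub> slice v (translation c)"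
      using x c v by (simp add: \<omega>p translate_pure)
    also have "\<dots> = slice v (x \<odot>\<^bsub>U\<^esub> translation c)" by (rule slice_smult[OF v x translation_closed[OF c], symmetric])
    also have "x \<odot>\<^bsub>U\<^esub> translation c = can_inv (cpure A C x c)"
      using can_inv_smult[OF x, of "cpure A C \<one>\<^bsub>A\<^esub> c"] x c by (simp add: left_act_pure)
    finally show "?\<omega> (cassoc A C V (cpure (ctensor A C) V (cpure A C x c) v)) = slice v (can_inv (cpure A C x c))" .
  qed
  have 3: "can_inv (\<delta> a) = pure_tensor B RA LA \<one>\<^bsub>A\<^esub> a" if a: "a \<in> carrier A" for a
  proof (rule can_inv_unique)
    show "pure_tensor B RA LA \<one>\<^bsub>A\<^esub> a \<in> carrier U"
      using pure_closed[OF right_mult_right_module left_mult_left_module, of "\<one>\<^bsub>A\<^esub>" a] a by simp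
    show "can (pure_tensor B RA LA \<one>\<^bsub>A\<^esub> a) = \<delta> a" using a by (simp add: canonical_pure left_act_one \<delta>_closed)
  qed
  have P: "additive_map (ctensor A V) T (\<lambda>t. pure_tensor B M K \<one>\<^bsub>A'\<^esub> (proj A \<delta> t))"
    by (rule additiveI)
      (use proj_cotensor[OF com] in \<open>simp_all add: T_pure_closed T_pure_add clinD(2)[OF proj_clin[OF com]] del: tensor_module_simps\<close>)
  have 4: "?\<omega> (cassoc A C V (cmap (ctensor A C) V \<delta> id t)) = pure_tensor B M K \<one>\<^bsub>A'\<^esub> (proj A \<delta> t)"
    by (rule ctensor_additive_eqI[OF cspace_A cspace_V additive_comp[OF clin_additive[OF coact_left_clin[OF com V]] \<omega>a] P _ t])
      (simp add: \<delta>_clin 2 3 \<delta>_closed slice_pure)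
  show ?thesis using 1 4 tK cotensor_carrier[OF com V] proj_ident[OF com tK] by simp
qed

lemma inv_G:
  assumes x: "x \<in> carrier T" shows "comparison_inv (G x) = x"
proof (rule T_eqI[OF additive_comp[OF G_additive comparison_inv_additive] _ _ x])
  show "additive_map T T (\<lambda>x. x)" by (simp add: additive_map_def)
  fix m n assume m: "m \<in> carrier A'" and n: "n \<in> carrier K"
  have nc: "n \<in> carrier (ctensor A V)" using n K_in by simp
  have "comparison_inv (F n) = pure_tensor B M K \<one>\<^bsub>A'\<^esub> n" using inv_F n by simp
  then show "comparison_inv (G (pure_tensor B M K m n)) = pure_tensor B M K m n"
    using m n by (simp add: G_pure comparison_inv_left_act F_closed nc T_smult_pure)
qed

text \<open>
  One composite is the identity because \<open>\<pi>\<close> retracts the coaction of \<open>V\<close>, the other one by \<open>inv_F\<close> and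
  \<open>A'\<close>-linearity.
\<close>

lemma comparison_bij: "bij_betw G (carrier (tensor B M K)) (carrier (ctensor A' V))"
proof (rule bij_betw_byWitness[where f' = comparison_inv])
  show "\<forall>a\<in>carrier (tensor B M K). comparison_inv (G a) = a" using inv_G by simp
  show "\<forall>a'\<in>carrier (ctensor A' V). G (comparison_inv a') = a'" using G_inv by simp
  show "G ` carrier (tensor B M K) \<subseteq> carrier (ctensor A' V)" using additive_closed[OF G_additive] by auto
  show "comparison_inv ` carrier (ctensor A' V) \<subseteq> carrier (tensor B M K)" using additive_closed[OF comparison_inv_additive] by auto
qed

end

context coalg begin

lemma cotensor_map:
  assumes A: "right_comodule C A \<delta>" and A': "right_comodule C A' \<delta>'" and V: "left_comodule C V \<rho>" and W: "left_comodule C W \<sigma>"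
    and f: "right_colinear C A \<delta> A' \<delta>' f" and \<phi>: "left_colinear C V \<rho> W \<sigma> \<phi>"
    and t: "t \<in> carrier (cotensor C A \<delta> V \<rho>)"
  shows "cmap A' W f \<phi> t \<in> carrier (cotensor C A' \<delta>' W \<sigma>)"
proof -
  note [simp] = right_comoduleD(1,2)[OF A] right_comoduleD(1,2)[OF A'] left_comoduleD(1,2)[OF V] left_comoduleD(1,2)[OF W]
  have fl [simp]: "f \<in> clin A A'" and fc: "a \<in> carrier A \<Longrightarrow> \<delta>' (f a) = cmap A' C f id (\<delta> a)" for a
    using f by (simp_all add: right_colinear_def)
  have \<phi>l [simp]: "\<phi> \<in> clin V W" and \<phi>c: "v \<in> carrier V \<Longrightarrow> \<sigma> (\<phi> v) = cmap C W id \<phi> (\<rho> v)" for v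
    using \<phi> by (simp_all add: left_colinear_def)
  have tc: "t \<in> carrier (ctensor A V)" and te: "cassoc A C V (cmap (ctensor A C) V \<delta> id t) = cmap A (ctensor C V) id \<rho> t"
    using t by (simp_all add: cotensor_def)
  have cf [simp]: "cmap A' C f id \<in> clin (ctensor A C) (ctensor A' C)" by simp
  have cp [simp]: "cmap C W id \<phi> \<in> clin (ctensor C V) (ctensor C W)" by simp
  have F: "cmap A' W f \<phi> t \<in> carrier (ctensor A' W)" by (rule clinD(1)[OF cmap_clin tc]) simp_all
  have dt: "cmap (ctensor A C) V \<delta> id t \<in> carrier (ctensor (ctensor A C) V)" by (rule clinD(1)[OF cmap_clin tc]) simp_all
  have "cmap (ctensor A' C) W \<delta>' id (cmap A' W f \<phi> t) = cmap (ctensor A' C) W (\<lambda>a. \<delta>' (f a)) (\<lambda>v. id (\<phi> v)) t"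
    by (rule cmap_comp[where X = A and Y = V and X' = A' and Y' = W]) (use tc in simp_all)
  also have "\<dots> = cmap (ctensor A' C) W (\<lambda>a. cmap A' C f id (\<delta> a)) (\<lambda>v. \<phi> (id v)) t"
    by (rule cmap_cong[where X = A and Y = V])
      (use tc clin_comp[OF fl right_comoduleD(2)[OF A']] clin_comp[OF right_comoduleD(2)[OF A] cf] in \<open>simp_all add: fc\<close>)
  also have "\<dots> = cmap (ctensor A' C) W (cmap A' C f id) \<phi> (cmap (ctensor A C) V \<delta> id t)"
    by (rule cmap_comp[where X = A and Y = V and X' = "ctensor A C" and Y' = V, symmetric]) (use tc in simp_all)
  finally have "cassoc A' C W (cmap (ctensor A' C) W \<delta>' id (cmap A' W f \<phi> t)) =
      cassoc A' C W (cmap (ctensor A' C) W (cmap A' C f id) \<phi> (cmap (ctensor A C) V \<delta> id t))" by simp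
  also have "\<dots> = cmap A' (ctensor C W) f (cmap C W id \<phi>) (cassoc A C V (cmap (ctensor A C) V \<delta> id t))"
    by (rule cassoc_natural[OF _ _ _ _ _ _ _ _ _ dt]) simp_all
  also have "\<dots> = cmap A' (ctensor C W) f (cmap C W id \<phi>) (cmap A (ctensor C V) id \<rho> t)" by (simp only: te)
  also have "\<dots> = cmap A' (ctensor C W) (\<lambda>a. f (id a)) (\<lambda>v. cmap C W id \<phi> (\<rho> v)) t"
    by (rule cmap_comp[where X = A and Y = V and X' = A and Y' = "ctensor C V"]) (use tc in simp_all)
  also have "\<dots> = cmap A' (ctensor C W) (\<lambda>a. id (f a)) (\<lambda>v. \<sigma> (\<phi> v)) t"
    by (rule cmap_cong[where X = A and Y = V])
      (use tc clin_comp[OF \<phi>l left_comoduleD(2)[OF W]] clin_comp[OF left_comoduleD(2)[OF V] cp] in \<open>simp_all add: \<phi>c\<close>)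
  also have "\<dots> = cmap A' (ctensor C W) id \<sigma> (cmap A' W f \<phi> t)"
    by (rule cmap_comp[where X = A and Y = V and X' = A' and Y' = W, symmetric]) (use tc in simp_all)
  finally show ?thesis using F by (simp add: cotensor_def)
qed

lemma right_colinear_id:
  assumes "right_comodule C A \<delta>" shows "right_colinear C A \<delta> A \<delta> id"
proof -
  note D = right_comoduleD[OF assms]
  show ?thesis using D(1) clinD(1)[OF D(2)] by (simp add: right_colinear_def cmap_ident)
qed

lemma left_colinear_id:
  assumes "left_comodule C V \<rho>" shows "left_colinear C V \<rho> V \<rho> id"
proof -
  note D = left_comoduleD[OF assms]
  show ?thesis using D(1) clinD(1)[OF D(2)] by (simp add: left_colinear_def cmap_ident)
qed

end

section \<open>Descent to the coinvariants\<close>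

text \<open>
  The quotient is realised on the cosets of \<open>S\<close>; only the quotient map and its kernel matter later.
\<close>

lemma quotient_module:
  fixes N :: "('r, 'n, 'z) module_scheme"
  assumes N: "left_module R N" and S: "lsubmodule R N S"
  obtains Q :: "('r, 'n set) module" and q where "left_module R Q" "q \<in> mod_homs R N Q"
    "\<And>x. x \<in> carrier N \<Longrightarrow> q x = \<zero>\<^bsub>Q\<^esub> \<longleftrightarrow> x \<in> S"
proof -
  note L = left_moduleD[OF N] and D = lsubmoduleD[OF S]
  interpret R: ring R by (rule L(1))
  interpret N: abelian_group N by (rule L(2))
  define q where "q x = (\<lambda>w. x \<oplus>\<^bsub>N\<^esub> w) ` S" for x
  have neg: "\<ominus>\<^bsub>N\<^esub> w \<in> S" if "w \<in> S" for w
    using D(4)[of "\<ominus>\<^bsub>R\<^esub> \<one>\<^bsub>R\<^esub>" w] that D(1)[OF that] by (simp add: left_smult_minus_one[OF N])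
  have sub: "q (y \<oplus>\<^bsub>N\<^esub> w) \<subseteq> q y" if "w \<in> S" "y \<in> carrier N" for y w
    unfolding q_def
  proof
    fix u assume "u \<in> (\<lambda>v. y \<oplus>\<^bsub>N\<^esub> w \<oplus>\<^bsub>N\<^esub> v) ` S"
    then obtain v where v: "v \<in> S" "u = y \<oplus>\<^bsub>N\<^esub> w \<oplus>\<^bsub>N\<^esub> v" by blast
    then have "u = y \<oplus>\<^bsub>N\<^esub> (w \<oplus>\<^bsub>N\<^esub> v)" using that D(1) by (simp add: N.a_assoc)
    then show "u \<in> (\<lambda>w. y \<oplus>\<^bsub>N\<^esub> w) ` S" using D(3)[OF that(1) v(1)] by blast
  qed
  have iff: "q x = q y \<longleftrightarrow> (\<exists>w\<in>S. x = y \<oplus>\<^bsub>N\<^esub> w)" if x: "x \<in> carrier N" and y: "y \<in> carrier N" for x y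
  proof
    assume e: "q x = q y"
    have "x \<in> q x" unfolding q_def using D(2) x by (intro image_eqI[of _ _ "\<zero>\<^bsub>N\<^esub>"]) simp_all
    then have "x \<in> q y" unfolding e .
    then show "\<exists>w\<in>S. x = y \<oplus>\<^bsub>N\<^esub> w" by (auto simp: q_def)
  next
    assume "\<exists>w\<in>S. x = y \<oplus>\<^bsub>N\<^esub> w"
    then obtain w where w: "w \<in> S" "x = y \<oplus>\<^bsub>N\<^esub> w" by blast
    have "y = x \<oplus>\<^bsub>N\<^esub> (\<ominus>\<^bsub>N\<^esub> w)" using w D(1)[OF w(1)] y by (simp add: N.a_assoc N.r_neg)
    then show "q x = q y" using sub[OF w(1) y] sub[OF neg[OF w(1)] x] w(2) by auto
  qed
  have ca: "q (x \<oplus>\<^bsub>N\<^esub> y) = q (x' \<oplus>\<^bsub>N\<^esub> y')"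
    if c: "x \<in> carrier N" "x' \<in> carrier N" "y \<in> carrier N" "y' \<in> carrier N" and e: "q x = q x'" "q y = q y'" for x x' y y'
  proof -
    obtain v where v: "v \<in> S" "x = x' \<oplus>\<^bsub>N\<^esub> v" using e(1) unfolding iff[OF c(1,2)] by (rule bexE)
    obtain w where w: "w \<in> S" "y = y' \<oplus>\<^bsub>N\<^esub> w" using e(2) unfolding iff[OF c(3,4)] by (rule bexE)
    have "x \<oplus>\<^bsub>N\<^esub> y = (x' \<oplus>\<^bsub>N\<^esub> y') \<oplus>\<^bsub>N\<^esub> (v \<oplus>\<^bsub>N\<^esub> w)"
      using c D(1)[OF v(1)] D(1)[OF w(1)] by (simp add: v(2) w(2) N.a_ac)
    then show ?thesis unfolding iff[OF N.a_closed[OF c(1,3)] N.a_closed[OF c(2,4)]] by (rule bexI) (rule D(3)[OF v(1) w(1)])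
  qed
  have cs: "q (r \<odot>\<^bsub>N\<^esub> x) = q (r \<odot>\<^bsub>N\<^esub> x')"
    if c: "r \<in> carrier R" "x \<in> carrier N" "x' \<in> carrier N" and e: "q x = q x'" for r x x'
  proof -
    obtain v where v: "v \<in> S" "x = x' \<oplus>\<^bsub>N\<^esub> v" using e unfolding iff[OF c(2,3)] by (rule bexE)
    have "r \<odot>\<^bsub>N\<^esub> x = r \<odot>\<^bsub>N\<^esub> x' \<oplus>\<^bsub>N\<^esub> r \<odot>\<^bsub>N\<^esub> v" unfolding v(2) by (rule L(5)[OF c(1,3) D(1)[OF v(1)]])
    then show ?thesis unfolding iff[OF L(3)[OF c(1,2)] L(3)[OF c(1,3)]] by (rule bexI) (rule D(4)[OF c(1) v(1)])
  qed
  show ?thesis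
  proof (rule that)
    show "left_module R (image_module N q)" by (rule image_module(1)[OF N]) (rule ca cs; assumption)+
    show "q \<in> mod_homs R N (image_module N q)" by (rule image_module(2)[OF N]) (rule ca cs; assumption)+
    show "q x = \<zero>\<^bsub>image_module N q\<^esub> \<longleftrightarrow> x \<in> S" if "x \<in> carrier N" for x
      using iff[OF that N.zero_closed] D(1) by (auto simp: image_module_def)
  qed
qed

text \<open>
  The situation of the theorem: a colinear algebra map between Galois extensions with the same group-like
  element. The second instance of \<open>galois_map\<close> is that of the identity of \<open>A'\<close>.
\<close>

locale galois_pair = galois_map C V \<rho> \<pi> A \<delta> A' f + Y: galois_map C V \<rho> \<pi> A' \<delta>' A' id
  for C :: "'c coalgebra" and V :: "(complex, 'v) module" and \<rho> \<pi>
    and A :: "(complex, 'a) module" and \<delta> and A' :: "(complex, 'b) module" and \<delta>' and f +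
  fixes e :: 'c
  assumes f_colinear: "right_colinear C A \<delta> A' \<delta>' f"
    and e: "e \<in> carrier C" "\<delta> \<one>\<^bsub>A\<^esub> = cpure A C \<one>\<^bsub>A\<^esub> e" "\<delta>' \<one>\<^bsub>A'\<^esub> = cpure A' C \<one>\<^bsub>A'\<^esub> e"
    and ff: "faithfully_flat_right (coinv_alg C A' \<delta>') (right_mult_module A')"
begin

abbreviation "B' \<equiv> coinv_alg C A' \<delta>'"
abbreviation "P \<equiv> cotensor_module C A' \<delta>' V \<rho>"
abbreviation "M0 \<equiv> restricted_right_module B' f"
abbreviation "H \<equiv> induced_module B B' f K"
abbreviation "RA' \<equiv> right_mult_module A'"

lemma f_coinvariant:
  assumes b: "b \<in> coinvariants C A \<delta>" shows "f b \<in> coinvariants C A' \<delta>'"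
proof (rule Y.coinvariant_of_galois[OF bij_betw_imp_inj_on[OF Y.gal] e(1,3)])
  have bA: "b \<in> carrier A" by (rule coinvD(1)[OF b])
  then show "f b \<in> carrier A'" by simp
  have "\<delta> b = cpure A C b e" using coinvD(2)[OF b one_closed] bA e by (simp add: left_act_pure)
  then show "\<delta>' (f b) = cpure A' C (f b) e"
    using f_colinear bA e(1) by (simp add: right_colinear_def f_clin)
qed

lemma f_algebra_hom: "algebra_hom B B' f"
proof -
  have "f \<in> ring_hom B B'" by (rule ring_hom_memI) (auto simp: coinvD f_coinvariant)
  moreover have "f \<in> clin B B'" by (rule clinI) (auto simp: coinvD f_coinvariant clinD[OF f_clin])
  ultimately show ?thesis using B_algebra Y.B_algebra by (simp add: algebra_hom_def)
qed

lemma f_B_B'_ring: "f \<in> ring_hom B B'" using f_algebra_hom by (simp add: algebra_hom_def)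

lemma M0_right_module: "right_module B M0" by (rule restricted_right_module[OF B_ring Y.B_ring f_B_B'_ring])

lemmas P_simps [simp] = Y.N_simps[OF V]

lemma F_P: "t \<in> carrier K \<Longrightarrow> F t \<in> carrier P"
  using cotensor_map[OF com Y.com V V f_colinear left_colinear_id[OF V]] by simp

lemma H_def: "H = tensor_module B M0 K (left_mult_module B')"
  by (simp add: induced_module_def)

lemma B'_left_mult: "left_module B' (left_mult_module B')"
proof -
  interpret S: ring B' by (rule Y.B_ring)
  show ?thesis
    by (rule left_moduleI) (simp_all only: S.ring_axioms left_mult_module_def with_smult_simps with_smult_abelian_group
        S.is_abelian_group S.r_distr S.l_distr S.m_assoc S.m_closed S.l_one)
qed

lemma H_left_module: "left_module B' H"
  and H_smult_pure: "s \<in> carrier B' \<Longrightarrow> m \<in> carrier B' \<Longrightarrow> n \<in> carrier K \<Longrightarrow>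
      s \<odot>\<^bsub>H\<^esub> pure_tensor B M0 K m n = pure_tensor B M0 K (s \<otimes>\<^bsub>A'\<^esub> m) n"
  unfolding H_def
  using tensor_module_left_module[OF M0_right_module K_left_module B'_left_mult]
  by (simp_all add: alg'.m_assoc coinvD Y.coinvD f_coinvariant)

lemma H_simps [simp]: "carrier H = carrier (tensor B M0 K)" "x \<oplus>\<^bsub>H\<^esub> y = x \<oplus>\<^bsub>tensor B M0 K\<^esub> y" "\<zero>\<^bsub>H\<^esub> = \<zero>\<^bsub>tensor B M0 K\<^esub>"
  by (simp_all add: H_def)

lemma P_left_module: "left_module B' P" by (rule Y.N_left_module[OF V])

lemma B'_sub: "carrier B' \<subseteq> carrier A'" using Y.coinvD by auto

lemma comparison_B'_additive: "additive_map (tensor B M0 K) (ctensor A' V) G"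
  by (rule comparison_additive[OF B'_sub _ _ M0_right_module]) simp_all

lemma comparison_B'_pure: "m \<in> carrier B' \<Longrightarrow> n \<in> carrier K \<Longrightarrow> G (pure_tensor B M0 K m n) = left_act A' V m (F n)"
  by (rule comparison_pure[OF B'_sub _ _ M0_right_module]) simp_all

lemma comparison_B'_closed:
  assumes "x \<in> carrier H" shows "G x \<in> carrier P"
proof -
  note S = csubspaceD[OF Y.cotensor_csubspace[OF V]]
  have "x \<in> carrier (tensor B M0 K)" using assms by simp
  then show ?thesis
  proof (rule tensor_induct[OF M0_right_module K_left_module])
    show "G (pure_tensor B M0 K m n) \<in> carrier P" if "m \<in> carrier M0" "n \<in> carrier K" for m n
      using that F_P comparison_B'_pure Y.cotensor_left_act[OF V] by simp
    show "G (x \<oplus>\<^bsub>tensor B M0 K\<^esub> y) \<in> carrier P"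
      if "x \<in> carrier (tensor B M0 K)" "y \<in> carrier (tensor B M0 K)" "G x \<in> carrier P" "G y \<in> carrier P" for x y
      using that S(3) by (simp add: additive_add[OF comparison_B'_additive])
  qed
qed

lemma comparison_mod_homs: "G \<in> mod_homs B' H P"
proof (rule mod_homsI)
  show "G x \<in> carrier P" if "x \<in> carrier H" for x by (rule comparison_B'_closed[OF that])
  show "G (x \<oplus>\<^bsub>H\<^esub> y) = G x \<oplus>\<^bsub>P\<^esub> G y" if "x \<in> carrier H" "y \<in> carrier H" for x y
    using that by (simp add: additive_add[OF comparison_B'_additive])
  fix r x assume r: "r \<in> carrier B'" and x: "x \<in> carrier H"
  have rA: "r \<in> carrier A'" using r B'_sub by blast
  have sa: "additive_map (tensor B M0 K) (tensor B M0 K) (\<lambda>x. r \<odot>\<^bsub>H\<^esub> x)"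
    using left_moduleD(3,5)[OF H_left_module] r by (simp add: additive_map_def)
  have "G (r \<odot>\<^bsub>H\<^esub> x) = left_act A' V r (G x)"
  proof (rule tensor_additive_eqI[OF M0_right_module K_left_module additive_comp[OF sa comparison_B'_additive]
        additive_comp[OF comparison_B'_additive clin_additive[OF alg'.left_act_clin[OF cspace_V rA]]]])
    fix m n assume m: "m \<in> carrier M0" and n: "n \<in> carrier K"
    then have mB: "m \<in> carrier B'" by simp
    have mA: "m \<in> carrier A'" using mB B'_sub by blast
    have rm: "r \<otimes>\<^bsub>A'\<^esub> m \<in> carrier B'" using r mB Y.coinv_mult by simp
    show "G (r \<odot>\<^bsub>H\<^esub> pure_tensor B M0 K m n) = left_act A' V r (G (pure_tensor B M0 K m n))"
      unfolding H_smult_pure[OF r mB n] comparison_B'_pure[OF rm n] comparison_B'_pure[OF mB n]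
      by (rule alg'.left_act_mult[OF cspace_V rA mA]) (use n K_in F_closed in simp)
  qed (use x in simp)
  then show "G (r \<odot>\<^bsub>H\<^esub> x) = r \<odot>\<^bsub>P\<^esub> G x" by simp
qed

lemma RA'_right_module: "right_module B' RA'" by (rule Y.right_mult_right_module)

text \<open>
  Left multiplications are endomorphisms of \<open>A'\<close> as a right \<open>B'\<close>-module, and they carry \<open>1\<close> to every
  element.
\<close>

lemma unit_tensor_faithful:
  assumes X: "left_module B' X" and n: "n \<in> carrier X" and z: "pure_tensor B' RA' X \<one>\<^bsub>A'\<^esub> n = \<zero>\<^bsub>tensor B' RA' X\<^esub>"
  shows "n = \<zero>\<^bsub>X\<^esub>"
proof (rule faithfully_flat_unit[OF ff X _ _ n z])
  show "\<one>\<^bsub>A'\<^esub> \<in> carrier RA'" by simp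
  fix m assume "m \<in> carrier RA'"
  then have m: "m \<in> carrier A'" by simp
  show "\<exists>l\<in>mod_homs B' RA' RA'. l \<one>\<^bsub>A'\<^esub> = m"
    by (rule bexI[of _ "\<lambda>x. m \<otimes>\<^bsub>A'\<^esub> x"])
      (use m Y.coinvD in \<open>auto intro!: mod_homsI simp: alg'.r_distr alg'.m_assoc\<close>)
qed

lemma G_inj: "x \<in> carrier (tensor B M K) \<Longrightarrow> y \<in> carrier (tensor B M K) \<Longrightarrow> G x = G y \<Longrightarrow> x = y"
  using comparison_bij by (auto simp: bij_betw_def dest: inj_onD)

text \<open>
  The image \<open>?i n\<close> of \<open>n\<close> in \<open>A' \<otimes>\<^sub>B (A \<box> V)\<close> is zero, because \<open>G\<close> is injective there. The map \<open>?k\<close> sends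
  \<open>a' \<otimes> t\<close> to \<open>a' \<otimes> (1 \<otimes> t)\<close> in \<open>A' \<otimes>\<^sub>B' (B' \<otimes>\<^sub>B (A \<box> V))\<close>, and \<open>?k (?i n)\<close> is \<open>1 \<otimes> n\<close>.
\<close>

lemma comparison_kernel_trivial:
  assumes n: "n \<in> carrier H" and z: "G n = \<zero>\<^bsub>P\<^esub>" shows "n = \<zero>\<^bsub>H\<^esub>"
proof (rule unit_tensor_faithful[OF H_left_module n])
  have n': "n \<in> carrier (tensor B M0 K)" using n by simp
  note tH = tensor_abelian_group[OF RA'_right_module H_left_module]
  have idM: "id \<in> mod_homs B M0 M" by (rule mod_homsI) (use Y.coinvD in simp_all)
  let ?i = "tensor_map B M K id id"
  note ia = tensor_map_additive[OF M0_right_module K_left_module M_right_module K_left_module idM mod_homs_id]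
  note ip = tensor_map_pure[OF M0_right_module K_left_module M_right_module K_left_module idM mod_homs_id]
  have GT: "additive_map (tensor B M K) (ctensor A' V) G" using G_additive by (simp add: additive_T)
  have "G (?i n) = G n"
    by (rule tensor_additive_eqI[OF M0_right_module K_left_module additive_comp[OF ia GT] comparison_B'_additive _ n'])
      (use Y.coinvD in \<open>simp add: ip G_pure comparison_B'_pure\<close>)
  also have "\<dots> = G \<zero>\<^bsub>tensor B M K\<^esub>"
    using z additive_zero[OF tensor_abelian_group[OF M_right_module K_left_module] _ GT] by simp
  finally have i0: "?i n = \<zero>\<^bsub>tensor B M K\<^esub>"
    using G_inj[OF additive_closed[OF ia n']] abelian_groupE(2)[OF tensor_abelian_group[OF M_right_module K_left_module]] by blast
  have pH: "pure_tensor B M0 K \<one>\<^bsub>A'\<^esub> t \<in> carrier H" if "t \<in> carrier K" for t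
    using pure_closed[OF M0_right_module K_left_module, of "\<one>\<^bsub>A'\<^esub>" t] that Y.coinv_one by simp
  have kb: "balanced B M K (tensor B' RA' H) (\<lambda>a t. pure_tensor B' RA' H a (pure_tensor B M0 K \<one>\<^bsub>A'\<^esub> t))"
  proof (rule balancedI)
    fix a t assume a: "a \<in> carrier M" and t: "t \<in> carrier K"
    then have aA: "a \<in> carrier RA'" by simp
    show "pure_tensor B' RA' H a (pure_tensor B M0 K \<one>\<^bsub>A'\<^esub> t) \<in> carrier (tensor B' RA' H)"
      by (rule pure_closed[OF RA'_right_module H_left_module aA pH[OF t]])
    show "pure_tensor B' RA' H a (pure_tensor B M0 K \<one>\<^bsub>A'\<^esub> (t \<oplus>\<^bsub>K\<^esub> t')) =
        pure_tensor B' RA' H a (pure_tensor B M0 K \<one>\<^bsub>A'\<^esub> t) \<oplus>\<^bsub>tensor B' RA' H\<^esub> pure_tensor B' RA' H a (pure_tensor B M0 K \<one>\<^bsub>A'\<^esub> t')"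
      if t': "t' \<in> carrier K" for t'
      using pure_add_right[OF RA'_right_module H_left_module aA pH[OF t] pH[OF t']]
        pure_add_right[OF M0_right_module K_left_module _ t t', of "\<one>\<^bsub>A'\<^esub>"] Y.coinv_one by (simp del: K_simps P_simps)
    show "pure_tensor B' RA' H (a \<oplus>\<^bsub>M\<^esub> a') (pure_tensor B M0 K \<one>\<^bsub>A'\<^esub> t) =
        pure_tensor B' RA' H a (pure_tensor B M0 K \<one>\<^bsub>A'\<^esub> t) \<oplus>\<^bsub>tensor B' RA' H\<^esub> pure_tensor B' RA' H a' (pure_tensor B M0 K \<one>\<^bsub>A'\<^esub> t)"
      if "a' \<in> carrier M" for a'
      using pure_add_left[OF RA'_right_module H_left_module aA _ pH[OF t], of a'] that by simp
    show "pure_tensor B' RA' H (r \<odot>\<^bsub>M\<^esub> a) (pure_tensor B M0 K \<one>\<^bsub>A'\<^esub> t) = pure_tensor B' RA' H a (pure_tensor B M0 K \<one>\<^bsub>A'\<^esub> (r \<odot>\<^bsub>K\<^esub> t))"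
      if r: "r \<in> carrier B" for r
    proof -
      have fr: "f r \<in> carrier B'" "f r \<in> carrier A'" using r f_coinvariant coinvD by simp_all
      have o: "\<one>\<^bsub>A'\<^esub> \<in> carrier B'" using Y.coinv_one by simp
      have "pure_tensor B' RA' H (r \<odot>\<^bsub>M\<^esub> a) (pure_tensor B M0 K \<one>\<^bsub>A'\<^esub> t) = pure_tensor B' RA' H a (f r \<odot>\<^bsub>H\<^esub> pure_tensor B M0 K \<one>\<^bsub>A'\<^esub> t)"
        using pure_balanced[OF RA'_right_module H_left_module fr(1) aA pH[OF t]] by simp
      also have "f r \<odot>\<^bsub>H\<^esub> pure_tensor B M0 K \<one>\<^bsub>A'\<^esub> t = pure_tensor B M0 K (r \<odot>\<^bsub>M0\<^esub> \<one>\<^bsub>A'\<^esub>) t"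
        using H_smult_pure[OF fr(1) o t] fr by simp
      also have "\<dots> = pure_tensor B M0 K \<one>\<^bsub>A'\<^esub> (r \<odot>\<^bsub>K\<^esub> t)"
        by (rule pure_balanced[OF M0_right_module K_left_module r _ t]) (use o in simp)
      finally show ?thesis .
    qed
  qed
  let ?k = "tensor_lift (tensor B' RA' H) (\<lambda>a t. pure_tensor B' RA' H a (pure_tensor B M0 K \<one>\<^bsub>A'\<^esub> t))"
  note ka = tensor_lift_additive[OF M_right_module K_left_module tH kb]
  note kp = tensor_lift_pure[OF M_right_module K_left_module tH kb]
  have ua: "additive_map (tensor B M0 K) (tensor B' RA' H) (pure_tensor B' RA' H \<one>\<^bsub>A'\<^esub>)"
    using pure_closed[OF RA'_right_module H_left_module, of "\<one>\<^bsub>A'\<^esub>"] pure_add_right[OF RA'_right_module H_left_module, of "\<one>\<^bsub>A'\<^esub>"]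
    by (simp add: additive_map_def)
  have "pure_tensor B' RA' H \<one>\<^bsub>A'\<^esub> n = ?k (?i n)"
  proof (rule tensor_additive_eqI[OF M0_right_module K_left_module ua additive_comp[OF ia ka] _ n'])
    fix m t assume m: "m \<in> carrier M0" and t: "t \<in> carrier K"
    have mB: "m \<in> carrier B'" and mA: "m \<in> carrier A'" using m Y.coinvD by simp_all
    have o: "\<one>\<^bsub>A'\<^esub> \<in> carrier B'" using Y.coinv_one by simp
    have mM: "m \<in> carrier M" using mA by simp
    have "?k (?i (pure_tensor B M0 K m t)) = pure_tensor B' RA' H m (pure_tensor B M0 K \<one>\<^bsub>A'\<^esub> t)"
      using ip[OF m t] kp[OF mM t] by simp
    also have "\<dots> = pure_tensor B' RA' H (m \<odot>\<^bsub>RA'\<^esub> \<one>\<^bsub>A'\<^esub>) (pure_tensor B M0 K \<one>\<^bsub>A'\<^esub> t)" using mA by simp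
    also have "\<dots> = pure_tensor B' RA' H \<one>\<^bsub>A'\<^esub> (m \<odot>\<^bsub>H\<^esub> pure_tensor B M0 K \<one>\<^bsub>A'\<^esub> t)"
      by (rule pure_balanced[OF RA'_right_module H_left_module mB _ pH[OF t]]) simp
    also have "m \<odot>\<^bsub>H\<^esub> pure_tensor B M0 K \<one>\<^bsub>A'\<^esub> t = pure_tensor B M0 K m t" using H_smult_pure[OF mB o t] mA by simp
    finally show "pure_tensor B' RA' H \<one>\<^bsub>A'\<^esub> (pure_tensor B M0 K m t) = ?k (?i (pure_tensor B M0 K m t))" ..
  qed
  also have "\<dots> = \<zero>\<^bsub>tensor B' RA' H\<^esub>"
    unfolding i0 by (rule additive_zero[OF tensor_abelian_group[OF M_right_module K_left_module] tH ka])
  finally show "pure_tensor B' RA' H \<one>\<^bsub>A'\<^esub> n = \<zero>\<^bsub>tensor B' RA' H\<^esub>" .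
qed

text \<open>
  Let \<open>y\<close> in \<open>A' \<otimes>\<^sub>B (A \<box> V)\<close> be the preimage of \<open>p\<close>, and let \<open>?m\<close> send \<open>a' \<otimes> t\<close> to \<open>a' \<otimes> f(t)\<close> in
  \<open>A' \<otimes>\<^sub>B' (A' \<box> V)\<close>. The bijection for the identity of \<open>A'\<close> maps \<open>?m y\<close> and \<open>1 \<otimes> p\<close> to the same
  element, so they are equal. Each \<open>f(t)\<close> is the image of \<open>1 \<otimes> t\<close>, so \<open>?m y\<close> vanishes modulo the image
  of the comparison map, and \<open>p\<close> does too by faithful flatness.
\<close>

lemma comparison_surj:
  assumes p: "p \<in> carrier P" shows "p \<in> G ` carrier H"
proof -
  have pc: "p \<in> carrier (ctensor A' V)" using p Y.K_in by simp
  note HD = left_moduleD[OF H_left_module] and PD = left_moduleD[OF P_left_module] and hD = mod_homsD[OF comparison_mod_homs]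
  have S: "lsubmodule B' P (G ` carrier H)"
    unfolding lsubmodule_def
  proof (intro conjI ballI)
    show "G ` carrier H \<subseteq> carrier P" using hD(1) by blast
    show "\<zero>\<^bsub>P\<^esub> \<in> G ` carrier H"
      using additive_zero[OF HD(2) PD(2) mod_homs_additive[OF comparison_mod_homs]] abelian_groupE(2)[OF HD(2)] by (metis imageI)
    show "x \<oplus>\<^bsub>P\<^esub> y \<in> G ` carrier H" if xy: "x \<in> G ` carrier H" "y \<in> G ` carrier H" for x y
    proof -
      obtain u where u: "x = G u" "u \<in> carrier H" using xy(1) by (rule imageE)
      obtain v where v: "y = G v" "v \<in> carrier H" using xy(2) by (rule imageE)
      show ?thesis unfolding u(1) v(1) hD(2)[OF u(2) v(2), symmetric] by (rule imageI[OF abelian_groupE(1)[OF HD(2) u(2) v(2)]])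
    qed
    show "r \<odot>\<^bsub>P\<^esub> x \<in> G ` carrier H" if rx: "r \<in> carrier B'" "x \<in> G ` carrier H" for r x
    proof -
      obtain u where u: "x = G u" "u \<in> carrier H" using rx(2) by (rule imageE)
      show ?thesis unfolding u(1) hD(3)[OF rx(1) u(2), symmetric] by (rule imageI[OF HD(3)[OF rx(1) u(2)]])
    qed
  qed
  obtain Q :: "('b, ('b, 'v) tens set) module" and q where Q: "left_module B' Q" "q \<in> mod_homs B' P Q"
    "\<And>x. x \<in> carrier P \<Longrightarrow> q x = \<zero>\<^bsub>Q\<^esub> \<longleftrightarrow> x \<in> G ` carrier H"
    by (rule quotient_module[OF P_left_module S]) (rule that)
  note tP = tensor_abelian_group[OF RA'_right_module P_left_module] and tQ = tensor_abelian_group[OF RA'_right_module Q(1)]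
  have mb: "balanced B M K (tensor B' RA' P) (\<lambda>a t. pure_tensor B' RA' P a (F t))"
  proof (rule balancedI)
    fix a t assume a: "a \<in> carrier M" and t: "t \<in> carrier K"
    then have aA: "a \<in> carrier RA'" by simp
    have tc: "t \<in> carrier (ctensor A V)" using t K_in by simp
    show "pure_tensor B' RA' P a (F t) \<in> carrier (tensor B' RA' P)"
      by (rule pure_closed[OF RA'_right_module P_left_module aA F_P[OF t]])
    show "pure_tensor B' RA' P a (F (t \<oplus>\<^bsub>K\<^esub> t')) = pure_tensor B' RA' P a (F t) \<oplus>\<^bsub>tensor B' RA' P\<^esub> pure_tensor B' RA' P a (F t')"
      if t': "t' \<in> carrier K" for t'
      using pure_add_right[OF RA'_right_module P_left_module aA F_P[OF t] F_P[OF t']] tc t' K_in by (simp add: clinD(2)[OF F_clin])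
    show "pure_tensor B' RA' P (a \<oplus>\<^bsub>M\<^esub> a') (F t) = pure_tensor B' RA' P a (F t) \<oplus>\<^bsub>tensor B' RA' P\<^esub> pure_tensor B' RA' P a' (F t)"
      if "a' \<in> carrier M" for a'
      using pure_add_left[OF RA'_right_module P_left_module aA _ F_P[OF t], of a'] that by simp
    show "pure_tensor B' RA' P (r \<odot>\<^bsub>M\<^esub> a) (F t) = pure_tensor B' RA' P a (F (r \<odot>\<^bsub>K\<^esub> t))" if r: "r \<in> carrier B" for r
    proof -
      have fr: "f r \<in> carrier B'" using r f_coinvariant by simp
      show ?thesis using pure_balanced[OF RA'_right_module P_left_module fr aA F_P[OF t]] r coinvD tc by (simp add: F_left_act)
    qed
  qed
  let ?m = "tensor_lift (tensor B' RA' P) (\<lambda>a t. pure_tensor B' RA' P a (F t))"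
  note ma = tensor_lift_additive[OF M_right_module K_left_module tP mb]
  note mp = tensor_lift_pure[OF M_right_module K_left_module tP mb]
  (* The comparison map for the identity of A', where the restricted module is A' itself. *)
  let ?G' = "comparison_map A' id V"
  have RM: "restricted_right_module A' id = RA'" by (simp add: right_mult_restricted)
  note bij' = Y.comparison_bij[unfolded RM]
  have G'a: "additive_map (tensor B' RA' P) (ctensor A' V) ?G'" by (rule iffD2[OF Y.additive_T Y.G_additive, unfolded RM])
  have G'p: "?G' (pure_tensor B' RA' P m n) = left_act A' V m n" if "m \<in> carrier A'" "n \<in> carrier P" for m n
    using Y.G_pure[OF that] that Y.K_in by (simp add: RM cmap_ident)
  have "p \<in> G ` carrier (tensor B M K)" unfolding bij_betw_imp_surj_on[OF comparison_bij] by (rule pc)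
  then obtain y where y': "p = G y" and y1: "y \<in> carrier (tensor B M K)" by (rule imageE)
  note y = y1 y'[symmetric]
  have GT: "additive_map (tensor B M K) (ctensor A' V) G" using G_additive by (simp add: additive_T)
  have "?G' (?m y) = G y"
    by (rule tensor_additive_eqI[OF M_right_module K_left_module additive_comp[OF ma G'a] GT _ y(1)])
      (use F_P in \<open>simp add: mp G'p G_pure\<close>)
  also have "\<dots> = ?G' (pure_tensor B' RA' P \<one>\<^bsub>A'\<^esub> p)" using y(2) G'p[OF _ p, of "\<one>\<^bsub>A'\<^esub>"] alg'.left_act_one[OF cspace_V pc] by simp
  finally have my: "?m y = pure_tensor B' RA' P \<one>\<^bsub>A'\<^esub> p"
    by (rule inj_onD[OF bij_betw_imp_inj_on[OF bij'] _ additive_closed[OF ma y(1)] pure_closed[OF RA'_right_module P_left_module _ p]]) simp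
  let ?t = "tensor_map B' RA' Q id q"
  note ta = tensor_map_additive[OF RA'_right_module P_left_module RA'_right_module Q(1) mod_homs_id Q(2)]
  note tp = tensor_map_pure[OF RA'_right_module P_left_module RA'_right_module Q(1) mod_homs_id Q(2)]
  have za: "additive_map (tensor B M K) (tensor B' RA' Q) (\<lambda>_. \<zero>\<^bsub>tensor B' RA' Q\<^esub>)"
    using tQ by (auto simp: additive_map_def abelian_groupE abelian_monoid.l_zero abelian_group_def intro: abelian_monoid.zero_closed)
  have "?t (?m y) = \<zero>\<^bsub>tensor B' RA' Q\<^esub>"
  proof (rule tensor_additive_eqI[OF M_right_module K_left_module additive_comp[OF ma ta] za _ y(1)])
    fix a t assume a: "a \<in> carrier M" and t: "t \<in> carrier K"
    have aA: "a \<in> carrier RA'" using a by simp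
    have o: "\<one>\<^bsub>A'\<^esub> \<in> carrier B'" using Y.coinv_one by simp
    have "F t = G (pure_tensor B M0 K \<one>\<^bsub>A'\<^esub> t)"
      using comparison_B'_pure[OF o t] t K_in F_closed by (simp add: alg'.left_act_one)
    moreover have "pure_tensor B M0 K \<one>\<^bsub>A'\<^esub> t \<in> carrier H"
      using pure_closed[OF M0_right_module K_left_module, of "\<one>\<^bsub>A'\<^esub>" t] t o by simp
    ultimately have "q (F t) = \<zero>\<^bsub>Q\<^esub>" using Q(3)[OF F_P[OF t]] by blast
    then show "?t (?m (pure_tensor B M K a t)) = \<zero>\<^bsub>tensor B' RA' Q\<^esub>"
      using mp[OF a t] tp[OF aA F_P[OF t]] pure_zero_right[OF RA'_right_module Q(1) aA] by simp
  qed
  then have "pure_tensor B' RA' Q \<one>\<^bsub>A'\<^esub> (q p) = \<zero>\<^bsub>tensor B' RA' Q\<^esub>"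
    unfolding my using tp[OF _ p, of "\<one>\<^bsub>A'\<^esub>"] by simp
  then have "q p = \<zero>\<^bsub>Q\<^esub>" by (rule unit_tensor_faithful[OF Q(1) mod_homsD(1)[OF Q(2) p]])
  then show ?thesis using Q(3)[OF p] by simp
qed

lemma comparison_iso: "left_module_iso B' H P G"
proof -
  note HD = left_moduleD[OF H_left_module] and PD = left_moduleD[OF P_left_module]
  interpret H: abelian_group H by (rule HD(2))
  interpret P: abelian_group P by (rule PD(2))
  note ha = mod_homs_additive[OF comparison_mod_homs]
  have "inj_on G (carrier H)"
  proof (rule inj_onI)
    fix x y assume x: "x \<in> carrier H" and y: "y \<in> carrier H" and e: "G x = G y"
    have "G (x \<oplus>\<^bsub>H\<^esub> (\<ominus>\<^bsub>H\<^esub> y)) = \<zero>\<^bsub>P\<^esub>"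
      using additive_add[OF ha x H.a_inv_closed[OF y]] additive_neg[OF HD(2) PD(2) ha y] e P.r_neg[OF additive_closed[OF ha y]] by (simp del: H_simps P_simps K_simps)
    then have "x \<oplus>\<^bsub>H\<^esub> (\<ominus>\<^bsub>H\<^esub> y) = \<zero>\<^bsub>H\<^esub>" by (rule comparison_kernel_trivial[OF H.a_closed[OF x H.a_inv_closed[OF y]]])
    then have "\<ominus>\<^bsub>H\<^esub> (\<ominus>\<^bsub>H\<^esub> y) = x" by (rule H.minus_equality[OF _ H.a_inv_closed[OF y] x])
    then show "x = y" using H.minus_minus[OF y] by simp
  qed
  moreover have "G ` carrier H = carrier P" using comparison_B'_closed comparison_surj by blast
  ultimately show ?thesis using H_left_module P_left_module comparison_mod_homs by (simp add: left_module_iso_def bij_betw_def del: H_simps P_simps K_simps)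
qed

text \<open>
  Both sides send \<open>b' \<otimes> t\<close> to \<open>b' (f \<otimes> \<phi>)(t)\<close>. Cosemisimplicity enters only to provide \<open>W\<close> with a
  retraction, so that the locale can be instantiated for it.
\<close>

lemma comparison_natural:
  assumes css: "cosemisimple C" and W: "left_comodule C W \<sigma>" and \<phi>: "left_colinear C V \<rho> W \<sigma> \<phi>" and x: "x \<in> carrier H"
  shows "comparison_map A' f W (induced_map B B' f (cotensor_module C A \<delta> W \<sigma>) (cmap A W id \<phi>) x) = cmap A' W id \<phi> (G x)"
proof -
  obtain \<pi>' where \<pi>': "cbilin C W W \<pi>'" "\<And>v. v \<in> carrier W \<Longrightarrow> tensor_lift W \<pi>' (\<sigma> v) = v"
    "\<And>c v. c \<in> carrier C \<Longrightarrow> v \<in> carrier W \<Longrightarrow> \<sigma> (\<pi>' c v) = cmap C W id (\<lambda>d. \<pi>' d v) (\<Delta> c)"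
    by (rule comodule_retraction[OF W css]) (rule that)
  interpret W: galois_map C W \<sigma> \<pi>' A \<delta> A' f
    by unfold_locales (use W \<pi>' hom gal in simp_all)
  let ?KW = "cotensor_module C A \<delta> W \<sigma>" and ?g = "cmap A W id \<phi>"
  have \<phi>l: "\<phi> \<in> clin V W" using \<phi> by (simp add: left_colinear_def)
  have gl: "?g \<in> clin (ctensor A V) (ctensor A W)" by (rule cmap_clin) (simp_all add: \<phi>l)
  have g'l: "cmap A' W id \<phi> \<in> clin (ctensor A' V) (ctensor A' W)" by (rule cmap_clin) (simp_all add: \<phi>l)
  have gK: "?g t \<in> carrier ?KW" if "t \<in> carrier K" for t
    using cotensor_map[OF com com V W right_colinear_id[OF com] \<phi>] that by simp
  have gh: "?g \<in> mod_homs B K ?KW"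
  proof (rule mod_homsI)
    show "?g t \<in> carrier ?KW" if "t \<in> carrier K" for t by (rule gK[OF that])
    show "?g (s \<oplus>\<^bsub>K\<^esub> t) = ?g s \<oplus>\<^bsub>?KW\<^esub> ?g t" if "s \<in> carrier K" "t \<in> carrier K" for s t
      using that K_in by (simp add: clinD(2)[OF gl])
    show "?g (r \<odot>\<^bsub>K\<^esub> t) = r \<odot>\<^bsub>?KW\<^esub> ?g t" if "r \<in> carrier B" "t \<in> carrier K" for r t
      using that K_in coinvD left_act_natural[OF cspace_V W.cspace_V \<phi>l] by simp
  qed
  note ia = tensor_map_additive[OF M0_right_module K_left_module M0_right_module W.K_left_module mod_homs_id gh]
  note ip = tensor_map_pure[OF M0_right_module K_left_module M0_right_module W.K_left_module mod_homs_id gh]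
  note Wa = W.comparison_additive[OF B'_sub _ _ M0_right_module, simplified]
  have Wp: "comparison_map A' f W (pure_tensor B M0 ?KW m n) = left_act A' W m (cmap A' W f id n)"
    if "m \<in> carrier B'" "n \<in> carrier ?KW" for m n
    by (rule W.comparison_pure[OF B'_sub _ _ M0_right_module that]) simp_all
  have x': "x \<in> carrier (tensor B M0 K)" using x by simp
  show ?thesis
    unfolding induced_map_def
  proof (rule tensor_additive_eqI[OF M0_right_module K_left_module additive_comp[OF ia Wa] additive_comp[OF comparison_B'_additive clin_additive[OF g'l]] _ x'])
    fix m t assume m: "m \<in> carrier M0" and t: "t \<in> carrier K"
    have mB: "m \<in> carrier B'" and mA: "m \<in> carrier A'" using m Y.coinvD by simp_all
    have tc: "t \<in> carrier (ctensor A V)" using t K_in by simp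
    have "cmap A' W f id (?g t) = cmap A' W (\<lambda>a. f (id a)) (\<lambda>v. id (\<phi> v)) t"
      by (rule cmap_comp[where X = A and Y = V and X' = A and Y' = W]) (use tc in \<open>simp_all add: \<phi>l f_clin\<close>)
    also have "\<dots> = cmap A' W (\<lambda>a. id (f a)) (\<lambda>v. \<phi> (id v)) t" by simp
    also have "\<dots> = cmap A' W id \<phi> (F t)"
      by (rule cmap_comp[where X = A and Y = V and X' = A' and Y' = V, symmetric]) (use tc in \<open>simp_all add: \<phi>l f_clin\<close>)
    finally have e: "cmap A' W f id (?g t) = cmap A' W id \<phi> (F t)" .
    have i: "tensor_map B M0 ?KW id ?g (pure_tensor B M0 K m t) = pure_tensor B M0 ?KW m (?g t)"
      using ip[OF m t] by (simp only: id_apply)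
    show "comparison_map A' f W (tensor_map B M0 ?KW id ?g (pure_tensor B M0 K m t)) = cmap A' W id \<phi> (G (pure_tensor B M0 K m t))"
      unfolding i Wp[OF mB gK[OF t]] comparison_B'_pure[OF mB t] e
      by (rule alg'.left_act_natural[OF cspace_V W.cspace_V \<phi>l mA F_closed[OF tc], symmetric])
  qed
qed

end

theorem theorem1p3:
  fixes C :: "'c coalgebra" and e :: 'c
    and A :: "(complex, 'a) module" and \<delta> :: "'a \<Rightarrow> ('a, 'c) tens"
    and A' :: "(complex, 'b) module" and \<delta>' :: "'b \<Rightarrow> ('b, 'c) tens"
    and V :: "(complex, 'v) module" and \<rho> :: "'v \<Rightarrow> ('c, 'v) tens"
    and B :: "(complex, 'a) module" and B' :: "(complex, 'b) module"
    and f :: "'a \<Rightarrow> 'b"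
  assumes "is_coalgebra C" and "group_like C e"
    and "coaugmented_galois C e A \<delta>" and "coaugmented_galois C e A' \<delta>'"
    and "B = coinv_alg C A \<delta>" and "B' = coinv_alg C A' \<delta>'"
    and "left_comodule C V \<rho>"
    and "faithfully_flat_right B' (right_mult_module A')"
    and "cosemisimple C"
    and "algebra_hom A A' f" and "right_colinear C A \<delta> A' \<delta>' f"
  shows "algebra_hom B B' f \<and>
    left_module_iso B' (induced_module B B' f (cotensor_module C A \<delta> V \<rho>))
      (cotensor_module C A' \<delta>' V \<rho>) (comparison_map A' f V) \<and>
    (\<forall>(W :: (complex, 'w) module) \<sigma> \<phi>.
      left_comodule C W \<sigma> \<and> left_colinear C V \<rho> W \<sigma> \<phi> \<longrightarrow>
      (\<forall>x \<in> carrier (induced_module B B' f (cotensor_module C A \<delta> V \<rho>)).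
        comparison_map A' f W
          (induced_map B B' f (cotensor_module C A \<delta> W \<sigma>) (cmap A W id \<phi>) x)
        = cmap A' W id \<phi> (comparison_map A' f V x)))"
proof -
  interpret coalg C by (rule coalg.intro[OF assms(1)])
  note g = assms(3,4)[unfolded coaugmented_galois_def]
  obtain \<pi> where \<pi>: "cbilin C V V \<pi>" "\<And>v. v \<in> carrier V \<Longrightarrow> tensor_lift V \<pi> (\<rho> v) = v"
    "\<And>c v. c \<in> carrier C \<Longrightarrow> v \<in> carrier V \<Longrightarrow> \<rho> (\<pi> c v) = cmap C V id (\<lambda>d. \<pi> d v) (\<Delta> c)"
    by (rule comodule_retraction[OF assms(7,9)]) (rule that)
  have id_hom: "algebra_hom A' A' id" using g by (simp add: algebra_hom_def)
  interpret galois_pair C V \<rho> \<pi> A \<delta> A' \<delta>' f e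
    by unfold_locales (use assms g \<pi> id_hom in \<open>simp_all add: group_like_def\<close>)
  show ?thesis
    unfolding assms(5,6)
    by (intro conjI allI impI ballI f_algebra_hom comparison_iso) (elim conjE, rule comparison_natural[OF assms(9)])
qed

end
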